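(* For every $p\in(1,\infty)\setminus\{2\}$ there exist constants $0<c_p\le C_p<\infty$, depending only on $p$, such that for every integer $n\ge1$ the Banach spaces $X_n$ and $Y_n$ (defined in the context) satisfy $$c_p\,n\le \hbar_{p,X_n}\le C_p\,n,\qquad c_p\sqrt n\le \beta_{p,X_n}\le C_p\sqrt n,$$ $$c_p\,n\le \beta_{p,Y_n}\le C_p\,n,\qquad c_p\sqrt n\le \hbar_{p,Y_n}\le C_p\sqrt n.$$
   Context: Let $\mathbb K\in\{\mathbb R,\mathbb C\}$ be the scalar field. Constants. Let $X$ be a Banach space over $\mathbb K$ and $p\in(1,\infty)$. For $f\in C^1_{\rm c}(\mathbb R;X)$ (compactly supported $C^1$ functions) the Hilbert transform is $Hf(x)=\frac1\pi\lim_{\varepsilon\downarrow 0}\int_{|x-y|>\varepsilon}\frac{f(y)}{x-y}\,dy$. The Hilbert transform constant $\hbar_{p,X}$ is the least $C$ such that $\|Hf\|_{L^p(\mathbb R;X)}\le C\|f\|_{L^p(\mathbb R;X)}$ for all $f\in C^1_{\rm c}(\mathbb R;X)$. The UMD constant $\beta_{p,X}$ is the least $C$ such that $$\Big\|\sum_{k=1}^m\epsilon_k\,df_k\Big\|_{L^p(S;X)}\le C\Big\|\sum_{k=1}^m df_k\Big\|_{L^p(S;X)},\qquad df_k:=f_k-f_{k-1},$$ for every $m\ge1$, every $X$-valued $L^p$-martingale $(f_k)_{k=0}^m$ adapted to a $\sigma$-finite filtration $(\mathscr F_k)_{k=0}^m$ on a $\sigma$-finite measure space $(S,\mathscr A,\mu)$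 (i.e. $\mu|_{\mathscr F_k}$ is $\sigma$-finite for each $k$), and all scalars $\epsilon_k\in\mathbb K$ with $|\epsilon_k|=1$. Spaces. For an integer $n\ge 1$ let $N=2^n$ and let $$\mathscr D_n=\bigcup_{s=0}^n\big\{\{(j-1)2^{n-s}+1,\ldots,j2^{n-s}\}:1\le j\le 2^s\big\}$$ be the set of dyadic blocks of $\{1,\dots,N\}$. Let $H_n$ be $\mathbb K^N$ with the Hilbert norm $\|x\|_{H_n}=\big(\sum_{I\in\mathscr D_n}|\sum_{j\in I}x_j|^2\big)^{1/2}$, and let $E_n=\ell^1_N+H_n$ be $\mathbb K^N$ with norm $\|x\|_{E_n}=\inf_{u+v=x}(\|u\|_{\ell^1_N}+\|v\|_{H_n})$, the infimum over $u,v\in\mathbb K^N$. Let $\Sigma_N$ be the $N\times N$ summation matrix with $(\Sigma_N)_{ij}=1$ if $j\le i$ and $0$ otherwise. Define matrices $D_s$ of size $2^s\times 2^s$ recursively by $D_0=(1)$ and $$D_s=\begin{pmatrix}D_{s-1}&(-1)^sJ_{2^{s-1}}\\(-1)^sJ_{2^{s-1}}&D_{s-1}\end{pmatrix},\qquad s=1,\dots,n,$$ where $J_d$ is the $d\times d$ all-ones matrix. Then $X_n$ and $Y_n$ are $\mathbb K^N$ equipped with the norms $$\|x\|_{X_n}=\max\{\|\Sigma_Nx\|_{\ell^\infty_N},\|x\|_{E_n}\},\qquad \|x\|_{Y_n}=\max\{\|D_nx\|_{\ell^\infty_N},\|x\|_{E_n}\}.$$ *)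

theory Defs
  imports "HOL-Probability.Probability"
begin

section \<open>Normed spaces on $\mathbb{K}^d$\<close>

text \<open>
  The dimension of the spaces of interest varies inside the theorem, so an element of
  $\mathbb{K}^d$ is a function \<^typ>\<open>nat \<Rightarrow> 'k\<close> of which only the values at the indices
  $1,\dots,d$ matter, and a normed space on $\mathbb{K}^d$ is given by its norm.
  The scalar type \<^typ>\<open>'k\<close> is meant to be \<^typ>\<open>real\<close> or \<^typ>\<open>complex\<close>.
  As all norms on $\mathbb{K}^d$ are equivalent, differentiability, measurability, limits and
  integrals of $\mathbb{K}^d$-valued functions are the coordinatewise ones.
\<close>

definition is_norm :: "nat \<Rightarrow> ((nat \<Rightarrow> 'k::real_normed_field) \<Rightarrow> real) \<Rightarrow> bool" where
  "is_norm d \<nu> \<longleftrightarrow>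
     (\<forall>x y. (\<forall>i\<in>{1..d}. x i = y i) \<longrightarrow> \<nu> x = \<nu> y) \<and>
     (\<forall>x. 0 \<le> \<nu> x) \<and>
     (\<forall>x. \<nu> x = 0 \<longleftrightarrow> (\<forall>i\<in>{1..d}. x i = 0)) \<and>
     (\<forall>a x. \<nu> (\<lambda>i. a * x i) = norm a * \<nu> x) \<and>
     (\<forall>x y. \<nu> (\<lambda>i. x i + y i) \<le> \<nu> x + \<nu> y)"

definition Lp_norm :: "'s measure \<Rightarrow> real \<Rightarrow> ('x \<Rightarrow> real) \<Rightarrow> ('s \<Rightarrow> 'x) \<Rightarrow> ennreal" where
  "Lp_norm M p \<nu> g =
     (let I = (\<integral>\<^sup>+ s. ennreal (\<nu> (g s) powr p) \<partial>M)
      in if I = \<infinity> then \<infinity> else ennreal (enn2real I powr (1 / p)))"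


section \<open>The Hilbert transform constant\<close>

definition C1_compact_support :: "nat \<Rightarrow> (real \<Rightarrow> nat \<Rightarrow> 'k::real_normed_field) \<Rightarrow> bool" where
  "C1_compact_support d f \<longleftrightarrow>
     (\<forall>i\<in>{1..d}. (\<lambda>x. f x i) C1_differentiable_on UNIV \<and> compact (closure {x. f x i \<noteq> 0}))"

definition hilbert_transform ::
    "(real \<Rightarrow> 'b::{banach, second_countable_topology}) \<Rightarrow> real \<Rightarrow> 'b" where
  "hilbert_transform f x =
     (1 / pi) *\<^sub>R Lim (at_right 0) (\<lambda>\<epsilon>. LINT y:{y. \<epsilon> < \<bar>x - y\<bar>}|lborel. (1 / (x - y)) *\<^sub>R f y)"

text \<open>The least constant is a value in $[0,\infty]$.\<close>

definition hilbert_const ::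
    "real \<Rightarrow> nat \<Rightarrow> ((nat \<Rightarrow> 'k::{real_normed_field, banach, second_countable_topology}) \<Rightarrow> real) \<Rightarrow> ennreal" where
  "hilbert_const p d \<nu> =
     Inf {C. \<forall>f. C1_compact_support d f \<longrightarrow>
            Lp_norm lborel p \<nu> (\<lambda>x i. hilbert_transform (\<lambda>y. f y i) x) \<le> C * Lp_norm lborel p \<nu> f}"


section \<open>The UMD constant\<close>

text \<open>
  Since $f_k \in L^p$ is integrable on sets of finite measure, but in general not on the whole
  space, $f_k = E(f_{k+1} | F_k)$ is expressed by the integrals over the sets of finite measure
  in the sigma-finite sub-sigma-algebra $F_k$.
\<close>

definition Lp_martingale ::
    "'s measure \<Rightarrow> (nat \<Rightarrow> 's measure) \<Rightarrow> nat \<Rightarrow> real \<Rightarrow> nat \<Rightarrow>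
     ((nat \<Rightarrow> 'k::{real_normed_field, banach, second_countable_topology}) \<Rightarrow> real) \<Rightarrow>
     (nat \<Rightarrow> 's \<Rightarrow> nat \<Rightarrow> 'k) \<Rightarrow> bool" where
  "Lp_martingale M F m p d \<nu> f \<longleftrightarrow>
     sigma_finite_measure M \<and>
     (\<forall>k\<le>m. sigma_finite_subalgebra M (F k)) \<and>
     (\<forall>k<m. subalgebra (F (Suc k)) (F k)) \<and>
     (\<forall>k\<le>m. (\<forall>i\<in>{1..d}. (\<lambda>s. f k s i) \<in> borel_measurable (F k)) \<and> Lp_norm M p \<nu> (f k) < \<infinity>) \<and>
     (\<forall>k<m. \<forall>A\<in>sets (F k). emeasure M A < \<infinity> \<longrightarrow>
        (\<forall>i\<in>{1..d}. (LINT s:A|M. f (Suc k) s i) = (LINT s:A|M. f k s i)))"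

text \<open>\<open>umd_estimate TYPE('s) p d \<nu> C\<close> is the UMD inequality with constant \<open>C\<close> for all measure
  spaces with points in \<^typ>\<open>'s\<close>.\<close>

definition umd_estimate ::
    "'s itself \<Rightarrow> real \<Rightarrow> nat \<Rightarrow>
     ((nat \<Rightarrow> 'k::{real_normed_field, banach, second_countable_topology}) \<Rightarrow> real) \<Rightarrow> ennreal \<Rightarrow> bool" where
  "umd_estimate (_ :: 's itself) p d \<nu> C \<longleftrightarrow>
     (\<forall>(M :: 's measure) F m f \<epsilon>.
        1 \<le> m \<and> Lp_martingale M F m p d \<nu> f \<and> (\<forall>k\<in>{1..m}. norm (\<epsilon> k) = 1) \<longrightarrow>
        Lp_norm M p \<nu> (\<lambda>s i. \<Sum>k=1..m. \<epsilon> k * (f k s i - f (k - 1) s i))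
          \<le> C * Lp_norm M p \<nu> (\<lambda>s i. \<Sum>k=1..m. f k s i - f (k - 1) s i))"

text \<open>
  The measure spaces range over those with points in \<^typ>\<open>real\<close> (and arbitrary
  sigma-algebras). This is no restriction: by \<open>umd_estimate_real_imp\<close> below, a constant that
  works for them works for the measure spaces on any other type.
\<close>

definition umd_const ::
    "real \<Rightarrow> nat \<Rightarrow> ((nat \<Rightarrow> 'k::{real_normed_field, banach, second_countable_topology}) \<Rightarrow> real) \<Rightarrow> ennreal" where
  "umd_const p d \<nu> = Inf {C. umd_estimate TYPE(real) p d \<nu> C}"

lemma is_norm_diff_le:
  fixes \<nu> :: "(nat \<Rightarrow> 'k::real_normed_field) \<Rightarrow> real"
  assumes "is_norm d \<nu>"
  shows "\<bar>\<nu> x - \<nu> y\<bar> \<le> (\<Sum>i\<in>{1..d}. norm (x i - y i) * \<nu> (\<lambda>j. if j = i then 1 else 0))"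
proof -
  have cong: "\<nu> x = \<nu> y" if "\<And>i. i \<in> {1..d} \<Longrightarrow> x i = y i" for x y
    using assms that unfolding is_norm_def by blast
  have hom: "\<nu> (\<lambda>i. a * x i) = norm a * \<nu> x" for a x
    using assms unfolding is_norm_def by blast
  have tri: "\<nu> (\<lambda>i. x i + y i) \<le> \<nu> x + \<nu> y" for x y
    using assms unfolding is_norm_def by blast
  have sum_le: "\<nu> (\<lambda>j. \<Sum>i\<in>I. g i j) \<le> (\<Sum>i\<in>I. \<nu> (g i))" if "finite I" for I :: "nat set" and g
    using that
  proof induction
    case empty
    then show ?case using hom[of 0 "\<lambda>_. 0"] by simp
  next
    case (insert i I)
    then show ?case using tri[of "g i" "\<lambda>j. \<Sum>i\<in>I. g i j"] by simp
  qed
  have bd: "\<nu> z \<le> (\<Sum>i\<in>{1..d}. norm (z i) * \<nu> (\<lambda>j. if j = i then 1 else 0))" for z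
  proof -
    have "\<nu> z = \<nu> (\<lambda>j. \<Sum>i\<in>{1..d}. z i * (if j = i then 1 else 0))"
      by (rule cong) (simp add: if_distrib sum.delta cong: if_cong)
    also have "\<dots> \<le> (\<Sum>i\<in>{1..d}. \<nu> (\<lambda>j. z i * (if j = i then 1 else 0)))"
      by (rule sum_le) simp
    finally show ?thesis by (simp only: hom)
  qed
  have "\<nu> x \<le> \<nu> y + \<nu> (\<lambda>i. x i - y i)" using tri[of y "\<lambda>i. x i - y i"] by simp
  moreover have "\<nu> y \<le> \<nu> x + \<nu> (\<lambda>i. x i - y i)"
    using tri[of x "\<lambda>i. - 1 * (x i - y i)"] hom[of "- 1" "\<lambda>i. x i - y i"] by simp
  ultimately show ?thesis using bd[of "\<lambda>i. x i - y i"] by linarith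
qed

lemma is_norm_measurable:
  fixes \<nu> :: "(nat \<Rightarrow> 'k::{real_normed_field, second_countable_topology}) \<Rightarrow> real"
  assumes "is_norm d \<nu>" and "\<And>i. i \<in> {1..d} \<Longrightarrow> (\<lambda>s. h s i) \<in> borel_measurable M"
  shows "(\<lambda>s. \<nu> (h s)) \<in> borel_measurable M"
proof -
  have "(\<nu> \<longlongrightarrow> \<nu> x) (at x)" for x
  proof (rule LIM_zero_cancel, rule Lim_null_comparison)
    show "\<forall>\<^sub>F y in at x. norm (\<nu> y - \<nu> x)
        \<le> (\<Sum>i\<in>{1..d}. norm (y i - x i) * \<nu> (\<lambda>j. if j = i then 1 else 0))"
      using is_norm_diff_le[OF assms(1)] by (intro always_eventually) simp
    have c: "((\<lambda>y. y i) \<longlongrightarrow> x i) (at x)" for i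
    proof -
      have "continuous_on UNIV (\<lambda>y :: nat \<Rightarrow> 'k. y i)" by simp
      then show ?thesis by (simp add: continuous_on_def)
    qed
    have "((\<lambda>y. \<Sum>i\<in>{1..d}. norm (y i - x i) * \<nu> (\<lambda>j. if j = i then 1 else 0)) \<longlongrightarrow>
        (\<Sum>i\<in>{1..d}. norm (x i - x i) * \<nu> (\<lambda>j. if j = i then 1 else 0))) (at x)"
      by (intro tendsto_intros c)
    then show "((\<lambda>y. \<Sum>i\<in>{1..d}. norm (y i - x i) * \<nu> (\<lambda>j. if j = i then 1 else 0)) \<longlongrightarrow> 0) (at x)"
      by simp
  qed
  then have "continuous_on UNIV \<nu>" by (simp add: continuous_on_def)
  then have [measurable]: "\<nu> \<in> borel_measurable borel" by (rule borel_measurable_continuous_onI)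
  define h' where "h' s i = (if i \<in> {1..d} then h s i else 0)" for s i
  have [measurable]: "h' \<in> borel_measurable M"
  proof (rule measurable_coordinatewise_then_product)
    show "(\<lambda>s. h' s i) \<in> borel_measurable M" for i
      using assms(2)[of i] by (cases "i \<in> {1..d}") (simp_all add: h'_def del: atLeastAtMost_iff)
  qed
  have "\<nu> (h s) = \<nu> (h' s)" for s
    using assms(1) unfolding is_norm_def h'_def by auto
  then show ?thesis by simp
qed

lemma countable_separation_real:
  assumes "countable (V :: 's set set)"
  obtains T :: "'s \<Rightarrow> real" where "\<And>s s' A. T s = T s' \<Longrightarrow> A \<in> V \<Longrightarrow> s \<in> A \<longleftrightarrow> s' \<in> A"
proof -
  have "(UNIV :: nat set set) \<lesssim> (UNIV :: real set)"
    using nat_sets_eqpoll_reals by (rule eqpoll_imp_lepoll)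
  then obtain g :: "nat set \<Rightarrow> real" where g: "inj g"
    unfolding lepoll_def by auto
  show thesis
  proof
    fix s s' A assume *: "g {n. s \<in> from_nat_into V n} = g {n. s' \<in> from_nat_into V n}" and A: "A \<in> V"
    obtain n where "A = from_nat_into V n"
      using A assms by (metis from_nat_into_surj)
    moreover have "{n. s \<in> from_nat_into V n} = {n. s' \<in> from_nat_into V n}"
      using g * by (auto dest: injD)
    ultimately show "s \<in> A \<longleftrightarrow> s' \<in> A" by auto
  qed
qed

lemma umd_estimate_real_imp:
  fixes \<nu> :: "(nat \<Rightarrow> 'k::{real_normed_field, banach, second_countable_topology}) \<Rightarrow> real"
  assumes norm: "is_norm d \<nu>" and est: "umd_estimate TYPE(real) p d \<nu> C"
  shows "umd_estimate TYPE('s) p d \<nu> C"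
  unfolding umd_estimate_def
proof (intro allI impI, elim conjE)
  fix M :: "'s measure" and F :: "nat \<Rightarrow> 's measure" and m :: nat
    and f :: "nat \<Rightarrow> 's \<Rightarrow> nat \<Rightarrow> 'k" and \<epsilon> :: "nat \<Rightarrow> 'k"
  assume m: "1 \<le> m" and mart: "Lp_martingale M F m p d \<nu> f" and \<epsilon>: "\<forall>k\<in>{1..m}. norm (\<epsilon> k) = 1"
  have sub: "subalgebra M (F k)" and sig: "sigma_finite_measure (restr_to_subalg M (F k))"
    if "k \<le> m" for k
    using mart that unfolding Lp_martingale_def sigma_finite_subalgebra_def by auto
  have inc: "subalgebra (F (Suc k)) (F k)" if "k < m" for k
    using mart that unfolding Lp_martingale_def by auto
  have inc0: "sets (F 0) \<subseteq> sets (F k)" if "k \<le> m" for k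
    using that
  proof (induction k)
    case (Suc k)
    then show ?case using inc[of k] unfolding subalgebra_def by auto
  qed simp
  have spF: "space (F k) = space M" and setsF: "sets (F k) \<subseteq> sets M" if "k \<le> m" for k
    using sub[OF that] unfolding subalgebra_def by auto
  have f: "(\<lambda>s. f k s i) \<in> borel_measurable (F k)" if "k \<le> m" "i \<in> {1..d}" for k i
    using mart that unfolding Lp_martingale_def by auto
  have fM: "(\<lambda>s. f k s i) \<in> borel_measurable M" if "k \<le> m" "i \<in> {1..d}" for k i
    by (rule measurable_from_subalg[OF sub[OF that(1)] f[OF that]])
  obtain A :: "nat \<Rightarrow> 's set" where A: "range A \<subseteq> sets (restr_to_subalg M (F 0))"
      "(\<Union>i. A i) = space (restr_to_subalg M (F 0))"
      "\<And>i. emeasure (restr_to_subalg M (F 0)) (A i) \<noteq> \<infinity>"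
    using sigma_finite_measure.sigma_finite[OF sig[of 0]] by blast
  have A1: "A i \<in> sets (F 0)" for i
    using A(1) sub[of 0] by (auto simp: sets_restr_to_subalg)
  have A2: "(\<Union>i. A i) = space M" using A(2) by (simp add: space_restr_to_subalg)
  have A3: "emeasure M (A i) \<noteq> \<infinity>" for i
    using A(3)[of i] emeasure_restr_to_subalg[OF sub[of 0] A1[of i]] by simp

  obtain \<B> :: "'k set set" where \<B>: "countable \<B>" "\<And>U. U \<in> \<B> \<Longrightarrow> open U"
      "\<And>S. open S \<Longrightarrow> \<exists>U. U \<subseteq> \<B> \<and> S = \<Union>U"
    using univ_second_countable by blast
  define V where "V = range A \<union> (\<lambda>(k, i, U). {s. f k s i \<in> U}) ` (UNIV \<times> UNIV \<times> \<B>)"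
  have "countable V" unfolding V_def using \<B>(1) by auto
  then obtain T :: "'s \<Rightarrow> real" where T: "\<And>s s' A. T s = T s' \<Longrightarrow> A \<in> V \<Longrightarrow> s \<in> A \<longleftrightarrow> s' \<in> A"
    by (rule countable_separation_real) blast
  have TA: "s \<in> A j \<longleftrightarrow> s' \<in> A j" if "T s = T s'" for s s' j
    using T[OF that] unfolding V_def by auto
  have Tf: "f k s i = f k s' i" if "T s = T s'" for k s s' i
  proof (rule ccontr)
    assume "f k s i \<noteq> f k s' i"
    then obtain W where W: "open W" "f k s i \<in> W" "f k s' i \<notin> W"
      using t1_space by blast
    obtain U where "U \<in> \<B>" "f k s i \<in> U" "U \<subseteq> W" using \<B>(3)[OF W(1)] W(2) by blast
    moreover have "{s. f k s i \<in> U} \<in> V" if "U \<in> \<B>" for U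
      using that unfolding V_def by force
    ultimately show False using T[OF that, of "{s. f k s i \<in> U}"] W(3) by auto
  qed

  define push where "push G = sigma UNIV {E. T -` E \<inter> space G \<in> sets G}" for G
  have space_push: "space (push G) = UNIV" for G unfolding push_def by simp
  have sets_push: "sets (push G) = {E. T -` E \<inter> space G \<in> sets G}" for G
  proof -
    have "sigma_algebra UNIV {E. T -` E \<inter> space G \<in> sets G}"
      unfolding sigma_algebra_iff2
    proof (intro conjI ballI allI impI)
      show "{} \<in> {E. T -` E \<inter> space G \<in> sets G}" by simp
      fix E assume "E \<in> {E. T -` E \<inter> space G \<in> sets G}"
      moreover have "T -` (UNIV - E) \<inter> space G = space G - (T -` E \<inter> space G)" by auto
      ultimately show "UNIV - E \<in> {E. T -` E \<inter> space G \<in> sets G}" by auto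
    next
      fix E :: "nat \<Rightarrow> real set" assume "range E \<subseteq> {E. T -` E \<inter> space G \<in> sets G}"
      then have "(\<Union>n. T -` E n \<inter> space G) \<in> sets G" by (intro sets.countable_UN) blast
      moreover have "T -` (\<Union>n. E n) \<inter> space G = (\<Union>n. T -` E n \<inter> space G)" by auto
      ultimately show "(\<Union>n. E n) \<in> {E. T -` E \<inter> space G \<in> sets G}"
        by (simp only: mem_Collect_eq)
    qed auto
    then show ?thesis unfolding push_def
      by (simp add: sigma_algebra.sigma_sets_eq)
  qed
  define M' where "M' = distr M (push M) T"
  define F' where "F' k = push (F k)" for k
  define g where "g k t = f k (inv_into (space M) T t)" for k t
  have T_meas: "T \<in> measurable M (push M)"
    by (rule measurableI) (auto simp: space_push sets_push)
  have M'[simp]: "space M' = UNIV" "sets M' = sets (push M)"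
    unfolding M'_def by (simp_all add: space_push)
  have gT: "g k (T s) i = f k s i" if "s \<in> space M" for k s i
    unfolding g_def by (rule Tf) (rule f_inv_into_f, use that in auto)
  have meas_push: "(\<lambda>t. g k t i) \<in> borel_measurable (push G)"
    if "(\<lambda>s. f k s i) \<in> borel_measurable G" "space G = space M" for G k i
  proof (rule measurableI)
    fix U :: "'k set" assume U: "U \<in> sets borel"
    have "T -` ((\<lambda>t. g k t i) -` U) \<inter> space G = (\<lambda>s. f k s i) -` U \<inter> space G"
      using gT that(2) by auto
    then show "(\<lambda>t. g k t i) -` U \<inter> space (push G) \<in> sets (push G)"
      using measurable_sets[OF that(1) U] by (simp add: space_push sets_push)
  qed simp
  have em: "emeasure M' E = emeasure M (T -` E \<inter> space M)" if "E \<in> sets (push M)" for E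
    unfolding M'_def by (rule emeasure_distr[OF T_meas that])
  have Lp: "Lp_norm M' p \<nu> G = Lp_norm M p \<nu> H"
    if "\<And>i. i \<in> {1..d} \<Longrightarrow> (\<lambda>t. G t i) \<in> borel_measurable (push M)"
       "\<And>s i. s \<in> space M \<Longrightarrow> G (T s) i = H s i" for G H
  proof -
    have [measurable]: "(\<lambda>t. \<nu> (G t)) \<in> borel_measurable (push M)"
      by (rule is_norm_measurable[OF norm that(1)])
    have "(\<integral>\<^sup>+ t. ennreal (\<nu> (G t) powr p) \<partial>M') = (\<integral>\<^sup>+ s. ennreal (\<nu> (G (T s)) powr p) \<partial>M)"
      unfolding M'_def by (rule nn_integral_distr[OF T_meas]) simp
    also have "\<dots> = (\<integral>\<^sup>+ s. ennreal (\<nu> (H s) powr p) \<partial>M)"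
    proof (rule nn_integral_cong)
      fix s assume "s \<in> space M"
      then have "G (T s) = H s" using that(2) by auto
      then show "ennreal (\<nu> (G (T s)) powr p) = ennreal (\<nu> (H s) powr p)" by simp
    qed
    finally show ?thesis unfolding Lp_norm_def by simp
  qed
  have int: "(LINT t:E|M'. g k t i) = (LINT s:T -` E \<inter> space M|M. f k s i)"
    if "E \<in> sets (push M)" "k \<le> m" "i \<in> {1..d}" for E k i
  proof -
    note [measurable] = meas_push[OF fM[OF that(2,3)] refl] that(1)
    have "(LINT t:E|M'. g k t i) = (LINT s|M. indicator E (T s) *\<^sub>R g k (T s) i)"
      unfolding M'_def set_lebesgue_integral_def
      by (rule integral_distr[OF T_meas]) measurable
    also have "\<dots> = (LINT s:T -` E \<inter> space M|M. f k s i)"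
      unfolding set_lebesgue_integral_def
      by (rule Bochner_Integration.integral_cong) (auto simp: gT indicator_def)
    finally show ?thesis .
  qed
  have sub': "subalgebra M' (F' k)" if "k \<le> m" for k
    using setsF[OF that] spF[OF that]
    by (auto simp: subalgebra_def F'_def space_push sets_push)
  define A' where "A' j = - (T ` space M) \<union> T ` (A j)" for j
  have Aj: "T -` A' j \<inter> space M = A j" for j
  proof (rule set_eqI)
    fix s
    have "A j \<subseteq> space M" using A2 by blast
    moreover have "s \<in> A j" if "s' \<in> A j" "T s = T s'" for s' using TA[OF that(2)] that(1) by simp
    ultimately show "s \<in> T -` A' j \<inter> space M \<longleftrightarrow> s \<in> A j"
      unfolding A'_def by (auto simp: image_iff)
  qed
  have A'k: "A' j \<in> sets (F' k)" if "k \<le> m" for j k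
    using A1[of j] inc0[OF that] Aj[of j] by (auto simp: F'_def sets_push spF[OF that])
  have A'M: "A' j \<in> sets (push M)" for j
    using A'k[of 0 j] sub'[of 0] by (auto simp: subalgebra_def)
  have Un: "(\<Union>j. A' j) = UNIV"
    using A2 unfolding A'_def by blast
  have sig': "sigma_finite_measure (restr_to_subalg M' (F' k))" if "k \<le> m" for k
  proof (rule sigma_finite_measure.intro, intro exI conjI)
    show "countable (range A')" by simp
    show "range A' \<subseteq> sets (restr_to_subalg M' (F' k))"
      using A'k[OF that] by (auto simp: sets_restr_to_subalg[OF sub'[OF that]])
    show "\<Union> (range A') = space (restr_to_subalg M' (F' k))"
      using Un by (simp add: space_restr_to_subalg)
    show "\<forall>a\<in>range A'. emeasure (restr_to_subalg M' (F' k)) a \<noteq> \<infinity>"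
      using A'k[OF that] A3 by (auto simp: emeasure_restr_to_subalg[OF sub'[OF that]] em A'M Aj)
  qed
  have sM': "sigma_finite_measure M'"
    by (rule sigma_finite_subalgebra_is_sigma_finite[of M' "F' 0"])
       (auto intro!: sigma_finite_subalgebra.intro sub' sig')
  have gM: "(\<lambda>t. g k t i) \<in> borel_measurable (push M)" if "k \<le> m" "i \<in> {1..d}" for k i
    by (rule meas_push[OF fM[OF that] refl])
  have mart': "Lp_martingale M' F' m p d \<nu> g"
    unfolding Lp_martingale_def
  proof (intro conjI allI impI ballI)
    show "sigma_finite_measure M'" by (rule sM')
  next
    fix k assume "k \<le> m"
    then show "sigma_finite_subalgebra M' (F' k)"
      by (auto intro!: sigma_finite_subalgebra.intro sub' sig')
  next
    fix k assume "k < m"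
    then show "subalgebra (F' (Suc k)) (F' k)"
      using inc[of k] by (auto simp: subalgebra_def F'_def space_push sets_push)
  next
    fix k i assume "k \<le> m" "i \<in> {1..d}"
    then show "(\<lambda>t. g k t i) \<in> borel_measurable (F' k)"
      unfolding F'_def by (intro meas_push f spF)
  next
    fix k assume k: "k \<le> m"
    have "Lp_norm M' p \<nu> (g k) = Lp_norm M p \<nu> (f k)"
      using k by (intro Lp gM gT)
    then show "Lp_norm M' p \<nu> (g k) < \<infinity>"
      using mart k unfolding Lp_martingale_def by auto
  next
    fix k E i assume k: "k < m" and E: "E \<in> sets (F' k)" "emeasure M' E < \<infinity>" and i: "i \<in> {1..d}"
    have EM: "E \<in> sets (push M)" using E(1) sub'[of k] k by (auto simp: subalgebra_def)
    have "T -` E \<inter> space M \<in> sets (F k)" "emeasure M (T -` E \<inter> space M) < \<infinity>"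
      using E k by (auto simp: F'_def sets_push spF em[OF EM])
    then have "(LINT s:T -` E \<inter> space M|M. f (Suc k) s i) = (LINT s:T -` E \<inter> space M|M. f k s i)"
      using mart k i unfolding Lp_martingale_def by blast
    then show "(LINT t:E|M'. g (Suc k) t i) = (LINT t:E|M'. g k t i)"
      using k i by (simp add: int[OF EM])
  qed
  have "Lp_norm M' p \<nu> (\<lambda>t i. \<Sum>k=1..m. \<epsilon> k * (g k t i - g (k - 1) t i))
          \<le> C * Lp_norm M' p \<nu> (\<lambda>t i. \<Sum>k=1..m. g k t i - g (k - 1) t i)"
    using est m mart' \<epsilon> unfolding umd_estimate_def by blast
  moreover have "Lp_norm M' p \<nu> (\<lambda>t i. \<Sum>k=1..m. \<epsilon> k * (g k t i - g (k - 1) t i))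
      = Lp_norm M p \<nu> (\<lambda>s i. \<Sum>k=1..m. \<epsilon> k * (f k s i - f (k - 1) s i))"
    by (rule Lp) (auto intro!: borel_measurable_sum borel_measurable_times borel_measurable_diff gM simp: gT)
  moreover have "Lp_norm M' p \<nu> (\<lambda>t i. \<Sum>k=1..m. g k t i - g (k - 1) t i)
      = Lp_norm M p \<nu> (\<lambda>s i. \<Sum>k=1..m. f k s i - f (k - 1) s i)"
    by (rule Lp) (auto intro!: borel_measurable_sum borel_measurable_diff gM simp: gT)
  ultimately show "Lp_norm M p \<nu> (\<lambda>s i. \<Sum>k=1..m. \<epsilon> k * (f k s i - f (k - 1) s i))
      \<le> C * Lp_norm M p \<nu> (\<lambda>s i. \<Sum>k=1..m. f k s i - f (k - 1) s i)"
    by simp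
qed


section \<open>The spaces $X_n$ and $Y_n$\<close>

definition dyadic_blocks :: "nat \<Rightarrow> nat set set" where
  "dyadic_blocks n = (\<Union>s\<in>{0..n}. {{(j - 1) * 2 ^ (n - s) + 1 .. j * 2 ^ (n - s)} | j. 1 \<le> j \<and> j \<le> 2 ^ s})"

definition H_norm :: "nat \<Rightarrow> (nat \<Rightarrow> 'k::real_normed_field) \<Rightarrow> real" where
  "H_norm n x = sqrt (\<Sum>I\<in>dyadic_blocks n. (norm (\<Sum>j\<in>I. x j))\<^sup>2)"

definition l1_norm :: "nat \<Rightarrow> (nat \<Rightarrow> 'k::real_normed_field) \<Rightarrow> real" where
  "l1_norm d x = (\<Sum>i\<in>{1..d}. norm (x i))"

definition linf_norm :: "nat \<Rightarrow> (nat \<Rightarrow> 'k::real_normed_field) \<Rightarrow> real" where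
  "linf_norm d x = Max ((\<lambda>i. norm (x i)) ` {1..d})"

definition E_norm :: "nat \<Rightarrow> (nat \<Rightarrow> 'k::real_normed_field) \<Rightarrow> real" where
  "E_norm n x =
     Inf {l1_norm (2 ^ n) u + H_norm n v | u v. \<forall>i\<in>{1..2 ^ n}. u i + v i = x i}"

text \<open>Matrices are functions of the row and the column index, both counted from 1.\<close>

definition mat_vec :: "nat \<Rightarrow> (nat \<Rightarrow> nat \<Rightarrow> 'k::real_normed_field) \<Rightarrow> (nat \<Rightarrow> 'k) \<Rightarrow> nat \<Rightarrow> 'k" where
  "mat_vec d A x i = (\<Sum>j\<in>{1..d}. A i j * x j)"

definition summation_matrix :: "nat \<Rightarrow> nat \<Rightarrow> 'k::real_normed_field" where
  "summation_matrix i j = (if j \<le> i then 1 else 0)"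

fun D_matrix :: "nat \<Rightarrow> nat \<Rightarrow> nat \<Rightarrow> 'k::real_normed_field" where
  "D_matrix 0 i j = 1"
| "D_matrix (Suc s) i j =
     (if i \<le> 2 ^ s \<and> j \<le> 2 ^ s then D_matrix s i j
      else if 2 ^ s < i \<and> 2 ^ s < j then D_matrix s (i - 2 ^ s) (j - 2 ^ s)
      else (- 1) ^ Suc s)"

definition X_norm :: "nat \<Rightarrow> (nat \<Rightarrow> 'k::real_normed_field) \<Rightarrow> real" where
  "X_norm n x = max (linf_norm (2 ^ n) (mat_vec (2 ^ n) summation_matrix x)) (E_norm n x)"

definition Y_norm :: "nat \<Rightarrow> (nat \<Rightarrow> 'k::real_normed_field) \<Rightarrow> real" where
  "Y_norm n x = max (linf_norm (2 ^ n) (mat_vec (2 ^ n) (D_matrix n) x)) (E_norm n x)"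

lemma is_normI:
  fixes \<nu> :: "(nat \<Rightarrow> 'k::real_normed_field) \<Rightarrow> real"
  assumes "\<And>x y. (\<And>i. i \<in> {1..d} \<Longrightarrow> x i = y i) \<Longrightarrow> \<nu> x = \<nu> y"
    and "\<And>x i. i \<in> {1..d} \<Longrightarrow> norm (x i) \<le> \<nu> x" and "\<And>x. 0 \<le> \<nu> x"
    and "\<And>a x. \<nu> (\<lambda>i. a * x i) = norm a * \<nu> x"
    and "\<And>x y. \<nu> (\<lambda>i. x i + y i) \<le> \<nu> x + \<nu> y"
  shows "is_norm d \<nu>"
  unfolding is_norm_def
proof (intro conjI allI impI)
  fix x
  have "\<nu> x = 0" if "\<forall>i\<in>{1..d}. x i = 0"
    using assms(1)[of x "\<lambda>i. 0 * x i"] assms(4)[of 0 x] that by simp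
  moreover have "x i = 0" if "\<nu> x = 0" "i \<in> {1..d}" for i
    using assms(2)[OF that(2), of x] that(1) by simp
  ultimately show "\<nu> x = 0 \<longleftrightarrow> (\<forall>i\<in>{1..d}. x i = 0)" by blast
next
  fix x y :: "nat \<Rightarrow> 'k" assume "\<forall>i\<in>{1..d}. x i = y i"
  then show "\<nu> x = \<nu> y" by (intro assms(1)) auto
qed (rule assms(3-5))+

lemma dyadic_blocks_subset:
  assumes "I \<in> dyadic_blocks n"
  shows "I \<subseteq> {1..2 ^ n}"
proof -
  obtain s j where *: "s \<le> n" "1 \<le> j" "j \<le> 2 ^ s"
      and I: "I = {(j - 1) * 2 ^ (n - s) + 1 .. j * 2 ^ (n - s)}"
    using assms unfolding dyadic_blocks_def by auto
  have "j * 2 ^ (n - s) \<le> 2 ^ s * 2 ^ (n - s)" using * by simp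
  also have "\<dots> = (2::nat) ^ n" using * by (simp flip: power_add)
  finally show ?thesis unfolding I by auto
qed

lemma finite_dyadic_blocks: "finite (dyadic_blocks n)"
  by (rule finite_subset[of _ "Pow {1..2 ^ n}"]) (use dyadic_blocks_subset in auto)

lemma singleton_dyadic_blocks:
  assumes "i \<in> {1..2 ^ n}"
  shows "{i} \<in> dyadic_blocks n"
proof -
  have "\<exists>j. {i} = {(j - 1) * 2 ^ (n - n) + 1 .. j * 2 ^ (n - n)} \<and> 1 \<le> j \<and> j \<le> 2 ^ n"
    by (rule exI[of _ i]) (use assms in auto)
  then show ?thesis unfolding dyadic_blocks_def by (intro UN_I[of n]) auto
qed

lemma H_norm_L2_set: "H_norm n x = L2_set (\<lambda>I. norm (\<Sum>j\<in>I. x j)) (dyadic_blocks n)"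
  unfolding H_norm_def L2_set_def ..

lemma is_norm_H_norm: "is_norm (2 ^ n) (H_norm n :: (nat \<Rightarrow> 'k::real_normed_field) \<Rightarrow> real)"
proof (rule is_normI)
  fix x y :: "nat \<Rightarrow> 'k" assume eq: "\<And>i. i \<in> {1..2 ^ n} \<Longrightarrow> x i = y i"
  have "sum x I = sum y I" if "I \<in> dyadic_blocks n" for I
    using dyadic_blocks_subset[OF that] eq by (intro sum.cong) auto
  then show "H_norm n x = H_norm n y" unfolding H_norm_def by simp
next
  fix x :: "nat \<Rightarrow> 'k" and i :: nat assume "i \<in> {1..2 ^ n}"
  then show "norm (x i) \<le> H_norm n x"
    unfolding H_norm_L2_set
    using member_le_L2_set[OF finite_dyadic_blocks singleton_dyadic_blocks, of i n "\<lambda>I. norm (\<Sum>j\<in>I. x j)"]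
    by simp
next
  show "0 \<le> H_norm n x" for x :: "nat \<Rightarrow> 'k" unfolding H_norm_L2_set by (rule L2_set_nonneg)
next
  show "H_norm n (\<lambda>i. a * x i) = norm a * H_norm n x" for a and x :: "nat \<Rightarrow> 'k"
    unfolding H_norm_L2_set by (simp add: norm_mult L2_set_right_distrib flip: sum_distrib_left)
next
  fix x y :: "nat \<Rightarrow> 'k"
  have "H_norm n (\<lambda>i. x i + y i) \<le> L2_set (\<lambda>I. norm (\<Sum>j\<in>I. x j) + norm (\<Sum>j\<in>I. y j)) (dyadic_blocks n)"
    unfolding H_norm_L2_set by (intro L2_set_mono) (auto simp: sum.distrib norm_triangle_ineq)
  also have "\<dots> \<le> H_norm n x + H_norm n y"
    unfolding H_norm_L2_set by (rule L2_set_triangle_ineq)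
  finally show "H_norm n (\<lambda>i. x i + y i) \<le> H_norm n x + H_norm n y" .
qed

lemma is_norm_l1_norm: "is_norm d (l1_norm d :: (nat \<Rightarrow> 'k::real_normed_field) \<Rightarrow> real)"
proof (rule is_normI)
  fix x :: "nat \<Rightarrow> 'k" and i :: nat assume "i \<in> {1..d}"
  then show "norm (x i) \<le> l1_norm d x"
    unfolding l1_norm_def using member_le_sum[of i "{1..d}" "\<lambda>i. norm (x i)"] by simp
next
  fix x y :: "nat \<Rightarrow> 'k" and a
  show "0 \<le> l1_norm d x" by (simp add: l1_norm_def sum_nonneg)
  show "l1_norm d (\<lambda>i. a * x i) = norm a * l1_norm d x"
    by (simp add: l1_norm_def norm_mult sum_distrib_left)
  show "l1_norm d (\<lambda>i. x i + y i) \<le> l1_norm d x + l1_norm d y"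
    unfolding l1_norm_def sum.distrib[symmetric] by (intro sum_mono norm_triangle_ineq)
qed (simp add: l1_norm_def)

lemma is_norm_E_norm: "is_norm (2 ^ n) (E_norm n :: (nat \<Rightarrow> 'k::real_normed_field) \<Rightarrow> real)"
proof -
  let ?l = "l1_norm (2 ^ n) :: (nat \<Rightarrow> 'k) \<Rightarrow> real" and ?H = "H_norm n :: (nat \<Rightarrow> 'k) \<Rightarrow> real"
  let ?S = "\<lambda>x. {?l u + ?H v | u v. \<forall>i\<in>{1..2 ^ n}. u i + v i = x i}"
  have l: "is_norm (2 ^ n) ?l" and H: "is_norm (2 ^ n) ?H"
    by (rule is_norm_l1_norm is_norm_H_norm)+
  have pos: "0 \<le> ?l u" "0 \<le> ?H u" for u
    by (simp_all add: l1_norm_def H_norm_def sum_nonneg)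
  have ne: "?S x \<noteq> {}" for x
  proof -
    have "?l x + ?H (\<lambda>_. 0) \<in> ?S x" by (intro CollectI exI[of _ x] exI[of _ "\<lambda>_. 0"]) simp
    then show ?thesis by blast
  qed
  have bdd: "bdd_below (?S x)" for x
    by (rule bdd_belowI[of _ 0]) (use pos in \<open>auto intro: add_nonneg_nonneg\<close>)
  have le: "E_norm n x \<le> ?l u + ?H v" if "\<And>i. i \<in> {1..2 ^ n} \<Longrightarrow> u i + v i = x i" for x u v
    unfolding E_norm_def by (rule cInf_lower[OF _ bdd]) (use that in blast)
  have ge: "b \<le> E_norm n x"
    if "\<And>u v. (\<And>i. i \<in> {1..2 ^ n} \<Longrightarrow> u i + v i = x i) \<Longrightarrow> b \<le> ?l u + ?H v" for b x
    unfolding E_norm_def by (rule cInf_greatest[OF ne]) (use that in blast)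
  have hom_le: "E_norm n (\<lambda>i. a * x i) \<le> norm a * E_norm n x" if a: "a \<noteq> 0" for a and x :: "nat \<Rightarrow> 'k"
  proof -
    have "E_norm n (\<lambda>i. a * x i) / norm a \<le> E_norm n x"
    proof (rule ge)
      fix u v :: "nat \<Rightarrow> 'k" assume uv: "\<And>i. i \<in> {1..2 ^ n} \<Longrightarrow> u i + v i = x i"
      have "E_norm n (\<lambda>i. a * x i) \<le> ?l (\<lambda>i. a * u i) + ?H (\<lambda>i. a * v i)"
        by (rule le) (simp add: uv flip: distrib_left)
      also have "\<dots> = norm a * (?l u + ?H v)"
        using l H unfolding is_norm_def by (simp add: distrib_left)
      finally show "E_norm n (\<lambda>i. a * x i) / norm a \<le> ?l u + ?H v"
        using a by (simp add: divide_le_eq mult.commute)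
    qed
    then show ?thesis using a by (simp add: divide_le_eq mult.commute)
  qed
  have nn: "0 \<le> E_norm n x" for x :: "nat \<Rightarrow> 'k"
    by (rule ge) (use pos in \<open>auto intro: add_nonneg_nonneg\<close>)
  show ?thesis
  proof (rule is_normI)
    fix x y :: "nat \<Rightarrow> 'k" assume "\<And>i. i \<in> {1..2 ^ n} \<Longrightarrow> x i = y i"
    then have "?S x = ?S y" by simp
    then show "E_norm n x = E_norm n y" unfolding E_norm_def by simp
  next
    fix x :: "nat \<Rightarrow> 'k" and i :: nat assume i: "i \<in> {1..2 ^ n}"
    show "norm (x i) \<le> E_norm n x"
    proof (rule ge)
      fix u v :: "nat \<Rightarrow> 'k" assume "\<And>i. i \<in> {1..2 ^ n} \<Longrightarrow> u i + v i = x i"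
      then have "norm (x i) \<le> norm (u i) + norm (v i)"
        using i norm_triangle_ineq[of "u i" "v i"] by simp
      also have "norm (u i) \<le> ?l u"
        unfolding l1_norm_def using member_le_sum[of i "{1..2 ^ n}" "\<lambda>i. norm (u i)"] i by simp
      also have "norm (v i) \<le> ?H v"
        unfolding H_norm_L2_set
        using member_le_L2_set[OF finite_dyadic_blocks singleton_dyadic_blocks[OF i], of "\<lambda>I. norm (\<Sum>j\<in>I. v j)"]
        by simp
      finally show "norm (x i) \<le> ?l u + ?H v" by simp
    qed
  next
    fix a and x :: "nat \<Rightarrow> 'k"
    show "E_norm n (\<lambda>i. a * x i) = norm a * E_norm n x"
    proof (cases "a = 0")
      case True
      have "?l (\<lambda>_. 0) = 0" "?H (\<lambda>_. 0) = 0" using l H unfolding is_norm_def by auto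
      then have "E_norm n (\<lambda>i. a * x i) \<le> 0" using le[of "\<lambda>_. 0" "\<lambda>_. 0" "\<lambda>i. a * x i"] True by simp
      then show ?thesis using nn[of "\<lambda>i. a * x i"] True by simp
    next
      case False
      have "E_norm n x \<le> norm (inverse a) * E_norm n (\<lambda>i. a * x i)"
        using hom_le[of "inverse a" "\<lambda>i. a * x i"] False by (simp flip: mult.assoc)
      then have "norm a * E_norm n x \<le> norm a * (norm (inverse a) * E_norm n (\<lambda>i. a * x i))"
        by (rule mult_left_mono) simp
      also have "\<dots> = norm (a * inverse a) * E_norm n (\<lambda>i. a * x i)"
        by (simp only: norm_mult mult.assoc)
      also have "\<dots> = E_norm n (\<lambda>i. a * x i)"
        using False by simp
      finally have "norm a * E_norm n x \<le> E_norm n (\<lambda>i. a * x i)" .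
      then show ?thesis using hom_le[OF False, of x] by simp
    qed
  next
    fix x y :: "nat \<Rightarrow> 'k"
    have "E_norm n (\<lambda>i. x i + y i) - E_norm n y \<le> E_norm n x"
    proof (rule ge)
      fix u v :: "nat \<Rightarrow> 'k" assume uv: "\<And>i. i \<in> {1..2 ^ n} \<Longrightarrow> u i + v i = x i"
      have "E_norm n (\<lambda>i. x i + y i) - (?l u + ?H v) \<le> E_norm n y"
      proof (rule ge)
        fix u' v' :: "nat \<Rightarrow> 'k" assume uv': "\<And>i. i \<in> {1..2 ^ n} \<Longrightarrow> u' i + v' i = y i"
        have "E_norm n (\<lambda>i. x i + y i) \<le> ?l (\<lambda>i. u i + u' i) + ?H (\<lambda>i. v i + v' i)"
          by (rule le) (simp add: algebra_simps flip: uv uv')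
        also have "?l (\<lambda>i. u i + u' i) \<le> ?l u + ?l u'" using l unfolding is_norm_def by blast
        also have "?H (\<lambda>i. v i + v' i) \<le> ?H v + ?H v'" using H unfolding is_norm_def by blast
        finally show "E_norm n (\<lambda>i. x i + y i) - (?l u + ?H v) \<le> ?l u' + ?H v'" by simp
      qed
      then show "E_norm n (\<lambda>i. x i + y i) - E_norm n y \<le> ?l u + ?H v" by simp
    qed
    then show "E_norm n (\<lambda>i. x i + y i) \<le> E_norm n x + E_norm n y" by simp
  qed (rule nn)
qed

lemma is_norm_max_linf:
  fixes A :: "nat \<Rightarrow> nat \<Rightarrow> 'k::real_normed_field"
  assumes d: "1 \<le> d" and \<nu>: "is_norm d \<nu>"
  shows "is_norm d (\<lambda>x. max (linf_norm d (mat_vec d A x)) (\<nu> x))"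
proof -
  let ?L = "\<lambda>x. linf_norm d (mat_vec d A x)"
  have ne: "(\<lambda>i. norm (x i)) ` {1..d} \<noteq> {}" for x :: "nat \<Rightarrow> 'k" using d by auto
  have mem: "norm (x i) \<le> linf_norm d x" if "i \<in> {1..d}" for i and x :: "nat \<Rightarrow> 'k"
    unfolding linf_norm_def using that by simp
  have ex: "\<exists>i\<in>{1..d}. linf_norm d x = norm (x i)" for x :: "nat \<Rightarrow> 'k"
    unfolding linf_norm_def using Max_in[OF _ ne[of x]] by auto
  have lin_add: "mat_vec d A (\<lambda>i. x i + y i) i = mat_vec d A x i + mat_vec d A y i" for x y i
    unfolding mat_vec_def by (simp add: distrib_left sum.distrib)
  have lin_mult: "mat_vec d A (\<lambda>i. a * x i) i = a * mat_vec d A x i" for a x i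
    unfolding mat_vec_def by (simp add: sum_distrib_left algebra_simps)
  have add: "?L (\<lambda>i. x i + y i) \<le> ?L x + ?L y" for x y
  proof -
    obtain i where i: "i \<in> {1..d}" "?L (\<lambda>i. x i + y i) = norm (mat_vec d A (\<lambda>i. x i + y i) i)"
      using ex by blast
    then show ?thesis
      using mem[OF i(1), of "mat_vec d A x"] mem[OF i(1), of "mat_vec d A y"]
        norm_triangle_ineq[of "mat_vec d A x i" "mat_vec d A y i"] by (simp add: lin_add)
  qed
  have hom: "?L (\<lambda>i. a * x i) = norm a * ?L x" for a x
  proof (rule antisym)
    obtain i where "i \<in> {1..d}" "?L (\<lambda>i. a * x i) = norm (mat_vec d A (\<lambda>i. a * x i) i)"
      using ex by blast
    then show "?L (\<lambda>i. a * x i) \<le> norm a * ?L x"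
      by (simp only: lin_mult norm_mult) (intro mult_left_mono mem norm_ge_zero)
    obtain i where "i \<in> {1..d}" "?L x = norm (mat_vec d A x i)"
      using ex by blast
    then show "norm a * ?L x \<le> ?L (\<lambda>i. a * x i)"
      using mem[of i "mat_vec d A (\<lambda>i. a * x i)"] by (simp only: lin_mult norm_mult)
  qed
  have cong: "?L x = ?L y" if "\<forall>i\<in>{1..d}. x i = y i" for x y
    unfolding mat_vec_def using that by simp
  have zero: "?L x = 0" if "\<forall>i\<in>{1..d}. x i = 0" for x
    using cong[of x "\<lambda>i. 0 * x i"] hom[of 0 x] that by simp
  have pos: "0 \<le> ?L x" for x
    using ex[of "mat_vec d A x"] by auto
  have n1: "\<nu> x = \<nu> y" if "\<forall>i\<in>{1..d}. x i = y i" for x y using \<nu> that unfolding is_norm_def by blast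
  have n2: "0 \<le> \<nu> x" for x using \<nu> unfolding is_norm_def by blast
  have n3: "\<nu> x = 0 \<longleftrightarrow> (\<forall>i\<in>{1..d}. x i = 0)" for x using \<nu> unfolding is_norm_def by blast
  have n4: "\<nu> (\<lambda>i. a * x i) = norm a * \<nu> x" for a x using \<nu> unfolding is_norm_def by blast
  have n5: "\<nu> (\<lambda>i. x i + y i) \<le> \<nu> x + \<nu> y" for x y using \<nu> unfolding is_norm_def by blast
  show ?thesis
    unfolding is_norm_def
  proof (intro conjI allI impI)
    fix x y :: "nat \<Rightarrow> 'k"
    show "max (?L x) (\<nu> x) = max (?L y) (\<nu> y)" if "\<forall>i\<in>{1..d}. x i = y i"
      using cong[OF that] n1[OF that] by simp
    show "0 \<le> max (?L x) (\<nu> x)" using n2[of x] by simp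
    show "max (?L x) (\<nu> x) = 0 \<longleftrightarrow> (\<forall>i\<in>{1..d}. x i = 0)"
    proof
      assume "max (?L x) (\<nu> x) = 0"
      then have "\<nu> x = 0" using n2[of x] pos[of x] by linarith
      then show "\<forall>i\<in>{1..d}. x i = 0" using n3 by blast
    next
      assume z: "\<forall>i\<in>{1..d}. x i = 0"
      show "max (?L x) (\<nu> x) = 0" using n3[of x] zero[OF z] z by simp
    qed
    show "max (?L (\<lambda>i. a * x i)) (\<nu> (\<lambda>i. a * x i)) = norm a * max (?L x) (\<nu> x)" for a
      by (simp add: hom n4 max_mult_distrib_left)
    show "max (?L (\<lambda>i. x i + y i)) (\<nu> (\<lambda>i. x i + y i)) \<le> max (?L x) (\<nu> x) + max (?L y) (\<nu> y)"
      using add[of x y] n5[of x y] by linarith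
  qed
qed

lemma is_norm_X_norm: "is_norm (2 ^ n) (X_norm n)"
  unfolding X_norm_def[abs_def] by (rule is_norm_max_linf[OF _ is_norm_E_norm]) simp

lemma is_norm_Y_norm: "is_norm (2 ^ n) (Y_norm n)"
  unfolding Y_norm_def[abs_def] by (rule is_norm_max_linf[OF _ is_norm_E_norm]) simp

end

theory Submission
 imports Defs
begin

text \<open>
 Let \<open>T\<close> be the discrete Hilbert transform or a martingale transform on a finite space, and \<open>M\<close> the
 summation matrix or \<open>D_n\<close>. Since \<open>T\<close> extends to Hilbert space valued functions,
 \<open>\<parallel>x\<parallel>\<^sub>H \<le> sqrt (n + 1) \<parallel>x\<parallel>\<^sub>1\<close> and \<open>\<parallel>M x\<parallel>\<^sub>\<infinity> \<le> C sqrt n \<parallel>x\<parallel>\<^sub>H\<close>, the constants are at most of order \<open>n\<close>, and of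
 order \<open>sqrt n\<close> if \<open>M T\<close> maps \<open>L\<^sup>p(\<ell>\<^sup>1)\<close> to \<open>L\<^sup>p(\<ell>\<^sup>\<infinity>)\<close> with norm of order \<open>sqrt n\<close>. The latter holds for \<open>D_n\<close>
 and the Hilbert transform and for the summation matrix and martingale transforms. For \<open>p = 3\<close> it follows from
 an estimate of the cubic form \<open>\<integral> \<Sum>\<^sub>i w\<^sub>i (M T w)\<^sub>i\<^sup>2\<close>, \<open>w \<ge> 0\<close>, a sum over the nodes of the dyadic tree in which the
 critical term of each node cancels: by Cotlar's identity for the antisymmetric Hilbert kernel, and up to a
 Carleson embedding for the self-adjoint martingale transforms. Doubling \<open>p\<close> in the same way (Hilbert
 transform) or stopping times (martingales), duality and interpolation give all \<open>p\<close>. Riemann sums and finite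
 approximations of filtrations carry the bounds over to the two constants.

 For the lower bounds the test functions have values near the unit vectors: the Hilbert transform produces
 \<open>(1 / (s - i))\<^sub>i\<close>, whose partial sums are harmonic, and the martingale transform with alternating signs produces
 block sums that alternate like the entries of \<open>D_n\<close>. In both cases the \<open>n\<close> blocks next to \<open>s\<close> have sums of
 absolute value at least a constant, which gives \<open>sqrt n\<close> in \<open>E_n\<close>.
\<close>

section \<open>Finite weighted sets\<close>

text \<open>A bound of order \<open>sqrt n\<close> for the operator requires a bound of order
  \<open>n\<close> for the cubic form. Products of two transformed block sums are harmless: over the
  whole tree they are at most a product of two square functions, each of which costs
  \<open>sqrt (n+1)\<close>. The obstacle is the part of a node with only one transformed block sum,
  multiplied by \<open>T Y\<close>, where \<open>Y\<close> is the mass that the larger blocks have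
  already sent into the block; \<open>T Y\<close> has no square function over the nodes. For halves
  of mass \<open>a\<close> and \<open>b\<close> this part is \<open>T Y\<close> times
  \<open>a T b + b T a\<close> if the matrix is symmetric, and \<open>T Y\<close> times
  \<open>b T a - a T b\<close> if it is antisymmetric. For an antisymmetric kernel the first becomes
  \<open>- Y T a T b\<close> plus a local remainder, with \<open>Y\<close> below the total mass. The
  second is a commutator, whose worst products cancel for a self-adjoint transform. So the parity of
  the matrix decides which of the two transforms is cheap on which space. Until the passage to the
  limit all spaces are finite sets; hence a term can be absorbed into the left side without asking
  whether it is finite, and all weight lies on uniformity in the set, the weights and
  \<open>n\<close>.\<close>

locale weighted_set =
 fixes Om :: "'a set" and wt :: "'a => real"
 assumes fin: "finite Om" and wt_nonneg: "s : Om ==> 0 <= wt s"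
begin

definition S :: "('a => real) => real" where
 "S g = (SUM s:Om. wt s*g s)"

definition nrm :: "real => ('a => real) => real" where
 "nrm p g = S (%s. abs (g s) powr p) powr (1/p)"

lemma S_cong: "(!!s. s : Om ==> f s = g s) ==> S f = S g"
 unfolding S_def by (intro sum.cong) auto

lemma S_mono: "(!!s. s : Om ==> f s <= g s) ==> S f <= S g"
 unfolding S_def by (intro sum_mono mult_left_mono) (auto simp: wt_nonneg)

lemma S_nonneg: "(!!s. s : Om ==> 0 <= f s) ==> 0 <= S f"
 unfolding S_def by (intro sum_nonneg mult_nonneg_nonneg) (auto simp: wt_nonneg)

lemma S_add: "S (%s. f s + g s) = S f + S g"
 unfolding S_def by (simp add: distrib_left sum.distrib)

lemma S_diff: "S (%s. f s - g s) = S f - S g"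
 unfolding S_def by (simp add: right_diff_distrib sum_subtractf)

lemma S_cmult: "S (%s. c*f s) = c*S f"
 unfolding S_def by (simp add: sum_distrib_left mult_ac)

lemma S_sum: "S (%s. SUM i:I. f i s) = (SUM i:I. S (f i))"
 unfolding S_def by (subst sum.swap) (simp add: sum_distrib_left)

lemma S_abs_le: "abs (S f) <= S (%s. abs (f s))"
 unfolding S_def
 by (rule order_trans[OF sum_abs]) (auto intro!: sum_mono simp: abs_mult wt_nonneg)

lemma S_zero_imp:
 assumes "S f = 0" and "!!s. s : Om ==> 0 <= f s" and "s : Om"
 shows "wt s*f s = 0"
 using assms fin wt_nonneg unfolding S_def by (subst (asm) sum_nonneg_eq_0_iff) auto

lemma nrm_nonneg: "0 <= nrm p g"
 unfolding nrm_def by simp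

lemma nrm_powr:
 assumes "p ~= 0" shows "nrm p g powr p = S (%s. abs (g s) powr p)"
 using assms S_nonneg[of "%s. abs (g s) powr p"] unfolding nrm_def by (simp add: powr_powr)

lemma nrm_mono:
 assumes "0 < p" "!!s. s : Om ==> abs (f s) <= abs (g s)" shows "nrm p f <= nrm p g"
 unfolding nrm_def using assms
 by (intro powr_mono2 S_mono) (auto intro!: powr_mono2 S_nonneg)

lemma nrm_cong: "(!!s. s : Om ==> abs (f s) = abs (g s)) ==> nrm p f = nrm p g"
 unfolding nrm_def by (intro arg_cong2[where f = "(powr)"] S_cong) auto

lemma nrm_abs [simp]: "nrm p (%s. abs (g s)) = nrm p g"
 by (rule nrm_cong) simp

lemma nrm_cmult:
 assumes "p ~= 0" shows "nrm p (%s. c*g s) = abs c*nrm p g"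
 using assms S_nonneg[of "%s. abs (g s) powr p"] unfolding nrm_def
 by (simp add: abs_mult powr_mult S_cmult powr_powr)

lemma nrm_leI:
 assumes "0 < p" "S (%s. abs (g s) powr p) <= B powr p" "0 <= B" shows "nrm p g <= B"
proof -
 have "nrm p g <= (B powr p) powr (1/p)"
  unfolding nrm_def using assms by (intro powr_mono2) (auto intro!: S_nonneg)
 then show ?thesis using assms by (simp add: powr_powr)
qed

lemma nrm_le_imp:
 assumes "0 < p" "nrm p g <= B" shows "S (%s. abs (g s) powr p) <= B powr p"
proof -
 have "nrm p g powr p <= B powr p"
  using assms by (intro powr_mono2) (auto simp: nrm_nonneg)
 then show ?thesis using assms by (simp add: nrm_powr)
qed

lemma add_powr_le:
 fixes a b p :: real
 assumes "0 <= a" "0 <= b" "0 < p"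
 shows "(a + b) powr p <= 2 powr p*(a powr p + b powr p)"
proof -
 have "(a + b) powr p <= (2*max a b) powr p"
  using assms by (intro powr_mono2) auto
 also have "... = 2 powr p*max a b powr p" using assms by (simp add: powr_mult)
 also have "max a b powr p <= a powr p + b powr p" using assms by (auto simp: max_def)
 finally show ?thesis by simp
qed

text \<open>A crude substitute for Minkowski's inequality: \<open>add_powr_le\<close> costs
  \<open>2 powr p\<close>, and replacing both norms by their sum costs another
  \<open>2 <= 2 powr p\<close>. Since only a pointwise domination is asked for, expressions that are
  merely subadditive can be inserted directly.\<close>

lemma nrm_add_le:
 assumes "1 <= p" "!!s. s : Om ==> abs (f s) <= abs (g s) + abs (h s)"
 shows "nrm p f <= 4*(nrm p g + nrm p h)"
proof (rule nrm_leI)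
 let ?G = "nrm p g" and ?H = "nrm p h"
 have "S (%s. abs (f s) powr p) <= S (%s. 2 powr p*(abs (g s) powr p + abs (h s) powr p))"
 proof (rule S_mono)
  fix s assume "s : Om"
  then have "abs (f s) powr p <= (abs (g s) + abs (h s)) powr p" using assms by (intro powr_mono2) auto
  also have "... <= 2 powr p*(abs (g s) powr p + abs (h s) powr p)"
   using assms by (intro add_powr_le) auto
  finally show "abs (f s) powr p <= 2 powr p*(abs (g s) powr p + abs (h s) powr p)" .
 qed
 also have "... = 2 powr p*(?G powr p + ?H powr p)"
  using assms by (simp add: S_cmult S_add nrm_powr)
 also have "... <= 2 powr p*((?G + ?H) powr p + (?G + ?H) powr p)"
  using assms by (intro mult_left_mono add_mono powr_mono2) (auto simp: nrm_nonneg)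
 also have "... = 2 powr p*(2*(?G + ?H) powr p)" by simp
 also have "... <= 2 powr p*(2 powr p*(?G + ?H) powr p)"
  using assms powr_mono[of 1 p 2] by (intro mult_left_mono mult_right_mono) auto
 also have "... = (4*(?G + ?H)) powr p"
 proof -
  have "(4::real) powr p = 2 powr p*2 powr p"
   using powr_mult[of "2::real" 2 p] by simp
  then show ?thesis using nrm_nonneg[of p g] nrm_nonneg[of p h] by (subst powr_mult) auto
 qed
 finally show "S (%s. abs (f s) powr p) <= (4*(?G + ?H)) powr p" .
qed (use assms nrm_nonneg[of p g] nrm_nonneg[of p h] in auto)

lemma Holder:
 assumes "1 < p" "1/p + 1/q = 1"
 shows "S (%s. abs (f s*g s)) <= nrm p f*nrm q g"
proof -
 have pos: "0 < p" "0 < q" and q: "1 < q"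
 proof -
  show "0 < p" using assms by simp
  have "1/q = 1 - 1/p" "1/p < 1" "0 < 1/p" using assms by auto
  then have "0 < 1/q" "1/q < 1" by linarith+
  then show "0 < q" "1 < q" by (simp_all add: zero_less_divide_iff divide_less_eq split: if_splits)
 qed
 define F where "F = nrm p f"
 define G where "G = nrm q g"
 have FG: "0 <= F" "0 <= G" unfolding F_def G_def by (rule nrm_nonneg)+
 show ?thesis
 proof (cases "F = 0 | G = 0")
  case True
  have "wt s*abs (f s*g s) = 0" if s: "s : Om" for s
  proof -
   have "S (%s. abs (f s) powr p) = 0 | S (%s. abs (g s) powr q) = 0"
    using True pos nrm_powr[of p f] nrm_powr[of q g] unfolding F_def G_def by auto
   then have "wt s*abs (f s) powr p = 0 | wt s*abs (g s) powr q = 0"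
    using S_zero_imp[of "%s. abs (f s) powr p" s] S_zero_imp[of "%s. abs (g s) powr q" s] s by auto
   then show ?thesis by auto
  qed
  then have "S (%s. abs (f s*g s)) = 0" unfolding S_def by (intro sum.neutral) auto
  then show ?thesis using FG unfolding F_def G_def by simp
 next
  case False
  then have FG: "0 < F" "0 < G" using FG by auto
  have *: "S (%s. abs (f s*g s)) = F*G*S (%s. (abs (f s)/F)*(abs (g s)/G))"
   unfolding S_cmult[symmetric] using FG by (intro S_cong) (simp add: abs_mult)
  have "S (%s. (abs (f s)/F)*(abs (g s)/G))
    <= S (%s. (1/p)*(inverse (F powr p)*abs (f s) powr p) + (1/q)*(inverse (G powr q)*abs (g s) powr q))"
  proof (rule S_mono)
   fix s
   have "(abs (f s)/F)*(abs (g s)/G) <= (abs (f s)/F) powr p/p + (abs (g s)/G) powr q/q"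
    using FG assms q by (intro Youngs_inequality) auto
   also have "... = (1/p)*(inverse (F powr p)*abs (f s) powr p) + (1/q)*(inverse (G powr q)*abs (g s) powr q)"
    using FG by (simp add: powr_divide divide_simps)
   finally show "(abs (f s)/F)*(abs (g s)/G)
    <= (1/p)*(inverse (F powr p)*abs (f s) powr p) + (1/q)*(inverse (G powr q)*abs (g s) powr q)" .
  qed
  also have "... = (1/p)*(inverse (F powr p)*F powr p) + (1/q)*(inverse (G powr q)*G powr q)"
   unfolding S_add S_cmult using pos by (simp only: F_def G_def nrm_powr)
  also have "... = 1" using FG assms by simp
  finally show ?thesis using FG unfolding * F_def[symmetric] G_def[symmetric] by simp
 qed
qed

end

section \<open>Interpolation and duality\<close>

lemma sum_geometric_int_le:
 fixes r :: real
 assumes "0 < r" "r < 1" "finite K"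
 shows "(SUM k:K. r powr (abs (of_int (k - c)))) <= 2/(1 - r)"
proof -
 define M where "M = Max ((%k. nat (abs (k - c))) ` K \<union> {0})"
 have fin: "finite ((%k. nat (abs (k - c))) ` K \<union> {0})" using assms by simp
 let ?A = "(%i. c + int i) ` {..M}" and ?B = "(%i. c - int i) ` {..M}"
 have sub: "K \<subseteq> ?A \<union> ?B"
 proof
  fix k assume "k : K"
  then have M: "nat (abs (k - c)) <= M" unfolding M_def using fin by (intro Max_ge) auto
  show "k : ?A \<union> ?B"
  proof (cases "k >= c")
   case True
   then have "k = c + int (nat (abs (k - c)))" by simp
   then show ?thesis using M by blast
  next
   case False
   then have "k = c - int (nat (abs (k - c)))" by simp
   then show ?thesis using M by blast
  qed
 qed
 have geo: "(SUM i<=M. r^i) <= 1/(1 - r)"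
 proof -
  have "(SUM i<=M. r^i) <= (\<Sum>i. r^i)"
   using assms by (intro sum_le_suminf summable_geometric) auto
  then show ?thesis using assms by (simp add: suminf_geometric)
 qed
 have "(SUM k:K. r powr (abs (of_int (k - c)))) <= (SUM k:?A \<union> ?B. r powr (abs (of_int (k - c))))"
  using sub by (intro sum_mono2) auto
 also have "... <= (SUM k:?A. r powr (abs (of_int (k - c)))) + (SUM k:?B. r powr (abs (of_int (k - c))))"
  by (subst sum.union_inter[symmetric]) (auto intro!: sum_nonneg)
 also have "(SUM k:?A. r powr (abs (of_int (k - c)))) = (SUM i<=M. r^i)"
  using assms by (subst sum.reindex) (auto simp: inj_on_def powr_realpow)
 also have "(SUM k:?B. r powr (abs (of_int (k - c)))) = (SUM i<=M. r^i)"
  using assms by (subst sum.reindex) (auto simp: inj_on_def powr_realpow)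
 finally show ?thesis using geo by simp
qed

text \<open>The number \<open>de\<close> is the rate at which the layers decay away from the
  critical one, \<open>p/p0-1\<close> on the side governed by \<open>p0\<close> and
  \<open>1 - p/p1\<close> on the side governed by \<open>p1\<close>. The factor
  \<open>2 powr de\<close> pays for rounding the critical index to an integer; the other factor is
  the two-sided geometric series.\<close>

definition interp_const :: "real => real => real => real" where
 "interp_const p0 p p1 =
   (let de = min (p/p0-1) (1 - p/p1) in (2 powr de*(2/(1 - 2 powr - de))) powr p)"

lemma interp_const_nonneg: "0 <= interp_const p0 p p1"
 unfolding interp_const_def Let_def by simp

text \<open>Both endpoint exponents enter pointwise: with \<open>R\<^sup>p\<close> the right-hand sum, the \<open>k\<close>-th summand
 on the left is at most \<open>R\<close> times a power of \<open>2\<close> decaying in the distance of \<open>k\<close> to \<open>log 2 R\<close>.\<close>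

lemma layer_sum_powr_le:
 fixes g :: "int => real"
 assumes p: "0 < p0" "p0 < p" "p < p1" and K: "finite K" and g: "!!k. k : K ==> 0 <= g k"
 shows "(SUM k:K. 2 powr k*g k) powr p
   <= interp_const p0 p p1*(SUM k:K. 2 powr (k*p)*(g k powr p0 + g k powr p1))"
proof -
 define Q where "Q = (SUM k:K. 2 powr (k*p)*(g k powr p0 + g k powr p1))"
 define R where "R = Q powr (1/p)"
 define de where "de = min (p/p0-1) (1 - p/p1)"
 have de: "0 < de" "de <= p/p0 - 1" "de <= 1 - p/p1"
  using p unfolding de_def by auto
 have Q0: "0 <= Q" unfolding Q_def by (intro sum_nonneg) auto
 have Rp: "R powr p = Q" using Q0 p unfolding R_def by (simp add: powr_powr)
 have R0: "0 <= R" unfolding R_def by simp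
 have term_le: "2 powr (k*p)*(g k powr p0 + g k powr p1) <= Q" if "k : K" for k
  unfolding Q_def using that K
  by (intro member_le_sum[of k K "%k. 2 powr (k*p)*(g k powr p0 + g k powr p1)"]) auto
 show ?thesis
 proof (cases "Q = 0")
  case True
  have "g k = 0" if "k : K" for k
  proof -
   have "2 powr (k*p)*(g k powr p0 + g k powr p1) <= 0" using term_le[OF that] True by simp
   then have "g k powr p0 + g k powr p1 <= 0" by (simp add: mult_le_0_iff)
   moreover have "0 <= g k powr p0" "0 <= g k powr p1" by auto
   ultimately have "g k powr p0 = 0" by linarith
   then show ?thesis by simp
  qed
  then show ?thesis using p True unfolding Q_def by simp
 next
  case False
  then have Qpos: "0 < Q" using Q0 by simp
  then have Rpos: "0 < R" unfolding R_def by simp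
  define c where "c = \<lfloor>log 2 R\<rfloor>"
  have key: "2 powr k*g k <= R*(2 powr de*(2 powr - de) powr (abs (of_int (k - c))))" if k: "k : K" for k
  proof -
   \<comment> \<open>The layers above the critical size \<open>R\<close> are those with
     \<open>t <= 1\<close>. There the exponent \<open>p/p0 > 1\<close> makes the bound from
     \<open>p0\<close> the small one, and for \<open>t > 1\<close> the exponent
     \<open>p/p1 < 1\<close> does the same for the bound from \<open>p1\<close>.\<close>
   define t where "t = R/2 powr k"
   have t: "0 < t" using Rpos unfolding t_def by simp
   have gk: "0 <= g k" using g k by simp
   have bd: "g k <= t powr (p/q)" if q: "0 < q" "2 powr (k*p)*g k powr q <= Q" for q
   proof -
    have "2 powr (k*p)*t powr p = Q"
     using Rpos unfolding t_def by (simp add: powr_divide powr_powr Rp)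
    then have "2 powr (k*p)*g k powr q <= 2 powr (k*p)*t powr p" using q by simp
    then have "g k powr q <= t powr p" by simp
    then have "(g k powr q) powr (1/q) <= (t powr p) powr (1/q)"
     using q by (intro powr_mono2) auto
    then show ?thesis using q gk by (simp add: powr_powr)
   qed
   have b0: "g k <= t powr (p/p0)" and b1: "g k <= t powr (p/p1)"
    using term_le[OF k] p by (auto intro!: bd simp: distrib_left intro: order_trans[rotated])
   have lt: "log 2 t = log 2 R - k" unfolding t_def using Rpos by (simp add: log_divide)
   have t_le: "g k <= t*2 powr (- de*abs (log 2 t))"
   proof (cases "t <= 1")
    case True
    have "g k <= t*t powr (p/p0-1)" using b0 t by (simp add: powr_diff)
    also have "... <= t*t powr de"
     using True t de by (intro mult_left_mono powr_mono') auto
    also have "t powr de = 2 powr (- de*abs (log 2 t))"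
    proof -
     have "log 2 t <= 0" using True t by simp
     then have "- de*abs (log 2 t) = log 2 t*de" by simp
     then show ?thesis using t by (simp add: powr_powr[symmetric] del: mult_minus_left)
    qed
    finally show ?thesis .
   next
    case False
    have "g k <= t*t powr (p/p1-1)" using b1 t by (simp add: powr_diff)
    also have "... <= t*t powr - de"
     using False t de by (intro mult_left_mono powr_mono) auto
    also have "t powr - de = 2 powr (- de*abs (log 2 t))"
    proof -
     have "0 <= log 2 t" using False t by simp
     then have "2 powr (- de*abs (log 2 t)) = (2 powr log 2 t) powr - de"
      by (simp add: powr_powr mult.commute)
     then show ?thesis using t by simp
    qed
    finally show ?thesis .
   qed
   have "abs (of_int (k - c)) <= abs (log 2 t) + 1"
    unfolding lt c_def by linarith
   then have "- de*abs (log 2 t) <= de - de*abs (of_int (k - c))"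
    using de(1) mult_left_mono[of "abs (of_int (k - c))" "abs (log 2 t) + 1" de] by (simp add: algebra_simps)
   then have "2 powr (- de*abs (log 2 t)) <= 2 powr (de - de*abs (of_int (k - c)))"
    by (intro powr_mono) auto
   also have "... = 2 powr de*(2 powr - de) powr (abs (of_int (k - c)))"
    by (simp add: powr_powr powr_add[symmetric])
   finally have "t*2 powr (- de*abs (log 2 t)) <= t*(2 powr de*(2 powr - de) powr (abs (of_int (k - c))))"
    using t by (intro mult_left_mono) auto
   then have "g k <= t*(2 powr de*(2 powr - de) powr (abs (of_int (k - c))))"
    using t_le by linarith
   then have "2 powr k*g k <= 2 powr k*(t*(2 powr de*(2 powr - de) powr (abs (of_int (k - c)))))"
    by (intro mult_left_mono) auto
   then show ?thesis unfolding t_def by simp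
  qed
  have r: "0 < 2 powr - de" "2 powr - de < (1::real)" using de(1) by (auto simp: powr_less_one)
  have "(SUM k:K. 2 powr k*g k) <= (SUM k:K. R*(2 powr de*(2 powr - de) powr (abs (of_int (k - c)))))"
   by (intro sum_mono key)
  also have "... = R*(2 powr de*(SUM k:K. (2 powr - de) powr (abs (of_int (k - c)))))"
   by (simp add: sum_distrib_left)
  also have "... <= R*(2 powr de*(2/(1 - 2 powr - de)))"
   using R0 r K by (intro mult_left_mono sum_geometric_int_le) auto
  finally have "(SUM k:K. 2 powr k*g k) powr p <= (R*(2 powr de*(2/(1 - 2 powr - de)))) powr p"
   using p g by (intro powr_mono2 sum_nonneg) auto
  also have "... = interp_const p0 p p1*Q"
   using R0 r unfolding interp_const_def Let_def de_def[symmetric] by (subst powr_mult) (auto simp: Rp)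
  finally show ?thesis unfolding Q_def .
 qed
qed

text \<open>\<open>pairing\<close> and \<open>norming\<close> make \<open>rh'\<close> the norm dual
  to \<open>rh\<close>, and \<open>adj\<close> makes \<open>T\<close> its own adjoint up to
  \<open>sg\<close>, so that duality leads back to the same operator. The instances are the
  Euclidean norm with itself and \<open>l1_norm\<close> with \<open>linf_norm\<close>. Linearity is
  asked for integer index sets because the layers of a function are indexed by powers of
  two.\<close>

locale vec_op = weighted_set Om wt for Om :: "'a set" and wt +
 fixes J :: "'j set" and rh rh' :: "('j => real) => real"
  and T :: "('j => 'a => real) => 'j => 'a => real" and sg :: real
 assumes finJ: "finite J"
  and rh_nonneg: "0 <= rh x" and rh'_nonneg: "0 <= rh' x"
  and rh_scale: "rh (%j. c*x j) = abs c*rh x" and rh'_scale: "rh' (%j. c*x j) = abs c*rh' x"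
  and rh'_triangle: "rh' (%j. x j + y j) <= rh' x + rh' y"
  and rh'_cong: "(!!j. j : J ==> x j = y j) ==> rh' x = rh' y"
  and pairing: "abs (SUM j:J. x j*y j) <= rh x*rh' y"
  and norming: "EX x. rh x <= 1 & (SUM j:J. x j*y j) = rh' y"
  and T_linear: "s : Om ==> j : J ==>
   T (%j s. SUM i:I. a i*w i j s) j s = (SUM i:(I::int set). a i*T (w i) j s)"
  and T_cong: "s : Om ==> j : J ==> (!!j s. j : J ==> s : Om ==> u j s = v j s) ==> T u j s = T v j s"
  and adj: "S (%s. SUM j:J. h j s*T u j s) = sg*S (%s. SUM j:J. u j s*T h j s)"
  and sg: "abs (sg) <= 1"
begin

definition strong_type :: "real => real => bool" where
 "strong_type p B \<longleftrightarrow>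
   (ALL u. nrm p (%s. rh' (%j. T u j s)) <= B*nrm p (%s. rh (%j. u j s)))"

text \<open>Only functions dominated by an indicator are tested, but the image is measured in the
  strong norm. This is what the stopping argument delivers, and it is enough at the two ends of an
  interpolation.\<close>

definition restricted_type :: "real => real => bool" where
 "restricted_type p B \<longleftrightarrow>
   (ALL u A. (ALL s:Om. rh (%j. u j s) <= indicator A s) -->
    S (%s. rh' (%j. T u j s) powr p) <= B powr p*S (indicator A))"

lemma strong_imp_restricted:
 assumes "strong_type p B" "0 < p" "0 <= B"
 shows "restricted_type p B"
 unfolding restricted_type_def
proof (intro allI impI)
 fix u A assume *: "ALL s:Om. rh (%j. u j s) <= indicator A s"
 have "S (%s. abs (rh' (%j. T u j s)) powr p) <= (B*nrm p (%s. rh (%j. u j s))) powr p"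
  using assms unfolding strong_type_def by (intro nrm_le_imp) auto
 also have "... = B powr p*S (%s. abs (rh (%j. u j s)) powr p)"
  using assms nrm_nonneg by (simp add: powr_mult nrm_powr)
 also have "S (%s. abs (rh (%j. u j s)) powr p) <= S (indicator A)"
 proof (rule S_mono)
  fix s assume "s : Om"
  then have "abs (rh (%j. u j s)) powr p <= indicator A s powr p"
   using * assms rh_nonneg by (intro powr_mono2) auto
  then show "abs (rh (%j. u j s)) powr p <= indicator A s" using assms by (auto simp: indicator_def split: if_splits)
 qed
 finally show "S (%s. rh' (%j. T u j s) powr p) <= B powr p*S (indicator A)"
  using rh'_nonneg by (simp add: mult_left_mono)
qed

lemma rh'_sum:
 assumes "finite I" shows "rh' (%j. SUM i:I. x i j) <= (SUM i:I. rh' (x i))"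
 using assms
proof induction
 case empty
 then show ?case using rh'_scale[of 0 "%_. 0"] by simp
next
 case (insert i I)
 then show ?case using rh'_triangle[of "x i" "%j. SUM i:I. x i j"] by simp
qed

theorem interpolation:
 assumes p: "0 < p0" "p0 < p" "p < p1"
  and r: "restricted_type p0 B" "restricted_type p1 B" and B: "0 < B"
 shows "strong_type p (2*B*(2*interp_const p0 p p1) powr (1/p))"
 unfolding strong_type_def
proof
 fix u :: "'j => 'a => real"
 define m where "m s = rh (%j. u j s)" for s
 have m0: "0 <= m s" for s unfolding m_def by (rule rh_nonneg)
 \<comment> \<open>Where \<open>m s = 0\<close> this is a default value; such a point falls into
   some layer, contributes norm zero to it and is excluded from \<open>A k\<close>.\<close>
 define l where "l s = \<lfloor>log 2 (m s)\<rfloor>" for s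
 define K where "K = l ` Om"
 have K: "finite K" unfolding K_def using fin by simp
 define A where "A k = {s : Om. 0 < m s & l s = k}" for k
 \<comment> \<open>On layer \<open>k\<close> the size \<open>m\<close> is at most
   \<open>2 powr (k+1)\<close>, so this factor makes the layer dominated by the indicator of
   \<open>A k\<close>.\<close>
 define v where "v k j s = 2 powr - (k+1)*(if l s = k then u j s else 0)" for k :: int and j s
 define g where "g k s = rh' (%j. T (v k) j s)/B" for k s
 have g0: "0 <= g k s" for k s unfolding g_def using rh'_nonneg B by simp
 have m_bds: "2 powr l s <= m s" "m s <= 2 powr (l s+1)" if "0 < m s" for s
 proof -
  have "2 powr l s <= 2 powr (log 2 (m s))" unfolding l_def by (intro powr_mono) auto
  then show "2 powr l s <= m s" using that by simp
  have "2 powr (log 2 (m s)) <= 2 powr (l s+1)" unfolding l_def by (intro powr_mono) linarith+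
  then show "m s <= 2 powr (l s+1)" using that by simp
 qed
 have v_le: "rh (%j. v k j s) <= indicator (A k) s" if "s : Om" for k s
 proof (cases "l s = k")
  case True
  then have "rh (%j. v k j s) = 2 powr - (k+1)*m s"
   unfolding v_def m_def by (simp add: rh_scale)
  also have "... <= indicator (A k) s"
  proof (cases "0 < m s")
   case True
   then have "2 powr - (k+1)*m s <= 2 powr - (k+1)*2 powr (k+1)"
    using m_bds(2)[of s] \<open>l s = k\<close> by (intro mult_left_mono) auto
   also have "... = 1" by (simp flip: powr_add)
   finally show ?thesis using True \<open>l s = k\<close> that unfolding A_def by simp
  next
   case False
   then have "m s = 0" using m0[of s] by simp
   then show ?thesis by (simp add: indicator_def)
  qed
  finally show ?thesis .
 next
  case False
  then have "rh (%j. v k j s) = 0" unfolding v_def using rh_scale[of 0 "%_. 0"] by simp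
  then show ?thesis by (simp add: indicator_def)
 qed
 have gS: "S (%s. g k s powr q) <= S (indicator (A k))" if "restricted_type q B" "0 < q" for k q
 proof -
  have "S (%s. g k s powr q) = inverse (B powr q)*S (%s. rh' (%j. T (v k) j s) powr q)"
   unfolding S_cmult[symmetric] g_def using B rh'_nonneg
   by (intro S_cong) (simp add: powr_divide field_simps)
  also have "... <= inverse (B powr q)*(B powr q*S (indicator (A k)))"
   using that v_le unfolding restricted_type_def by (intro mult_left_mono) auto
  finally show ?thesis using B by (simp flip: mult.assoc)
 qed
 have dec: "u j s = (SUM k:K. 2 powr (k+1) * v k j s)" if "s : Om" for j s
 proof -
  have "(SUM k:K. 2 powr (k+1) * v k j s) = (SUM k:K. if k = l s then u j s else 0)"
   unfolding v_def by (intro sum.cong) (auto simp: powr_add[symmetric] simp flip: mult.assoc)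
  then show ?thesis using that K unfolding K_def by simp
 qed
 have pt: "rh' (%j. T u j s) <= 2*B*(SUM k:K. 2 powr k*g k s)" if s: "s : Om" for s
 proof -
  have "rh' (%j. T u j s) = rh' (%j. SUM k:K. 2 powr (k+1)*T (v k) j s)"
  proof (rule rh'_cong)
   fix j assume j: "j : J"
   have "T u j s = T (%j s. SUM k:K. 2 powr (k+1) * v k j s) j s"
    by (rule T_cong[OF s j]) (rule dec)
   also have "... = (SUM k:K. 2 powr (k+1)*T (v k) j s)" by (rule T_linear[OF s j])
   finally show "T u j s = (SUM k:K. 2 powr (k+1)*T (v k) j s)" .
  qed
  also have "... <= (SUM k:K. rh' (%j. 2 powr (k+1)*T (v k) j s))" by (rule rh'_sum[OF K])
  also have "... = 2*B*(SUM k:K. 2 powr k*g k s)"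
   unfolding g_def sum_distrib_left using B
   by (intro sum.cong) (auto simp: rh'_scale powr_add)
  finally show ?thesis .
 qed
 let ?D = "interp_const p0 p p1"
 have D0: "0 <= ?D" by (rule interp_const_nonneg)
 have "S (%s. abs (rh' (%j. T u j s)) powr p)
   <= S (%s. (2*B) powr p*(?D*(SUM k:K. 2 powr (k*p)*(g k s powr p0 + g k s powr p1))))"
 proof (rule S_mono)
  fix s assume s: "s : Om"
  have "abs (rh' (%j. T u j s)) powr p <= (2*B*(SUM k:K. 2 powr k*g k s)) powr p"
   using pt[OF s] p rh'_nonneg by (intro powr_mono2) auto
  also have "... = (2*B) powr p*(SUM k:K. 2 powr k*g k s) powr p"
   using B g0 by (intro powr_mult)
  also have "(SUM k:K. 2 powr k*g k s) powr p
    <= ?D*(SUM k:K. 2 powr (k*p)*(g k s powr p0 + g k s powr p1))"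
   by (rule layer_sum_powr_le[OF p K g0])
  finally show "abs (rh' (%j. T u j s)) powr p
   <= (2*B) powr p*(?D*(SUM k:K. 2 powr (k*p)*(g k s powr p0 + g k s powr p1)))"
   by (simp add: mult_left_mono)
 qed
 also have "... = (2*B) powr p*(?D*(SUM k:K. 2 powr (k*p)*(S (%s. g k s powr p0) + S (%s. g k s powr p1))))"
  by (simp add: S_cmult S_sum S_add)
 also have "... <= (2*B) powr p*(?D*(SUM k:K. 2 powr (k*p)*(S (indicator (A k)) + S (indicator (A k)))))"
  using p r D0 by (intro mult_left_mono sum_mono add_mono gS) auto
 also have "... = (2*B) powr p*(2*?D)*S (%s. SUM k:K. 2 powr (k*p)*indicator (A k) s)"
  unfolding S_sum S_cmult by (simp add: sum_distrib_left mult_ac)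
 also have "... <= (2*B) powr p*(2*?D)*S (%s. abs (m s) powr p)"
 proof (intro mult_left_mono S_mono)
  fix s assume s: "s : Om"
  have "(SUM k:K. 2 powr (k*p)*indicator (A k) s) = (SUM k:K. if k = l s then 2 powr (l s*p)*indicator (A (l s)) s else 0)"
   unfolding A_def by (intro sum.cong) (auto simp: indicator_def)
  also have "... = 2 powr (l s*p)*indicator (A (l s)) s"
   using K s unfolding K_def by simp
  also have "... <= abs (m s) powr p"
  proof (cases "0 < m s")
   case True
   have "2 powr (l s*p) = (2 powr l s) powr p" by (simp add: powr_powr)
   also have "... <= m s powr p" using m_bds(1)[OF True] p by (intro powr_mono2) auto
   finally show ?thesis using True s unfolding A_def by (simp add: indicator_def)
  next
   case False
   then show ?thesis unfolding A_def by (simp add: indicator_def)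
  qed
  finally show "(SUM k:K. 2 powr (k*p)*indicator (A k) s) <= abs (m s) powr p" .
 qed (use D0 in auto)
 also have "... = (2*B*(2*?D) powr (1/p)*nrm p m) powr p"
  using B D0 p nrm_nonneg[of p m] by (simp add: powr_mult powr_powr nrm_powr)
 finally show "nrm p (%s. rh' (%j. T u j s)) <= 2*B*(2*?D) powr (1/p)*nrm p (%s. rh (%j. u j s))"
  unfolding m_def using p B nrm_nonneg by (intro nrm_leI) auto
qed

theorem duality:
 assumes st: "strong_type p B" and B: "0 <= B" and pq: "1 < p" "1/p + 1/q = 1"
 shows "strong_type q B"
 unfolding strong_type_def
proof
 fix u :: "'j => 'a => real"
 have pos: "0 < p" "0 < q" and q: "1 < q"
 proof -
  show "0 < p" using pq by simp
  have "1/q = 1 - 1/p" "1/p < 1" "0 < 1/p" using pq by auto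
  then have "0 < 1/q" "1/q < 1" by linarith+
  then show "0 < q" "1 < q" by (simp_all add: zero_less_divide_iff divide_less_eq split: if_splits)
 qed
 have qp: "(q-1)*p = q" using pq pos by (simp add: field_simps)
 define X where "X s = rh' (%j. T u j s)" for s
 have X0: "0 <= X s" for s unfolding X_def by (rule rh'_nonneg)
 have "EX x. rh x <= 1 & (SUM j:J. x j*T u j s) = X s" for s
  unfolding X_def using norming[of "%j. T u j s"] by simp
 then obtain x where x: "!!s. rh (x s) <= 1" "!!s. (SUM j:J. x s j*T u j s) = X s"
  by metis
 \<comment> \<open>The extremal function: \<open>x s\<close> norms the image of \<open>u\<close> at
   \<open>s\<close>, and the power \<open>q-1\<close> turns the pairing into the \<open>q\<close>-th
   power of the norm, while the \<open>p\<close>-norm of \<open>h\<close> stays below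
   \<open>?N powr (q-1)\<close>.\<close>
 define h where "h j s = X s powr (q-1)*x s j" for j s
 have h_le: "rh (%j. h j s) <= X s powr (q-1)" for s
  unfolding h_def rh_scale using x(1)[of s] by (simp add: mult_left_le)
 let ?N = "nrm q X" and ?U = "nrm q (%s. rh (%j. u j s))"
 have N0: "0 <= ?N" by (rule nrm_nonneg)
 have "?N powr q = S (%s. SUM j:J. h j s*T u j s)"
 proof -
  have "X s powr q = (SUM j:J. h j s*T u j s)" for s
  proof -
   have "(SUM j:J. h j s*T u j s) = X s powr (q-1)*X s"
    unfolding h_def by (simp add: sum_distrib_left[symmetric] x(2) mult.assoc)
   also have "... = X s powr q" using X0[of s] q by (cases "X s = 0") (auto simp: powr_diff)
   finally show ?thesis ..
  qed
  then show ?thesis using pos X0 by (simp add: nrm_powr)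
 qed
 also have "... = sg*S (%s. SUM j:J. u j s*T h j s)" by (rule adj)
 also have "... <= abs (sg*S (%s. SUM j:J. u j s*T h j s))" by simp
 also have "... <= abs (S (%s. SUM j:J. u j s*T h j s))"
  using sg by (simp add: abs_mult mult_left_le_one_le)
 also have "... <= S (%s. abs (SUM j:J. u j s*T h j s))" by (rule S_abs_le)
 also have "... <= S (%s. abs (rh' (%j. T h j s)*rh (%j. u j s)))"
  using pairing rh_nonneg rh'_nonneg by (intro S_mono) (simp add: abs_mult mult.commute)
 also have "... <= nrm p (%s. rh' (%j. T h j s))*?U" by (rule Holder[OF pq])
 also have "... <= (B*nrm p (%s. rh (%j. h j s)))*?U"
  using st unfolding strong_type_def by (intro mult_right_mono nrm_nonneg) auto
 also have "... <= (B*?N powr (q-1))*?U"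
 proof (intro mult_right_mono mult_left_mono nrm_nonneg B)
  have "nrm p (%s. rh (%j. h j s)) <= nrm p (%s. X s powr (q-1))"
   using pos h_le rh_nonneg by (intro nrm_mono) auto
  also have "... = S (%s. abs (X s) powr q) powr (1/p)"
   unfolding nrm_def using X0 by (simp add: powr_powr qp)
  also have "... = ?N powr (q-1)"
  proof -
   have "q/p = q - 1" using pq pos by (simp add: field_simps)
   then show ?thesis using pos by (simp add: nrm_powr[symmetric] powr_powr)
  qed
  finally show "nrm p (%s. rh (%j. h j s)) <= ?N powr (q-1)" .
 qed
 finally have main: "?N powr q <= ?N powr (q-1)*(B*?U)" by (simp add: mult_ac)
 show "nrm q (%s. rh' (%j. T u j s)) <= B*?U"
 proof (cases "?N = 0")
  case True
  then show ?thesis using B nrm_nonneg unfolding X_def by simp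
 next
  case False
  then have "?N powr q = ?N powr (q-1)*?N" using N0 by (simp add: powr_diff)
  then have "?N <= B*?U" using main False N0 by simp
  then show ?thesis unfolding X_def .
 qed
qed

text \<open>Duality supplies the conjugate exponent \<open>P/(P-1)\<close> with the same bound, and
  interpolation fills the interval.\<close>

lemma strong_type_between:
 assumes "strong_type P B" "0 < B" "1 < P" "P/(P-1) < p" "p < P"
 shows "strong_type p (2*B*(2*interp_const (P/(P-1)) p P) powr (1/p))"
proof (rule interpolation)
 show "restricted_type P B" using assms by (intro strong_imp_restricted) auto
 have "1/P + 1/(P/(P-1)) = 1" using assms by (simp add: field_simps)
 then have "strong_type (P/(P-1)) B" using assms by (intro duality[OF assms(1)]) auto
 then show "restricted_type (P/(P-1)) B" using assms by (intro strong_imp_restricted) auto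
qed (use assms in auto)

end

section \<open>Dyadic trees\<close>

text \<open>The off-diagonal skeleton shared by both matrices. \<open>D_n\<close> minus the identity
  is of this form with \<open>ka = ka'\<close>. The summation matrix is of this form with
  \<open>ka' = - ka\<close> after \<open>1/2\<close> is subtracted from all entries and another
  \<open>1/2\<close> on the diagonal; without the shift by \<open>1/2\<close> it would have no
  parity.\<close>

fun tree_matrix :: "(nat => real) => (nat => real) => nat => nat => nat => real" where
 "tree_matrix ka ka' 0 i j = 0"
| "tree_matrix ka ka' (Suc s) i j =
   (if i <= 2^s & j <= 2^s then tree_matrix ka ka' s i j
   else if 2^s < i & 2^s < j then tree_matrix ka ka' s (i - 2^s) (j - 2^s)
   else if i <= 2^s then ka s else ka' s)"

definition block_sum :: "(nat => 'a => real) => nat => nat => 'a => real" where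
 "block_sum w s b x = (SUM i:{1..2^s}. w (b + i) x)"

definition tree_apply ::
  "(nat => real) => (nat => real) => (nat => 'a => real) => nat => nat => nat => 'a => real" where
 "tree_apply ka ka' w s b i x = (SUM j:{1..2^s}. tree_matrix ka ka' s i j*w (b + j) x)"

text \<open>A node is recorded under the height of its two halves, not its own, and under the offset
  of its left half; the leaves contribute nothing.\<close>

fun node_sum :: "(nat => nat => real) => nat => nat => real" where
 "node_sum be 0 b = 0"
| "node_sum be (Suc s) b = be s b + node_sum be s b + node_sum be s (b + 2^s)"

lemma sum_halves:
 fixes f :: "nat => 'b::comm_monoid_add"
 shows "(SUM i:{1..2^Suc s}. f i) = (SUM i:{1..2^s}. f i) + (SUM i:{1..2^s}. f (2^s + i))"
proof -
 have "{1..2^Suc s} = {1..2^s} \<union> {2^s + 1..2^s + 2^s :: nat}" by auto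
 then have "(SUM i:{1..2^Suc s}. f i) = (SUM i:{1..2^s}. f i) + (SUM i:{2^s + 1..2^s + 2^s}. f i)"
  by (simp only:) (rule sum.union_disjoint, auto)
 also have "(SUM i:{2^s + 1..2^s + 2^s}. f i) = (SUM i:{1..2^s}. f (2^s + i))"
  by (rule sum.reindex_bij_witness[of _ "%i. 2^s + i" "%i. i - 2^s"]) auto
 finally show ?thesis .
qed

lemma block_sum_Suc: "block_sum w (Suc s) b x = block_sum w s b x + block_sum w s (b + 2^s) x"
 unfolding block_sum_def by (subst sum_halves) (simp add: add.assoc)

lemma tree_apply_left:
 assumes "i : {1..2^s}"
 shows "tree_apply ka ka' w (Suc s) b i x = tree_apply ka ka' w s b i x + ka s*block_sum w s (b + 2^s) x"
proof -
 have "(SUM j:{1..2^s}. tree_matrix ka ka' (Suc s) i j*w (b + j) x) = tree_apply ka ka' w s b i x"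
  unfolding tree_apply_def using assms by (intro sum.cong) auto
 moreover have "(SUM j:{1..2^s}. tree_matrix ka ka' (Suc s) i (2^s + j)*w (b + (2^s + j)) x)
   = ka s*block_sum w s (b + 2^s) x"
  unfolding block_sum_def sum_distrib_left using assms by (intro sum.cong) (auto simp: add.assoc)
 ultimately show ?thesis by (simp only: tree_apply_def[of _ _ _ "Suc s"] sum_halves)
qed

lemma tree_apply_right:
 assumes "i : {1..2^s}"
 shows "tree_apply ka ka' w (Suc s) b (2^s + i) x
  = tree_apply ka ka' w s (b + 2^s) i x + ka' s*block_sum w s b x"
proof -
 have "(SUM j:{1..2^s}. tree_matrix ka ka' (Suc s) (2^s + i) j*w (b + j) x) = ka' s*block_sum w s b x"
  unfolding block_sum_def sum_distrib_left using assms by (intro sum.cong) auto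
 moreover have "(SUM j:{1..2^s}. tree_matrix ka ka' (Suc s) (2^s + i) (2^s + j)*w (b + (2^s + j)) x)
   = tree_apply ka ka' w s (b + 2^s) i x"
  unfolding tree_apply_def using assms by (intro sum.cong) (auto simp: add.assoc)
 ultimately show ?thesis by (simp only: tree_apply_def[of _ _ _ "Suc s"] sum_halves)
qed

lemma tree_matrix_abs_le:
 assumes "!!s. abs (ka s) <= 1" "!!s. abs (ka' s) <= 1"
 shows "abs (tree_matrix ka ka' s i j) <= 1"
 by (induction s arbitrary: i j) (use assms in auto)

lemma tree_matrix_transpose:
 assumes "!!s. ka' s = ta*ka s" "ta*ta = 1"
 shows "tree_matrix ka ka' s j i = ta*tree_matrix ka ka' s i j"
proof (induction s arbitrary: i j)
 case (Suc s)
 have "ta*(ta*c) = c" for c using assms(2) by (simp flip: mult.assoc)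
 then show ?case by (cases "i <= 2^s"; cases "j <= 2^s") (simp_all add: Suc[of i j] Suc[of "i - 2^s" "j - 2^s"] assms(1)[of s])
qed simp

lemma sum_lessThan_add:
 fixes f :: "nat => 'b::comm_monoid_add"
 shows "(SUM j<p + q. f j) = (SUM j<p. f j) + (SUM j<q. f (p + j))"
 by (induction q) (simp_all add: add.assoc)

lemma node_sum_eq:
 "node_sum be n b = (SUM s<n. SUM j<2^(n - 1 - s). be s (b + j*2^Suc s))"
proof (induction n arbitrary: b)
 case (Suc n)
 have "(SUM j<2^(n - s). be s (b + j*2^Suc s))
   = (SUM j<2^(n - 1 - s). be s (b + j*2^Suc s)) + (SUM j<2^(n - 1 - s). be s (b + 2^n + j*2^Suc s))"
  if s: "s < n" for s
 proof -
  let ?q = "2^(n - 1 - s) :: nat"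
  have e: "(2::nat)^(n - s) = ?q + ?q"
  proof -
   have "n - s = Suc (n - 1 - s)" using s by simp
   then show ?thesis by (simp only: power_Suc mult_2)
  qed
  have e2: "(2::nat)^n = ?q*2^Suc s"
  proof -
   have "n = (n - 1 - s) + Suc s" using s by simp
   then have "(2::nat)^n = 2^((n - 1 - s) + Suc s)" by simp
   then show ?thesis by (simp only: power_add)
  qed
  have "(SUM j<?q + ?q. be s (b + j*2^Suc s))
    = (SUM j<?q. be s (b + j*2^Suc s)) + (SUM j<?q. be s (b + (?q + j)*2^Suc s))"
   by (rule sum_lessThan_add)
  then show ?thesis unfolding e e2 by (simp add: algebra_simps)
 qed
 then show ?case by (simp add: Suc sum.distrib)
qed simp

definition tree_index :: "nat => (nat \<times> nat) set" where
 "tree_index n = (SIGMA s:{..n}. {..<2^(n - s)})"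

definition block_coord :: "(nat => 'a => real) => nat \<times> nat => 'a => real" where
 "block_coord w = (%(s, j). block_sum w s (j*2^s))"

lemma finite_tree_index [simp]: "finite (tree_index n)"
 unfolding tree_index_def by simp

lemma sum_tree_index: "sum f (tree_index n) = (SUM s<=n. SUM j<2^(n - s). f (s, j))"
 unfolding tree_index_def by (subst sum.Sigma) auto

lemma sum_pairs: "(SUM j<q. f (2*j) + f (2*j+1)) = (SUM j<2*q. f j)" for f :: "nat => real"
 by (induction q) (simp_all add: algebra_simps)

text \<open>Every node contributes through its two halves, and a block is a half of at most one node.\<close>

lemma node_sum_le:
 assumes "!!s j. be s (j*2^Suc s) <= f (s, 2*j) + f (s, 2*j+1)" and "!!k. 0 <= f k"
 shows "node_sum be n 0 <= sum f (tree_index n)"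
proof -
 have "node_sum be n 0 <= (SUM s<n. SUM j<2^(n - s). f (s, j))"
  unfolding node_sum_eq
 proof (rule sum_mono)
  fix s assume s: "s : {..<n}"
  let ?q = "2^(n - 1 - s) :: nat"
  have e: "(2::nat)^(n - s) = 2*?q"
  proof -
   have "n - s = Suc (n - 1 - s)" using s by auto
   then show ?thesis by (simp only: power_Suc)
  qed
  have "(SUM j<?q. be s (0 + j*2^Suc s)) <= (SUM j<?q. f (s, 2*j) + f (s, 2*j+1))"
   using assms(1) by (intro sum_mono) simp
  also have "... = (SUM j<2*?q. f (s, j))"
   using sum_pairs[of "%j. f (s, j)"] by simp
  finally show "(SUM j<?q. be s (0 + j*2^Suc s)) <= (SUM j<2^(n - s). f (s, j))" unfolding e .
 qed
 also have "... <= (SUM s<=n. SUM j<2^(n - s). f (s, j))"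
  using assms(2) by (intro sum_mono2 sum_nonneg) auto
 finally show ?thesis unfolding sum_tree_index .
qed

section \<open>Cauchy-Schwarz inequality for sums over the nodes\<close>

definition cross :: "(nat => nat => real) => (nat => nat => real) => nat => nat => real" where
 "cross f g s b = f s b*g s (b + 2^s) + f s (b + 2^s)*g s b"

definition same :: "(nat => nat => real) => (nat => nat => real) => nat => nat => real" where
 "same f g s b = f s b*g s b + f s (b + 2^s)*g s (b + 2^s)"

definition tree_norm :: "nat => (nat => nat => real) => real" where
 "tree_norm n f = L2_set (%(s, j). f s (j*2^s)) (tree_index n)"

lemma tree_norm_nonneg: "0 <= tree_norm n f"
 unfolding tree_norm_def by (rule L2_set_nonneg)

lemma tree_norm_power2: "(tree_norm n f)^2 = (SUM (s, j):tree_index n. (f s (j*2^s))^2)"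
 unfolding tree_norm_def L2_set_def by (simp add: sum_nonneg case_prod_unfold)

lemma node_sum_sum: "node_sum (%s b. SUM i:I. c i*ph i s b) n b = (SUM i:I. c i*node_sum (ph i) n b)"
 by (induction n arbitrary: b) (simp_all add: sum.distrib distrib_left)

lemma node_sum_add: "node_sum (%s b. be s b + ga s b) n b = node_sum be n b + node_sum ga n b"
 by (induction n arbitrary: b) simp_all

lemma node_sum_cmult: "node_sum (%s b. c*be s b) n b = c*node_sum be n b"
 by (induction n arbitrary: b) (simp_all add: distrib_left)

text \<open>The choice \<open>l = Y/X\<close> gives the product; if \<open>X\<close> or
  \<open>Y\<close> is zero, a very large or a very small \<open>l\<close> does. Weighted means add
  up over the nodes, products of norms do not, so the Cauchy-Schwarz inequality is proved for all
  \<open>l\<close> first and optimised at the end.\<close>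

lemma le_mult_if_le_weighted_mean:
 fixes z X Y :: real
 assumes "!!l. 0 < l ==> z <= (l*X^2 + Y^2/l)/2" "0 <= X" "0 <= Y"
 shows "z <= X*Y"
proof (rule field_le_epsilon)
 fix e :: real assume e: "0 < e"
 consider "0 < X" "0 < Y" | "X = 0" | "Y = 0" using assms by linarith
 then show "z <= X*Y + e"
 proof cases
  case 1
  then show ?thesis using assms(1)[of "Y/X"] e by (simp add: power2_eq_square field_simps)
 next
  case 2
  define l where "l = (Y^2+1)/e"
  have l: "0 < l" unfolding l_def using e by (simp add: add_nonneg_pos)
  have "Y^2 <= e*l" unfolding l_def using e by simp
  then have "Y^2/l <= e" using l by (simp add: divide_le_eq)
  then show ?thesis using assms(1)[OF l] e 2 by simp
 next
  case 3
  define l where "l = e/(X^2+1)"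
  have l: "0 < l" unfolding l_def using e by (simp add: add_nonneg_pos)
  have "l*X^2 <= l*(X^2+1)" using l by simp
  also have "... = e" unfolding l_def using zero_le_power2[of X] by (simp add: add_nonneg_eq_0_iff)
  finally show ?thesis using assms(1)[OF l] e 3 by simp
 qed
qed

lemma mult_le_weighted_mean: "0 < l ==> x*y <= (l*x^2 + y^2/l)/2" for x y l :: real
 using zero_le_power2[of "l*x - y"] by (simp add: field_simps power2_eq_square)

lemma node_sum_le_tree_norm:
 assumes "!!s b l. 0 < l ==> be s b <= (l*(f s b)^2 + (g s b)^2/l)/2
   + (l*(f s (b + 2^s))^2 + (g s (b + 2^s))^2/l)/2"
 shows "node_sum be n 0 <= tree_norm n f*tree_norm n g"
proof (rule le_mult_if_le_weighted_mean)
 fix l :: real assume l: "0 < l"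
 have "node_sum be n 0 <= (SUM k:tree_index n. case k of (s, j) => (l*(f s (j*2^s))^2 + (g s (j*2^s))^2/l)/2)"
 proof (rule node_sum_le)
  fix s j :: nat
  have "2*j*2^s = j*2^Suc s" "(2*j+1)*2^s = j*2^Suc s + 2^s" by simp_all
  then show "be s (j*2^Suc s) <= (case (s, 2*j) of (s, j) => (l*(f s (j*2^s))^2 + (g s (j*2^s))^2/l)/2)
    + (case (s, 2*j+1) of (s, j) => (l*(f s (j*2^s))^2 + (g s (j*2^s))^2/l)/2)"
   using assms[OF l, of s "j*2^Suc s"] by (simp only: prod.case)
 qed (use l in \<open>auto split: prod.split\<close>)
 also have "... = (l*(tree_norm n f)^2 + (tree_norm n g)^2/l)/2"
  unfolding tree_norm_power2 sum_distrib_left sum_divide_distrib sum.distrib[symmetric]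
  by (intro sum.cong) (auto simp: add_divide_distrib)
 finally show "node_sum be n 0 <= (l*(tree_norm n f)^2 + (tree_norm n g)^2/l)/2" .
qed (auto simp: tree_norm_nonneg)

lemma node_sum_cross: "node_sum (cross f g) n 0 <= tree_norm n f*tree_norm n g"
proof (rule node_sum_le_tree_norm)
 fix s b and l :: real assume "0 < l"
 from mult_le_weighted_mean[OF this, of "f s b" "g s (b + 2^s)"]
  mult_le_weighted_mean[OF this, of "f s (b + 2^s)" "g s b"]
 show "cross f g s b <= (l*(f s b)^2 + (g s b)^2/l)/2
   + (l*(f s (b + 2^s))^2 + (g s (b + 2^s))^2/l)/2"
  unfolding cross_def add_divide_distrib by linarith
qed

lemma node_sum_same: "node_sum (same f g) n 0 <= tree_norm n f*tree_norm n g"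
proof (rule node_sum_le_tree_norm)
 fix s b and l :: real assume "0 < l"
 from mult_le_weighted_mean[OF this, of "f s b" "g s b"]
  mult_le_weighted_mean[OF this, of "f s (b + 2^s)" "g s (b + 2^s)"]
 show "same f g s b <= (l*(f s b)^2 + (g s b)^2/l)/2
   + (l*(f s (b + 2^s))^2 + (g s (b + 2^s))^2/l)/2"
  unfolding same_def by linarith
qed

lemma block_sum_level:
 "(SUM j<q. block_sum w s (b + j*2^s) x) = (SUM i:{1..q*2^s}. w (b + i) x)"
proof (induction q)
 case (Suc q)
 have "{1..Suc q*2^s} = {1..q*2^s} \<union> {q*2^s + 1..q*2^s + 2^s}" by auto
 then have "(SUM i:{1..Suc q*2^s}. w (b + i) x)
   = (SUM i:{1..q*2^s}. w (b + i) x) + (SUM i:{q*2^s + 1..q*2^s + 2^s}. w (b + i) x)"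
  by (simp only:) (rule sum.union_disjoint, auto)
 also have "(SUM i:{q*2^s + 1..q*2^s + 2^s}. w (b + i) x) = block_sum w s (b + q*2^s) x"
  unfolding block_sum_def
  by (rule sum.reindex_bij_witness[of _ "%i. q*2^s + i" "%i. i - q*2^s"]) (auto simp: add.assoc)
 finally show ?case using Suc by simp
qed simp

lemma sum_squares_le_square_sum:
 fixes f :: "'i => real"
 assumes "finite I" "!!i. i : I ==> 0 <= f i"
 shows "(SUM i:I. (f i)^2) <= (SUM i:I. f i)^2"
proof -
 have "(SUM i:I. (f i)^2) <= (SUM i:I. f i*(SUM i:I. f i))"
  unfolding power2_eq_square using assms by (intro sum_mono mult_left_mono member_le_sum) auto
 then show ?thesis by (simp add: power2_eq_square sum_distrib_right)
qed

text \<open>On each of the \<open>n+1\<close> levels the blocks partition the index set, and for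
  nonnegative numbers a sum of squares is at most the square of the sum.\<close>

lemma block_coord_squares_le:
 "(SUM k:tree_index n. (block_coord w k x)^2) <= (real n+1)*(SUM i:{1..2^n}. abs (w i x))^2"
proof -
 have "(SUM j<2^(n - s). (block_coord w (s, j) x)^2) <= (SUM i:{1..2^n}. abs (w i x))^2" if s: "s <= n" for s
 proof -
  have "(SUM j<2^(n - s). (block_coord w (s, j) x)^2)
    <= (SUM j<2^(n - s). (block_sum (%i x. abs (w i x)) s (0 + j*2^s) x)^2)"
  proof (rule sum_mono)
   fix j
   have "abs (block_coord w (s, j) x) <= abs (block_sum (%i x. abs (w i x)) s (0 + j*2^s) x)"
    unfolding block_coord_def block_sum_def by (auto intro: order_trans[OF sum_abs])
   then show "(block_coord w (s, j) x)^2 <= (block_sum (%i x. abs (w i x)) s (0 + j*2^s) x)^2"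
    by (simp add: abs_le_square_iff)
  qed
  also have "... <= (SUM j<2^(n - s). block_sum (%i x. abs (w i x)) s (0 + j*2^s) x)^2"
   by (rule sum_squares_le_square_sum) (auto simp: block_sum_def intro!: sum_nonneg)
  also have "... = (SUM i:{1..2^n}. abs (w i x))^2"
   unfolding block_sum_level using s by (simp flip: power_add)
  finally show ?thesis .
 qed
 then have "(SUM k:tree_index n. (block_coord w k x)^2) <= (SUM s<=n. (SUM i:{1..2^n}. abs (w i x))^2)"
  unfolding sum_tree_index by (intro sum_mono) auto
 then show ?thesis by (simp add: add.commute)
qed

lemma tree_norm_block_sum_le:
 "tree_norm n (%s b. block_sum w s b x) <= sqrt (real n+1)*(SUM i:{1..2^n}. abs (w i x))"
proof -
 have "(tree_norm n (%s b. block_sum w s b x))^2 <= (real n+1)*(SUM i:{1..2^n}. abs (w i x))^2"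
  using block_coord_squares_le[where n = n and w = w and x = x] unfolding tree_norm_power2 block_coord_def
  by (simp add: case_prod_unfold)
 then have "sqrt ((tree_norm n (%s b. block_sum w s b x))^2) <= sqrt ((real n+1)*(SUM i:{1..2^n}. abs (w i x))^2)"
  by (rule real_sqrt_le_mono)
 then show ?thesis by (simp add: real_sqrt_mult tree_norm_nonneg sum_nonneg)
qed

section \<open>The polarised cubic form and its decomposition over the nodes\<close>

locale scalar_op = weighted_set Om wt for Om :: "'a set" and wt +
 fixes T :: "('a => real) => 'a => real" and sg :: real
 assumes T_add: "T (%s. f s + g s) s = T f s + T g s"
  and T_scale: "T (%s. c*f s) s = c*T f s"
  and T_cong: "(!!s. s : Om ==> f s = g s) ==> T f = T g"
  and T_adj: "S (%s. g s*T f s) = sg*S (%s. f s*T g s)"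
  and sg: "sg * sg = 1"
begin

lemma T_zero: "T (%s. 0) s = 0"
 using T_scale[of 0 "%_. 0" s] by simp

lemma T_sum: "T (%s. SUM i:I. f i s) s = (SUM i:I. T (f i) s)"
proof (cases "finite I")
 case True
 then show ?thesis by induction (simp_all add: T_zero T_add)
qed (simp add: T_zero)

lemma T_lincomb: "T (%s. SUM i:I. c i*f i s) s = (SUM i:I. c i*T (f i) s)"
 by (simp add: T_sum T_scale)

text \<open>The derivative, in the direction \<open>h\<close>, of the cubic form at
  \<open>u\<close>, restricted to the block of height \<open>s\<close> with offset \<open>b\<close>.
  \<open>Y\<close> is what the columns outside of the block contribute to its rows, and
  \<open>Z\<close> is the same for \<open>h\<close>. The polarised form is required when the
  exponent is doubled, where \<open>h\<close> is not \<open>u\<close>.\<close>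

definition tree_form where
 "tree_form ka ka' u h s b Y Z = (SUM i:{1..2^s}. S (%x.
   h (b + i) x*(T (%x. Y x + tree_apply ka ka' u s b i x) x)^2
   + 2*u (b + i) x*T (%x. Y x + tree_apply ka ka' u s b i x) x*T (%x. Z x + tree_apply ka ka' h s b i x) x))"

text \<open>The change of \<open>outer_form\<close> on the half with masses \<open>au\<close>,
  \<open>ah\<close> when the masses \<open>bu\<close>, \<open>bh\<close> of the other half, times
  the matrix entry \<open>c\<close>, are added to \<open>Y\<close> and \<open>Z\<close>.\<close>

definition half_node where
 "half_node c Y Z au ah bu bh = S (%x.
   2*c*(T Y x*(ah x*T bu x + au x*T bh x) + T Z x*(au x*T bu x))
   + c^2*(ah x*(T bu x)^2 + 2*(au x*T bu x*T bh x)))"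

definition node where
 "node ka ka' u h s b Y Z =
   half_node (ka s) Y Z (block_sum u s b) (block_sum h s b) (block_sum u s (b + 2^s)) (block_sum h s (b + 2^s))
   + half_node (ka' s) Y Z (block_sum u s (b + 2^s)) (block_sum h s (b + 2^s)) (block_sum u s b) (block_sum h s b)"

text \<open>What remains of \<open>tree_form\<close> if the entries of the matrix inside the block
  are removed; then only the sums over the block matter.\<close>

definition outer_form where
 "outer_form u h s b Y Z = S (%x. block_sum h s b x*(T Y x)^2 + 2*block_sum u s b x*T Y x*T Z x)"

lemma tree_form_Suc:
 "tree_form ka ka' u h (Suc s) b Y Z =
   tree_form ka ka' u h s b (%x. Y x + ka s*block_sum u s (b + 2^s) x) (%x. Z x + ka s*block_sum h s (b + 2^s) x)
  + tree_form ka ka' u h s (b + 2^s) (%x. Y x + ka' s*block_sum u s b x) (%x. Z x + ka' s*block_sum h s b x)"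
proof -
 have L: "t + tree_apply ka ka' w (Suc s) b i x = t + ka s*block_sum w s (b + 2^s) x + tree_apply ka ka' w s b i x"
  if "i : {1..2^s}" for t w i x unfolding tree_apply_left[OF that] by simp
 have R: "t + tree_apply ka ka' w (Suc s) b (2^s + i) x
   = t + ka' s*block_sum w s b x + tree_apply ka ka' w s (b + 2^s) i x"
  if "i : {1..2^s}" for t w i x unfolding tree_apply_right[OF that] by simp
 show ?thesis
  unfolding tree_form_def sum_halves
  by (intro arg_cong2[where f = "(+)"] sum.cong refl) (simp_all only: L R add.assoc)
qed

lemma outer_form_split:
 "outer_form u h s b (%x. Y x + ka s*block_sum u s (b + 2^s) x) (%x. Z x + ka s*block_sum h s (b + 2^s) x)
  + outer_form u h s (b + 2^s) (%x. Y x + ka' s*block_sum u s b x) (%x. Z x + ka' s*block_sum h s b x)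
  = outer_form u h (Suc s) b Y Z + node ka ka' u h s b Y Z"
 unfolding outer_form_def node_def half_node_def S_add[symmetric]
 by (intro S_cong) (simp add: T_add T_scale block_sum_Suc power2_eq_square algebra_simps)

text \<open>Going from a block to its halves moves the mass of the other half into \<open>Y\<close>,
  so the difference of the two forms is a telescoping sum of node contributions. The hypothesis on
  \<open>Y\<close> survives the move: what leaves the block sum enters \<open>Y\<close> with a
  factor of modulus at most one. Thus at every node \<open>Y\<close> is bounded by the total mass
  \<open>mu\<close>.\<close>

theorem tree_form_bound:
 assumes ka: "!!s. abs (ka s) <= 1" "!!s. abs (ka' s) <= 1"
  and u: "!!i x. 0 <= u i x" and h: "!!i x. 0 <= h i x"
  and be: "!!s b Y Z. (!!x. abs (Y x) + block_sum u (Suc s) b x <= mu x) ==>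
   (!!x. abs (Z x) + block_sum h (Suc s) b x <= mh x) ==> abs (node ka ka' u h s b Y Z) <= be s b"
  and Y: "!!x. abs (Y x) + block_sum u s b x <= mu x" and Z: "!!x. abs (Z x) + block_sum h s b x <= mh x"
 shows "abs (tree_form ka ka' u h s b Y Z - outer_form u h s b Y Z) <= node_sum be s b"
 using Y Z
proof (induction s arbitrary: b Y Z)
 case 0
 then show ?case by (simp add: tree_form_def outer_form_def block_sum_def tree_apply_def)
next
 case (Suc s)
 let ?Y1 = "%x. Y x + ka s*block_sum u s (b + 2^s) x" and ?Z1 = "%x. Z x + ka s*block_sum h s (b + 2^s) x"
 let ?Y2 = "%x. Y x + ka' s*block_sum u s b x" and ?Z2 = "%x. Z x + ka' s*block_sum h s b x"
 have pos: "0 <= block_sum u s b x" "0 <= block_sum h s b x" for s b x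
  unfolding block_sum_def by (auto intro!: sum_nonneg u h)
 have shift: "abs (y + c*t) + r <= M" if "abs y + (r + t) <= M" "abs c <= 1" "0 <= t" for y c t r M :: real
 proof -
  have "abs (y + c*t) <= abs y + abs c*t" using that by (metis abs_mult abs_of_nonneg abs_triangle_ineq)
  also have "abs c*t <= t" using that by (simp add: mult_left_le_one_le)
  finally show ?thesis using that by linarith
 qed
 have "abs (tree_form ka ka' u h s b ?Y1 ?Z1 - outer_form u h s b ?Y1 ?Z1) <= node_sum be s b"
  by (rule Suc.IH; rule shift) (use Suc.prems ka pos in \<open>auto simp: block_sum_Suc\<close>)
 moreover have "abs (tree_form ka ka' u h s (b + 2^s) ?Y2 ?Z2 - outer_form u h s (b + 2^s) ?Y2 ?Z2) <= node_sum be s (b + 2^s)"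
  by (rule Suc.IH; rule shift) (use Suc.prems ka pos in \<open>auto simp: block_sum_Suc add.commute\<close>)
 moreover have "abs (node ka ka' u h s b Y Z) <= be s b"
  by (rule be[OF Suc.prems])
 moreover have "tree_form ka ka' u h (Suc s) b Y Z - outer_form u h (Suc s) b Y Z =
   (tree_form ka ka' u h s b ?Y1 ?Z1 - outer_form u h s b ?Y1 ?Z1)
   + (tree_form ka ka' u h s (b + 2^s) ?Y2 ?Z2 - outer_form u h s (b + 2^s) ?Y2 ?Z2)
   + node ka ka' u h s b Y Z"
  using outer_form_split[of u h s b Y ka Z ka'] by (simp add: tree_form_Suc)
 ultimately show ?case by simp
qed

end

section \<open>Operators on vector-valued functions\<close>

lemma powr_3_eq: "0 <= x ==> x powr 3 = x^3" for x :: real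
 by (cases "x = 0") (auto simp: powr_numeral)

lemma linf_norm_ge: "i : {1..d} ==> norm (x i) <= linf_norm d x"
 unfolding linf_norm_def by simp

lemma linf_norm_attained:
 assumes "1 <= d" obtains i where "i : {1..d}" "linf_norm d x = norm (x i)"
proof -
 have "linf_norm d x : (%i. norm (x i)) ` {1..d}"
  unfolding linf_norm_def using assms by (intro Max_in) auto
 then show ?thesis using that by auto
qed

lemma linf_norm_le: "1 <= d ==> (!!i. i : {1..d} ==> norm (x i) <= B) ==> linf_norm d x <= B"
 by (metis linf_norm_attained)

lemma linf_norm_nonneg: "1 <= d ==> 0 <= linf_norm d x"
 by (metis linf_norm_attained norm_ge_zero)

lemma linf_norm_cong: "(!!i. i : {1..d} ==> norm (x i) = norm (y i)) ==> linf_norm d x = linf_norm d y"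
 unfolding linf_norm_def by (intro arg_cong[where f = Max] image_cong) auto

lemma linf_norm_scale:
 fixes x :: "nat => real"
 assumes "1 <= d" shows "linf_norm d (%i. c*x i) = abs c*linf_norm d x"
proof (rule antisym)
 show "linf_norm d (%i. c*x i) <= abs c*linf_norm d x"
  using assms linf_norm_ge[of _ d x] by (intro linf_norm_le) (auto simp: abs_mult intro!: mult_left_mono)
 obtain i where i: "i : {1..d}" "linf_norm d x = norm (x i)" using assms by (rule linf_norm_attained)
 show "abs c*linf_norm d x <= linf_norm d (%i. c*x i)"
  using linf_norm_ge[OF i(1), of "%i. c*x i"] i(2) by (simp add: abs_mult)
qed

lemma linf_norm_triangle:
 assumes "1 <= d" shows "linf_norm d (%i. x i + y i) <= linf_norm d x + linf_norm d y"
 using assms by (intro linf_norm_le) (auto intro!: order_trans[OF norm_triangle_ineq] add_mono linf_norm_ge)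

lemma L2_set_norming: "EX x. L2_set x J <= 1 & (SUM j:J. x j*y j) = L2_set y J"
proof (cases "L2_set y J = 0")
 case True
 then show ?thesis by (intro exI[of _ "%_. 0"]) (simp add: L2_set_def)
next
 case False
 let ?n = "L2_set y J"
 have pos: "0 < ?n" using False by (simp add: order_less_le L2_set_nonneg)
 have sq: "(SUM j:J. (y j)^2) = ?n^2" unfolding L2_set_def by (simp add: sum_nonneg)
 have "L2_set (%j. inverse ?n*y j) J = 1"
  using pos by (subst L2_set_right_distrib[symmetric]) auto
 moreover have "(SUM j:J. inverse ?n*y j*y j) = inverse ?n*(SUM j:J. (y j)^2)"
  by (simp add: sum_distrib_left power2_eq_square mult.assoc)
 ultimately show ?thesis
  using pos unfolding sq by (intro exI[of _ "%j. inverse ?n*y j"]) (simp add: power2_eq_square)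
qed

context scalar_op
begin

definition l2_strong :: "'j set => real => real => bool" where
 "l2_strong J p B \<longleftrightarrow>
   (ALL u. nrm p (%s. L2_set (%j. T (u j) s) J) <= B*nrm p (%s. L2_set (%j. u j s) J))"

definition tree_op where
 "tree_op ka ka' n u i s = T (tree_apply ka ka' u n 0 i) s"

definition tree_strong where
 "tree_strong ka ka' n p B \<longleftrightarrow>
   (ALL u. nrm p (%s. linf_norm (2^n) (%i. tree_op ka ka' n u i s))
    <= B*nrm p (%s. l1_norm (2^n) (%i. u i s)))"

lemma sg_abs: "abs (sg) = 1"
 using sg by (metis abs_mult_self_eq abs_1 abs_mult mult_eq_0_iff mult_right_cancel power2_eq_1_iff power2_eq_square abs_minus_cancel)

lemma vec_op_l2:
 assumes "finite J"
 shows "vec_op Om wt J (%x. L2_set x J) (%x. L2_set x J) (%u j. T (u j)) sg"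
proof unfold_locales
 show "L2_set (%j. c*x j) J = abs c*L2_set x J" for c x
  by (simp add: L2_set_def power_mult_distrib sum_distrib_left[symmetric] real_sqrt_mult)
 show "abs (SUM j:J. x j*y j) <= L2_set x J*L2_set y J" for x y
  by (rule order_trans[OF sum_abs]) (simp add: abs_mult L2_set_mult_ineq)
 show "S (%s. SUM j:J. h j s*T (u j) s) = sg*S (%s. SUM j:J. u j s*T (h j) s)" for h u
  by (simp add: S_sum T_adj[of "h _" "u _"] sum_distrib_left)
 show "T (u j) s = T (v j) s"
  if "s : Om" "j : J" "!!j s. j : J ==> s : Om ==> u j s = v j s" for s j u v
  using T_cong[of "u j" "v j"] that by simp
qed (use assms sg_abs in \<open>auto simp: L2_set_triangle_ineq L2_set_norming T_lincomb intro!: L2_set_cong\<close>)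

lemma tree_op_linear: "tree_op ka ka' n (%j s. SUM k:I. a k*w k j s) i s = (SUM k:I. a k*tree_op ka ka' n (w k) i s)"
proof -
 have "tree_apply ka ka' (%j s. SUM k:I. a k*w k j s) n 0 i = (%x. SUM k:I. a k*tree_apply ka ka' (w k) n 0 i x)"
  unfolding tree_apply_def sum_distrib_left by (subst sum.swap) (simp add: mult_ac)
 then show ?thesis unfolding tree_op_def by (simp only: T_lincomb)
qed

lemma tree_op_add: "tree_op ka ka' n (%j s. u j s + v j s) i s = tree_op ka ka' n u i s + tree_op ka ka' n v i s"
proof -
 have "tree_apply ka ka' (%j s. u j s + v j s) n 0 i = (%x. tree_apply ka ka' u n 0 i x + tree_apply ka ka' v n 0 i x)"
  unfolding tree_apply_def by (simp add: distrib_left sum.distrib)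
 then show ?thesis unfolding tree_op_def by (simp only: T_add)
qed

lemma tree_op_scale: "tree_op ka ka' n (%j s. c*u j s) i s = c*tree_op ka ka' n u i s"
proof -
 have "tree_apply ka ka' (%j s. c*u j s) n 0 i = (%x. c*tree_apply ka ka' u n 0 i x)"
  unfolding tree_apply_def by (simp add: sum_distrib_left mult_ac)
 then show ?thesis unfolding tree_op_def by (simp only: T_scale)
qed

lemma tree_op_eq_sum:
 "tree_op ka ka' n u i s = (SUM j:{1..2^n}. tree_matrix ka ka' n i j*T (u j) s)"
proof -
 have "tree_apply ka ka' u n 0 i = (%x. SUM j:{1..2^n}. tree_matrix ka ka' n i j*u j x)"
  unfolding tree_apply_def by simp
 then show ?thesis unfolding tree_op_def by (simp only: T_lincomb)
qed

text \<open>Moving the operator to the other factor of the pairing transposes the matrix, with sign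
  \<open>ta\<close>, and takes the adjoint of \<open>T\<close>, with sign \<open>sg\<close>.\<close>

lemma vec_op_tree:
 assumes ta: "!!s. ka' s = ta*ka s" "ta*ta = 1"
 shows "vec_op Om wt {1..2^n} (l1_norm (2^n)) (linf_norm (2^n)) (tree_op ka ka' n) (sg*ta)"
proof unfold_locales
 show "finite {1..2^n :: nat}" by simp
 show "0 <= l1_norm (2^n) x" for x :: "nat => real" unfolding l1_norm_def by (simp add: sum_nonneg)
 show "0 <= linf_norm (2^n) x" for x :: "nat => real" by (simp add: linf_norm_nonneg)
 show "l1_norm (2^n) (%j. c*x j) = abs c*l1_norm (2^n) x" for c and x :: "nat => real"
  unfolding l1_norm_def by (simp add: sum_distrib_left abs_mult)
 show "linf_norm (2^n) (%j. c*x j) = abs c*linf_norm (2^n) x" for c and x :: "nat => real"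
  by (simp add: linf_norm_scale)
 show "linf_norm (2^n) (%j. x j + y j) <= linf_norm (2^n) x + linf_norm (2^n) y" for x y :: "nat => real"
  by (simp add: linf_norm_triangle)
 show "linf_norm (2^n) x = linf_norm (2^n) y" if "!!j. j : {1..2^n} ==> x j = y j" for x y :: "nat => real"
  using that by (intro linf_norm_cong) auto
 show "abs (SUM j:{1..2^n}. x j*y j) <= l1_norm (2^n) x*linf_norm (2^n) y" for x y :: "nat => real"
 proof -
  have "abs (SUM j:{1..2^n}. x j*y j) <= (SUM j:{1..2^n}. norm (x j)*linf_norm (2^n) y)"
   using linf_norm_ge[of _ "2^n" y]
   by (intro order_trans[OF sum_abs] sum_mono) (auto simp: abs_mult intro!: mult_left_mono)
  then show ?thesis unfolding l1_norm_def sum_distrib_right .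
 qed
 show "EX x. l1_norm (2^n) x <= 1 & (SUM j:{1..2^n}. x j*y j) = linf_norm (2^n) y" for y :: "nat => real"
 proof -
  obtain i where i: "i : {1..2^n}" "linf_norm (2^n) y = norm (y i)"
   by (rule linf_norm_attained[of "2^n" y]) auto
  show ?thesis
  proof (intro exI[of _ "%j. if j = i then sgn (y i) else 0"] conjI)
   show "l1_norm (2^n) (%j. if j = i then sgn (y i) else 0) <= 1"
    unfolding l1_norm_def using i by (simp add: if_distrib[of abs] abs_sgn_eq cong: if_cong)
   show "(SUM j:{1..2^n}. (if j = i then sgn (y i) else 0)*y j) = linf_norm (2^n) y"
   proof -
    have "(SUM j:{1..2^n}. (if j = i then sgn (y i) else 0)*y j) = (SUM j:{1..2^n}. if j = i then abs (y i) else 0)"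
     by (intro sum.cong) (auto simp: abs_sgn mult.commute)
    then show ?thesis using i by simp
   qed
  qed
 qed
 show "tree_op ka ka' n (%j s. SUM i:I. a i*w i j s) j s = (SUM i:I. a i*tree_op ka ka' n (w i) j s)" for I :: "int set" and a w j s
  by (rule tree_op_linear)
 show "tree_op ka ka' n u j s = tree_op ka ka' n v j s"
  if "!!j s. j : {1..2^n} ==> s : Om ==> u j s = v j s" for s j u v
 proof -
  have "tree_op ka ka' n u j = tree_op ka ka' n v j"
   unfolding tree_op_def
   by (intro ext fun_cong[OF T_cong]) (use that in \<open>auto simp: tree_apply_def intro!: sum.cong\<close>)
  then show ?thesis by simp
 qed
 show "S (%s. SUM j:{1..2^n}. h j s*tree_op ka ka' n u j s) = sg*ta*S (%s. SUM j:{1..2^n}. u j s*tree_op ka ka' n h j s)" for h u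
 proof -
  have "S (%s. SUM i:{1..2^n}. h i s*tree_op ka ka' n u i s)
    = (SUM i:{1..2^n}. SUM j:{1..2^n}. tree_matrix ka ka' n i j*S (%s. h i s*T (u j) s))"
   unfolding tree_op_eq_sum by (simp add: S_sum sum_distrib_left S_cmult[symmetric] mult_ac)
  also have "... = (SUM j:{1..2^n}. SUM i:{1..2^n}. tree_matrix ka ka' n i j*S (%s. h i s*T (u j) s))"
   by (rule sum.swap)
  also have "... = (SUM j:{1..2^n}. SUM i:{1..2^n}. sg*ta*(tree_matrix ka ka' n j i*S (%s. u j s*T (h i) s)))"
  proof (intro sum.cong refl)
   fix i j
   show "tree_matrix ka ka' n i j*S (%s. h i s*T (u j) s)
     = sg*ta*(tree_matrix ka ka' n j i*S (%s. u j s*T (h i) s))"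
    using T_adj[of "h i" "u j"] tree_matrix_transpose[OF ta, where s = n and i = i and j = j] ta(2) by simp
  qed
  also have "... = sg*ta*S (%s. SUM j:{1..2^n}. u j s*tree_op ka ka' n h j s)"
   unfolding tree_op_eq_sum by (simp add: S_sum sum_distrib_left S_cmult[symmetric] mult_ac)
  finally show ?thesis .
 qed
 show "abs (sg*ta) <= 1"
 proof -
  have "abs (ta) = 1" using ta(2) by (metis abs_mult_self_eq abs_of_nonneg abs_square_eq_1 power2_eq_square)
  then show ?thesis using sg_abs by (simp add: abs_mult)
 qed
qed

lemma l2_strong_dual:
 assumes "finite J" "l2_strong J p B" "0 <= B" "1 < p" "1/p + 1/q = 1"
 shows "l2_strong J q B"
proof -
 interpret V: vec_op Om wt J "%x. L2_set x J" "%x. L2_set x J" "%u j. T (u j)" sg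
  by (rule vec_op_l2[OF assms(1)])
 show ?thesis
  using V.duality[of p B q] assms unfolding l2_strong_def V.strong_type_def by blast
qed

lemma l2_strong_between:
 assumes "finite J" "l2_strong J P B" "0 < B" "1 < P" "P/(P-1) < p" "p < P"
 shows "l2_strong J p (2*B*(2*interp_const (P/(P-1)) p P) powr (1/p))"
proof -
 interpret V: vec_op Om wt J "%x. L2_set x J" "%x. L2_set x J" "%u j. T (u j)" sg
  by (rule vec_op_l2[OF assms(1)])
 show ?thesis
  using V.strong_type_between[of P B p] assms unfolding l2_strong_def V.strong_type_def by blast
qed

lemma tree_strong_dual:
 assumes ta: "!!s. ka' s = ta*ka s" "ta*ta = 1"
  and st: "tree_strong ka ka' n p B" "0 <= B" "1 < p" "1/p + 1/q = 1"
 shows "tree_strong ka ka' n q B"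
proof -
 interpret V: vec_op Om wt "{1..2^n}" "l1_norm (2^n)" "linf_norm (2^n)" "tree_op ka ka' n" "sg*ta"
  by (rule vec_op_tree[OF ta])
 show ?thesis
  using V.duality[of p B q] st unfolding tree_strong_def V.strong_type_def by blast
qed

lemma tree_strong_between:
 assumes ta: "!!s. ka' s = ta*ka s" "ta*ta = 1"
  and st: "tree_strong ka ka' n P B" "0 < B" "1 < P" "P/(P-1) < p" "p < P"
 shows "tree_strong ka ka' n p (2*B*(2*interp_const (P/(P-1)) p P) powr (1/p))"
proof -
 interpret V: vec_op Om wt "{1..2^n}" "l1_norm (2^n)" "linf_norm (2^n)" "tree_op ka ka' n" "sg*ta"
  by (rule vec_op_tree[OF ta])
 show ?thesis
  using V.strong_type_between[of P B p] st unfolding tree_strong_def V.strong_type_def by blast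
qed

lemma l2_strong_scalar:
 assumes "finite J" "l2_strong J p B" "j : J"
 shows "nrm p (T f) <= B*nrm p f"
proof -
 have "L2_set (%i. (if i = j then c else 0)) J = abs c" for c
  using assms unfolding L2_set_def by (simp add: if_distrib[of "%x. x^2"] cong: if_cong)
 moreover have "T ((%i s. if i = j then f s else 0) i) s = (if i = j then T f s else 0)" for i s
  by (simp add: T_zero)
 ultimately show ?thesis
  using assms(2)[unfolded l2_strong_def, rule_format, of "%i s. if i = j then f s else 0"] by simp
qed

text \<open>Positive and negative parts: \<open>4\<close> from \<open>nrm_add_le\<close>, times two
  parts.\<close>

lemma tree_strongI_nonneg:
 assumes p: "1 <= p" and B: "0 <= B"
  and pos: "!!u. (!!i s. 0 <= u i s) ==>
   nrm p (%s. linf_norm (2^n) (%i. tree_op ka ka' n u i s)) <= B*nrm p (%s. SUM i:{1..2^n}. u i s)"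
 shows "tree_strong ka ka' n p (8*B)"
proof -
 let ?N = "{1..2^n :: nat}" and ?F = "tree_op ka ka' n"
 let ?X = "%u s. linf_norm (2^n) (%i. ?F u i s)"
 show ?thesis
  unfolding tree_strong_def
 proof
  fix u :: "nat => 'a => real"
  define P where "P i s = max (u i s) 0" for i s
  define M where "M i s = max (- u i s) 0" for i s
  have u: "u = (%i s. P i s + (- 1)*M i s)" unfolding P_def M_def by (auto simp: fun_eq_iff max_def)
  let ?U = "nrm p (%s. l1_norm (2^n) (%i. u i s))"
  have part: "nrm p (?X f) <= B*?U" if f: "!!i s. 0 <= f i s" "!!i s. f i s <= abs (u i s)" for f
  proof -
   have "nrm p (%s. SUM i:?N. f i s) <= ?U"
   proof (rule nrm_mono)
    fix s
    show "abs (SUM i:?N. f i s) <= abs (l1_norm (2^n) (%i. u i s))"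
     unfolding l1_norm_def using f by (auto intro!: sum_mono simp: sum_nonneg)
   qed (use p in simp)
   then show ?thesis using pos[of f, OF f(1)] B by (smt (verit) mult_left_mono)
  qed
  have "nrm p (?X u) <= 4*(nrm p (?X P) + nrm p (?X M))"
  proof (rule nrm_add_le)
   fix s
   have "?X u s <= ?X P s + linf_norm (2^n) (%i. (- 1)*?F M i s)"
    by (subst u) (simp only: tree_op_add tree_op_scale linf_norm_triangle one_le_power one_le_numeral)
   also have "linf_norm (2^n) (%i. (- 1)*?F M i s) = ?X M s"
    by (subst linf_norm_scale) auto
   finally show "abs (?X u s) <= abs (?X P s) + abs (?X M s)"
    by (simp add: linf_norm_nonneg)
  qed (use p in simp)
  also have "... <= 4*(B*?U + B*?U)"
   by (intro mult_left_mono add_mono part) (auto simp: P_def M_def)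
  also have "... = 8*B*?U" by simp
  finally show "nrm p (?X u) <= 8*B*?U" .
 qed
qed

text \<open>The test vector \<open>u + tt X e\<^sub>i\<close>, where \<open>i\<close> is chosen pointwise such that the \<open>i\<close>-th coordinate
 of the image of \<open>u\<close> attains the maximum \<open>X\<close>, turns the cubic estimate into a bound for \<open>X\<close>.\<close>

lemma cubic_imp_strong:
 assumes B: "0 < B"
  and cubic: "!!w. (!!i s. 0 <= w i s) ==>
   S (%s. SUM i:{1..2^n}. w i s*(tree_op ka ka' n w i s)^2) <= B^2*S (%s. (SUM i:{1..2^n}. w i s)^3)"
 shows "tree_strong ka ka' n 3 (40*B)"
proof -
 let ?N = "{1..2^n :: nat}"
 let ?F = "tree_op ka ka' n"
 let ?X = "%u s. linf_norm (2^n) (%i. ?F u i s)"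
 have pos: "nrm 3 (?X u) <= 5*B*nrm 3 (%s. SUM i:?N. u i s)" if u: "!!i s. 0 <= u i s" for u
 proof -
  define X where "X = ?X u"
  define m where "m s = (SUM i:?N. u i s)" for s
  have X0: "0 <= X s" for s unfolding X_def by (simp add: linf_norm_nonneg)
  have m0: "0 <= m s" for s unfolding m_def by (intro sum_nonneg u)
  have "EX i:?N. X s = abs (?F u i s)" for s
   unfolding X_def using linf_norm_attained[of "2^n" "%i. ?F u i s"] by (metis one_le_numeral one_le_power real_norm_def)
  then obtain k where k: "!!s. k s : ?N" "!!s. X s = abs (?F u (k s) s)" by metis
  define e where "e j s = (if j = k s then X s else 0)" for j s
  have e0: "0 <= e j s" for j s unfolding e_def using X0 by simp
  have e_sum: "(SUM j:?N. e j s) = X s" for s unfolding e_def using k(1)[of s] by simp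
  \<comment> \<open>With this \<open>tt\<close> the terms with \<open>X^3\<close> on the right get
    the total coefficient \<open>10*tt^2*B^2 = 2/5\<close> and can be absorbed. The term with
    \<open>m^3\<close> gets \<open>40*B^3\<close>, and \<open>40/(1 - 2/5)\<close> is less than
    \<open>125\<close>, the cube of \<open>5\<close>.\<close>
  define tt where "tt = 1/(5*B)"
  have tt: "0 < tt" unfolding tt_def using B by simp
  define w where "w j s = u j s + tt*e j s" for j s
  have w0: "0 <= w j s" for j s unfolding w_def using u e0 tt by simp
  have w_sum: "(SUM j:?N. w j s) = m s + tt*X s" for s
   unfolding w_def m_def sum.distrib sum_distrib_left[symmetric] e_sum ..
  define R where "R s = ?F e (k s) s" for s
  have Fw: "?F w j s = ?F u j s + tt*?F e j s" for j s
   unfolding w_def by (simp add: tree_op_add tree_op_scale)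
  have 1: "S (%s. X s*(R s)^2) <= B^2*S (%s. X s^3)"
  proof -
   have "S (%s. X s*(R s)^2) <= S (%s. SUM i:?N. e i s*(?F e i s)^2)"
   proof (rule S_mono)
    fix s
    have "X s*(R s)^2 = e (k s) s*(?F e (k s) s)^2" unfolding R_def e_def by simp
    also have "... <= (SUM i:?N. e i s*(?F e i s)^2)"
     using k(1)[of s] e0 by (intro member_le_sum[of "k s" ?N "%i. e i s*(?F e i s)^2"]) auto
    finally show "X s*(R s)^2 <= (SUM i:?N. e i s*(?F e i s)^2)" .
   qed
   also have "... <= B^2*S (%s. (SUM i:?N. e i s)^3)" by (rule cubic) (rule e0)
   finally show ?thesis by (simp only: e_sum)
  qed
  have 2: "tt*S (%s. X s*(?F u (k s) s + tt*R s)^2) <= B^2*(4*S (%s. m s^3) + 4*tt^3*S (%s. X s^3))"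
  proof -
   have "tt*S (%s. X s*(?F u (k s) s + tt*R s)^2) <= S (%s. SUM i:?N. w i s*(?F w i s)^2)"
    unfolding S_cmult[symmetric]
   proof (rule S_mono)
    fix s
    have "tt*(X s*(?F u (k s) s + tt*R s)^2) <= w (k s) s*(?F w (k s) s)^2"
     unfolding Fw R_def w_def e_def using u[of "k s" s] by (simp add: distrib_right)
    also have "... <= (SUM i:?N. w i s*(?F w i s)^2)"
     using k(1)[of s] w0 by (intro member_le_sum[of "k s" ?N "%i. w i s*(?F w i s)^2"]) auto
    finally show "tt*(X s*(?F u (k s) s + tt*R s)^2) <= (SUM i:?N. w i s*(?F w i s)^2)" .
   qed
   also have "... <= B^2*S (%s. (m s + tt*X s)^3)" using cubic[of w, OF w0] by (simp only: w_sum)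
   also have "... <= B^2*S (%s. 4*m s^3 + 4*tt^3*X s^3)"
   proof (intro mult_left_mono S_mono)
    fix s
    have "(a + b)^3 <= 4*a^3 + 4*b^3" if "0 <= a" "0 <= b" for a b :: real
    proof -
     have "0 <= 3*((a + b)*(a - b)^2)" using that by simp
     then show ?thesis by (simp add: power2_eq_square power3_eq_cube algebra_simps)
    qed
    from this[of "m s" "tt*X s"] show "(m s + tt*X s)^3 <= 4*m s^3 + 4*tt^3*X s^3"
     using m0 X0 tt by (simp add: power_mult_distrib)
   qed simp
   finally show ?thesis by (simp only: S_add S_cmult)
  qed
  have "S (%s. X s^3) <= S (%s. 2*(X s*(?F u (k s) s + tt*R s)^2) + 2*tt^2*(X s*(R s)^2))"
  proof (rule S_mono)
   fix s
   have "(?F u (k s) s)^2 <= 2*(?F u (k s) s + tt*R s)^2 + 2*tt^2*(R s)^2"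
    using zero_le_power2[of "?F u (k s) s + 2*(tt*R s)"] by (simp add: power2_eq_square algebra_simps)
   then have "X s*(?F u (k s) s)^2 <= X s*(2*(?F u (k s) s + tt*R s)^2 + 2*tt^2*(R s)^2)"
    using X0 by (intro mult_left_mono) auto
   moreover have "X s^3 = X s*(?F u (k s) s)^2"
    unfolding k(2) by (simp add: power3_eq_cube power2_eq_square)
   ultimately show "X s^3 <= 2*(X s*(?F u (k s) s + tt*R s)^2) + 2*tt^2*(X s*(R s)^2)"
    by (simp add: algebra_simps)
  qed
  also have "... = 2*S (%s. X s*(?F u (k s) s + tt*R s)^2) + 2*tt^2*S (%s. X s*(R s)^2)"
   by (simp only: S_add S_cmult)
  also have "S (%s. X s*(?F u (k s) s + tt*R s)^2) <= B^2/tt*(4*S (%s. m s^3) + 4*tt^3*S (%s. X s^3))"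
   using 2 tt by (simp add: field_simps)
  also note 1
  finally have "S (%s. X s^3) <= 2*(B^2/tt*(4*S (%s. m s^3) + 4*tt^3*S (%s. X s^3)))
    + 2*tt^2*(B^2*S (%s. X s^3))"
   using tt by (simp add: mult_left_mono)
  also have "... = 40*B^3*S (%s. m s^3) + 2/5*S (%s. X s^3)"
   unfolding tt_def using B by (simp add: power2_eq_square power3_eq_cube field_simps)
  finally have "S (%s. X s^3) <= 40*(B^3*S (%s. m s^3)) + 2/5*S (%s. X s^3)"
   by (simp only: mult.assoc)
  moreover have "0 <= B^3*S (%s. m s^3)"
   using B m0 by (intro mult_nonneg_nonneg S_nonneg) auto
  ultimately have "S (%s. X s^3) <= 125*(B^3*S (%s. m s^3))" by linarith
  also have "... = (5*B)^3*S (%s. m s^3)" by (simp add: power_mult_distrib mult.assoc)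
  finally have "S (%s. abs (X s) powr 3) <= (5*B) powr 3*S (%s. abs (m s) powr 3)"
   using X0 m0 B by (simp add: powr_3_eq)
  also have "... = (5*B*nrm 3 m) powr 3"
  proof -
   have "S (%s. abs (m s) powr 3) = nrm 3 m powr 3" by (rule nrm_powr[symmetric]) simp
   moreover have "(5*B*nrm 3 m) powr 3 = (5*B) powr 3*nrm 3 m powr 3"
    by (rule powr_mult)
   ultimately show ?thesis by (simp only:)
  qed
  finally have "nrm 3 X <= 5*B*nrm 3 m" using B nrm_nonneg[of 3 m] by (intro nrm_leI) auto
  then show ?thesis unfolding X_def m_def .
 qed
 have "tree_strong ka ka' n 3 (8*(5*B))"
  by (rule tree_strongI_nonneg) (use B pos in auto)
 then show ?thesis by simp
qed

end

section \<open>The discrete Hilbert transform\<close>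

context weighted_set
begin

lemma nrm_mult:
 assumes "0 < p" shows "nrm p (%s. f s*g s) <= nrm (2*p) f*nrm (2*p) g"
proof (rule nrm_leI)
 let ?F = "nrm (2*p) f" and ?G = "nrm (2*p) g"
 have n2: "nrm 2 (%s. abs (f s) powr p) = nrm (2*p) f powr p" for f
  using assms unfolding nrm_def by (simp add: powr_powr mult.commute)
 have "S (%s. abs (f s*g s) powr p) = S (%s. abs (abs (f s) powr p*abs (g s) powr p))"
  by (intro S_cong) (simp add: abs_mult powr_mult)
 also have "... <= nrm 2 (%s. abs (f s) powr p)*nrm 2 (%s. abs (g s) powr p)"
  by (rule Holder) auto
 also have "... = (?F*?G) powr p" unfolding n2 by (simp add: powr_mult)
 finally show "S (%s. abs (f s*g s) powr p) <= (?F*?G) powr p" .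
qed (use assms nrm_nonneg in auto)

lemma nrm_power2:
 assumes "0 < p" shows "nrm p (%s. (f s)^2) = (nrm (2*p) f)^2"
proof -
 have "nrm p (%s. (f s)^2) = S (%s. abs (f s) powr (2*p)) powr (1/p)"
 proof -
  have "abs (x^2) powr p = abs x powr (2*p)" for x :: real
   using powr_powr[of "abs x" 2 p] by (cases "x = 0") (auto simp: powr_numeral)
  then show ?thesis unfolding nrm_def by simp
 qed
 also have "... = (nrm (2*p) f)^2"
  unfolding nrm_def power2_eq_square powr_add[symmetric] using assms by (simp add: field_simps)
 finally show ?thesis .
qed

end

section \<open>Boundedness on L2 from the product identity of the kernel\<close>

lemma sum_inverse_squares_le: "(SUM i:{1..M}. 1/(real i)^2) <= 2"
proof -
 have "(SUM i:{1..M}. 1/(real i)^2) <= 2 - 1/real M" if "1 <= M" for M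
  using that
 proof (induction M rule: dec_induct)
  case (step M)
  have "1/(real (Suc M))^2 <= 1/real M - 1/real (Suc M)"
  proof -
   have "1/(real (Suc M))^2 <= 1/(real M*real (Suc M))"
    using step by (intro divide_left_mono) (auto simp: power2_eq_square)
   then show ?thesis using step by (simp add: field_simps)
  qed
  then show ?case using step by simp
 qed simp
 from this[of M] show ?thesis by (cases "1 <= M") (auto intro: order_trans)
qed

lemma sum_inverse_squares_int_le:
 fixes D :: "int set" assumes "finite D" shows "(SUM d:D. 1/(real_of_int d)^2) <= 4"
proof -
 define M where "M = Max ((%d. nat (abs d)) ` D \<union> {0})"
 have le: "nat (abs d) <= M" if "d : D" for d
  unfolding M_def using assms that by (intro Max_ge) auto
 let ?A = "int ` {1..M}" and ?B = "(%i. - int i) ` {1..M}"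
 have "(SUM d:D. 1/(real_of_int d)^2) = (SUM d:D - {0}. 1/(real_of_int d)^2)"
  using assms by (intro sum.mono_neutral_right) auto
 also have "... <= (SUM d:?A \<union> ?B. 1/(real_of_int d)^2)"
 proof (rule sum_mono2)
  show "D - {0} \<subseteq> ?A \<union> ?B"
  proof
   fix d assume d: "d : D - {0}"
   show "d : ?A \<union> ?B"
   proof (cases "d > 0")
    case True
    then have "d = int (nat (abs d))" "nat (abs d) : {1..M}" using le[of d] d by auto
    then show ?thesis by blast
   next
    case False
    then have "d = - int (nat (abs d))" "nat (abs d) : {1..M}" using le[of d] d by auto
    then show ?thesis by blast
   qed
  qed
 qed auto
 also have "... <= (SUM d:?A. 1/(real_of_int d)^2) + (SUM d:?B. 1/(real_of_int d)^2)"
  by (subst sum.union_inter[symmetric]) (auto intro!: sum_nonneg)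
 also have "... = (SUM i:{1..M}. 1/(real i)^2) + (SUM i:{1..M}. 1/(real i)^2)"
  by (subst (1 2) sum.reindex) (auto simp: inj_on_def)
 finally show ?thesis using sum_inverse_squares_le[of M] by linarith
qed

definition dht :: "int set => (int => real) => int => real" where
 "dht G f x = (SUM y:G. f y/real_of_int (x - y))"

definition coincidence :: "int set => (int => real) => (int => real) => (int => real) => real" where
 "coincidence G a b c =
   (SUM x:G. SUM z:G. (a x*b x*c z + b x*c x*a z + c x*a x*b z)/(real_of_int (x - z))^2)"

text \<open>The discrete form of the identity \<open>cHaHb + aHbHc + bHcHa = abc\<close> behind Cotlar's theorem:
 for distinct points the kernels add up to zero, and only the triples with exactly two equal
 points remain. Division by zero makes the diagonal terms of the kernel vanish.\<close>

lemma dht_trilinear: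
 assumes fin: "finite G"
 shows "(SUM z:G. c z*dht G a z*dht G b z) + (SUM x:G. a x*dht G b x*dht G c x)
   + (SUM y:G. b y*dht G c y*dht G a y) = coincidence G a b c"
proof -
 define k where "k d = 1/real_of_int d" for d
 have H: "dht G f x = (SUM y:G. f y*k (x - y))" for f x
  unfolding dht_def k_def by simp
 have 1: "(SUM z:G. c z*dht G a z*dht G b z) = (SUM x:G. SUM y:G. SUM z:G. a x*b y*c z*(k (z - x)*k (z - y)))"
 proof -
  have "(SUM z:G. c z*dht G a z*dht G b z) = (SUM z:G. SUM x:G. SUM y:G. a x*b y*c z*(k (z - x)*k (z - y)))"
   unfolding H by (simp add: sum_distrib_left sum_distrib_right mult_ac)
  also have "... = (SUM x:G. SUM z:G. SUM y:G. a x*b y*c z*(k (z - x)*k (z - y)))" by (rule sum.swap)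
  also have "... = (SUM x:G. SUM y:G. SUM z:G. a x*b y*c z*(k (z - x)*k (z - y)))"
   by (rule sum.cong[OF refl], rule sum.swap)
  finally show ?thesis .
 qed
 have 2: "(SUM x:G. a x*dht G b x*dht G c x) = (SUM x:G. SUM y:G. SUM z:G. a x*b y*c z*(k (x - y)*k (x - z)))"
  unfolding H by (simp add: sum_distrib_left sum_distrib_right mult_ac)
 have 3: "(SUM y:G. b y*dht G c y*dht G a y) = (SUM x:G. SUM y:G. SUM z:G. a x*b y*c z*(k (y - z)*k (y - x)))"
 proof -
  have "(SUM y:G. b y*dht G c y*dht G a y) = (SUM y:G. SUM z:G. SUM x:G. a x*b y*c z*(k (y - z)*k (y - x)))"
   unfolding H by (simp add: sum_distrib_left sum_distrib_right mult_ac)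
  also have "... = (SUM y:G. SUM x:G. SUM z:G. a x*b y*c z*(k (y - z)*k (y - x)))"
   by (rule sum.cong[OF refl], rule sum.swap)
  also have "... = (SUM x:G. SUM y:G. SUM z:G. a x*b y*c z*(k (y - z)*k (y - x)))" by (rule sum.swap)
  finally show ?thesis .
 qed
 have kernel: "k (z - x)*k (z - y) + k (x - y)*k (x - z) + k (y - z)*k (y - x)
   = (if x = y then (k (x - z))^2 else 0) + (if y = z then (k (y - x))^2 else 0) + (if z = x then (k (z - y))^2 else 0)" for x y z
 proof (cases "x = y | y = z | z = x")
  case True
  have odd: "k (- d) = - k d" for d unfolding k_def by simp
  have "k 0 = 0" unfolding k_def by simp
  then show ?thesis using odd[of "z - x"] odd[of "y - x"] odd[of "z - y"] True
   by (auto simp: power2_eq_square)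
 next
  case False
  have *: "1/((z - x)*(z - y)) + 1/((x - y)*(x - z)) + 1/((y - z)*(y - x)) = 0"
   if "x ~= y" "y ~= z" "z ~= x" for x y z :: real
  proof -
   have "1/((z - x)*(z - y)) + 1/((x - y)*(x - z)) + 1/((y - z)*(y - x))
     = ((x - y) + (y - z)*1 + (z - x))/((x - y)*(z - x)*(z - y))"
    using that by (simp add: divide_simps) (simp add: algebra_simps)
   then show ?thesis by simp
  qed
  show ?thesis using False *[of "real_of_int x" "real_of_int y" "real_of_int z"] by (simp add: k_def)
 qed
 have "(SUM z:G. c z*dht G a z*dht G b z) + (SUM x:G. a x*dht G b x*dht G c x)
   + (SUM y:G. b y*dht G c y*dht G a y)
   = (SUM x:G. SUM y:G. SUM z:G. a x*b y*c z *
     (k (z - x)*k (z - y) + k (x - y)*k (x - z) + k (y - z)*k (y - x)))"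
  unfolding 1 2 3 by (simp add: distrib_left sum.distrib)
 also have "... = (SUM x:G. SUM y:G. SUM z:G. if x = y then a x*b y*c z*(k (x - z))^2 else 0)
   + (SUM x:G. SUM y:G. SUM z:G. if y = z then a x*b y*c z*(k (y - x))^2 else 0)
   + (SUM x:G. SUM y:G. SUM z:G. if z = x then a x*b y*c z*(k (z - y))^2 else 0)"
  unfolding kernel sum.distrib[symmetric] by (intro sum.cong refl) (simp add: distrib_left)
 also have "(SUM x:G. SUM y:G. SUM z:G. if x = y then a x*b y*c z*(k (x - z))^2 else 0)
   = (SUM x:G. SUM z:G. a x*b x*c z*(k (x - z))^2)"
 proof (rule sum.cong[OF refl])
  fix x assume x: "x : G"
  have "(SUM y:G. SUM z:G. if x = y then a x*b y*c z*(k (x - z))^2 else 0)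
    = (SUM y:G. if x = y then (SUM z:G. a x*b y*c z*(k (x - z))^2) else 0)"
   by (intro sum.cong) auto
  then show "(SUM y:G. SUM z:G. if x = y then a x*b y*c z*(k (x - z))^2 else 0) = (SUM z:G. a x*b x*c z*(k (x - z))^2)"
   using x fin by simp
 qed
 also have "(SUM x:G. SUM y:G. SUM z:G. if y = z then a x*b y*c z*(k (y - x))^2 else 0)
   = (SUM y:G. SUM x:G. b y*c y*a x*(k (y - x))^2)"
  by (subst sum.swap) (use fin in \<open>auto intro!: sum.cong\<close>)
 also have "(SUM x:G. SUM y:G. SUM z:G. if z = x then a x*b y*c z*(k (z - y))^2 else 0)
   = (SUM x:G. SUM y:G. c x*a x*b y*(k (x - y))^2)"
  using fin by (auto intro!: sum.cong)
 also have "(SUM x:G. SUM z:G. a x*b x*c z*(k (x - z))^2) + (SUM y:G. SUM x:G. b y*c y*a x*(k (y - x))^2)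
   + (SUM x:G. SUM y:G. c x*a x*b y*(k (x - y))^2) = coincidence G a b c"
  unfolding coincidence_def k_def sum.distrib[symmetric]
  by (intro sum.cong refl) (simp add: power_divide add_divide_distrib)
 finally show ?thesis .
qed

text \<open>The part of the window that is symmetric about \<open>x\<close> cancels. At most
  \<open>2*t\<close> points are left, at distance at least \<open>R - t + 1\<close>, and
  \<open>2*t <= R - t\<close> because the window is three times as long as the range of
  \<open>x\<close>.\<close>

lemma dht_window:
 fixes r :: int
 assumes "abs x <= r" shows "abs (dht {-3*r..3*r} (%_. 1) x) <= 1"
proof -
 define t where "t = abs x"
 define R where "R = 3*r"
 have t: "0 <= t" "3*t <= R" using assms unfolding t_def R_def by auto
 define I where "I = {-(R - t)..R - t}"
 have "dht {-R..R} (%_. 1) x = (SUM d:{x - R..x + R}. 1/real_of_int d)"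
  unfolding dht_def
  by (rule sum.reindex_bij_witness[of _ "%d. x - d" "%y. x - y"]) auto
 also have "... = (SUM d:I. 1/real_of_int d) + (SUM d:{x - R..x + R} - I. 1/real_of_int d)"
  using t by (subst sum.subset_diff[of I]) (auto simp: I_def t_def)
 also have "(SUM d:I. 1/real_of_int d) = 0"
 proof -
  have "(SUM d:I. 1/real_of_int d) = (SUM d:I. 1/real_of_int (- d))"
   by (rule sum.reindex_bij_witness[of _ uminus uminus]) (auto simp: I_def)
  also have "... = - (SUM d:I. 1/real_of_int d)" by (simp add: sum_negf)
  finally show ?thesis by linarith
 qed
 finally have "abs (dht {-R..R} (%_. 1) x) <= (SUM d:{x - R..x + R} - I. abs (1/real_of_int d))"
  by (simp only: add_0_left sum_abs)
 also have "... <= (SUM d:{x - R..x + R} - I. 1/(real_of_int (R - t)+1))"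
 proof (rule sum_mono)
  fix d assume "d : {x - R..x + R} - I"
  then have "R - t + 1 <= abs d" unfolding I_def by auto
  then have "real_of_int (R - t) + 1 <= abs (real_of_int d)" by linarith
  then show "abs (1/real_of_int d) <= 1/(real_of_int (R - t)+1)"
   using t by (auto intro!: divide_left_mono)
 qed
 also have "... = real (card ({x - R..x + R} - I))/(real_of_int (R - t)+1)" by simp
 also have "card ({x - R..x + R} - I) = nat (2*t)"
 proof -
  have "I \<subseteq> {x - R..x + R}" unfolding I_def t_def by auto
  then have "card ({x - R..x + R} - I) = card {x - R..x + R} - card I"
   by (intro card_Diff_subset) (auto simp: I_def)
  then show ?thesis unfolding I_def using t by simp
 qed
 also have "real (nat (2*t))/(real_of_int (R - t)+1) <= 1"
  using t by (simp add: divide_le_eq)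
 finally show ?thesis unfolding R_def by simp
qed

lemma quadratic_bound:
 fixes N F a b :: real
 assumes "N^2 <= a*F*N + b*F^2" "0 <= N" "0 <= F" "0 <= a" "0 <= b"
 shows "N <= (a + sqrt b)*F"
proof (rule ccontr)
 let ?t = "sqrt b"
 assume "~ ?thesis"
 then have lt: "(a + ?t)*F < N" by simp
 have "0 <= a*F" using assms by simp
 then have "?t*F <= N" using lt unfolding distrib_right by linarith
 then have "?t*F*(?t*F) <= N*(?t*F)" using assms by (intro mult_right_mono) auto
 then have "b*F^2 <= ?t*F*N" using assms by (simp add: power2_eq_square algebra_simps)
 moreover have "(a + ?t)*F*N < N*N"
 proof (cases "N = 0")
  case True
  have "0 <= (a + ?t)*F" using assms by simp
  then show ?thesis using lt True by linarith
 next
  case False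
  then show ?thesis using lt assms by (intro mult_strict_right_mono) auto
 qed
 ultimately show False using assms(1) by (simp add: power2_eq_square algebra_simps)
qed

text \<open>In the identity for \<open>g\<close>, \<open>g\<close> and the constant one, the first
  term is the square of the norm of the transform; the coincidences are at most
  \<open>12*F^2\<close>, and the other two terms contain the transform of the constant at points of
  the support of \<open>g\<close>. Near the ends of its domain the transform of a constant is not
  bounded uniformly in the length; hence the passage from \<open>G\<close> to the larger window
  \<open>W\<close>.\<close>

lemma dht_L2:
 assumes "finite G" shows "(SUM x:G. (dht G f x)^2) <= 36*(SUM x:G. (f x)^2)"
proof -
 define r where "r = Max (abs ` G \<union> {0})"
 have r: "abs x <= r" if "x : G" for x unfolding r_def using assms that by (intro Max_ge) auto
 have r0: "0 <= r" unfolding r_def using assms by (intro Max_ge) auto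
 define W where "W = {-3*r..3*r}"
 have finW: "finite W" unfolding W_def by simp
 have GW: "G \<subseteq> W" unfolding W_def using r r0 by fastforce
 define g where "g x = (if x : G then f x else 0)" for x
 have dW: "dht W g x = dht G f x" for x
  unfolding dht_def g_def using GW finW by (intro sum.mono_neutral_cong_right) auto
 define N where "N = sqrt (SUM x:W. (dht W g x)^2)"
 define F where "F = sqrt (SUM x:W. (g x)^2)"
 have NF: "N^2 = (SUM x:W. (dht W g x)^2)" "F^2 = (SUM x:W. (g x)^2)" "0 <= N" "0 <= F"
  unfolding N_def F_def by (auto simp: sum_nonneg)
 have ker: "(SUM z:W. 1/(real_of_int (x - z))^2) <= 4" for x
 proof -
  have "(SUM z:W. 1/(real_of_int (x - z))^2) = (SUM d:(%z. x - z) ` W. 1/(real_of_int d)^2)"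
   by (subst sum.reindex) (auto simp: inj_on_def)
  also have "... <= 4" using finW by (intro sum_inverse_squares_int_le) auto
  finally show ?thesis .
 qed
 have ker': "(SUM x:W. 1/(real_of_int (x - z))^2) <= 4" for z
  using ker[of z] by (simp add: power2_commute)
 have "coincidence W g g (%_. 1)
   <= (SUM x:W. SUM z:W. (2*(g x)^2 + (g z)^2)*(1/(real_of_int (x - z))^2))"
  unfolding coincidence_def
 proof (intro sum_mono)
  fix x z
  have "g x*g x*1 + g x*1*g z + 1*g x*g z <= 2*(g x)^2 + (g z)^2"
   using zero_le_power2[of "g x - g z"] by (simp add: power2_eq_square algebra_simps)
  then show "(g x*g x*1 + g x*1*g z + 1*g x*g z)/(real_of_int (x - z))^2
    <= (2*(g x)^2 + (g z)^2)*(1/(real_of_int (x - z))^2)"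
   by (simp add: divide_right_mono)
 qed
 also have "... = (SUM x:W. SUM z:W. 2*(g x)^2*(1/(real_of_int (x - z))^2))
   + (SUM x:W. SUM z:W. (g z)^2*(1/(real_of_int (x - z))^2))"
  by (simp only: distrib_right sum.distrib)
 also have "(SUM x:W. SUM z:W. (g z)^2*(1/(real_of_int (x - z))^2))
   = (SUM z:W. (g z)^2*(SUM x:W. 1/(real_of_int (x - z))^2))"
  by (subst sum.swap) (simp only: sum_distrib_left)
 also have "(SUM x:W. SUM z:W. 2*(g x)^2*(1/(real_of_int (x - z))^2))
   = (SUM x:W. 2*(g x)^2*(SUM z:W. 1/(real_of_int (x - z))^2))"
  by (simp only: sum_distrib_left)
 also have "(SUM x:W. 2*(g x)^2*(SUM z:W. 1/(real_of_int (x - z))^2))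
   + (SUM z:W. (g z)^2*(SUM x:W. 1/(real_of_int (x - z))^2)) <= (SUM x:W. 2*(g x)^2*4) + (SUM z:W. (g z)^2*4)"
  by (intro add_mono sum_mono mult_left_mono ker ker') auto
 also have "... = 12*F^2" unfolding NF sum_distrib_right[symmetric] sum_distrib_left[symmetric] by simp
 finally have co: "coincidence W g g (%_. 1) <= 12*F^2" .
 have cs: "- (SUM x:W. g x*dht W g x*dht W (%_. 1) x) <= F*N"
 proof -
  have "- (SUM x:W. g x*dht W g x*dht W (%_. 1) x) <= (SUM x:W. abs (g x)*abs (dht W g x))"
   unfolding sum_negf[symmetric]
  proof (rule sum_mono)
   fix x
   show "- (g x*dht W g x*dht W (%_. 1) x) <= abs (g x)*abs (dht W g x)"
   proof (cases "x : G")
    case True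
    have "- (g x*dht W g x*dht W (%_. 1) x) <= abs (g x*dht W g x)*abs (dht W (%_. 1) x)"
     unfolding abs_mult[symmetric] by linarith
    also have "... <= abs (g x*dht W g x)*1"
     unfolding W_def by (intro mult_left_mono dht_window r True) auto
    finally show ?thesis by (simp add: abs_mult)
   qed (simp add: g_def)
  qed
  also have "... <= L2_set g W*L2_set (dht W g) W" by (rule L2_set_mult_ineq)
  finally show ?thesis unfolding L2_set_def N_def F_def .
 qed
 have "N^2 <= 2*F*N + 12*F^2"
  using dht_trilinear[OF finW, of "%_. 1" g g] co cs unfolding NF(1)
  by (simp add: power2_eq_square mult_ac)
 then have "N <= (2 + sqrt 12)*F" using NF by (intro quadratic_bound) auto
 also have "... <= 6*F"
  using NF real_sqrt_le_mono[of 12 16] by (intro mult_right_mono) auto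
 finally have "N^2 <= 36*F^2" using NF power_mono[of N "6*F" 2] by (simp add: power_mult_distrib)
 moreover have "(SUM x:G. (dht G f x)^2) <= N^2"
  unfolding NF dW using finW GW by (intro sum_mono2) auto
 moreover have "F^2 = (SUM x:G. (f x)^2)"
  unfolding NF g_def using finW GW by (intro sum.mono_neutral_cong_right) auto
 ultimately show ?thesis by simp
qed

section \<open>Square functions of the discrete Hilbert transform: doubling the exponent\<close>

locale dht_space =
 fixes G :: "int set"
 assumes finG: "finite G"

sublocale dht_space \<subseteq> scalar_op G "%_. 1" "dht G" "- 1"
proof
 fix f g :: "int => real"
 show "finite G" by (rule finG)
 have "(SUM x:G. SUM y:G. g x*(f y/real_of_int (x - y))) = (SUM x:G. SUM y:G. - (f x*(g y/real_of_int (x - y))))"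
  by (subst sum.swap) (intro sum.cong refl, simp add: divide_simps, simp add: algebra_simps)
 then show "weighted_set.S G (%_. 1) (%s. g s*dht G f s) = - 1*weighted_set.S G (%_. 1) (%s. f s*dht G g s)"
  using finG by (simp add: weighted_set.S_def weighted_set_def dht_def sum_distrib_left sum_negf)
qed (auto simp: dht_def sum.distrib add_divide_distrib sum_distrib_left fun_eq_iff intro!: sum.cong)

context dht_space
begin

lemma S_eq: "S g = sum g G"
 unfolding S_def by simp

lemma kernel_sum_le: "(SUM z:G. 1/(real_of_int (x - z))^2) <= 4"
proof -
 have "(SUM z:G. 1/(real_of_int (x - z))^2) = (SUM d:(%z. x - z) ` G. 1/(real_of_int d)^2)"
  by (subst sum.reindex) (auto simp: inj_on_def)
 also have "... <= 4" using finG by (intro sum_inverse_squares_int_le) auto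
 finally show ?thesis .
qed

lemma kernel_sum_le': "(SUM x:G. 1/(real_of_int (x - z))^2) <= 4"
 using kernel_sum_le[of z] by (simp add: power2_commute)

text \<open>Hoelder's inequality on pairs of points for the measure with density
  \<open>1/(x-z)^2\<close>, both of whose marginal densities are at most \<open>4\<close>.\<close>

lemma kernel_Holder:
 assumes g: "!!x. 0 <= g x" and h: "!!x. 0 <= h x" and pq: "1 < p" "1/p + 1/q = 1"
 shows "(SUM x:G. SUM z:G. g x*h z/(real_of_int (x - z))^2) <= 4*(nrm p g*nrm q h)"
proof -
 have pos: "0 < p" "0 < q"
 proof -
  show "0 < p" using pq by simp
  have "1/q = 1 - 1/p" "1/p < 1" using pq by auto
  then have "0 < 1/q" by linarith
  then show "0 < q" by simp
 qed
 let ?nu = "%(x, z). 1/(real_of_int (x - z))^2"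
 interpret W: weighted_set "G \<times> G" ?nu
  by unfold_locales (auto simp: finG)
 have WS: "W.S f = (SUM x:G. SUM z:G. 1/(real_of_int (x - z))^2*f (x, z))" for f
  unfolding W.S_def by (simp add: sum.cartesian_product case_prod_unfold)
 have n1: "W.nrm p (%k. g (fst k)) <= 4 powr (1/p)*nrm p g"
 proof -
  have "W.S (%k. abs (g (fst k)) powr p) = (SUM x:G. abs (g x) powr p*(SUM z:G. 1/(real_of_int (x - z))^2))"
   unfolding WS by (simp add: sum_distrib_left)
  also have "... <= (SUM x:G. abs (g x) powr p*4)" by (intro sum_mono mult_left_mono kernel_sum_le) auto
  finally have "W.S (%k. abs (g (fst k)) powr p) <= 4*S (%x. abs (g x) powr p)"
   unfolding S_eq by (simp add: sum_distrib_left mult.commute)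
  then have "W.nrm p (%k. g (fst k)) <= (4*S (%x. abs (g x) powr p)) powr (1/p)"
   unfolding W.nrm_def using pos by (intro powr_mono2 W.S_nonneg) auto
  then show ?thesis unfolding nrm_def by (simp add: powr_mult)
 qed
 have n2: "W.nrm q (%k. h (snd k)) <= 4 powr (1/q)*nrm q h"
 proof -
  have "W.S (%k. abs (h (snd k)) powr q) = (SUM z:G. abs (h z) powr q*(SUM x:G. 1/(real_of_int (x - z))^2))"
   unfolding WS by (subst sum.swap) (simp add: sum_distrib_left)
  also have "... <= (SUM z:G. abs (h z) powr q*4)" by (intro sum_mono mult_left_mono kernel_sum_le') auto
  finally have "W.S (%k. abs (h (snd k)) powr q) <= 4*S (%x. abs (h x) powr q)"
   unfolding S_eq by (simp add: sum_distrib_left mult.commute)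
  then have "W.nrm q (%k. h (snd k)) <= (4*S (%x. abs (h x) powr q)) powr (1/q)"
   unfolding W.nrm_def using pos by (intro powr_mono2 W.S_nonneg) auto
  then show ?thesis unfolding nrm_def by (simp add: powr_mult)
 qed
 have "(SUM x:G. SUM z:G. g x*h z/(real_of_int (x - z))^2) = W.S (%k. abs (g (fst k)*h (snd k)))"
  unfolding WS using g h by (intro sum.cong) auto
 also have "... <= W.nrm p (%k. g (fst k))*W.nrm q (%k. h (snd k))" by (rule W.Holder[OF pq])
 also have "... <= (4 powr (1/p)*nrm p g)*(4 powr (1/q)*nrm q h)"
  by (intro mult_mono n1 n2 W.nrm_nonneg mult_nonneg_nonneg nrm_nonneg) auto
 also have "... = 4 powr (1/p + 1/q)*(nrm p g*nrm q h)" by (simp add: powr_add)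
 finally show ?thesis using pq by simp
qed

lemma kernel_square_bounds:
 assumes h: "!!x. 0 <= h x" and pq: "1 < p" "1/p + 1/q = 1"
 shows "(SUM x:G. SUM z:G. (U x)^2*h z/(real_of_int (x - z))^2) <= 4*((nrm (2*p) U)^2*nrm q h)"
  and "(SUM x:G. SUM z:G. (U z)^2*h x/(real_of_int (x - z))^2) <= 4*((nrm (2*p) U)^2*nrm q h)"
  and "(SUM x:G. SUM z:G. (U x)^2*h x/(real_of_int (x - z))^2) <= 4*((nrm (2*p) U)^2*nrm q h)"
proof -
 have 2: "nrm p (%x. (U x)^2) = (nrm (2*p) U)^2" using pq by (intro nrm_power2) auto
 show 1: "(SUM x:G. SUM z:G. (U x)^2*h z/(real_of_int (x - z))^2) <= 4*((nrm (2*p) U)^2*nrm q h)"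
  using kernel_Holder[of "%x. (U x)^2" h p q] h pq by (simp add: 2)
 show "(SUM x:G. SUM z:G. (U z)^2*h x/(real_of_int (x - z))^2) <= 4*((nrm (2*p) U)^2*nrm q h)"
  using 1 by (subst sum.swap) (simp add: power2_commute)
 have "(SUM x:G. SUM z:G. (U x)^2*h x/(real_of_int (x - z))^2)
   = (SUM x:G. (U x)^2*h x*(SUM z:G. 1/(real_of_int (x - z))^2))"
  by (simp add: sum_distrib_left)
 also have "... <= (SUM x:G. (U x)^2*h x*4)"
  using h by (intro sum_mono mult_left_mono kernel_sum_le) auto
 also have "... = 4*S (%x. abs ((U x)^2*h x))"
  unfolding S_eq using h by (simp add: sum_distrib_left mult.commute abs_mult)
 also have "... <= 4*((nrm (2*p) U)^2*nrm q h)"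
  using Holder[OF pq, of "%x. (U x)^2" h] by (simp add: 2)
 finally show "(SUM x:G. SUM z:G. (U x)^2*h x/(real_of_int (x - z))^2) <= 4*((nrm (2*p) U)^2*nrm q h)" .
qed

lemma l2_strong_2:
 assumes "finite J" shows "l2_strong J 2 6"
 unfolding l2_strong_def
proof
 fix u :: "'a => int => real"
 have "abs x powr 2 = x^2" for x :: real by (cases "x = 0") (auto simp: powr_numeral)
 then have sq: "abs (L2_set v J) powr 2 = (SUM j:J. (v j)^2)" for v
  unfolding L2_set_def by (simp add: sum_nonneg)
 have "S (%s. abs (L2_set (%j. dht G (u j) s) J) powr 2) = (SUM j:J. S (%s. (dht G (u j) s)^2))"
  unfolding sq S_sum ..
 also have "... <= (SUM j:J. 36*S (%s. (u j s)^2))"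
  unfolding S_eq by (intro sum_mono dht_L2 finG)
 also have "... = 36*S (%s. abs (L2_set (%j. u j s) J) powr 2)"
  unfolding sq S_sum by (simp add: sum_distrib_left)
 also have "... = 36*nrm 2 (%s. L2_set (%j. u j s) J) powr 2"
  by (subst nrm_powr) auto
 also have "... = (6*nrm 2 (%s. L2_set (%j. u j s) J)) powr 2"
  unfolding powr_mult by simp
 finally show "nrm 2 (%s. L2_set (%j. dht G (u j) s) J) <= 6*nrm 2 (%s. L2_set (%j. u j s) J)"
  by (intro nrm_leI) (auto simp: nrm_nonneg)
qed

lemma nrm_conjugate_powr:
 assumes pq: "1 < p" "1/p + 1/q = 1"
 shows "nrm q (%s. abs (L s) powr (2*p - 2)) = nrm (2*p) L powr (2*p - 2)"
proof -
 have "q ~= 0" using pq by auto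
 then have q: "q = p/(p-1)" using pq by (simp add: field_simps)
 have e: "(2*p - 2)*q = 2*p" "1/q = (1/(2*p))*(2*p - 2)"
  unfolding q using pq by (simp_all add: field_simps)
 show ?thesis unfolding nrm_def using e by (simp add: powr_powr)
qed

lemma absorb_powr:
 assumes N: "0 <= N" and F: "0 <= F" and p: "1 < p" and ab: "0 <= a" "0 <= b"
  and le: "N powr (2*p) <= (a*F*N + b*F^2)*N powr (2*p - 2)"
 shows "N <= (a + sqrt b)*F"
proof (cases "N = 0")
 case True
 then show ?thesis using F ab by simp
next
 case False
 then have "N powr (2*p) = N^2*N powr (2*p - 2)"
  using N powr_add[of N 2 "2*p - 2"] by (simp add: powr_numeral)
 then have "N^2 <= a*F*N + b*F^2" using le False N by simp
 then show ?thesis using N F ab by (rule quadratic_bound)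
qed

text \<open>The square function \<open>L\<close> is tested through \<open>h\<close> times
  \<open>L^2\<close>. The product identity for \<open>h\<close>, \<open>u j\<close>,
  \<open>u j\<close> replaces this by coincidences and by terms in which one transform has moved
  from \<open>u j\<close> to \<open>h\<close>. The transform of \<open>h\<close> is estimated at the
  conjugate exponent \<open>q\<close>, where duality gives the bound of \<open>p\<close>, and the
  other factor by Hoelder's inequality at \<open>2*p\<close>. What results is a quadratic inequality
  between the two norms, whose solution has \<open>sqrt 12 <= 4\<close>.\<close>

lemma l2_strong_double:
 assumes J: "finite J" and st: "l2_strong J p B" and p: "1 < p" and B: "1 <= B"
 shows "l2_strong J (2*p) (2*B + 4)"
proof (cases "J = {}")
 case True
 then show ?thesis unfolding l2_strong_def nrm_def using p by (simp add: S_eq)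
next
 case False
 then obtain j0 where j0: "j0 : J" by blast
 define q where "q = p/(p-1)"
 have pq: "1/p + 1/q = 1" unfolding q_def using p by (simp add: field_simps)
 have stq: "l2_strong J q B" using l2_strong_dual[OF J st _ p pq] B by simp
 show ?thesis
  unfolding l2_strong_def
 proof
  fix u :: "'a => int => real"
  let ?T = "dht G"
  define U where "U s = L2_set (%j. u j s) J" for s
  define L where "L s = L2_set (%j. ?T (u j) s) J" for s
  have UL0: "0 <= U s" "0 <= L s" for s unfolding U_def L_def by (auto simp: L2_set_nonneg)
  have U2: "(U s)^2 = (SUM j:J. (u j s)^2)" and L2: "(L s)^2 = (SUM j:J. (?T (u j) s)^2)" for s
   unfolding U_def L_def L2_set_def by (auto simp: sum_nonneg)
  define h where "h s = abs (L s) powr (2*p - 2)" for s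
  have h0: "0 <= h s" for s unfolding h_def by simp
  let ?F = "nrm (2*p) U" and ?N = "nrm (2*p) L" and ?H = "nrm q h"
  have FN0: "0 <= ?F" "0 <= ?N" "0 <= ?H" by (rule nrm_nonneg)+
  have H: "?H = ?N powr (2*p - 2)" unfolding h_def by (rule nrm_conjugate_powr[OF p pq])
  have tri: "S (%s. h s*(?T (u j) s)^2) = coincidence G (u j) (u j) h - 2*S (%s. u j s*?T (u j) s*?T h s)" for j
   using dht_trilinear[OF finG, of h "u j" "u j"] unfolding S_eq by (simp add: power2_eq_square mult_ac)
  have "?N powr (2*p) = S (%s. h s*(L s)^2)"
  proof -
   have "abs (L s) powr (2*p) = h s*(L s)^2" for s
    unfolding h_def using UL0(2)[of s] powr_add[of "L s" "2*p - 2" 2]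
    by (cases "L s = 0") (auto simp: powr_numeral)
   then show ?thesis using p by (simp add: nrm_powr)
  qed
  also have "... = (SUM j:J. S (%s. h s*(?T (u j) s)^2))"
   unfolding L2 S_sum[symmetric] by (simp add: sum_distrib_left)
  also have "... = (SUM j:J. coincidence G (u j) (u j) h) - 2*S (%s. (SUM j:J. u j s*?T (u j) s)*?T h s)"
   unfolding tri by (simp add: sum_subtractf sum_distrib_left[symmetric] sum_distrib_right S_sum)
  also have "... <= 12*(?F^2*?H) + 2*(?F*?N*(B*?H))"
  proof -
   have "(SUM j:J. coincidence G (u j) (u j) h)
     = (SUM x:G. SUM z:G. SUM j:J. (u j x*u j x*h z + u j x*h x*u j z + h x*u j x*u j z)/(real_of_int (x - z))^2)"
    unfolding coincidence_def by (subst sum.swap, rule sum.cong[OF refl], rule sum.swap)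
   also have "... <= (SUM x:G. SUM z:G. (U x)^2*h z/(real_of_int (x - z))^2
      + (U x)^2*h x/(real_of_int (x - z))^2 + (U z)^2*h x/(real_of_int (x - z))^2)"
   proof (intro sum_mono)
    fix x z
    have "(SUM j:J. u j x*u j x*h z + u j x*h x*u j z + h x*u j x*u j z)
      <= (SUM j:J. (u j x)^2*h z + (u j x)^2*h x + (u j z)^2*h x)"
    proof (rule sum_mono)
     fix j
     have "2*(u j x*u j z)*h x <= ((u j x)^2 + (u j z)^2)*h x"
      using h0 zero_le_power2[of "u j x - u j z"]
      by (intro mult_right_mono) (auto simp: power2_eq_square algebra_simps)
     then show "u j x*u j x*h z + u j x*h x*u j z + h x*u j x*u j z
       <= (u j x)^2*h z + (u j x)^2*h x + (u j z)^2*h x"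
      by (simp add: power2_eq_square algebra_simps)
    qed
    also have "... = (U x)^2*h z + (U x)^2*h x + (U z)^2*h x"
     unfolding U2 by (simp add: sum.distrib sum_distrib_right)
    finally have "(SUM j:J. u j x*u j x*h z + u j x*h x*u j z + h x*u j x*u j z)/(real_of_int (x - z))^2
      <= ((U x)^2*h z + (U x)^2*h x + (U z)^2*h x)/(real_of_int (x - z))^2"
     by (rule divide_right_mono) simp
    then show "(SUM j:J. (u j x*u j x*h z + u j x*h x*u j z + h x*u j x*u j z)/(real_of_int (x - z))^2)
      <= (U x)^2*h z/(real_of_int (x - z))^2 + (U x)^2*h x/(real_of_int (x - z))^2
       + (U z)^2*h x/(real_of_int (x - z))^2"
     by (simp add: sum_divide_distrib add_divide_distrib)
   qed
   also have "... <= 12*(?F^2*?H)"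
    using kernel_square_bounds[where h = h and U = U, OF h0 p pq] unfolding sum.distrib by linarith
   finally have 1: "(SUM j:J. coincidence G (u j) (u j) h) <= 12*(?F^2*?H)" .
   have "- S (%s. (SUM j:J. u j s*?T (u j) s)*?T h s) <= S (%s. abs ((SUM j:J. u j s*?T (u j) s)*?T h s))"
    using S_abs_le[of "%s. (SUM j:J. u j s*?T (u j) s)*?T h s"] by linarith
   also have "... <= S (%s. abs ((U s*L s)*?T h s))"
   proof (rule S_mono)
    fix s
    have "abs (SUM j:J. u j s*?T (u j) s) <= U s*L s"
     unfolding U_def L_def by (rule order_trans[OF sum_abs]) (simp add: abs_mult L2_set_mult_ineq)
    then show "abs ((SUM j:J. u j s*?T (u j) s)*?T h s) <= abs ((U s*L s)*?T h s)"
     using UL0[of s] by (simp add: abs_mult mult_right_mono)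
   qed
   also have "... <= nrm p (%s. U s*L s)*nrm q (?T h)" by (rule Holder[OF p pq])
   also have "... <= (?F*?N)*(B*?H)"
    using p B FN0 l2_strong_scalar[OF J stq j0, of h] by (intro mult_mono nrm_mult nrm_nonneg) auto
   finally show ?thesis using 1 by linarith
  qed
  finally have "?N powr (2*p) <= (2*B*?F*?N + 12*?F^2)*?N powr (2*p - 2)"
   unfolding H by (simp add: algebra_simps)
  then have "?N <= (2*B + sqrt 12)*?F" using FN0 B p by (intro absorb_powr[of ?N ?F p]) auto
  also have "... <= (2*B + 4)*?F"
   using FN0 real_sqrt_le_mono[of 12 16] by (intro mult_right_mono) auto
  finally show "nrm (2*p) (%s. L2_set (%j. ?T (u j) s) J) <= (2*B + 4)*nrm (2*p) (%s. L2_set (%j. u j s) J)"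
   unfolding L_def U_def .
 qed
qed

text \<open>Majorants of the two parts of a node: the coincidences of the product identity, which
  involve two points \<open>x\<close> and \<open>z\<close>, and the products taken at one point.
  Both are linear in \<open>N\<close>. Hence one expression serves for a single node, where
  \<open>N\<close> evaluates at the node, and for the tree, where \<open>N\<close> sums over the
  nodes.\<close>

abbreviation off_diag where
 "off_diag c N bu bh mu mh x z == N (c (bh x) (bu x))*mu z + mu x*N (c (bu x) (bh z)) + mu x*N (c (bh x) (bu z))
   + N (c (bu x) (bu x))*mh z + mh x*N (c (bu x) (bu z))"

abbreviation on_diag where
 "on_diag c c' N tu th mu mh x == 2*(mu x*N (c (tu x) (th x))) + mh x*N (c (tu x) (tu x))
   + mh x*N (c' (tu x) (tu x)) + 2*(mu x*N (c' (tu x) (th x)))"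

text \<open>With equal constants in both corners, \<open>T Y\<close> and \<open>T Z\<close> are
  multiplied by expressions \<open>f T g + g T f\<close> in the two halves. The product identity, in
  the form \<open>tri\<close>, trades each of them for coincidences minus \<open>Y\<close> or
  \<open>Z\<close> times two transformed block sums. After that no transform of \<open>Y\<close> or
  \<open>Z\<close> is left, so \<open>mu\<close> and \<open>mh\<close> bound them.\<close>

lemma node_bound:
 fixes u h :: "nat => int => real"
 assumes ka: "abs (ka s) = 1" and u: "!!i x. 0 <= u i x" and h: "!!i x. 0 <= h i x"
  and Y: "!!x. abs (Y x) + block_sum u (Suc s) b x <= mu x" and Z: "!!x. abs (Z x) + block_sum h (Suc s) b x <= mh x"
 defines "bu \<equiv> %x s b. block_sum u s b x" and "bh \<equiv> %x s b. block_sum h s b x"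
  and "tu \<equiv> %x s b. abs (dht G (block_sum u s b) x)" and "th \<equiv> %x s b. abs (dht G (block_sum h s b) x)"
 shows "abs (node ka ka u h s b Y Z) <=
  2*(SUM x:G. SUM z:G. (off_diag cross (%g. g s b) bu bh mu mh x z)/(of_int (x - z))^2)
  + S (%x. on_diag cross same (%g. g s b) tu th mu mh x)"
proof -
 let ?T = "dht G"
 define au where "au = block_sum u s b"
 define ah where "ah = block_sum h s b"
 define du where "du = block_sum u s (b + 2^s)"
 define dh where "dh = block_sum h s (b + 2^s)"
 have pos: "0 <= au x" "0 <= ah x" "0 <= du x" "0 <= dh x" for x
  unfolding au_def ah_def du_def dh_def block_sum_def by (auto intro!: sum_nonneg u h)
 have le: "abs (Y x) <= mu x" "abs (Z x) <= mh x" "au x <= mu x" "du x <= mu x" "ah x <= mh x" "dh x <= mh x" for x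
  using Y[of x] Z[of x] pos[of x] unfolding block_sum_Suc au_def[symmetric] ah_def[symmetric] du_def[symmetric] dh_def[symmetric]
  by linarith+
 have m0: "0 <= mu x" "0 <= mh x" for x using le(1,2)[of x] by linarith+
 have cr: "cross (bh x) (bu z) s b = ah x*du z + dh x*au z" "cross (bu x) (bh z) s b = au x*dh z + du x*ah z"
   "cross (bu x) (bu z) s b = au x*du z + du x*au z" for x z
  unfolding cross_def bh_def bu_def au_def ah_def du_def dh_def by auto
 have tcr: "cross (tu x) (th x) s b = abs (?T au x)*abs (?T dh x) + abs (?T du x)*abs (?T ah x)"
   "cross (tu x) (tu x) s b = 2*(abs (?T au x)*abs (?T du x))"
   "same (tu x) (tu x) s b = (?T au x)^2 + (?T du x)^2"
   "same (tu x) (th x) s b = abs (?T au x)*abs (?T ah x) + abs (?T du x)*abs (?T dh x)" for x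
  unfolding cross_def same_def tu_def th_def au_def ah_def du_def dh_def by (auto simp: power2_eq_square)
 have k2: "(ka s)^2 = 1" using ka by (metis one_power2 power2_abs)
 have tri: "S (%x. ?T c x*(f x*?T g x + g x*?T f x)) = coincidence G f g c - S (%x. c x*?T f x*?T g x)" for f g c
  using dht_trilinear[OF finG, of c f g] unfolding S_eq by (simp add: sum.distrib algebra_simps)
 define Co where "Co = coincidence G ah du Y + coincidence G au dh Y + coincidence G au du Z"
 define Ma where "Ma = S (%x. Y x*?T ah x*?T du x) + S (%x. Y x*?T au x*?T dh x) + S (%x. Z x*?T au x*?T du x)"
 let ?E = "%x z. (ah x*du x + au x*dh x)*Y z + Y x*(du x*ah z + dh x*au z) + Y x*(ah x*du z + au x*dh z) + au x*du x*Z z + Z x*(du x*au z + au x*du z)"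
  and ?R = "%x. ah x*(?T du x)^2 + 2*(au x*?T du x*?T dh x) + dh x*(?T au x)^2 + 2*(du x*?T au x*?T ah x)"
  and ?A = "%x. 2*abs (Y x*?T ah x*?T du x) + 2*abs (Y x*?T au x*?T dh x) + 2*abs (Z x*?T au x*?T du x)"
 define Rest where "Rest = S (%x. ?R x)"
 have "node ka ka u h s b Y Z = 2*ka s *
   (S (%x. ?T Y x*(ah x*?T du x + du x*?T ah x)) + S (%x. ?T Y x*(au x*?T dh x + dh x*?T au x))
    + S (%x. ?T Z x*(au x*?T du x + du x*?T au x))) + Rest"
  unfolding node_def half_node_def k2 Rest_def au_def[symmetric] ah_def[symmetric] du_def[symmetric] dh_def[symmetric]
  unfolding S_add[symmetric] S_cmult[symmetric] by (intro S_cong) (simp add: algebra_simps)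
 also have "... = 2*ka s*(Co - Ma) + Rest"
  unfolding tri Co_def Ma_def by (simp add: algebra_simps)
 finally have "abs (node ka ka u h s b Y Z) <= abs (2*ka s*(Co - Ma)) + abs Rest" by linarith
 also have "abs (2*ka s*(Co - Ma)) = 2*abs (Co - Ma)" using ka by (simp add: abs_mult)
 finally have main: "abs (node ka ka u h s b Y Z) <= 2*abs Co + 2*abs Ma + abs Rest"
  using abs_triangle_ineq4[of Co Ma] by linarith
 have Co: "abs Co <= (SUM x:G. SUM z:G. (off_diag cross (%g. g s b) bu bh mu mh x z)/(of_int (x - z))^2)"
 proof -
  have Co_eq: "Co = (SUM x:G. SUM z:G. (?E x z)/(of_int (x - z))^2)"
   unfolding Co_def coincidence_def sum.distrib[symmetric] add_divide_distrib[symmetric]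
   by (intro sum.cong refl arg_cong2[where f = "(/)"]) (simp add: algebra_simps)
  have "abs Co <= (SUM x:G. SUM z:G. abs ((?E x z)/(of_int (x - z))^2))"
   unfolding Co_eq by (rule order_trans[OF sum_abs]) (intro sum_mono sum_abs)
  also have "... <= (SUM x:G. SUM z:G. (off_diag cross (%g. g s b) bu bh mu mh x z)/(of_int (x - z))^2)"
  proof (intro sum_mono)
   fix x z
   have t: "abs (c * v) <= c*w" if "abs v <= w" "0 <= c" for c v w :: real
    using that by (simp add: abs_mult mult_left_mono)
   have 1: "abs ((ah x*du x + au x*dh x)*Y z) <= (ah x*du x + au x*dh x)*mu z"
    by (rule t) (use le pos in auto)
   have 2: "abs ((du x*ah z + dh x*au z)*Y x) <= (du x*ah z + dh x*au z)*mu x"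
    by (rule t) (use le pos in auto)
   have 3: "abs ((ah x*du z + au x*dh z)*Y x) <= (ah x*du z + au x*dh z)*mu x"
    by (rule t) (use le pos in auto)
   have 4: "abs ((au x*du x)*Z z) <= (au x*du x)*mh z"
    by (rule t) (use le pos in auto)
   have 5: "abs ((du x*au z + au x*du z)*Z x) <= (du x*au z + au x*du z)*mh x"
    by (rule t) (use le pos in auto)
   have 6: "0 <= (au x*du x)*mh z" using pos m0 by auto
   have "abs (?E x z)
    <= off_diag cross (%g. g s b) bu bh mu mh x z"
    using 1 2 3 4 5 6 unfolding cr by (simp add: algebra_simps)
   then show "abs ((?E x z)/(of_int (x - z))^2)
    <= (off_diag cross (%g. g s b) bu bh mu mh x z)/(of_int (x - z))^2"
    unfolding abs_divide by (simp add: divide_right_mono)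
  qed
  finally show ?thesis .
 qed
 have MR: "2*abs Ma + abs Rest <= S (%x. on_diag cross same (%g. g s b) tu th mu mh x)"
 proof -
  have "2*abs Ma + abs Rest <= S (%x. ?A x
    + abs (?R x))"
  proof -
   have "abs Ma <= abs (S (%x. Y x*?T ah x*?T du x)) + abs (S (%x. Y x*?T au x*?T dh x)) + abs (S (%x. Z x*?T au x*?T du x))"
    unfolding Ma_def by (rule order_trans[OF abs_triangle_ineq add_right_mono[OF abs_triangle_ineq]])
   also have "... <= S (%x. abs (Y x*?T ah x*?T du x)) + S (%x. abs (Y x*?T au x*?T dh x)) + S (%x. abs (Z x*?T au x*?T du x))"
    by (intro add_mono S_abs_le)
   finally have "2*abs Ma + abs Rest <= 2*(S (%x. abs (Y x*?T ah x*?T du x)) + S (%x. abs (Y x*?T au x*?T dh x)) + S (%x. abs (Z x*?T au x*?T du x)))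
    + S (%x. abs (?R x))"
    unfolding Rest_def by (intro add_mono mult_left_mono S_abs_le) auto
   then show ?thesis by (simp only: S_add S_cmult distrib_left)
  qed
  also have "... <= S (%x. on_diag cross same (%g. g s b) tu th mu mh x)"
  proof (rule S_mono)
   fix x
   define p1 where "p1 = abs (?T au x)"
   define p2 where "p2 = abs (?T ah x)"
   define p3 where "p3 = abs (?T du x)"
   define p4 where "p4 = abs (?T dh x)"
   have p0: "0 <= p1" "0 <= p2" "0 <= p3" "0 <= p4" unfolding p1_def p2_def p3_def p4_def by auto
   have a: "abs (c * v * w) <= d*(abs v * abs w)" if "abs c <= d" for c d v w :: real
    using that by (simp add: abs_mult mult.assoc mult_right_mono)
   have sq: "(?T du x)^2 = p3*p3" "(?T au x)^2 = p1*p1" unfolding p3_def p1_def by (simp_all add: power2_eq_square)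
   have 1: "abs (Y x*?T ah x*?T du x) <= mu x*(p2*p3)" unfolding p2_def p3_def by (rule a) (rule le)
   have 2: "abs (Y x*?T au x*?T dh x) <= mu x*(p1*p4)" unfolding p1_def p4_def by (rule a) (rule le)
   have 3: "abs (Z x*?T au x*?T du x) <= mh x*(p1*p3)" unfolding p1_def p3_def by (rule a) (rule le)
   have 4: "abs (au x*?T du x*?T dh x) <= mu x*(p3*p4)" unfolding p3_def p4_def by (rule a) (use le pos in auto)
   have 5: "abs (du x*?T au x*?T ah x) <= mu x*(p1*p2)" unfolding p1_def p2_def by (rule a) (use le pos in auto)
   have 6: "abs (ah x*(p3*p3)) <= mh x*(p3*p3)" using le(5)[of x] pos(2)[of x] p0 by (simp add: abs_mult mult_right_mono)
   have 7: "abs (dh x*(p1*p1)) <= mh x*(p1*p1)" using le(6)[of x] pos(4)[of x] p0 by (simp add: abs_mult mult_right_mono)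
   have "abs (?R x)
     <= mh x*(p3*p3) + 2*(mu x*(p3*p4)) + mh x*(p1*p1) + 2*(mu x*(p1*p2))"
    unfolding sq using 4 5 6 7 by linarith
   with 1 2 3 have "?A x
    + abs (?R x)
    <= 2*(mu x*(p2*p3)) + 2*(mu x*(p1*p4)) + 2*(mh x*(p1*p3))
     + (mh x*(p3*p3) + 2*(mu x*(p3*p4)) + mh x*(p1*p1) + 2*(mu x*(p1*p2)))"
    by linarith
   also have "... = on_diag cross same (%g. g s b) tu th mu mh x"
    unfolding tcr sq p1_def[symmetric] p2_def[symmetric] p3_def[symmetric] p4_def[symmetric] by (simp add: algebra_simps)
   finally show "?A x
    + abs (?R x)
    <= on_diag cross same (%g. g s b) tu th mu mh x" .
  qed
  finally show ?thesis .
 qed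
 show ?thesis using main Co MR by linarith
qed

lemma nrm_tree_norm_le:
 assumes "l2_strong (tree_index n) p A" "0 < p" "0 <= A"
 shows "nrm p (%x. tree_norm n (%s b. abs (dht G (block_sum u s b) x)))
  <= A*(sqrt (real n+1)*nrm p (%x. SUM i:{1..2^n}. abs (u i x)))"
proof -
 have "nrm p (%x. tree_norm n (%s b. abs (dht G (block_sum u s b) x)))
   = nrm p (%x. L2_set (%k. dht G (block_coord u k) x) (tree_index n))"
  unfolding tree_norm_def L2_set_def by (simp add: block_coord_def case_prod_unfold)
 also have "... <= A*nrm p (%x. L2_set (%k. block_coord u k x) (tree_index n))"
  using assms(1) unfolding l2_strong_def by blast
 also have "nrm p (%x. L2_set (%k. block_coord u k x) (tree_index n))
   <= nrm p (%x. sqrt (real n+1)*(SUM i:{1..2^n}. abs (u i x)))"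
 proof (rule nrm_mono[OF assms(2)])
  fix x
  have "L2_set (%k. block_coord u k x) (tree_index n) = tree_norm n (%s b. block_sum u s b x)"
   unfolding tree_norm_def by (rule L2_set_cong) (auto simp: block_coord_def)
  then show "abs (L2_set (%k. block_coord u k x) (tree_index n)) <= abs (sqrt (real n+1)*(SUM i:{1..2^n}. abs (u i x)))"
   using tree_norm_block_sum_le[of n u x] tree_norm_nonneg[of n "%s b. block_sum u s b x"] by simp
 qed
 also have "... = sqrt (real n+1)*nrm p (%x. SUM i:{1..2^n}. abs (u i x))"
  using assms by (subst nrm_cmult) auto
 finally show ?thesis using assms by (simp add: mult_left_mono)
qed

lemma node_sum_sum': "node_sum (%s b. SUM i:I. ph i s b) n b = (SUM i:I. node_sum (ph i) n b)"
 using node_sum_sum[of "%_. 1" ph I n b] by simp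

lemma node_sum_mult_right: "node_sum (%s b. be s b*c) n b = node_sum be n b*c"
 using node_sum_cmult[of c be n b] by (simp add: mult.commute)

lemma node_sum_divide: "node_sum (%s b. be s b/c) n b = node_sum be n b/c"
 using node_sum_cmult[of "1/c" be n b] by simp

text \<open>Every product in the majorants contains exactly two block sums, or two transformed ones,
  besides factors \<open>mu\<close> and \<open>mh\<close>. The Cauchy-Schwarz inequality over the
  nodes gives \<open>sqrt (n+1)\<close> for each of the two, hence \<open>n+1\<close>. The number
  \<open>40\<close> is \<open>2*4*5\<close>: the factor in front of the coincidences, the mass of
  the kernel, and the sum \<open>2 + 3/2 + 3/2\<close> of the coefficients after \<open>mu x\<close>
  times \<open>mu z\<close> has been replaced by squares.\<close>

theorem dht_tree_form_bound:
 fixes u h :: "nat => int => real"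
 assumes ka: "!!s. abs (ka s) = 1" and u: "!!i x. 0 <= u i x" and h: "!!i x. 0 <= h i x"
  and pq: "1 < p" "1/p + 1/q = 1"
  and A: "l2_strong (tree_index n) (2*p) A" "l2_strong (tree_index n) q A'" "0 <= A" "0 <= A'"
 shows "abs (tree_form ka ka u h n 0 (%_. 0) (%_. 0))
  <= (40 + 4*A*A' + 2*A^2)*(real n+1)
    * ((nrm (2*p) (%x. SUM i:{1..2^n}. u i x))^2*nrm q (%x. SUM i:{1..2^n}. h i x))"
proof -
 have "0 < q"
 proof -
  have "1/q = 1 - 1/p" "1/p < 1" using pq by auto
  then have "0 < 1/q" by linarith
  then show "0 < q" by simp
 qed
 define mu where "mu x = (SUM i:{1..2^n}. u i x)" for x
 define mh where "mh x = (SUM i:{1..2^n}. h i x)" for x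
 have m0: "0 <= mu x" "0 <= mh x" for x unfolding mu_def mh_def by (auto intro!: sum_nonneg u h)
 let ?n1 = "real n + 1" and ?N = "%g. node_sum g n 0" and ?M = "(nrm (2*p) mu)^2*nrm q mh"
 define bu where "bu = (%x s b. block_sum u s b x)"
 define bh where "bh = (%x s b. block_sum h s b x)"
 define tu where "tu = (%x s b. abs (dht G (block_sum u s b) x))"
 define th where "th = (%x s b. abs (dht G (block_sum h s b) x))"
 define be where "be s b = 2*(SUM x:G. SUM z:G. (off_diag cross (%g. g s b) bu bh mu mh x z)/(of_int (x - z))^2)
  + (SUM x:G. on_diag cross same (%g. g s b) tu th mu mh x)" for s b
 have "outer_form u h n 0 (%_. 0) (%_. 0) = 0"
  unfolding outer_form_def by (simp add: T_zero S_def)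
 moreover have "abs (tree_form ka ka u h n 0 (%_. 0) (%_. 0) - outer_form u h n 0 (%_. 0) (%_. 0)) <= node_sum be n 0"
 proof (rule tree_form_bound)
  show "abs (node ka ka u h s b Y Z) <= be s b"
   if "!!x. abs (Y x) + block_sum u (Suc s) b x <= mu x" "!!x. abs (Z x) + block_sum h (Suc s) b x <= mh x" for s b Y Z
   using node_bound[OF ka u h that] unfolding be_def S_eq bu_def bh_def tu_def th_def by simp
 qed (use ka u h in \<open>auto simp: mu_def mh_def block_sum_def\<close>)
 ultimately have "abs (tree_form ka ka u h n 0 (%_. 0) (%_. 0)) <= node_sum be n 0" by simp
 also have "... = 2*(SUM x:G. SUM z:G. (off_diag cross ?N bu bh mu mh x z)/(of_int (x - z))^2)
   + (SUM x:G. on_diag cross same ?N tu th mu mh x)"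
  unfolding be_def[abs_def] node_sum_add node_sum_cmult node_sum_sum' node_sum_divide node_sum_mult_right ..
 also have "... <= 40*?n1*?M + (4*A*A' + 2*A^2)*?n1*?M"
 proof (rule add_mono)
  have tn: "tree_norm n (bu x) <= sqrt ?n1*mu x" "tree_norm n (bh x) <= sqrt ?n1*mh x" for x
   using tree_norm_block_sum_le[of n u x] tree_norm_block_sum_le[of n h x] u h
   unfolding bu_def bh_def mu_def mh_def by auto
  have cr: "node_sum (cross f g) n 0 <= ?n1*(a*b)"
   if "tree_norm n f <= sqrt ?n1*a" "tree_norm n g <= sqrt ?n1*b" "0 <= a" "0 <= b" for f g a b
  proof -
   have "node_sum (cross f g) n 0 <= tree_norm n f*tree_norm n g" by (rule node_sum_cross)
   also have "... <= (sqrt ?n1*a)*(sqrt ?n1*b)"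
    using that by (intro mult_mono tree_norm_nonneg) auto
   also have "... = (sqrt ?n1 * sqrt ?n1)*(a*b)" by (simp only: mult.assoc mult.left_commute)
   also have "sqrt ?n1 * sqrt ?n1 = ?n1" by simp
   finally show ?thesis .
  qed
  have "(SUM x:G. SUM z:G. (off_diag cross ?N bu bh mu mh x z)/(of_int (x - z))^2)
   <= (SUM x:G. SUM z:G. ?n1*(2*((mu x)^2*mh z/(of_int (x - z))^2)
     + 3/2*((mu x)^2*mh x/(of_int (x - z))^2) + 3/2*((mu z)^2*mh x/(of_int (x - z))^2)))"
  proof (intro sum_mono)
   have alg: "N*(k'*a + k*(b + c)*d)/D = N*(k'*(a/D) + k*(b*d/D) + k*(c*d/D))"
    for N a b c d D k k' :: real by (simp add: divide_inverse algebra_simps)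
   have alg2: "N*(c*a)*b + a*(N*(a*d)) + a*(N*(c*b)) + N*(a*a)*d + c*(N*(a*b))
     = N*(2*(a^2*d) + 3*(a*b)*c)" for N a b c d :: real
    by (simp add: power2_eq_square algebra_simps)
   fix x z
   have "off_diag cross ?N bu bh mu mh x z
    <= ?n1*(mh x*mu x)*mu z + mu x*(?n1*(mu x*mh z)) + mu x*(?n1*(mh x*mu z))
     + ?n1*(mu x*mu x)*mh z + mh x*(?n1*(mu x*mu z))"
    by (intro add_mono mult_right_mono mult_left_mono cr tn m0)
   also have "... = ?n1*(2*((mu x)^2*mh z) + 3*(mu x*mu z)*mh x)"
    by (rule alg2)
   also have "... <= ?n1*(2*((mu x)^2*mh z) + 3/2*((mu x)^2 + (mu z)^2)*mh x)"
   proof -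
    have "3*(mu x*mu z)*mh x <= 3/2*((mu x)^2 + (mu z)^2)*mh x"
     using zero_le_power2[of "mu x - mu z"] m0
     by (intro mult_right_mono) (auto simp: power2_eq_square algebra_simps)
    then show ?thesis by (intro mult_left_mono) auto
   qed
   finally have "(off_diag cross ?N bu bh mu mh x z)/(of_int (x - z))^2
    <= (?n1*(2*((mu x)^2*mh z) + 3/2*((mu x)^2 + (mu z)^2)*mh x))/(of_int (x - z))^2"
    by (rule divide_right_mono) simp
   also have "... = ?n1*(2*((mu x)^2*mh z/(of_int (x - z))^2)
     + 3/2*((mu x)^2*mh x/(of_int (x - z))^2) + 3/2*((mu z)^2*mh x/(of_int (x - z))^2))"
    by (rule alg)
   finally show "(off_diag cross ?N bu bh mu mh x z)/(of_int (x - z))^2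
    <= ?n1*(2*((mu x)^2*mh z/(of_int (x - z))^2)
     + 3/2*((mu x)^2*mh x/(of_int (x - z))^2) + 3/2*((mu z)^2*mh x/(of_int (x - z))^2))" .
  qed
  also have "... = ?n1*(2*(SUM x:G. SUM z:G. (mu x)^2*mh z/(of_int (x - z))^2)
    + 3/2*(SUM x:G. SUM z:G. (mu x)^2*mh x/(of_int (x - z))^2)
    + 3/2*(SUM x:G. SUM z:G. (mu z)^2*mh x/(of_int (x - z))^2))"
   by (simp only: sum_distrib_left sum.distrib distrib_left)
  also have "... <= ?n1*(20*?M)"
   using kernel_square_bounds[where h = mh and U = mu, OF m0(2) pq] by (intro mult_left_mono) auto
  also have "?n1*(20*?M) = (40*?n1*?M)/2" by simp
  finally show "2*(SUM x:G. SUM z:G. (off_diag cross ?N bu bh mu mh x z)/(of_int (x - z))^2) <= 40*?n1*?M"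
   by linarith
 next
  define Lu where "Lu x = tree_norm n (tu x)" for x
  define Lh where "Lh x = tree_norm n (th x)" for x
  have L0: "0 <= Lu x" "0 <= Lh x" for x unfolding Lu_def Lh_def by (auto simp: tree_norm_nonneg)
  have nLu: "nrm (2*p) Lu <= A*(sqrt ?n1*nrm (2*p) mu)"
   using nrm_tree_norm_le[OF A(1), of u] pq A u unfolding Lu_def tu_def mu_def by simp
  have nLh: "nrm q Lh <= A'*(sqrt ?n1*nrm q mh)"
   using nrm_tree_norm_le[OF A(2), of h] \<open>0 < q\<close> A h unfolding Lh_def th_def mh_def by simp
  have "(SUM x:G. on_diag cross same ?N tu th mu mh x)
    <= (SUM x:G. 2*(mu x*(Lu x*Lh x)) + mh x*(Lu x*Lu x) + mh x*(Lu x*Lu x) + 2*(mu x*(Lu x*Lh x)))"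
   unfolding Lu_def Lh_def
   by (intro sum_mono add_mono mult_left_mono node_sum_cross node_sum_same m0) auto
  also have "... = 4*S (%x. abs ((mu x*Lu x)*Lh x)) + 2*S (%x. abs ((Lu x)^2*mh x))"
   unfolding S_eq sum_distrib_left sum.distrib[symmetric]
   by (intro sum.cong refl) (use m0 L0 in \<open>simp add: power2_eq_square algebra_simps\<close>)
  also have "... <= 4*(nrm p (%x. mu x*Lu x)*nrm q Lh) + 2*(nrm p (%x. (Lu x)^2)*nrm q mh)"
   by (intro add_mono mult_left_mono Holder[OF pq]) auto
  also have "... <= 4*((nrm (2*p) mu*nrm (2*p) Lu)*nrm q Lh) + 2*((nrm (2*p) Lu)^2*nrm q mh)"
   using pq by (intro add_mono mult_left_mono mult_right_mono nrm_mult nrm_nonneg) (auto simp: nrm_power2)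
  also have "... <= 4*((nrm (2*p) mu*(A*(sqrt ?n1*nrm (2*p) mu)))*(A'*(sqrt ?n1*nrm q mh)))
    + 2*((A*(sqrt ?n1*nrm (2*p) mu))^2*nrm q mh)"
   using nLu nLh A
   by (intro add_mono mult_mono mult_left_mono power_mono order_refl mult_nonneg_nonneg nrm_nonneg) (auto simp: nrm_nonneg)
  also have "... = (4*A*A' + 2*A^2)*(sqrt ?n1 * sqrt ?n1)*?M"
   by (simp only: power2_eq_square algebra_simps)
  finally show "(SUM x:G. on_diag cross same ?N tu th mu mh x)
    <= (4*A*A' + 2*A^2)*?n1*?M" by simp
 qed
 also have "... = (40 + 4*A*A' + 2*A^2)*?n1*?M" by (simp add: algebra_simps)
 finally show ?thesis unfolding mu_def mh_def .
qed

end

context scalar_op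
begin

lemma l2_strong_mono:
 assumes "l2_strong J p B" "B <= B'" shows "l2_strong J p B'"
 using assms nrm_nonneg unfolding l2_strong_def by (meson mult_right_mono order_trans)

lemma tree_strong_mono:
 assumes "tree_strong ka ka' n p B" "B <= B'" shows "tree_strong ka ka' n p B'"
 using assms nrm_nonneg unfolding tree_strong_def by (meson mult_right_mono order_trans)

lemma tree_form_root:
 "tree_form ka ka' u h n 0 (%_. 0) (%_. 0) = S (%x. SUM i:{1..2^n}.
   h i x*(tree_op ka ka' n u i x)^2 + 2*u i x*tree_op ka ka' n u i x*tree_op ka ka' n h i x)"
 unfolding tree_form_def tree_op_def S_sum by simp

text \<open>Euler's identity: on the diagonal the derivative of a cubic form is three times the
  form.\<close>

lemma cubic_le_tree_form:
 "3*S (%s. SUM i:{1..2^n}. w i s*(tree_op ka ka' n w i s)^2) = tree_form ka ka' w w n 0 (%_. 0) (%_. 0)"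
 unfolding tree_form_root S_cmult[symmetric] sum_distrib_left
 by (intro S_cong sum.cong) (auto simp: power2_eq_square)

end

context dht_space
begin

text \<open>For \<open>p = 3/2\<close> and \<open>q = 3\<close> both norms in the bound of the
  polarised form have the exponent \<open>3\<close>, so on the diagonal it becomes the cubic
  estimate.\<close>

lemma tree_strong_3:
 assumes ka: "!!s. abs (ka s) = 1" and A: "l2_strong (tree_index n) 3 A" "0 <= A"
 shows "tree_strong ka ka n 3 (40 * sqrt ((40 + 6*A^2)*(real n+1)))"
proof (rule cubic_imp_strong)
 have K0: "0 < 40 + 6*A^2" by (simp add: add_pos_nonneg)
 then show "0 < sqrt ((40 + 6*A^2)*(real n+1))" by simp
 fix w :: "nat => int => real" assume w: "!!i s. 0 <= w i s"
 define m where "m s = (SUM i:{1..2^n}. w i s)" for s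
 have m0: "0 <= m s" for s unfolding m_def by (intro sum_nonneg w)
 let ?Q = "S (%s. SUM i:{1..2^n}. w i s*(tree_op ka ka n w i s)^2)"
 have "(nrm 3 m)^2*nrm 3 m = nrm 3 m powr 3"
  using nrm_nonneg[of 3 m] by (simp add: powr_3_eq power2_eq_square power3_eq_cube)
 also have "... = S (%s. m s^3)" using m0 by (subst nrm_powr) (auto simp: powr_3_eq)
 finally have M: "(nrm 3 m)^2*nrm 3 m = S (%s. m s^3)" .
 have "3*?Q <= (40 + 4*A*A + 2*A^2)*(real n+1)*S (%s. m s^3)"
  using dht_tree_form_bound[where p = "3/2" and q = 3 and u = w and h = w and n = n and A = A and A' = A and ka = ka, OF ka w w] A
  unfolding cubic_le_tree_form m_def[symmetric] by (simp add: M)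
 moreover have "0 <= ?Q" using w by (intro S_nonneg sum_nonneg) auto
 ultimately have "?Q <= (40 + 6*A^2)*(real n+1)*S (%s. m s^3)"
  by (simp add: power2_eq_square algebra_simps)
 then show "?Q <= (sqrt ((40 + 6*A^2)*(real n+1)))^2*S (%s. (SUM i:{1..2^n}. w i s)^3)"
  using K0 unfolding m_def by simp
qed

text \<open>The maximum over the coordinates is made linear: \<open>h\<close> is carried by a
  coordinate \<open>k s\<close> where it is attained, with the weight that produces the
  \<open>2*p\<close>-th power. The polarised form bounds the wanted term up to products
  \<open>u F u F h\<close>, in which \<open>F h\<close> is estimated by the dual bound at
  \<open>q\<close>, since the l1 norm of \<open>h\<close> is \<open>g\<close>. The quadratic
  inequality is then solved as for square functions.\<close>

lemma tree_strong_double: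
 assumes ka: "!!s. abs (ka s) = 1" and p: "1 < p" and pq: "1/p + 1/q = 1"
  and A: "l2_strong (tree_index n) (2*p) A" "l2_strong (tree_index n) q A'" "0 <= A" "0 <= A'"
  and st: "tree_strong ka ka n p B" and B: "0 <= B"
 shows "tree_strong ka ka n (2*p) (8*(2*B + sqrt ((40 + 4*A*A' + 2*A^2)*(real n+1))))"
proof (rule tree_strongI_nonneg)
 define K where "K = (40 + 4*A*A' + 2*A^2)*(real n+1)"
 have K0: "0 <= K" unfolding K_def using A by simp
 show "1 <= 2*p" using p by simp
 show "0 <= 2*B + sqrt ((40 + 4*A*A' + 2*A^2)*(real n+1))"
  using B K0 unfolding K_def by simp
 have stq: "tree_strong ka ka n q B"
  by (rule tree_strong_dual[where ta = 1, OF _ _ st B p pq]) auto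
 fix u :: "nat => int => real" assume u: "!!i s. 0 <= u i s"
 let ?N = "{1..2^n :: nat}"
 define F where "F = tree_op ka ka n"
 define X where "X s = linf_norm (2^n) (%i. F u i s)" for s
 have X0: "0 <= X s" for s unfolding X_def by (simp add: linf_norm_nonneg)
 define m where "m s = (SUM i:?N. u i s)" for s
 have m0: "0 <= m s" for s unfolding m_def by (intro sum_nonneg u)
 have "EX i:?N. X s = abs (F u i s)" for s
  unfolding X_def using linf_norm_attained[of "2^n" "%i. F u i s"] by (metis one_le_numeral one_le_power real_norm_def)
 then obtain k where k: "!!s. k s : ?N" "!!s. X s = abs (F u (k s) s)" by metis
 define g where "g s = abs (X s) powr (2*p - 2)" for s
 have g0: "0 <= g s" for s unfolding g_def by simp
 define h where "h i s = (if i = k s then g s else 0)" for i s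
 have h0: "0 <= h i s" for i s unfolding h_def using g0 by simp
 have h_sum: "(SUM i:?N. h i s) = g s" for s unfolding h_def using k(1)[of s] by simp
 define W where "W s = linf_norm (2^n) (%i. F h i s)" for s
 have W0: "0 <= W s" for s unfolding W_def by (simp add: linf_norm_nonneg)
 let ?N' = "nrm (2*p) X" and ?F' = "nrm (2*p) m" and ?H = "nrm q g"
 have nn: "0 <= ?N'" "0 <= ?F'" "0 <= ?H" by (rule nrm_nonneg)+
 have H: "?H = ?N' powr (2*p - 2)" unfolding g_def by (rule nrm_conjugate_powr[OF p pq])
 have "?N' powr (2*p) = S (%s. SUM i:?N. h i s*(F u i s)^2)"
 proof -
  have "abs (X s) powr (2*p) = (SUM i:?N. h i s*(F u i s)^2)" for s
  proof -
   have "(SUM i:?N. h i s*(F u i s)^2) = (SUM i:?N. if i = k s then g s*(X s)^2 else 0)"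
    unfolding h_def k(2) by (intro sum.cong) auto
   also have "... = g s*(X s)^2" using k(1)[of s] by simp
   also have "... = abs (X s) powr (2*p)"
    unfolding g_def using X0[of s] powr_add[of "X s" "2*p - 2" 2]
    by (cases "X s = 0") (auto simp: powr_numeral)
   finally show ?thesis ..
  qed
  then show ?thesis using p by (simp add: nrm_powr)
 qed
 also have "... = tree_form ka ka u h n 0 (%_. 0) (%_. 0) - 2*S (%s. SUM i:?N. u i s*F u i s*F h i s)"
  unfolding tree_form_root F_def by (simp add: sum.distrib S_add S_cmult[symmetric] sum_distrib_left mult.assoc)
 also have "... <= K*(?F'^2*?H) + 2*(?F'*?N'*(B*?H))"
 proof -
  have 1: "tree_form ka ka u h n 0 (%_. 0) (%_. 0) <= K*(?F'^2*?H)"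
   using dht_tree_form_bound[where ka = ka and u = u and h = h, OF ka u h0 p pq A] unfolding K_def m_def h_sum by linarith
  have "- S (%s. SUM i:?N. u i s*F u i s*F h i s) <= S (%s. abs (SUM i:?N. u i s*F u i s*F h i s))"
   using S_abs_le[of "%s. SUM i:?N. u i s*F u i s*F h i s"] by linarith
  also have "... <= S (%s. abs ((m s*X s)*W s))"
  proof (rule S_mono)
   fix s
   have "abs (SUM i:?N. u i s*F u i s*F h i s) <= (SUM i:?N. u i s*X s*W s)"
   proof (rule order_trans[OF sum_abs], rule sum_mono)
    fix i assume i: "i : ?N"
    have "abs (F u i s) <= X s" "abs (F h i s) <= W s"
     unfolding X_def W_def using linf_norm_ge[OF i, of "%i. F u i s"] linf_norm_ge[OF i, of "%i. F h i s"] by auto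
    then show "abs (u i s*F u i s*F h i s) <= u i s*X s*W s"
     using u[of i s] X0[of s] by (simp add: abs_mult mult_mono)
   qed
   also have "... = m s*X s*W s" unfolding m_def by (simp add: sum_distrib_right)
   also have "... = abs ((m s*X s)*W s)" using m0[of s] X0[of s] W0[of s] by simp
   finally show "abs (SUM i:?N. u i s*F u i s*F h i s) <= abs ((m s*X s)*W s)" .
  qed
  also have "... <= nrm p (%s. m s*X s)*nrm q W" by (rule Holder[OF p pq])
  also have "... <= (?F'*?N')*(B*?H)"
  proof (intro mult_mono nrm_mult nrm_nonneg)
   have "nrm q W <= B*nrm q (%s. l1_norm (2^n) (%i. h i s))"
    using stq unfolding tree_strong_def W_def F_def by blast
   also have "(%s. l1_norm (2^n) (%i. h i s)) = g"
    unfolding l1_norm_def using h0 by (simp only: real_norm_def abs_of_nonneg h_sum)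
   finally show "nrm q W <= B*?H" .
  qed (use p nn in auto)
  finally show ?thesis using 1 by linarith
 qed
 finally have "?N' powr (2*p) <= (2*B*?F'*?N' + K*?F'^2)*?N' powr (2*p - 2)"
  unfolding H by (simp add: algebra_simps)
 then have "?N' <= (2*B + sqrt K)*?F'" using nn B p K0 by (intro absorb_powr[of ?N' ?F' p]) auto
 then show "nrm (2*p) (%s. linf_norm (2^n) (%i. tree_op ka ka n u i s))
   <= (2*B + sqrt ((40 + 4*A*A' + 2*A^2)*(real n+1)))*nrm (2*p) (%s. SUM i:?N. u i s)"
  unfolding X_def F_def K_def m_def .
qed

end

section \<open>All exponents, with constants independent of the finite set\<close>

lemma exponent_between:
 fixes p b :: real
 assumes "1 < p" "1 < b"
 obtains k where "1 < b*2^k" "b*2^k/(b*2^k-1) < p" "p < b*2^k"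
proof -
 obtain k where k: "max p (p/(p-1)) < 2^k"
  using real_arch_pow[of 2 "max p (p/(p-1))"] by auto
 have "(2::real)^k < b*2^k" using assms by simp
 then have P: "p < b*2^k" "p/(p-1) < b*2^k" using k by (auto intro: less_trans)
 then have "1 < b*2^k" "b*2^k/(b*2^k-1) < p" using assms by (auto simp: field_simps)
 then show ?thesis using that P by blast
qed

theorem dht_l2_strong:
 assumes "1 < p"
 shows "EX A>=1. ALL G. dht_space G --> (ALL J::'j set. finite J --> scalar_op.l2_strong G (%_. 1) (dht G) J p A)"
proof -
 have *: "EX A>=1. ALL G. dht_space G --> (ALL J::'j set. finite J --> scalar_op.l2_strong G (%_. 1) (dht G) J (2*2^k) A)" for k :: nat
 proof (induction k)
  case 0
  have "scalar_op.l2_strong G (%_. 1) (dht G) J 2 6" if "dht_space G" "finite J" for G and J :: "'j set"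
  proof -
   interpret dht_space G by fact
   show ?thesis by (rule l2_strong_2[OF that(2)])
  qed
  then show ?case by (intro exI[of _ 6]) auto
 next
  case (Suc k)
  then obtain A where A: "1 <= A"
    "!!G (J::'j set). dht_space G ==> finite J ==> scalar_op.l2_strong G (%_. 1) (dht G) J (2*2^k) A"
   by blast
  have "scalar_op.l2_strong G (%_. 1) (dht G) J (2*2^Suc k) (2*A + 4)" if "dht_space G" "finite J" for G and J :: "'j set"
  proof -
   interpret dht_space G by fact
   have "(1::real) < 2*2^k" using one_le_power[of "2::real" k] by linarith
   then show ?thesis using l2_strong_double[OF that(2) A(2)[OF that] _ A(1)] by simp
  qed
  then show ?case using A(1) by (intro exI[of _ "2*A + 4"]) auto
 qed
 obtain k :: nat where k: "1 < 2*(2::real)^k" "2*2^k/(2*2^k-1) < p" "p < 2*2^k"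
  using exponent_between[OF assms, of 2] by auto
 obtain A where A: "1 <= A"
   "!!G (J::'j set). dht_space G ==> finite J ==> scalar_op.l2_strong G (%_. 1) (dht G) J (2*2^k) A"
  using *[of k] by blast
 let ?P = "2*(2::real)^k"
 let ?C = "max 1 (2*A*(2*interp_const (?P/(?P-1)) p ?P) powr (1/p))"
 have "scalar_op.l2_strong G (%_. 1) (dht G) J p ?C" if "dht_space G" "finite J" for G and J :: "'j set"
 proof -
  interpret dht_space G by fact
  show ?thesis
   by (rule l2_strong_mono[OF l2_strong_between[OF that(2) A(2)[OF that] _ k]]) (use A(1) in auto)
 qed
 then show ?thesis by (intro exI[of _ ?C]) auto
qed

text \<open>Doubling from the exponent \<open>3\<close> consumes square function bounds at
  \<open>2*p\<close> and at the conjugate of \<open>p\<close>, which is why those are available for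
  all exponents beforehand. In the last step duality uses that the matrix is symmetric,
  \<open>ta = 1\<close>.\<close>

theorem dht_tree_strong:
 assumes ka: "!!s. abs (ka s) = 1" and p: "1 < p"
 shows "EX C>=1. ALL G. dht_space G --> (ALL n. scalar_op.tree_strong G (%_. 1) (dht G) ka ka n p (C * sqrt (real n+1)))"
proof -
 have *: "EX C>=1. ALL G. dht_space G --> (ALL n. scalar_op.tree_strong G (%_. 1) (dht G) ka ka n (3*2^k) (C * sqrt (real n+1)))" for k :: nat
 proof (induction k)
  case 0
  obtain A where A: "1 <= A"
    "!!G (J::(nat \<times> nat) set). dht_space G ==> finite J ==> scalar_op.l2_strong G (%_. 1) (dht G) J 3 A"
   using dht_l2_strong[of 3, where 'j = "nat \<times> nat"] by auto
  let ?C = "max 1 (40 * sqrt (40 + 6*A^2))"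
  have "scalar_op.tree_strong G (%_. 1) (dht G) ka ka n 3 (?C * sqrt (real n+1))" if "dht_space G" for G n
  proof -
   interpret dht_space G by fact
   have "tree_strong ka ka n 3 (40 * sqrt ((40 + 6*A^2)*(real n+1)))"
    by (rule tree_strong_3[OF ka A(2)[OF that]]) (use A(1) in auto)
   then show ?thesis
   proof (rule tree_strong_mono)
    have "40 * sqrt ((40 + 6*A^2)*(real n+1)) = 40 * sqrt (40 + 6*A^2) * sqrt (real n+1)"
     by (simp only: real_sqrt_mult mult.assoc)
    also have "... <= ?C * sqrt (real n+1)" by (intro mult_right_mono) auto
    finally show "40 * sqrt ((40 + 6*A^2)*(real n+1)) <= ?C * sqrt (real n+1)" .
   qed
  qed
  then show ?case by (intro exI[of _ ?C]) simp
 next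
  case (Suc k)
  let ?p = "3*(2::real)^k" and ?q = "3*(2::real)^k/(3*2^k-1)"
  have p1: "1 < ?p" using one_le_power[of "2::real" k] by linarith
  have pq: "1/?p + 1/?q = 1" using p1 by (simp add: field_simps)
  have q1: "1 < ?q" using p1 by (simp add: field_simps)
  obtain C where C: "1 <= C" "!!G n. dht_space G ==> scalar_op.tree_strong G (%_. 1) (dht G) ka ka n ?p (C * sqrt (real n+1))"
   using Suc by blast
  obtain A where A: "1 <= A"
    "!!G (J::(nat \<times> nat) set). dht_space G ==> finite J ==> scalar_op.l2_strong G (%_. 1) (dht G) J (2*?p) A"
   using dht_l2_strong[of "2*?p", where 'j = "nat \<times> nat"] p1 by auto
  obtain A' where A': "1 <= A'"
    "!!G (J::(nat \<times> nat) set). dht_space G ==> finite J ==> scalar_op.l2_strong G (%_. 1) (dht G) J ?q A'"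
   using dht_l2_strong[OF q1, where 'j = "nat \<times> nat"] by auto
  let ?K = "40 + 4*A*A' + 2*A^2"
  let ?D = "8*(2*C + sqrt ?K)"
  have "scalar_op.tree_strong G (%_. 1) (dht G) ka ka n (2*?p) (?D * sqrt (real n+1))" if "dht_space G" for G n
  proof -
   interpret dht_space G by fact
   have "tree_strong ka ka n (2*?p) (8*(2*(C * sqrt (real n+1)) + sqrt (?K*(real n+1))))"
    by (rule tree_strong_double[OF ka p1 pq A(2)[OF that] A'(2)[OF that] _ _ C(2)[OF that]]) (use A(1) A'(1) C(1) in auto)
   moreover have alg: "8*(2*(C * sqrt m) + sqrt (K*m)) = 8*(2*C + sqrt K) * sqrt m" for m K :: real
    by (simp add: real_sqrt_mult algebra_simps)
   have "8*(2*(C * sqrt (real n+1)) + sqrt (?K*(real n+1))) = ?D * sqrt (real n+1)"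
    by (rule alg)
   ultimately show ?thesis by simp
  qed
  moreover have "1 <= ?D" using C(1) A(1) A'(1) by (simp add: add_increasing2)
  ultimately show ?case by (intro exI[of _ ?D]) (simp add: mult.left_commute)
 qed
 obtain k :: nat where k: "1 < 3*(2::real)^k" "3*2^k/(3*2^k-1) < p" "p < 3*2^k"
  using exponent_between[OF p, of 3] by auto
 obtain C where C: "1 <= C" "!!G n. dht_space G ==> scalar_op.tree_strong G (%_. 1) (dht G) ka ka n (3*2^k) (C * sqrt (real n+1))"
  using *[of k] by blast
 let ?P = "3*(2::real)^k"
 let ?I = "(2*interp_const (?P/(?P-1)) p ?P) powr (1/p)"
 let ?D = "max 1 (2*C*?I)"
 have "scalar_op.tree_strong G (%_. 1) (dht G) ka ka n p (?D * sqrt (real n+1))" if "dht_space G" for G n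
 proof -
  interpret dht_space G by fact
  have "tree_strong ka ka n p (2*(C * sqrt (real n+1))*?I)"
   by (rule tree_strong_between[where ta = 1, OF _ _ C(2)[OF that] _ k]) (use C(1) in auto)
  then show ?thesis
  proof (rule tree_strong_mono)
   have "2*(C * sqrt (real n+1))*?I = (2*C*?I) * sqrt (real n+1)" by (simp only: mult_ac)
   also have "... <= ?D * sqrt (real n+1)" by (intro mult_right_mono) auto
   finally show "2*(C * sqrt (real n+1))*?I <= ?D * sqrt (real n+1)" .
  qed
 qed
 then show ?thesis by (intro exI[of _ ?D]) auto
qed

section \<open>Martingale transforms on finite filtered spaces\<close>

text \<open>The atoms at time \<open>k\<close> are the fibres of the label function \<open>lab k\<close>.\<close>

locale fin_filtration = weighted_set Om wt for Om :: "'a set" and wt +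
 fixes lab :: "nat => 'a => 'l" and m :: nat
 assumes wt_pos: "s : Om ==> 0 < wt s"
  and lab_refine: "s : Om ==> t : Om ==> lab (Suc k) s = lab (Suc k) t ==> lab k s = lab k t"
  and lab_final: "inj_on (lab m) Om"
begin

definition atom :: "nat => 'a => 'a set" where
 "atom k s = {t : Om. lab k t = lab k s}"

definition E :: "nat => ('a => real) => 'a => real" where
 "E k f s = (SUM t:atom k s. wt t*f t)/(SUM t:atom k s. wt t)"

definition adapted :: "nat => ('a => 'b) => bool" where
 "adapted k f \<longleftrightarrow> (ALL s:Om. ALL t:Om. lab k s = lab k t --> f s = f t)"

definition D :: "nat => ('a => real) => 'a => real" where
 "D k f s = E k f s - E (k-1) f s"

definition predictable :: "(nat => 'a => real) => bool" where
 "predictable ep \<longleftrightarrow> (ALL k:{1..m}. adapted (k-1) (ep k) & (ALL s. abs (ep k s) <= 1))"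

definition Tp :: "(nat => 'a => real) => nat => ('a => real) => 'a => real" where
 "Tp ep l f s = (SUM k:{1..l}. ep k s*D k f s)"

lemma finite_atom: "finite (atom k s)"
 unfolding atom_def using fin by simp

lemma atom_pos: "s : Om ==> 0 < (SUM t:atom k s. wt t)"
 by (rule sum_pos2[OF finite_atom, of s]) (auto simp: atom_def wt_pos wt_nonneg)

lemma atom_eq: "lab k s = lab k t ==> atom k s = atom k t"
 unfolding atom_def by auto

lemma E_add: "E k (%s. f s + g s) s = E k f s + E k g s"
 unfolding E_def by (simp add: distrib_left sum.distrib add_divide_distrib)

lemma E_scale: "E k (%s. c*f s) s = c*E k f s"
 unfolding E_def by (simp add: sum_distrib_left mult.left_commute)

lemma E_local: "(!!t. t : Om ==> lab k t = lab k s ==> f t = g t) ==> E k f s = E k g s"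
 unfolding E_def atom_def by (intro arg_cong2[where f = "(/)"] sum.cong) auto

lemma E_adapted: "adapted k (E k f)"
 unfolding adapted_def E_def using atom_eq by metis

lemma E_mono: "(!!t. t : Om ==> f t <= g t) ==> E k f s <= E k g s"
 unfolding E_def by (intro divide_right_mono sum_mono mult_left_mono sum_nonneg) (auto simp: atom_def wt_nonneg)

lemma E_const: "s : Om ==> E k (%_. c) s = c"
 unfolding E_def using atom_pos[of s k] by (simp add: sum_distrib_right[symmetric])

lemma E_pull:
 assumes "adapted k g" "s : Om" shows "E k (%s. g s*f s) s = g s*E k f s"
proof -
 have "E k (%s. g s*f s) s = E k (%t. g s*f t) s"
 proof (rule E_local)
  fix t assume "t : Om" "lab k t = lab k s"
  then have "g t = g s" using assms unfolding adapted_def by blast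
  then show "g t*f t = g s*f t" by simp
 qed
 then show ?thesis by (simp only: E_scale)
qed

lemma E_id: "adapted k f ==> s : Om ==> E k f s = f s"
 using E_pull[of k f s "%_. 1"] E_const[of s k 1] by simp

lemma E_final: "s : Om ==> E m f s = f s"
 using lab_final by (intro E_id) (auto simp: adapted_def inj_on_def)

lemma S_E: "S (E k f) = S f"
proof -
 define A where "A s = (SUM r:atom k s. wt r)" for s
 have sum_atom: "(SUM t:atom k s. g t) = (SUM t:Om. if lab k t = lab k s then g t else 0)" for g :: "'a => real" and s
  unfolding atom_def by (rule sum.inter_filter[OF fin])
 have "S (E k f) = (SUM s:Om. SUM t:Om. if lab k t = lab k s then wt s*(wt t*f t)/A s else 0)"
  unfolding S_def E_def A_def[symmetric] sum_atom[symmetric] by (simp add: sum_distrib_left sum_divide_distrib)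
 also have "... = (SUM t:Om. SUM s:Om. if lab k t = lab k s then wt s*(wt t*f t)/A s else 0)"
  by (rule sum.swap)
 also have "... = (SUM t:Om. wt t*f t)"
 proof (rule sum.cong[OF refl])
  fix t assume t: "t : Om"
  have "(SUM s:Om. if lab k t = lab k s then wt s*(wt t*f t)/A s else 0)
    = (SUM s:Om. if lab k s = lab k t then wt s*(wt t*f t)/A t else 0)"
   unfolding A_def by (intro sum.cong) (auto simp: atom_def)
  also have "... = A t*(wt t*f t)/A t"
   unfolding sum_atom[symmetric] A_def by (simp add: sum_distrib_right sum_divide_distrib)
  also have "... = wt t*f t" using atom_pos[OF t, of k] unfolding A_def by simp
  finally show "(SUM s:Om. if lab k t = lab k s then wt s*(wt t*f t)/A s else 0) = wt t*f t" .
 qed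
 finally show ?thesis unfolding S_def .
qed

lemma S_E_mult: "adapted k g ==> S (%s. g s*E k f s) = S (%s. g s*f s)"
 using S_E[of k "%s. g s*f s"] S_cong[of "%s. g s*E k f s" "E k (%s. g s*f s)"] E_pull by simp

lemma adapted_Suc: "adapted k f ==> adapted (Suc k) f"
 using lab_refine unfolding adapted_def by blast

lemma adapted_mono: "adapted k f ==> k <= l ==> adapted l f"
 by (induction l) (auto simp: le_Suc_eq intro: adapted_Suc)

lemma adapted_comp2: "adapted k f ==> adapted k g ==> adapted k (%s. h (f s) (g s))"
 unfolding adapted_def by metis

lemma adapted_comp: "adapted k f ==> adapted k (%s. h (f s))"
 unfolding adapted_def by metis

lemma adapted_sum: "(!!i. i : I ==> adapted k (f i)) ==> adapted k (%s. SUM i:I. f i s)"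
 unfolding adapted_def by (metis (no_types, lifting) sum.cong)

lemma adapted_fun: "(!!i. adapted k (%s. f s i)) ==> adapted k f"
 unfolding adapted_def by blast

lemma D_adapted: "adapted k (D k f)"
 unfolding D_def using E_adapted[of k f] adapted_mono[OF E_adapted[of "k - 1" f]]
 by (intro adapted_comp2[where h = "(-)"]) auto

lemma S_mult_D: "1 <= k ==> adapted (k-1) g ==> S (%s. g s*D k f s) = 0"
 using S_E_mult[of "k - 1" g f] S_E_mult[of k g f] adapted_mono[of "k - 1" g k]
 unfolding D_def by (simp add: right_diff_distrib S_diff)

lemma D_add: "D k (%s. f s + g s) s = D k f s + D k g s"
 unfolding D_def by (simp add: E_add)

lemma D_scale: "D k (%s. c*f s) s = c*D k f s"
 unfolding D_def by (simp add: E_scale right_diff_distrib)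

lemma E_step: "1 <= k ==> E k f s = E (k-1) f s + D k f s"
 unfolding D_def by simp

lemma Tp_step: "1 <= k ==> Tp ep k f s = Tp ep (k-1) f s + ep k s*D k f s"
 unfolding Tp_def by (cases k) auto

lemma Tp_0 [simp]: "Tp ep 0 f s = 0"
 unfolding Tp_def by simp

lemma Tp_adapted:
 assumes "predictable ep" "l <= m" shows "adapted l (Tp ep l f)"
proof -
 have "adapted l (%s. ep k s*D k f s)" if k: "k : {1..l}" for k
 proof -
  have "adapted (k-1) (ep k)" using assms k unfolding predictable_def by auto
  then have "adapted k (%s. ep k s*D k f s)"
   by (intro adapted_comp2[where h = "(*)"] D_adapted) (auto intro: adapted_mono)
  then show ?thesis using k by (auto intro: adapted_mono)
 qed
 then show ?thesis unfolding Tp_def[abs_def] by (rule adapted_sum)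
qed

lemma S_telescope: "S (Z l) = S (Z 0) + (SUM k:{1..l}. S (%s. Z k s - Z (k-1) s))" for Z :: "nat => 'a => real"
 by (induction l) (simp_all add: S_diff)

text \<open>Only products of increments with equal index survive. The right side is symmetric in
  \<open>f\<close> and \<open>g\<close>, which makes the transform self-adjoint.\<close>

lemma S_pairing:
 assumes "predictable ep"
 shows "S (%s. g s*Tp ep m f s) = (SUM k:{1..m}. S (%s. ep k s*(D k g s*D k f s)))"
proof -
 have "S (%s. g s*(ep k s*D k f s)) = S (%s. ep k s*(D k g s*D k f s))" if k: "k : {1..m}" for k
 proof -
  have ep: "adapted (k-1) (ep k)" using assms k unfolding predictable_def by auto
  have "adapted k (%s. ep k s*D k f s)"
   using adapted_mono[OF ep, of k] by (intro adapted_comp2[where h = "(*)"] D_adapted) auto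
  then have "S (%s. (ep k s*D k f s)*g s) = S (%s. (ep k s*D k f s)*E k g s)"
   by (rule S_E_mult[symmetric])
  also have "... = S (%s. (ep k s*E (k-1) g s)*D k f s) + S (%s. ep k s*(D k g s*D k f s))"
   unfolding S_add[symmetric] using k by (intro S_cong) (simp add: E_step algebra_simps)
  also have "S (%s. (ep k s*E (k-1) g s)*D k f s) = 0"
   using k by (intro S_mult_D adapted_comp2[where h = "(*)"] ep E_adapted) auto
  finally show ?thesis by (simp add: mult_ac)
 qed
 then show ?thesis unfolding Tp_def sum_distrib_left S_sum by (intro sum.cong) auto
qed

lemma scalar_op_Tp:
 assumes "predictable ep" shows "scalar_op Om wt (Tp ep m) 1"
proof
 fix f g :: "'a => real" and s c
 show "Tp ep m (%s. f s + g s) s = Tp ep m f s + Tp ep m g s"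
  unfolding Tp_def by (simp add: D_add distrib_left sum.distrib)
 show "Tp ep m (%s. c*f s) s = c*Tp ep m f s"
  unfolding Tp_def by (simp add: D_scale sum_distrib_left mult.left_commute)
 show "Tp ep m f = Tp ep m g" if "!!s. s : Om ==> f s = g s"
  using that unfolding Tp_def[abs_def] D_def by (intro ext sum.cong arg_cong2[where f = "(*)"] arg_cong2[where f = "(-)"] E_local) auto
 show "S (%s. g s*Tp ep m f s) = 1*S (%s. f s*Tp ep m g s)"
  unfolding S_pairing[OF assms] by (simp add: mult.commute)
qed simp

lemma sum_D_squares: "(SUM k:{1..m}. S (%s. (D k f s)^2)) <= S (%s. (f s)^2)"
proof -
 have "S (%s. (E k f s)^2 - (E (k-1) f s)^2) = S (%s. (D k f s)^2)" if "k : {1..m}" for k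
 proof -
  have "S (%s. (E k f s)^2 - (E (k-1) f s)^2) = S (%s. (D k f s)^2) + S (%s. (2*E (k-1) f s)*D k f s)"
   unfolding S_add[symmetric] using that by (intro S_cong) (simp add: E_step power2_eq_square algebra_simps)
  also have "S (%s. (2*E (k-1) f s)*D k f s) = 0"
   using that by (intro S_mult_D adapted_comp[where h = "(*) 2"] E_adapted) auto
  finally show ?thesis by simp
 qed
 then have "(SUM k:{1..m}. S (%s. (D k f s)^2)) = S (%s. (E m f s)^2) - S (%s. (E 0 f s)^2)"
  using S_telescope[of "%k s. (E k f s)^2" m] by simp
 also have "... <= S (%s. (E m f s)^2)" using S_nonneg[of "%s. (E 0 f s)^2"] by simp
 also have "... = S (%s. (f s)^2)" by (intro S_cong) (simp add: E_final)
 finally show ?thesis .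
qed

lemma Tp_L2:
 assumes "predictable ep" shows "S (%s. (Tp ep m f s)^2) <= S (%s. (f s)^2)"
proof -
 have "S (%s. (Tp ep k f s)^2 - (Tp ep (k-1) f s)^2) <= S (%s. (D k f s)^2)" if k: "k : {1..m}" for k
 proof -
  have ep: "adapted (k-1) (ep k)" and ep1: "abs (ep k s) <= 1" for s using assms k unfolding predictable_def by auto
  have "S (%s. (Tp ep k f s)^2 - (Tp ep (k-1) f s)^2)
    = S (%s. (ep k s*D k f s)^2) + S (%s. (2*(Tp ep (k-1) f s*ep k s))*D k f s)"
   unfolding S_add[symmetric] using k by (intro S_cong) (simp add: Tp_step power2_eq_square algebra_simps)
  also have "S (%s. (2*(Tp ep (k-1) f s*ep k s))*D k f s) = 0"
   using k by (intro S_mult_D adapted_comp[where h = "(*) 2"] adapted_comp2[where h = "(*)"] Tp_adapted assms ep) auto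
  also have "S (%s. (ep k s*D k f s)^2) <= S (%s. (D k f s)^2)"
  proof (rule S_mono)
   fix s
   have "abs (ep k s*D k f s) <= abs (D k f s)" using ep1 by (simp add: abs_mult mult_left_le_one_le)
   then show "(ep k s*D k f s)^2 <= (D k f s)^2" by (simp add: abs_le_square_iff)
  qed
  finally show ?thesis by simp
 qed
 then have "(SUM k:{1..m}. S (%s. (Tp ep k f s)^2 - (Tp ep (k-1) f s)^2)) <= (SUM k:{1..m}. S (%s. (D k f s)^2))"
  by (rule sum_mono)
 moreover have "S (%s. (Tp ep 0 f s)^2) = 0" unfolding S_def by simp
 ultimately have "S (%s. (Tp ep m f s)^2) <= (SUM k:{1..m}. S (%s. (D k f s)^2))"
  using S_telescope[of "%k s. (Tp ep k f s)^2" m] by linarith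
 then show ?thesis using sum_D_squares[of f] by linarith
qed

end

section \<open>Extrapolation to higher exponents by stopping\<close>

lemma summable_powr_geometric: "summable (%j. (real j+1) powr q*(1/2)^j)"
proof -
 have "(%j. ((real j + 2)/(real j+1)) powr q) \<longlonglongrightarrow> 1 powr q"
 proof (rule tendsto_powr)
  have "(%j. 1 + inverse (real (Suc j))) \<longlonglongrightarrow> 1 + 0"
   by (intro tendsto_intros LIMSEQ_inverse_real_of_nat)
  moreover have "1 + inverse (real (Suc j)) = (real j + 2)/(real j+1)" for j by (simp add: field_simps)
  ultimately show "(%j. (real j + 2)/(real j+1)) \<longlonglongrightarrow> 1" by simp
 qed auto
 then have "\<forall>\<^sub>F j in sequentially. ((real j + 2)/(real j+1)) powr q < 3/2"
  by (rule order_tendstoD) simp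
 then obtain N where N: "!!j. N <= j ==> ((real j + 2)/(real j+1)) powr q < 3/2"
  unfolding eventually_sequentially by blast
 show ?thesis
 proof (rule summable_ratio_test[of "3/4" N])
  fix j assume "N <= j"
  have "(real (Suc j)+1) powr q = ((real j + 2)/(real j+1)) powr q*(real j+1) powr q"
   by (simp flip: powr_mult add: add.commute)
  also have "... <= 3/2*(real j+1) powr q"
   using N[OF \<open>N <= j\<close>] by (intro mult_right_mono) auto
  finally have "(real (Suc j)+1) powr q*(1/2)^Suc j <= 3/2*(real j+1) powr q*(1/2)^Suc j"
   by (rule mult_right_mono) simp
  then show "norm ((real (Suc j)+1) powr q*(1/2)^Suc j) <= 3/4*norm ((real j+1) powr q*(1/2)^j)"
   by simp
 qed simp
qed

text \<open>The spacing of the levels is \<open>4*B\<close>, which explains the \<open>4\<close>.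
  Level \<open>j\<close> costs \<open>(j+1) powr q\<close> and is reached on a set of measure of
  order \<open>2^-j\<close>; this is the series.\<close>

definition extrapolation_const :: "real => real" where
 "extrapolation_const q = 4*(1 + 2*(\<Sum>j. (real j+1) powr q*(1/2)^j)) powr (1/q)"

context fin_filtration
begin

lemma E_Jensen:
 fixes rh :: "('j => real) => real"
 assumes scale: "!!c x. rh (%j. c*x j) = abs c*rh x"
  and tri: "!!x y. rh (%j. x j + y j) <= rh x + rh y"
 shows "rh (%j. E k (u j) s) <= E k (%t. rh (%j. u j t)) s"
proof -
 have sum: "rh (%j. SUM i:I. x i j) <= (SUM i:I. rh (x i))" if "finite I" for I :: "'a set" and x
  using that
 proof induction
  case empty
  then show ?case using scale[of 0 "%_. 0"] by simp
 next
  case (insert i I)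
  then show ?case using tri[of "x i" "%j. SUM i:I. x i j"] by simp
 qed
 let ?A = "SUM t:atom k s. wt t"
 have A0: "0 <= ?A" by (intro sum_nonneg) (auto simp: atom_def wt_nonneg)
 have "rh (%j. E k (u j) s) = rh (%j. inverse ?A*(SUM t:atom k s. wt t*u j t))"
  unfolding E_def by (simp add: divide_inverse mult.commute)
 also have "... <= inverse ?A*(SUM t:atom k s. rh (%j. wt t*u j t))"
  unfolding scale[of "inverse ?A"] using A0 sum[OF finite_atom, of "%t j. wt t*u j t" k s]
  by (simp add: mult_left_mono)
 also have "... = E k (%t. rh (%j. u j t)) s"
  unfolding E_def scale by (simp add: divide_inverse mult.commute, intro disjI2 sum.cong) (auto simp: atom_def wt_nonneg)
 finally show ?thesis .
qed

lemma D_sum: "D k (%s. SUM j:I. c j*f j s) s = (SUM j:I. c j*D k (f j) s)"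
proof (cases "finite I")
 case True
 then show ?thesis
 proof induction
  case empty
  then show ?case using D_scale[of k 0 "%_. 0" s] by simp
 next
  case (insert i I)
  then show ?case by (simp add: D_add D_scale)
 qed
next
 case False
 then show ?thesis using D_scale[of k 0 "%_. 0" s] by simp
qed

text \<open>The transform is stopped when its running size crosses the levels \<open>4 B j\<close>. Between two
 consecutive crossings it is itself a transform, of \<open>u\<close> restricted to the set where the lower
 level is reached, so the measures of these sets decay geometrically.\<close>

theorem restricted_extrapolation:
 fixes rh rh' :: "('j => real) => real" and K :: "'j => 'j => real"
 assumes rh: "!!x. 0 <= rh x" "!!c x. rh (%j. c*x j) = abs c*rh x" "!!x y. rh (%j. x j + y j) <= rh x + rh y"
  and rh': "!!x. 0 <= rh' x" "!!c x. rh' (%j. c*x j) = abs c*rh' x" "!!x y. rh' (%j. x j + y j) <= rh' x + rh' y"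
  and K: "!!x. rh' (%i. SUM j:J. K i j*x j) <= rh x"
  and strong: "!!ep u. predictable ep ==>
   nrm p (%s. rh' (%i. Tp ep m (%s. SUM j:J. K i j*u j s) s)) <= B*nrm p (%s. rh (%j. u j s))"
  and B: "1 <= B" and p: "1 <= p" "p <= q"
  and ep: "predictable ep" and u: "!!s. s : Om ==> rh (%j. u j s) <= indicator A s"
 shows "S (%s. rh' (%i. Tp ep m (%s. SUM j:J. K i j*u j s) s) powr q)
  <= (extrapolation_const q*B) powr q*S (indicator A)"
proof -
 define v where "v u i s = (SUM j:J. K i j*u j s)" for u :: "'j => 'a => real" and i s
 define Y where "Y l s = rh' (%i. Tp ep l (v u i) s)" for l s
 have Y0: "0 <= Y l s" for l s unfolding Y_def by (rule rh')
 define ka where "ka = 4*B"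
 have ka: "0 < ka" unfolding ka_def using B by simp
 \<comment> \<open>An average of values of norm at most one has norm at most one, \<open>K\<close>
   does not increase norms, and an increment is a difference of two averages.\<close>
 have jump: "rh' (%i. D l (v u i) s) <= 2" if s: "s : Om" for l s
 proof -
  have E1: "rh (%j. E k (u j) s) <= 1" for k
  proof -
   have "rh (%j. E k (u j) s) <= E k (%t. rh (%j. u j t)) s" by (rule E_Jensen[OF rh(2,3)])
   also have "... <= E k (%_. 1) s"
    using u by (intro E_mono) (meson indicator_le_1 order_trans)
   finally show ?thesis using s by (simp add: E_const)
  qed
  have "rh' (%i. D l (v u i) s) = rh' (%i. SUM j:J. K i j*D l (u j) s)"
   unfolding v_def by (simp add: D_sum)
  also have "... <= rh (%j. D l (u j) s)" by (rule K)
  also have "... = rh (%j. E l (u j) s + (- 1)*E (l-1) (u j) s)" unfolding D_def by simp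
  also have "... <= rh (%j. E l (u j) s) + rh (%j. (- 1)*E (l-1) (u j) s)" by (rule rh)
  also have "... <= 1 + 1" unfolding rh(2) using E1 by (intro add_mono) auto
  finally show ?thesis by simp
 qed
 have Y_step: "Y l s <= Y (l-1) s + 2" if "s : Om" "l : {1..m}" for l s
 proof -
  have "Y l s = rh' (%i. Tp ep (l-1) (v u i) s + ep l s*D l (v u i) s)"
   unfolding Y_def using that by (simp add: Tp_step)
  also have "... <= Y (l-1) s + abs (ep l s)*rh' (%i. D l (v u i) s)"
   unfolding Y_def rh'(2)[symmetric] by (rule rh')
  also have "abs (ep l s)*rh' (%i. D l (v u i) s) <= 1*2"
   using ep that jump[OF that(1)] rh'(1) unfolding predictable_def by (intro mult_mono) auto
  finally show ?thesis by simp
 qed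
 define hit where "hit j l s = (EX k<=l. real j*ka <= Y k s)" for j l s
 have hit_adapted: "adapted l (hit j l)" if "l <= m" for j l
 proof -
  have "adapted l (Y k)" if "k <= l" for k
  proof -
   have "adapted k (%s i. Tp ep k (v u i) s)"
    using \<open>l <= m\<close> that by (intro adapted_fun Tp_adapted ep) auto
   then have "adapted k (Y k)" unfolding Y_def[abs_def] by (rule adapted_comp)
   then show ?thesis using that by (rule adapted_mono)
  qed
  then show ?thesis unfolding hit_def adapted_def by metis
 qed
 define ep' where "ep' j k s = (if hit j (k-1) s & ~ hit (Suc j) (k-1) s then ep k s else 0)" for j k s
 have ep': "predictable (ep' j)" for j
  unfolding predictable_def
 proof (intro ballI conjI allI)
  fix k s assume k: "k : {1..m}"
  show "abs (ep' j k s) <= 1" using ep k unfolding ep'_def predictable_def by auto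
  have "adapted (k-1) (hit j (k-1))" "adapted (k-1) (hit (Suc j) (k-1))" "adapted (k-1) (ep k)"
   using k ep hit_adapted[of "k - 1"] unfolding predictable_def by auto
  then show "adapted (k-1) (ep' j k)" unfolding ep'_def adapted_def by metis
 qed
 define u' where "u' j i s = (if hit j m s then u i s else 0)" for j i s
 \<comment> \<open>The stopped coefficients vanish until the lower level is reached. From then on
   the whole atom has reached it, so cutting \<open>u\<close> down to the points that ever reach it
   does not change the increments in use.\<close>
 have local: "Tp (ep' j) m (v (u' j) i) s = Tp (ep' j) m (v u i) s" if s: "s : Om" for j i s
  unfolding Tp_def
 proof (intro sum.cong refl)
  fix k assume k: "k : {1..m}"
  show "ep' j k s*D k (v (u' j) i) s = ep' j k s*D k (v u i) s"
  proof (cases "hit j (k-1) s")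
   case True
   have eq: "v (u' j) i t = v u i t" if "t : Om" "lab (k-1) t = lab (k-1) s" for t
   proof -
    have "adapted (k-1) (hit j (k-1))" using k by (intro hit_adapted) auto
    then have "hit j (k-1) t = hit j (k-1) s" using that s unfolding adapted_def by blast
    then have "hit j (k-1) t" using True by simp
    then have "hit j m t" using k unfolding hit_def by (meson atLeastAtMost_iff diff_le_self le_trans)
    then show ?thesis unfolding v_def u'_def by simp
   qed
   have refine: "lab (k-1) t = lab (k-1) s" if "t : Om" "lab k t = lab k s" for t
    using lab_refine[of t s "k - 1"] that s k by simp
   have "E (k-1) (v (u' j) i) s = E (k-1) (v u i) s" by (rule E_local) (rule eq)
   moreover have "E k (v (u' j) i) s = E k (v u i) s" by (rule E_local) (rule eq, simp, rule refine)
   ultimately show ?thesis unfolding D_def by simp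
  qed (simp add: ep'_def)
 qed
 \<comment> \<open>The lower level is overshot by at most one jump, \<open>2\<close>. The stretch
   between the times \<open>a\<close> and \<open>b\<close> therefore gains at least
   \<open>4*B - 2\<close>, which is at least \<open>2*B\<close> because
   \<open>1 <= B\<close>.\<close>
 have low: "2*B <= rh' (%i. Tp (ep' j) m (v u i) s)" if s: "s : Om" and h: "hit (Suc j) m s" for j s
 proof -
  define a where "a = (LEAST k. real j*ka <= Y k s)"
  define b where "b = (LEAST k. real (Suc j)*ka <= Y k s)"
  obtain k0 where k0: "k0 <= m" "real (Suc j)*ka <= Y k0 s" using h unfolding hit_def by blast
  have b: "real (Suc j)*ka <= Y b s" unfolding b_def by (rule LeastI[of _ k0]) (rule k0)
  have bm: "b <= m" using Least_le[of "%k. real (Suc j)*ka <= Y k s" k0] k0 unfolding b_def by simp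
  have jb: "real j*ka <= Y b s" using b ka by (simp add: algebra_simps)
  have a: "real j*ka <= Y a s" unfolding a_def by (rule LeastI[of _ b]) (rule jb)
  have ab: "a <= b" unfolding a_def by (rule Least_le) (rule jb)
  have hit_a: "hit j l s \<longleftrightarrow> a <= l" for l
  proof
   assume "hit j l s"
   then obtain k where "k <= l" "real j*ka <= Y k s" unfolding hit_def by blast
   then show "a <= l" using Least_le[of "%k. real j*ka <= Y k s" k] unfolding a_def by simp
  qed (use a in \<open>auto simp: hit_def\<close>)
  have hit_b: "hit (Suc j) l s \<longleftrightarrow> b <= l" for l
  proof
   assume "hit (Suc j) l s"
   then obtain k where "k <= l" "real (Suc j)*ka <= Y k s" unfolding hit_def by blast
   then show "b <= l" using Least_le[of "%k. real (Suc j)*ka <= Y k s" k] unfolding b_def by simp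
  qed (use b in \<open>auto simp: hit_def\<close>)
  have Tp_eq: "Tp (ep' j) m f s = Tp ep b f s + (- 1)*Tp ep a f s" for f
  proof -
   have "Tp (ep' j) m f s = (SUM k:{1..m}. if k : {a<..b} then ep k s*D k f s else 0)"
    unfolding Tp_def ep'_def hit_a hit_b by (intro sum.cong) auto
   also have "... = (SUM k:{a<..b}. ep k s*D k f s)"
    using bm by (subst sum.inter_restrict[symmetric]) (auto intro!: sum.cong)
   also have "... = Tp ep b f s - Tp ep a f s"
   proof -
    have "{1..b} = {1..a} \<union> {a<..b}" using ab by auto
    then have "Tp ep b f s = Tp ep a f s + (SUM k:{a<..b}. ep k s*D k f s)"
     unfolding Tp_def by (simp only:) (rule sum.union_disjoint, auto)
    then show ?thesis by simp
   qed
   finally show ?thesis by simp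
  qed
  have Ya: "Y a s <= real j*ka + 2"
  proof (cases a)
   case 0
   have "Y 0 s = 0" unfolding Y_def using rh'(2)[of 0 "%_. 0"] by simp
   then show ?thesis using 0 ka by simp
  next
   case (Suc l)
   then have "Y l s < real j*ka" using not_less_Least[of l "%k. real j*ka <= Y k s"] unfolding a_def[symmetric] by simp
   then show ?thesis using Y_step[OF s, of a] Suc ab bm by simp
  qed
  have "Y b s <= rh' (%i. Tp (ep' j) m (v u i) s) + Y a s"
   using rh'(3)[of "%i. Tp (ep' j) m (v u i) s" "%i. Tp ep a (v u i) s"] unfolding Tp_eq Y_def by simp
  moreover have "real (Suc j)*ka = real j*ka + 4*B" unfolding ka_def by (simp add: algebra_simps)
  ultimately show ?thesis using b Ya B by linarith
 qed
 define M where "M j = S (%s. indicator A s * of_bool (hit j m s))" for j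
 \<comment> \<open>Chebyshev's inequality at height \<open>2*B\<close> against the operator bound
   \<open>B\<close> shrinks the measure by \<open>2 powr p\<close>, hence at least by the factor
   \<open>2\<close>.\<close>
 have step: "S (%s. of_bool (hit (Suc j) m s)) <= 1/2*S (%s. indicator A s * of_bool (hit j m s))" for j
 proof -
  have "(2*B) powr p*S (%s. of_bool (hit (Suc j) m s)) <= S (%s. abs (rh' (%i. Tp (ep' j) m (v (u' j) i) s)) powr p)"
   unfolding S_cmult[symmetric]
  proof (rule S_mono)
   fix s assume s: "s : Om"
   show "(2*B) powr p * of_bool (hit (Suc j) m s) <= abs (rh' (%i. Tp (ep' j) m (v (u' j) i) s)) powr p"
   proof (cases "hit (Suc j) m s")
    case True
    have "(2*B) powr p <= abs (rh' (%i. Tp (ep' j) m (v (u' j) i) s)) powr p"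
     using low[OF s True] p B rh'(1) by (intro powr_mono2) (auto simp: local[OF s])
    then show ?thesis using True by simp
   qed simp
  qed
  also have "... <= (B*nrm p (%s. rh (%i. u' j i s))) powr p"
   using p strong[OF ep', of j "u' j"] unfolding v_def by (intro nrm_le_imp) auto
  also have "... = B powr p*S (%s. abs (rh (%i. u' j i s)) powr p)"
   using p by (simp add: powr_mult nrm_powr)
  also have "... <= B powr p*S (%s. indicator A s * of_bool (hit j m s))"
  proof (intro mult_left_mono S_mono)
   fix s assume s: "s : Om"
   show "abs (rh (%i. u' j i s)) powr p <= indicator A s * of_bool (hit j m s)"
   proof (cases "hit j m s")
    case True
    have "abs (rh (%i. u i s)) powr p <= indicator A s powr p"
     using u[OF s] p rh(1) by (intro powr_mono2) auto
    then show ?thesis using True p unfolding u'_def by (auto simp: indicator_def split: if_splits)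
   next
    case False
    then show ?thesis unfolding u'_def using rh(2)[of 0 "%_. 0"] by simp
   qed
  qed simp
  finally have "2 powr p*S (%s. of_bool (hit (Suc j) m s)) <= S (%s. indicator A s * of_bool (hit j m s))"
   using B by (simp add: powr_mult)
  moreover have "2*S (%s. of_bool (hit (Suc j) m s)) <= 2 powr p*S (%s. of_bool (hit (Suc j) m s))"
   using powr_mono[of 1 p 2] p by (intro mult_right_mono S_nonneg) auto
  ultimately show ?thesis by linarith
 qed
 have A0: "0 <= S (indicator A)" by (rule S_nonneg) simp
 have decay: "S (%s. of_bool (hit (Suc j) m s)) <= (1/2)^j*S (indicator A)" for j
 proof (induction j)
  case 0
  have "S (%s. indicator A s * of_bool (hit 0 m s)) <= S (indicator A)" by (intro S_mono) auto
  then show ?case using step[of 0] A0 by simp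
 next
  case (Suc j)
  have "S (%s. indicator A s * of_bool (hit (Suc j) m s)) <= S (%s. of_bool (hit (Suc j) m s))"
   by (intro S_mono) (auto simp: indicator_def)
  then show ?case using step[of "Suc j"] Suc by simp
 qed
 \<comment> \<open>A bound for the number of levels reached anywhere, which keeps the sum over
   levels finite.\<close>
 define L where "L = nat \<lceil>(SUM s:Om. Y m s)/ka\<rceil>"
 have pt: "Y m s powr q <= ka powr (q - p)*Y m s powr p
   + (SUM j<L. (real (Suc j)+1) powr q*ka powr q * of_bool (hit (Suc j) m s))" if s: "s : Om" for s
 proof (cases "Y m s < ka")
  case True
  have "Y m s powr q = Y m s powr (q - p)*Y m s powr p" by (simp flip: powr_add)
  also have "... <= ka powr (q - p)*Y m s powr p"
   using True Y0 p by (intro mult_right_mono powr_mono2) auto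
  finally show ?thesis using sum_nonneg[of "{..<L}" "%j. (real (Suc j)+1) powr q*ka powr q * of_bool (hit (Suc j) m s)"] by auto
 next
  case False
  define j where "j = nat \<lfloor>Y m s/ka\<rfloor>"
  have f1: "1 <= \<lfloor>Y m s/ka\<rfloor>" using False ka by (simp add: le_floor_iff)
  have jr: "real j = of_int \<lfloor>Y m s/ka\<rfloor>" unfolding j_def using f1 by simp
  have j: "real j*ka <= Y m s" "Y m s <= (real j+1)*ka" "1 <= j"
  proof -
   have "of_int \<lfloor>Y m s/ka\<rfloor> <= Y m s/ka" "Y m s/ka <= of_int \<lfloor>Y m s/ka\<rfloor> + 1" by linarith+
   then have "real j <= Y m s/ka" "Y m s/ka <= real j + 1" unfolding jr .
   then show "real j*ka <= Y m s" "Y m s <= (real j+1)*ka"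
    using ka by (simp_all add: pos_le_divide_eq pos_divide_le_eq)
   show "1 <= j" unfolding j_def using f1 by linarith
  qed
  obtain i where i: "j = Suc i" using j(3) by (cases j) auto
  have "Y m s <= (SUM s:Om. Y m s)" using s fin Y0 by (intro member_le_sum) auto
  then have "Y m s/ka <= (SUM s:Om. Y m s)/ka" using ka by (simp add: divide_right_mono)
  then have "j <= L" unfolding j_def L_def by linarith
  then have iL: "i < L" using i by simp
  have "Y m s powr q <= ((real (Suc i)+1)*ka) powr q" using j(2) Y0 p i by (intro powr_mono2) auto
  also have "... = (real (Suc i)+1) powr q*ka powr q * of_bool (hit (Suc i) m s)"
   using j(1) i unfolding hit_def powr_mult by auto
  also have "... <= (SUM j<L. (real (Suc j)+1) powr q*ka powr q * of_bool (hit (Suc j) m s))"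
   using iL by (intro member_le_sum[of i "{..<L}" "%j. (real (Suc j)+1) powr q*ka powr q * of_bool (hit (Suc j) m s)"]) auto
  finally show ?thesis by (simp add: add_increasing)
 qed
 let ?C = "\<Sum>j. (real j+1) powr q*(1/2)^j"
 have C0: "0 <= ?C" by (intro suminf_nonneg summable_powr_geometric) auto
 have pq: "ka powr (q - p)*B powr p <= ka powr q"
 proof -
  have "B powr p <= ka powr p" unfolding ka_def using B p by (intro powr_mono2) auto
  then have "ka powr (q - p)*B powr p <= ka powr (q - p)*ka powr p" by (intro mult_left_mono) auto
  then show ?thesis by (simp flip: powr_add)
 qed
 have main: "S (%s. Y m s powr p) <= B powr p*S (indicator A)"
 proof -
  have "S (%s. abs (Y m s) powr p) <= (B*nrm p (%s. rh (%j. u j s))) powr p"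
   unfolding Y_def v_def using p by (intro nrm_le_imp strong ep) auto
  also have "... = B powr p*S (%s. abs (rh (%j. u j s)) powr p)"
   using p by (simp add: powr_mult nrm_powr)
  also have "... <= B powr p*S (indicator A)"
  proof (intro mult_left_mono S_mono)
   fix s assume "s : Om"
   then have "abs (rh (%j. u j s)) powr p <= indicator A s powr p" using u p rh(1) by (intro powr_mono2) auto
   then show "abs (rh (%j. u j s)) powr p <= indicator A s" using p by (auto simp: indicator_def split: if_splits)
  qed simp
  finally show ?thesis using Y0 by simp
 qed
 have "S (%s. Y m s powr q) <= S (%s. ka powr (q - p)*Y m s powr p
   + (SUM j<L. (real (Suc j)+1) powr q*ka powr q * of_bool (hit (Suc j) m s)))"
  by (rule S_mono) (rule pt)
 also have "... = ka powr (q - p)*S (%s. Y m s powr p)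
   + (SUM j<L. (real (Suc j)+1) powr q*ka powr q*S (%s. of_bool (hit (Suc j) m s)))"
  unfolding S_add S_sum S_cmult ..
 also have "... <= ka powr (q - p)*(B powr p*S (indicator A))
   + (SUM j<L. (real (Suc j)+1) powr q*ka powr q*((1/2)^j*S (indicator A)))"
  by (intro add_mono mult_left_mono main sum_mono decay) auto
 also have "... = ka powr (q - p)*B powr p*S (indicator A)
   + ka powr q*S (indicator A)*(2*(SUM j<L. (real (Suc j)+1) powr q*(1/2)^Suc j))"
  by (simp add: sum_distrib_left mult_ac)
 also have "... <= ka powr q*S (indicator A) + ka powr q*S (indicator A)*(2*?C)"
 proof (intro add_mono mult_right_mono mult_left_mono pq A0)
  have "(SUM j<L. (real (Suc j)+1) powr q*(1/2)^Suc j) = (SUM j:Suc ` {..<L}. (real j+1) powr q*(1/2)^j)"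
   by (subst sum.reindex) auto
  also have "... <= ?C" by (intro sum_le_suminf summable_powr_geometric) auto
  finally show "(SUM j<L. (real (Suc j)+1) powr q*(1/2)^Suc j) <= ?C" .
 qed (use A0 in auto)
 also have "... = ka powr q*(1 + 2*?C)*S (indicator A)" by (simp add: algebra_simps)
 also have "ka powr q*(1 + 2*?C) = (extrapolation_const q*B) powr q"
  using C0 p unfolding extrapolation_const_def ka_def by (simp add: powr_mult powr_powr)
 finally show ?thesis unfolding Y_def v_def .
qed

end

section \<open>From one exponent to all exponents\<close>

definition upper_exponent :: "real => real => real" where
 "upper_exponent p0 p = max p0 (max p (p/(p-1))) + 1"

text \<open>From the inside: extrapolation up to \<open>P+1\<close>, interpolation between
  \<open>p0\<close> and \<open>P+1\<close> at \<open>P\<close>, duality and interpolation between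
  \<open>P\<close> and its conjugate at \<open>p\<close>. The detour through a large
  \<open>P\<close> is made because stopping only raises the exponent and lower exponents are reached
  by duality alone.\<close>

definition transform_const :: "real => real => real" where
 "transform_const p0 p = (let P = upper_exponent p0 p in
   2*(2*extrapolation_const (P+1)*(2*interp_const p0 P (P+1)) powr (1/P))
    * (2*interp_const (P/(P-1)) p P) powr (1/p))"

lemma extrapolation_const_ge: "0 < q ==> 4 <= extrapolation_const q"
proof -
 assume q: "0 < q"
 have "0 <= (\<Sum>j. (real j+1) powr q*(1/2)^j)"
  by (intro suminf_nonneg summable_powr_geometric) auto
 then have "1 <= (1 + 2*(\<Sum>j. (real j+1) powr q*(1/2)^j)) powr (1/q)"
  using q by (intro ge_one_powr_ge_zero) auto
 then show ?thesis unfolding extrapolation_const_def by simp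
qed

lemma interp_const_pos:
 assumes "0 < p0" "p0 < p" "p < p1" shows "0 < interp_const p0 p p1"
proof -
 define de where "de = min (p/p0-1) (1 - p/p1)"
 have de: "0 < de" unfolding de_def using assms by auto
 then have "2 powr - de < (1::real)" by (simp add: powr_less_one)
 then show ?thesis unfolding interp_const_def Let_def de_def[symmetric] using de by simp
qed

lemma upper_exponent:
 assumes "1 < p" "1 < p0"
 shows "p0 < upper_exponent p0 p" "p < upper_exponent p0 p" "1 < upper_exponent p0 p"
  "upper_exponent p0 p/(upper_exponent p0 p-1) < p"
proof -
 have *: "p0 < upper_exponent p0 p" "p < upper_exponent p0 p" "p/(p-1) < upper_exponent p0 p"
  unfolding upper_exponent_def by linarith+
 then show "p0 < upper_exponent p0 p" "p < upper_exponent p0 p" "1 < upper_exponent p0 p" using assms by auto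
 have "p < upper_exponent p0 p*(p-1)" using *(3) assms by (simp add: divide_less_eq)
 then show "upper_exponent p0 p/(upper_exponent p0 p-1) < p"
  using * assms by (simp add: divide_less_eq algebra_simps)
qed

lemma (in vec_op) strong_type_all:
 assumes p: "1 < p" "1 < p0" and B: "0 < B" and st: "strong_type p0 B"
  and r: "restricted_type (upper_exponent p0 p+1) (extrapolation_const (upper_exponent p0 p+1)*B)"
 shows "strong_type p (transform_const p0 p*B)"
proof -
 define P where "P = upper_exponent p0 p"
 note P = upper_exponent[OF p, folded P_def]
 define C where "C = extrapolation_const (P+1)"
 have C: "4 <= C" unfolding C_def using P by (intro extrapolation_const_ge) auto
 have "strong_type p0 (C*B)"
  unfolding strong_type_def
 proof
  fix u
  have "B*nrm p0 (%s. rh (%j. u j s)) <= C*B*nrm p0 (%s. rh (%j. u j s))"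
   using B C nrm_nonneg by (intro mult_right_mono) auto
  then show "nrm p0 (%s. rh' (%j. T u j s)) <= C*B*nrm p0 (%s. rh (%j. u j s))"
   using st unfolding strong_type_def by (meson order_trans)
 qed
 then have "restricted_type p0 (C*B)" using p B C by (intro strong_imp_restricted) auto
 then have "strong_type P (2*(C*B)*(2*interp_const p0 P (P+1)) powr (1/P))"
  using p P B C r unfolding C_def P_def[symmetric] by (intro interpolation) auto
 moreover have "0 < interp_const p0 P (P+1)" using p P by (intro interp_const_pos) auto
 ultimately have "strong_type p (2*(2*(C*B)*(2*interp_const p0 P (P+1)) powr (1/P))
   * (2*interp_const (P/(P-1)) p P) powr (1/p))"
  using P B C by (intro strong_type_between) auto
 then show ?thesis unfolding transform_const_def Let_def P_def[symmetric] C_def by (simp add: mult_ac)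
qed

context fin_filtration
begin

theorem martingale_l2_strong:
 fixes J :: "'j set"
 assumes ep: "predictable ep" and J: "finite J" and p: "1 < p"
 shows "scalar_op.l2_strong Om wt (Tp ep m) J p (transform_const 2 p)"
proof -
 define de where "de i j = (if i = j then 1 else 0 :: real)" for i j ::'j
 have de: "(SUM j:J. de i j*x j) = x i" if "i : J" for i and x :: "'j => real"
  unfolding de_def using that J by (simp add: if_distrib[of "%x. x * _"] cong: if_cong)
 have L2: "L2_set (%i. Tp ep m (%s. SUM j:J. de i j*u j s) s) J = L2_set (%i. Tp ep m (u i) s) J" for ep u s
  by (intro L2_set_cong refl) (simp only: de)
 have strong2: "nrm 2 (%s. L2_set (%i. Tp ep m (u i) s) J) <= 1*nrm 2 (%s. L2_set (%j. u j s) J)"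
  if "predictable ep" for ep and u :: "'j => 'a => real"
 proof -
  have "abs x powr 2 = x^2" for x :: real by (cases "x = 0") (auto simp: powr_numeral)
  then have sq: "abs (L2_set v J) powr 2 = (SUM j:J. (v j)^2)" for v
   unfolding L2_set_def by (simp add: sum_nonneg)
  have "S (%s. abs (L2_set (%i. Tp ep m (u i) s) J) powr 2) = (SUM j:J. S (%s. (Tp ep m (u j) s)^2))"
   unfolding sq S_sum ..
  also have "... <= (SUM j:J. S (%s. (u j s)^2))" by (intro sum_mono Tp_L2 that)
  also have "... = S (%s. abs (L2_set (%j. u j s) J) powr 2)" unfolding sq S_sum ..
  also have "... = nrm 2 (%s. L2_set (%j. u j s) J) powr 2" by (subst nrm_powr) auto
  finally show ?thesis by (intro nrm_leI) (auto simp: nrm_nonneg)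
 qed
 interpret V: vec_op Om wt J "%x. L2_set x J" "%x. L2_set x J" "%u j. Tp ep m (u j)" 1
  by (rule scalar_op.vec_op_l2[OF scalar_op_Tp[OF ep] J])
 have sc: "L2_set (%j. c*x j) J = abs c*L2_set x J" for c x by (rule V.rh_scale)
 have "V.strong_type p (transform_const 2 p*1)"
 proof (rule V.strong_type_all[OF p])
  show "V.strong_type 2 1" unfolding V.strong_type_def using strong2[OF ep] by blast
  let ?q = "upper_exponent 2 p + 1"
  have q: "2 <= ?q" using upper_exponent[OF p, of 2] by simp
  show "V.restricted_type ?q (extrapolation_const ?q*1)"
   unfolding V.restricted_type_def
  proof (intro allI impI)
   fix u A assume u: "ALL s:Om. L2_set (%j. u j s) J <= indicator A s"
   have "S (%s. L2_set (%i. Tp ep m (%s. SUM j:J. de i j*u j s) s) J powr ?q)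
     <= (extrapolation_const ?q*1) powr ?q*S (indicator A)"
   proof (rule restricted_extrapolation[where p = 2 and rh = "%x. L2_set x J"])
    show "L2_set (%i. SUM j:J. de i j*x j) J <= L2_set x J" for x
     by (simp add: de cong: L2_set_cong)
    show "nrm 2 (%s. L2_set (%i. Tp ep m (%s. SUM j:J. de i j*u j s) s) J) <= 1*nrm 2 (%s. L2_set (%j. u j s) J)"
     if "predictable ep" for ep u unfolding L2 by (rule strong2[OF that])
   qed (use u q ep in \<open>auto simp: sc L2_set_triangle_ineq L2_set_nonneg\<close>)
   then show "S (%s. L2_set (%i. Tp ep m (u i) s) J powr ?q) <= (extrapolation_const ?q*1) powr ?q*S (indicator A)"
    unfolding L2 .
  qed
 qed auto
 then show ?thesis
  unfolding scalar_op.l2_strong_def[OF scalar_op_Tp[OF ep]] V.strong_type_def by simp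
qed

end

text \<open>A Bellman function estimate for \<open>(X c)^2/N\<close>. For \<open>0 < N\<close> this
  quotient is the maximum over \<open>r\<close> of \<open>2 r X c - r^2 N\<close>. If
  \<open>r\<close> is the maximiser at the old point, the new value is this expression at the new
  point plus the defect \<open>Q = y^2/N'\<close>. The increments of \<open>X\<close> and
  \<open>c\<close>, and through \<open>g\<close> those of the vector of length \<open>N\<close>,
  enter the expression linearly, up to one product of increments, and will average to zero; the
  square of the increment of \<open>c\<close> is gained from the defect. The condition
  \<open>abs c <= N\<close> keeps \<open>abs r <= abs X\<close>.\<close>

lemma carleson_pointwise:
 fixes X X' c c' N N' g de :: real
 assumes N: "0 <= N" "0 <= N'" and c: "abs c <= N" "abs c' <= N'"
  and NN: "N'^2 = N^2 + 2*g + de^2" and de: "abs (N' - N) <= de"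
 defines "r \<equiv> X*c/N"
 shows "X^2*c^2/N + 2*r*(X*(c' - c) + c*(X' - X)) - r^2*(g/N) + X^2*(c' - c)^2/(8*N)
   - 12*N*(X' - X)^2 - 3*(X^2*de^2/N) <= X'^2*c'^2/N'"
proof (cases "N = 0")
 case True
 then show ?thesis using N unfolding r_def by simp
next
 case False
 then have Np: "0 < N" using N by simp
 define a where "a = X' - X"
 define d where "d = c' - c"
 have X': "X' = X + a" and c': "c' = c + d" unfolding a_def d_def by auto
 have de0: "0 <= de" using de by linarith
 have rX: "r^2 <= X^2"
 proof -
  have "abs (c/N) <= 1" using c Np by simp
  then have "abs X*abs (c/N) <= abs X*1" by (intro mult_left_mono) auto
  then have "abs r <= abs X" unfolding r_def by (simp add: abs_mult)
  then show ?thesis by (simp add: abs_le_square_iff)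
 qed
 have rN: "r*N = X*c" unfolding r_def using Np by simp
 define y where "y = X'*c' - r*N'"
 define Q where "Q = y^2/N'"
 have Q0: "0 <= Q" unfolding Q_def using N by simp
 have Psi: "X'^2*c'^2/N' = Q + 2*r*(X'*c') - r^2*N'"
 proof (cases "N' = 0")
  case True
  then show ?thesis using c unfolding Q_def by simp
 next
  case False
  then show ?thesis unfolding Q_def y_def by (simp add: field_simps power2_eq_square)
 qed
 \<comment> \<open>If \<open>0 < N'\<close> and \<open>N' <= 2*N\<close>, a fixed part of
   \<open>X^2*d^2/N\<close> can be read off the defect. Otherwise the jump is so large that
   \<open>abs d <= 3*de\<close>, and the gain is covered by the error term with
   \<open>de\<close>.\<close>
 have key: "X^2*d^2/(4*N) - 4*N*a^2 - 9/4*(X^2*de^2/N) <= Q"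
 proof (cases "0 < N' & N' <= 2*N")
  case True
  have y: "y = X*d + (c'*a - r*(N' - N))"
   unfolding y_def X' right_diff_distrib rN c' by (simp add: algebra_simps)
  have "X^2*d^2/2 - 2*(c'^2*a^2) - 2*(r^2*(N' - N)^2) <= y^2"
  proof -
   have "y^2 - (X^2*d^2/2 - 2*(c'^2*a^2) - 2*(r^2*(N' - N)^2))
     = (X*d + 2*(c'*a - r*(N' - N)))^2/2 + (c'*a + r*(N' - N))^2"
    unfolding y by (simp add: power2_eq_square field_simps)
   also have "... >= 0" by simp
   finally show ?thesis by simp
  qed
  moreover have "c'^2*a^2 <= 4*N^2*a^2"
  proof (rule mult_right_mono)
   have "abs c' <= 2*N" using c True by linarith
   then have "abs c'^2 <= (2*N)^2" by (intro power_mono) auto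
   then show "c'^2 <= 4*N^2" by (simp add: power_mult_distrib)
  qed simp
  moreover have "r^2*(N' - N)^2 <= X^2*de^2"
   using rX de de0 by (intro mult_mono) (auto simp: abs_le_square_iff[symmetric])
  ultimately have "X^2*d^2/2 - 8*N^2*a^2 - 2*(X^2*de^2) <= y^2" by linarith
  then have "(X^2*d^2/2 - 8*N^2*a^2 - 2*(X^2*de^2))/(2*N) <= y^2/(2*N)"
   using Np by (intro divide_right_mono) auto
  also have "... <= Q" unfolding Q_def using True Np by (intro divide_left_mono) auto
  also have "(X^2*d^2/2 - 8*N^2*a^2 - 2*(X^2*de^2))/(2*N)
    = X^2*d^2/(4*N) - 4*N*a^2 - X^2*de^2/N"
   using Np by (simp add: field_simps power2_eq_square)
  finally have "X^2*d^2/(4*N) - 4*N*a^2 - X^2*de^2/N <= Q" .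
  moreover have "0 <= X^2*de^2/N" using Np by simp
  ultimately show ?thesis by linarith
 next
  case False
  have "abs d <= 3*de"
  proof (cases "N' = 0")
   case True
   then show ?thesis using c de unfolding d_def by auto
  next
   case F: False
   then have "2*N < N'" using False N by auto
   then show ?thesis using c de unfolding d_def by linarith
  qed
  then have "d^2 <= 9*de^2" using abs_le_square_iff[of d "3*de"] de0 by (simp add: power_mult_distrib)
  then have "X^2*d^2 <= 9*(X^2*de^2)" using mult_left_mono[of "d^2" "9*de^2" "X^2"] by simp
  then have "X^2*d^2/(4*N) <= 9*(X^2*de^2)/(4*N)" using Np by (intro divide_right_mono) auto
  moreover have "0 <= 4*N*a^2" using Np by simp
  ultimately show ?thesis using Q0 by simp
 qed
 have cross: "- (X^2*d^2/(8*N) + 8*N*a^2) <= 2*r*(a*d)"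
 proof -
  have "- 2*r*(a*d) <= r^2*d^2/(8*N) + 8*N*a^2"
  proof -
   have "r^2*d^2/(8*N) + 8*N*a^2 + 2*r*(a*d) = (r*d + 8*N*a)^2/(8*N)"
    using Np by (simp add: field_simps power2_eq_square)
   also have "... >= 0" using Np by simp
   finally show ?thesis by simp
  qed
  also have "r^2*d^2/(8*N) <= X^2*d^2/(8*N)"
   using rX Np by (intro divide_right_mono mult_right_mono) auto
  finally show ?thesis by simp
 qed
 have lin: "- (r^2*(g/N)) - X^2*de^2/(2*N) <= - (r^2*(N' - N))"
 proof -
  have "N' - N <= g/N + de^2/(2*N)"
  proof -
   have "2*N*N' <= N^2 + N'^2" using zero_le_power2[of "N' - N"] by (simp add: power2_eq_square algebra_simps)
   then have "2*N*(N' - N) <= 2*g + de^2" unfolding NN by (simp add: power2_eq_square algebra_simps)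
   then show ?thesis using Np by (simp add: field_simps)
  qed
  then have "r^2*(N' - N) <= r^2*(g/N + de^2/(2*N))" by (intro mult_left_mono) auto
  also have "... = r^2*(g/N) + r^2*de^2/(2*N)" by (simp add: distrib_left)
  also have "r^2*de^2/(2*N) <= X^2*de^2/(2*N)"
   using rX Np by (intro divide_right_mono mult_right_mono) auto
  finally show ?thesis by simp
 qed
 have base: "X^2*c^2/N = r*(X*c)" unfolding r_def by (simp add: power2_eq_square)
 have exp: "2*r*(X'*c') = 2*r*(X*c) + 2*r*(X*d + c*a) + 2*r*(a*d)"
  unfolding X' c' by (simp add: algebra_simps)
 have rr: "r^2*N' = r^2*(N' - N) + r*(X*c)"
  unfolding rN[symmetric] by (simp add: power2_eq_square algebra_simps)
 have e: "X^2*d^2/(4*N) = 2*(X^2*d^2/(8*N))" by simp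
 have f: "X^2*de^2/(2*N) = (X^2*de^2/N)/2" by simp
 have pos: "0 <= X^2*de^2/N" using Np by simp
 have assoc: "4*N*a^2 = 4*(N*a^2)" "8*N*a^2 = 8*(N*a^2)" "12*N*a^2 = 12*(N*a^2)"
  "2*r*(X*c) = 2*(r*(X*c))" by simp_all
 have arith: "k + u - t + e' - 12*M - 3*P <= Q + (2*k + u + x) - (s + k)"
  if "2*e' - 4*M - 9/4*P <= Q" "- (e' + 8*M) <= x" "- t - P/2 <= - s" "0 <= P"
  for k u t e' M P Q x s :: real
  using that by linarith
 show ?thesis
  unfolding Psi base a_def[symmetric] d_def[symmetric] exp rr assoc
  by (rule arith[OF key[unfolded e assoc] cross[unfolded assoc] lin[unfolded f] pos])
qed

lemma cube_convexity_pointwise: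
 fixes N N' g de :: real
 assumes "0 <= N" "0 <= N'" "N'^2 = N^2 + 2*g + de^2"
 shows "N^3 + 3*N*g + 3/2*(N*de^2) <= N'^3"
proof -
 have "0 <= (N' - N)^2*(N' + N/2)" using assms by simp
 also have "... = N'^3 - 3/2*N*N'^2 + N^3/2"
  by (simp add: power2_eq_square power3_eq_cube field_simps)
 also have "... = N'^3 - (N^3 + 3*N*g + 3/2*(N*de^2))"
  unfolding assms(3) by (simp add: power2_eq_square power3_eq_cube field_simps)
 finally show ?thesis by simp
qed

lemma L2_set_diff_le: "abs (L2_set f J - L2_set g J) <= L2_set (%j. f j - g j) J"
proof -
 have "L2_set f J <= L2_set g J + L2_set (%j. f j - g j) J"
  using L2_set_triangle_ineq[of g "%j. f j - g j" J] by simp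
 moreover have "L2_set g J <= L2_set f J + L2_set (%j. g j - f j) J"
  using L2_set_triangle_ineq[of f "%j. g j - f j" J] by simp
 moreover have "L2_set (%j. g j - f j) J = L2_set (%j. f j - g j) J"
  unfolding L2_set_def by (simp add: power2_commute)
 ultimately show ?thesis by linarith
qed

lemma L2_set_power2: "(L2_set f J)^2 = (SUM j:J. (f j)^2)"
 unfolding L2_set_def by (simp add: sum_nonneg)

context fin_filtration
begin

definition mart :: "(nat => 'a => real) => bool" where
 "mart f \<longleftrightarrow> (ALL k<=m. adapted k (f k)) &
   (ALL k:{1..m}. ALL g. adapted (k-1) g --> S (%s. g s*(f k s - f (k-1) s)) = 0)"

lemma mart_adapted: "mart f ==> k <= m ==> adapted k (f k)"
 unfolding mart_def by blast

lemma mart_S: "mart f ==> k : {1..m} ==> adapted (k-1) g ==> S (%s. g s*(f k s - f (k-1) s)) = 0"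
 unfolding mart_def by blast

lemma mart_E: "mart (%k. E k f)"
 unfolding mart_def using S_mult_D[of _ _ f] by (auto simp: E_adapted D_def)

lemma mart_Tp:
 assumes "predictable ep" shows "mart (%k. Tp ep k f)"
proof -
 have "S (%s. g s*(Tp ep k f s - Tp ep (k-1) f s)) = 0" if k: "k : {1..m}" and g: "adapted (k-1) g" for k g
 proof -
  have "adapted (k-1) (ep k)" using assms k unfolding predictable_def by auto
  then have "S (%s. (g s*ep k s)*D k f s) = 0"
   using k g by (intro S_mult_D adapted_comp2[where h = "(*)"]) auto
  then show ?thesis using k by (simp add: Tp_step mult.assoc)
 qed
 then show ?thesis unfolding mart_def using Tp_adapted[OF assms] by blast
qed

lemma mart_scale:
 assumes "mart f" shows "mart (%k s. c*f k s)"
proof -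
 have "S (%s. g s*(c*f k s - c*f (k-1) s)) = 0" if "k : {1..m}" "adapted (k-1) g" for k g
 proof -
  have "S (%s. (g s*c)*(f k s - f (k-1) s)) = 0"
   by (intro mart_S[OF assms that(1)] adapted_comp[OF that(2), where h = "%x. x*c"])
  then show ?thesis by (simp add: algebra_simps)
 qed
 then show ?thesis
  using assms adapted_comp[where h = "(*) c"] unfolding mart_def by blast
qed

text \<open>The pointwise estimate telescopes, with the \<open>8\<close> from its gain term.
  \<open>N\<close> is not a martingale but the length of the vector martingale \<open>F\<close>, so
  its first order change is a sum over \<open>j\<close> of increments of \<open>F j\<close> with
  adapted coefficients, and each of these averages to zero. The point is that increments of
  \<open>c\<close> are summed against a weight in the denominator, although of \<open>c\<close>
  nothing but the domination by \<open>N\<close> is known.\<close>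

lemma Carleson_sum:
 fixes F :: "'j => nat => 'a => real"
 assumes X: "mart X" and c: "mart c" and F: "!!j. j : J ==> mart (F j)"
  and N_def: "!!l s. N l s = L2_set (%j. F j l s) J" and cN: "!!l s. l <= m ==> s : Om ==> abs (c l s) <= N l s"
 shows "(SUM l:{1..m}. S (%s. (X (l-1) s)^2*(c l s - c (l-1) s)^2/N (l-1) s))
  <= 8*(S (%s. (X m s)^2*N m s) + (SUM l:{1..m}. S (%s. 12*N (l-1) s*(X l s - X (l-1) s)^2
    + 3*((X (l-1) s)^2*(SUM j:J. (F j l s - F j (l-1) s)^2)/N (l-1) s))))"
proof -
 define Ps where "Ps l s = (X l s)^2*(c l s)^2/N l s" for l s
 define P where "P l s = (X (l-1) s)^2*(c l s - c (l-1) s)^2/N (l-1) s" for l s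
 define R where "R l s = 12*N (l-1) s*(X l s - X (l-1) s)^2
    + 3*((X (l-1) s)^2*(SUM j:J. (F j l s - F j (l-1) s)^2)/N (l-1) s)" for l s
 have step: "S (P l)/8 - S (R l) <= S (%s. Ps l s - Ps (l-1) s)" if l: "l : {1..m}" for l
 proof -
  define r where "r s = X (l-1) s*c (l-1) s/N (l-1) s" for s
  let ?g = "%s. SUM j:J. F j (l-1) s*(F j l s - F j (l-1) s)"
  let ?L = "%s. 2*r s*(X (l-1) s*(c l s - c (l-1) s) + c (l-1) s*(X l s - X (l-1) s)) - (r s)^2*(?g s/N (l-1) s)"
  have l1: "l - 1 <= m" "l <= m" using l by auto
  have same: "X (l-1) s = X (l-1) t" "c (l-1) s = c (l-1) t" "N (l-1) s = N (l-1) t"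
    "!!j. j : J ==> F j (l-1) s = F j (l-1) t"
   if "s : Om" "t : Om" "lab (l-1) s = lab (l-1) t" for s t
  proof -
   show "X (l-1) s = X (l-1) t" "c (l-1) s = c (l-1) t"
    using mart_adapted[OF X l1(1)] mart_adapted[OF c l1(1)] that unfolding adapted_def by blast+
   show e: "F j (l-1) s = F j (l-1) t" if "j : J" for j
    using mart_adapted[OF F[OF that] l1(1)] \<open>s \<in> Om\<close> \<open>t \<in> Om\<close> \<open>lab (l - 1) s = lab (l - 1) t\<close>
    unfolding adapted_def by blast
   show "N (l-1) s = N (l-1) t" unfolding N_def by (rule L2_set_cong) (use e in auto)
  qed
  have adI: "adapted (l-1) g" if "!!s t. X (l-1) s = X (l-1) t ==> c (l-1) s = c (l-1) t ==> N (l-1) s = N (l-1) t ==>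
    (!!j. j : J ==> F j (l-1) s = F j (l-1) t) ==> g s = g t" for g :: "'a => real"
   unfolding adapted_def by (intro ballI impI that same)
  have "S ?L = S (%s. (2*r s*X (l-1) s)*(c l s - c (l-1) s)) + S (%s. (2*r s*c (l-1) s)*(X l s - X (l-1) s))
    - (SUM j:J. S (%s. ((r s)^2*(F j (l-1) s/N (l-1) s))*(F j l s - F j (l-1) s)))"
   unfolding S_sum[symmetric] S_add[symmetric] S_diff[symmetric]
   by (intro S_cong) (simp add: sum_distrib_left sum_divide_distrib algebra_simps)
  also have "S (%s. (2*r s*X (l-1) s)*(c l s - c (l-1) s)) = 0"
   by (rule mart_S[OF c l], rule adI) (simp add: r_def)
  also have "S (%s. (2*r s*c (l-1) s)*(X l s - X (l-1) s)) = 0"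
   by (rule mart_S[OF X l], rule adI) (simp add: r_def)
  also have "(SUM j:J. S (%s. ((r s)^2*(F j (l-1) s/N (l-1) s))*(F j l s - F j (l-1) s))) = 0"
  proof (rule sum.neutral, rule ballI)
   fix j assume j: "j : J"
   show "S (%s. ((r s)^2*(F j (l-1) s/N (l-1) s))*(F j l s - F j (l-1) s)) = 0"
    by (rule mart_S[OF F[OF j] l], rule adI) (simp add: r_def j)
  qed
  finally have L0: "S ?L = 0" by simp
  have "S (%s. P l s/8 - R l s + ?L s) <= S (%s. Ps l s - Ps (l-1) s)"
  proof (rule S_mono)
   fix s assume s: "s : Om"
   let ?de = "L2_set (%j. F j l s - F j (l-1) s) J"
   have N0: "0 <= N k s" for k unfolding N_def by (rule L2_set_nonneg)
   have dN: "abs (N l s - N (l-1) s) <= ?de" unfolding N_def by (rule L2_set_diff_le)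
   have de2: "?de^2 = (SUM j:J. (F j l s - F j (l-1) s)^2)" by (rule L2_set_power2)
   have "(N l s)^2 = (N (l-1) s)^2 + 2*?g s + ?de^2"
    unfolding N_def L2_set_power2 sum_distrib_left sum.distrib[symmetric]
    by (intro sum.cong) (simp_all add: power2_eq_square algebra_simps)
   from carleson_pointwise[OF _ _ cN[OF l1(1) s] cN[OF l1(2) s] this, where X = "X (l-1) s" and X' = "X l s"] N0 dN
   have "Ps (l-1) s + 2*r s*(X (l-1) s*(c l s - c (l-1) s) + c (l-1) s*(X l s - X (l-1) s)) - (r s)^2*(?g s/N (l-1) s)
     + (X (l-1) s)^2*(c l s - c (l-1) s)^2/(8*N (l-1) s) - 12*N (l-1) s*(X l s - X (l-1) s)^2
     - 3*((X (l-1) s)^2*?de^2/N (l-1) s) <= Ps l s"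
    unfolding Ps_def r_def by blast
   then show "P l s/8 - R l s + ?L s <= Ps l s - Ps (l-1) s"
    unfolding P_def R_def de2 by simp
  qed
  then have "S (P l)/8 - S (R l) + S ?L <= S (%s. Ps l s - Ps (l-1) s)"
   unfolding S_add S_diff using S_cmult[of "1/8" "P l"] by simp
  then show ?thesis unfolding L0 by simp
 qed
 have "(SUM l:{1..m}. S (P l)/8 - S (R l)) <= S (Ps m) - S (Ps 0)"
  using sum_mono[of "{1..m}", OF step] S_telescope[of Ps m] by simp
 also have "... <= S (Ps m)"
  unfolding Ps_def N_def by (simp add: S_nonneg L2_set_nonneg)
 also have "... <= S (%s. (X m s)^2*N m s)"
 proof (rule S_mono)
  fix s assume "s : Om"
  from cN[OF _ this, of m] have "(c m s)^2 <= (N m s)^2" by (intro power2_le_iff_abs_le[THEN iffD2]) (auto simp: N_def L2_set_nonneg)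
  then have "(c m s)^2/N m s <= (N m s)^2/N m s" unfolding N_def by (intro divide_right_mono) (auto simp: L2_set_nonneg)
  also have "... = N m s" by (simp add: power2_eq_square)
  finally show "Ps m s <= (X m s)^2*N m s" unfolding Ps_def times_divide_eq_right[symmetric] by (intro mult_left_mono) auto
 qed
 finally have "(SUM l:{1..m}. S (P l))/8 - (SUM l:{1..m}. S (R l)) <= S (%s. (X m s)^2*N m s)"
  by (simp add: sum_subtractf sum_divide_distrib)
 then show ?thesis unfolding P_def[abs_def] R_def[abs_def] by simp
qed

text \<open>Convexity of the cube of the length: the first order terms average to zero, and the
  second order terms dominate the weighted energy of the vector martingale.\<close>

lemma cube_sum:
 fixes F :: "'j => nat => 'a => real"
 assumes F: "!!j. j : J ==> mart (F j)" and N_def: "!!l s. N l s = L2_set (%j. F j l s) J"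
 shows "(SUM l:{1..m}. S (%s. N (l-1) s*(SUM j:J. (F j l s - F j (l-1) s)^2))) <= 2/3*S (%s. N m s^3)"
proof -
 have step: "3/2*S (%s. N (l-1) s*(SUM j:J. (F j l s - F j (l-1) s)^2)) <= S (%s. N l s^3 - N (l-1) s^3)"
  if l: "l : {1..m}" for l
 proof -
  let ?g = "%s. SUM j:J. F j (l-1) s*(F j l s - F j (l-1) s)"
  have l1: "l - 1 <= m" "l <= m" using l by auto
  have same: "N (l-1) s = N (l-1) t" "!!j. j : J ==> F j (l-1) s = F j (l-1) t"
   if "s : Om" "t : Om" "lab (l-1) s = lab (l-1) t" for s t
  proof -
   show e: "F j (l-1) s = F j (l-1) t" if "j : J" for j
    using mart_adapted[OF F[OF that] l1(1)] \<open>s \<in> Om\<close> \<open>t \<in> Om\<close> \<open>lab (l - 1) s = lab (l - 1) t\<close>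
    unfolding adapted_def by blast
   show "N (l-1) s = N (l-1) t" unfolding N_def by (rule L2_set_cong) (use e in auto)
  qed
  have adI: "adapted (l-1) g" if "!!s t. N (l-1) s = N (l-1) t ==>
    (!!j. j : J ==> F j (l-1) s = F j (l-1) t) ==> g s = g t" for g :: "'a => real"
   unfolding adapted_def by (intro ballI impI that same)
  have "S (%s. 3*N (l-1) s*?g s) = (SUM j:J. S (%s. (3*N (l-1) s*F j (l-1) s)*(F j l s - F j (l-1) s)))"
   unfolding S_sum[symmetric] by (intro S_cong) (simp add: sum_distrib_left mult.assoc)
  also have "... = 0"
  proof (rule sum.neutral, rule ballI)
   fix j assume j: "j : J"
   show "S (%s. (3*N (l-1) s*F j (l-1) s)*(F j l s - F j (l-1) s)) = 0"
    by (rule mart_S[OF F[OF j] l], rule adI) (simp add: j)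
  qed
  finally have L0: "S (%s. 3*N (l-1) s*?g s) = 0" .
  have "S (%s. 3*N (l-1) s*?g s + 3/2*(N (l-1) s*(SUM j:J. (F j l s - F j (l-1) s)^2)))
    <= S (%s. N l s^3 - N (l-1) s^3)"
  proof (rule S_mono)
   fix s
   let ?de = "L2_set (%j. F j l s - F j (l-1) s) J"
   have "(N l s)^2 = (N (l-1) s)^2 + 2*?g s + ?de^2"
    unfolding N_def L2_set_power2 sum_distrib_left sum.distrib[symmetric]
    by (intro sum.cong) (simp_all add: power2_eq_square algebra_simps)
   from cube_convexity_pointwise[OF _ _ this]
   have "N (l-1) s^3 + 3*N (l-1) s*?g s + 3/2*(N (l-1) s*?de^2) <= N l s^3"
    unfolding N_def by (simp add: L2_set_nonneg)
   then show "3*N (l-1) s*?g s + 3/2*(N (l-1) s*(SUM j:J. (F j l s - F j (l-1) s)^2))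
     <= N l s^3 - N (l-1) s^3"
    unfolding L2_set_power2 by simp
  qed
  then show ?thesis unfolding S_add S_cmult[of "3/2"] L0 by simp
 qed
 have "3/2*(SUM l:{1..m}. S (%s. N (l-1) s*(SUM j:J. (F j l s - F j (l-1) s)^2))) <= S (%s. N m s^3) - S (%s. N 0 s^3)"
  unfolding sum_distrib_left[of "3/2"] S_telescope[of "%l s. N l s^3" m] by (simp only: add_diff_cancel_left') (rule sum_mono[OF step])
 moreover have "0 <= S (%s. N 0 s^3)" unfolding N_def by (intro S_nonneg) (simp add: L2_set_nonneg)
 ultimately show ?thesis by linarith
qed

text \<open>The products of the increments of \<open>T a\<close> and \<open>b\<close> and of \<open>a\<close> and \<open>T b\<close> cancel.\<close>

lemma S_commutator:
 assumes ep: "predictable ep"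
 shows "S (%s. Tp ep m c s*(b s*Tp ep m a s - a s*Tp ep m b s)) = (SUM l:{1..m}. S (%s. ep l s*D l c s *
   ((Tp ep (l-1) a s - ep l s*E (l-1) a s)*D l b s - (Tp ep (l-1) b s - ep l s*E (l-1) b s)*D l a s)))"
proof -
 define M where "M l s = E l b s*Tp ep l a s - E l a s*Tp ep l b s" for l s
 define U where "U l s = Tp ep (l-1) a s - ep l s*E (l-1) a s" for l s
 define V where "V l s = Tp ep (l-1) b s - ep l s*E (l-1) b s" for l s
 have "S (%s. Tp ep l c s*M l s - Tp ep (l-1) c s*M (l-1) s)
   = S (%s. ep l s*D l c s*(U l s*D l b s - V l s*D l a s))" if l: "l : {1..m}" for l
 proof -
  have l1: "1 <= l" "l - 1 <= m" using l by auto
  have ad: "adapted (l-1) (ep l)" "adapted (l-1) (Tp ep (l-1) f)" "adapted (l-1) (E (l-1) f)" for f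
   using ep l l1 Tp_adapted[OF ep] unfolding predictable_def by (auto simp: E_adapted)
  have same: "ep l s = ep l t" "Tp ep (l-1) f s = Tp ep (l-1) f t" "E (l-1) f s = E (l-1) f t"
   if "s : Om" "t : Om" "lab (l-1) s = lab (l-1) t" for s t f
   using ad(1) ad(2,3)[of f] that unfolding adapted_def by blast+
  have adI: "adapted (l-1) g" if "!!s t. ep l s = ep l t ==> (!!f. Tp ep (l-1) f s = Tp ep (l-1) f t) ==>
    (!!f. E (l-1) f s = E (l-1) f t) ==> g s = g t" for g :: "'a => real"
   unfolding adapted_def by (intro ballI impI that same)
  have "S (%s. Tp ep l c s*M l s - Tp ep (l-1) c s*M (l-1) s)
    = S (%s. ep l s*D l c s*(U l s*D l b s - V l s*D l a s))
    + S (%s. (Tp ep (l-1) c s*U l s)*D l b s) - S (%s. (Tp ep (l-1) c s*V l s)*D l a s)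
    + S (%s. (ep l s*M (l-1) s)*D l c s)"
   unfolding S_add[symmetric] S_diff[symmetric] M_def U_def V_def
    E_step[OF l1(1), of a] E_step[OF l1(1), of b] Tp_step[OF l1(1)]
   by (intro S_cong) (simp add: algebra_simps)
  moreover have "S (%s. (Tp ep (l-1) c s*U l s)*D l b s) = 0"
   by (rule S_mult_D[OF l1(1)], rule adI) (simp add: U_def)
  moreover have "S (%s. (Tp ep (l-1) c s*V l s)*D l a s) = 0"
   by (rule S_mult_D[OF l1(1)], rule adI) (simp add: V_def)
  moreover have "S (%s. (ep l s*M (l-1) s)*D l c s) = 0"
   by (rule S_mult_D[OF l1(1)], rule adI) (simp add: M_def)
  ultimately show ?thesis by simp
 qed
 then have "S (%s. Tp ep m c s*M m s) = S (%s. Tp ep 0 c s*M 0 s)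
   + (SUM l:{1..m}. S (%s. ep l s*D l c s*(U l s*D l b s - V l s*D l a s)))"
  using S_telescope[of "%l s. Tp ep l c s*M l s" m] by simp
 moreover have "S (%s. Tp ep 0 c s*M 0 s) = 0" by (simp add: S_def)
 moreover have "S (%s. Tp ep m c s*M m s) = S (%s. Tp ep m c s*(b s*Tp ep m a s - a s*Tp ep m b s))"
  unfolding M_def by (intro S_cong) (simp add: E_final)
 ultimately show ?thesis unfolding U_def V_def by simp
qed

end

section \<open>The cubic form of a martingale transform\<close>

lemma amgm_weighted: "0 < N ==> 2*(abs c*abs x*abs d) <= x^2*c^2/N + N*d^2" for N c x d :: real
proof -
 assume N: "0 < N"
 have "0 <= (abs x*abs c - N*abs d)^2/N" using N by simp
 also have "... = x^2*c^2/N + N*d^2 - 2*(abs c*abs x*abs d)"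
  using N by (simp add: power2_diff power_mult_distrib field_simps power2_eq_square)
 finally show ?thesis by simp
qed

lemma transform_const_pos:
 assumes "1 < p" "1 < p0" shows "0 < transform_const p0 p"
proof -
 define P where "P = upper_exponent p0 p"
 note P = upper_exponent[OF assms, folded P_def]
 have "4 <= extrapolation_const (P+1)" using P by (intro extrapolation_const_ge) auto
 moreover have "0 < interp_const p0 P (P+1)" "0 < interp_const (P/(P-1)) p P"
  using P assms by (auto intro!: interp_const_pos)
 ultimately show ?thesis unfolding transform_const_def Let_def P_def[symmetric] by simp
qed

abbreviation "cubic_const == (8 + 4*transform_const 2 3)^3"

definition martingale_tree_const :: "real => real" where
 "martingale_tree_const p = max 1 (transform_const 3 p*(40 * sqrt (45*cubic_const)))"

context fin_filtration
begin

lemma E_zero_imp: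
 assumes "!!t. t : Om ==> 0 <= f t" "E k f s = 0" "s : Om" "t : Om" "lab k t = lab k s"
 shows "f t = 0"
proof -
 have "(SUM t:atom k s. wt t*f t) = 0" using assms(2) atom_pos[OF assms(3), of k] unfolding E_def by simp
 moreover have "0 <= wt r*f r" if "r : atom k s" for r
  using that assms(1)[of r] wt_nonneg[of r] unfolding atom_def by simp
 ultimately have "wt t*f t = 0"
  using sum_nonneg_eq_0_iff[OF finite_atom, of k s "%t. wt t*f t"] assms(4,5) unfolding atom_def by blast
 then show ?thesis using wt_pos[OF assms(4)] by simp
qed

text \<open>Covers the points where the denominator of the Carleson sum is zero; there the quotient
  has the default value zero and controls nothing, but the increment of \<open>c\<close> vanishes as
  well.\<close>

lemma D_eq_0:
 assumes "!!t. t : Om ==> abs (c t) <= f t" "E (l-1) f s = 0" "s : Om" "1 <= l"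
 shows "D l c s = 0"
proof -
 have z: "c t = 0" if "t : Om" "lab (l-1) t = lab (l-1) s" for t
 proof -
  have "f t = 0" by (rule E_zero_imp[OF _ assms(2,3) that]) (meson abs_ge_zero assms(1) order_trans)
  then show ?thesis using assms(1)[OF that(1)] by simp
 qed
 have "E k c s = 0" if "k = l | k = l - 1" for k
 proof -
  have "E k c s = E k (%_. 0) s"
  proof (rule E_local, rule z)
   fix t assume "t : Om" "lab k t = lab k s"
   then show "lab (l-1) t = lab (l-1) s" using that lab_refine[of t s "l - 1"] assms(3,4) by auto
  qed
  then show ?thesis by (simp add: E_def)
 qed
 then show ?thesis unfolding D_def by simp
qed

abbreviation "dsq ep l g s == (D l g s)^2 + (ep l s*D l g s)^2"
abbreviation "esq ep l g s == (E l g s)^2 + (Tp ep l g s)^2"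

text \<open>All that one block contributes. The first part is \<open>3/2\<close> times the Carleson
  bounds for the two martingales \<open>E l a\<close> and \<open>Tp ep l a\<close>, hence
  \<open>12\<close> from \<open>8\<close>. The second part are the increments of \<open>a\<close>
  that the weighted mean inequality leaves over, and the third pays for the terms of a node without
  \<open>Y\<close> and \<open>Z\<close>.\<close>

definition block_energy :: "(nat => 'a => real) => (nat => 'a => real) => (nat => 'a => real) => ('a => real) => real" where
 "block_energy N Q ep a =
   12*(S (%s. N m s*esq ep m a s)
    + (SUM l:{1..m}. S (%s. 12*(N (l-1) s*dsq ep l a s)
      + 3*(Q l s*esq ep (l-1) a s/N (l-1) s))))
   + 3*(SUM l:{1..m}. S (%s. N (l-1) s*(D l a s)^2))
   + 3/4*S (%s. N m s*(Tp ep m a s)^2)"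

text \<open>By \<open>S_commutator\<close> each summand is an increment of \<open>c\<close>, times a
  past value, times an increment of \<open>a\<close> or \<open>b\<close>. The weighted mean with
  weight \<open>N\<close> separates them: the increment of \<open>c\<close> with the past value
  gives a Carleson sum, the remaining increment is energy.\<close>

lemma commutator_le:
 fixes F :: "'j => nat => 'a => real"
 assumes ep: "predictable ep" and F: "!!j. j : J ==> mart (F j)"
  and N_def: "!!l s. N l s = L2_set (%j. F j l s) J"
  and Q_def: "!!l s. Q l s = (SUM j:J. (F j l s - F j (l-1) s)^2)"
  and f: "!!t. t : Om ==> abs (c t) <= f t" and fN: "!!l s. l <= m ==> s : Om ==> E l f s <= N l s"
 shows "3*abs (S (%s. Tp ep m c s*(b s*Tp ep m a s - a s*Tp ep m b s))) + 3/4*S (%s. N m s*(Tp ep m a s)^2)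
   + 3/4*S (%s. N m s*(Tp ep m b s)^2)
  <= block_energy N Q ep a + block_energy N Q ep b"
proof -
 have N0: "0 <= N l s" for l s unfolding N_def by (rule L2_set_nonneg)
 have Ef: "abs (E l c s) <= E l f s" for l s
 proof -
  have "E l c s <= E l f s" "- E l c s <= E l f s"
   using f E_mono[of c f l s] E_mono[of "%s. -1*c s" f l s] E_scale[of l "-1" c s] by (force simp: abs_le_iff)+
  then show ?thesis by linarith
 qed
 define P where "P X = (SUM l:{1..m}. S (%s. (X (l-1) s)^2*(D l c s)^2/N (l-1) s))" for X :: "nat => 'a => real"
 define C where "C X = 8*(S (%s. (X m s)^2*N m s) + (SUM l:{1..m}. S (%s. 12*N (l-1) s*(X l s - X (l-1) s)^2
    + 3*((X (l-1) s)^2*Q l s/N (l-1) s))))" for X :: "nat => 'a => real"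
 have PC: "P X <= C X" if "mart X" for X
  unfolding P_def C_def Q_def D_def
  by (rule Carleson_sum[OF that mart_E F N_def order_trans[OF Ef fN]])
 define V where "V g = (SUM l:{1..m}. S (%s. N (l-1) s*(D l g s)^2))" for g
 have CC: "C (%l. E l g) + C (%l. Tp ep l g) = 2/3*(block_energy N Q ep g - 3*V g - 3/4*S (%s. N m s*(Tp ep m g s)^2))" for g
 proof -
  have 1: "S (%s. 12*(N (l-1) s*dsq ep l g s)
      + 3*(Q l s*esq ep (l-1) g s/N (l-1) s))
    = S (%s. 12*N (l-1) s*(E l g s - E (l-1) g s)^2 + 3*((E (l-1) g s)^2*Q l s/N (l-1) s))
    + S (%s. 12*N (l-1) s*(Tp ep l g s - Tp ep (l-1) g s)^2 + 3*((Tp ep (l-1) g s)^2*Q l s/N (l-1) s))"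
   if "l : {1..m}" for l
  proof -
   have l: "1 <= l" using that by simp
   show ?thesis unfolding S_add[symmetric]
    by (intro S_cong) (simp only: E_step[OF l, of g] Tp_step[OF l], simp add: distrib_left distrib_right add_divide_distrib mult_ac)
  qed
  have 2: "S (%s. N m s*esq ep m g s) = S (%s. (E m g s)^2*N m s) + S (%s. (Tp ep m g s)^2*N m s)"
   unfolding S_add[symmetric] by (intro S_cong) (simp add: algebra_simps)
  have 3: "(SUM l:{1..m}. S (%s. 12*(N (l-1) s*dsq ep l g s)
      + 3*(Q l s*esq ep (l-1) g s/N (l-1) s)))
    = (SUM l:{1..m}. S (%s. 12*N (l-1) s*(E l g s - E (l-1) g s)^2 + 3*((E (l-1) g s)^2*Q l s/N (l-1) s)))
    + (SUM l:{1..m}. S (%s. 12*N (l-1) s*(Tp ep l g s - Tp ep (l-1) g s)^2 + 3*((Tp ep (l-1) g s)^2*Q l s/N (l-1) s)))"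
   unfolding sum.distrib[symmetric] by (rule sum.cong[OF refl 1])
  show ?thesis unfolding block_energy_def C_def V_def 2 3 by simp
 qed
 have pt: "abs (ep l s*D l c s*((Tp ep (l-1) a s - ep l s*E (l-1) a s)*D l b s - (Tp ep (l-1) b s - ep l s*E (l-1) b s)*D l a s))
   <= 1/2*((Tp ep (l-1) a s)^2*(D l c s)^2/N (l-1) s + (E (l-1) a s)^2*(D l c s)^2/N (l-1) s
    + (Tp ep (l-1) b s)^2*(D l c s)^2/N (l-1) s + (E (l-1) b s)^2*(D l c s)^2/N (l-1) s)
    + N (l-1) s*(D l a s)^2 + N (l-1) s*(D l b s)^2"
  if l: "l : {1..m}" and s: "s : Om" for l s
 proof (cases "N (l-1) s = 0")
  case True
  have "0 <= E (l-1) f s" using Ef[of "l - 1" s] by linarith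
  then have "E (l-1) f s = 0" using fN[of "l - 1" s] l s True by auto
  then have "D l c s = 0" using l s by (intro D_eq_0[OF f]) auto
  then show ?thesis using N0[of "l - 1" s] True by simp
 next
  case False
  then have Np: "0 < N (l-1) s" using N0[of "l - 1" s] by simp
  have e: "abs (ep l s) <= 1" using ep l unfolding predictable_def by auto
  have gen: "abs (e*dc*((A - e*x)*db - (B - e*y)*da)) <= abs dc*abs A*abs db + abs dc*abs x*abs db + abs dc*abs B*abs da + abs dc*abs y*abs da"
   if e: "abs e <= 1" for e dc A x db B y da :: real
  proof -
   have 1: "abs (A' - e*x') <= abs A' + abs x'" for A' x'
   proof -
    have "abs (e*x') <= abs x'" using e by (simp add: abs_mult mult_left_le_one_le)
    then show ?thesis using abs_triangle_ineq4[of A' "e*x'"] by linarith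
   qed
   have "abs ((A - e*x)*db - (B - e*y)*da) <= (abs A + abs x)*abs db + (abs B + abs y)*abs da"
    using abs_triangle_ineq4[of "(A - e*x)*db" "(B - e*y)*da"]
     mult_right_mono[OF 1[of A x], of "abs db"] mult_right_mono[OF 1[of B y], of "abs da"]
    unfolding abs_mult[of _ db] abs_mult[of _ da] by simp
   then have "abs dc*abs ((A - e*x)*db - (B - e*y)*da) <= abs dc*((abs A + abs x)*abs db + (abs B + abs y)*abs da)"
    by (rule mult_left_mono) simp
   moreover have "abs (e*dc*((A - e*x)*db - (B - e*y)*da)) <= abs dc*abs ((A - e*x)*db - (B - e*y)*da)"
    using e unfolding abs_mult mult.assoc by (intro mult_left_le_one_le) auto
   ultimately show ?thesis by (simp add: algebra_simps)
  qed
  have arith: "x <= 1/2*(A1 + A2 + A3 + A4) + Ma + Mb"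
   if "x <= p + q + r + t" "2*p <= A1 + Mb" "2*q <= A2 + Mb" "2*r <= A3 + Ma" "2*t <= A4 + Ma"
   for x p q r t A1 A2 A3 A4 Ma Mb :: real
   using that by argo
  show ?thesis by (rule arith[OF gen[OF e] amgm_weighted[OF Np] amgm_weighted[OF Np] amgm_weighted[OF Np] amgm_weighted[OF Np]])
 qed
 have "abs (S (%s. Tp ep m c s*(b s*Tp ep m a s - a s*Tp ep m b s)))
   <= (SUM l:{1..m}. S (%s. abs (ep l s*D l c s*((Tp ep (l-1) a s - ep l s*E (l-1) a s)*D l b s - (Tp ep (l-1) b s - ep l s*E (l-1) b s)*D l a s))))"
  unfolding S_commutator[OF ep] by (rule order_trans[OF sum_abs sum_mono]) (rule S_abs_le)
 also have "... <= (SUM l:{1..m}. S (%s. 1/2*((Tp ep (l-1) a s)^2*(D l c s)^2/N (l-1) s + (E (l-1) a s)^2*(D l c s)^2/N (l-1) s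
    + (Tp ep (l-1) b s)^2*(D l c s)^2/N (l-1) s + (E (l-1) b s)^2*(D l c s)^2/N (l-1) s)
    + N (l-1) s*(D l a s)^2 + N (l-1) s*(D l b s)^2))"
  by (intro sum_mono S_mono pt)
 also have "... = 1/2*(P (%l. Tp ep l a) + P (%l. E l a) + P (%l. Tp ep l b) + P (%l. E l b)) + V a + V b"
  unfolding P_def V_def S_add S_cmult[of "1/2"] sum.distrib sum_distrib_left[of "1/2", symmetric] ..
 also have "... <= 1/2*(C (%l. Tp ep l a) + C (%l. E l a) + C (%l. Tp ep l b) + C (%l. E l b)) + V a + V b"
  using PC[OF mart_E, of a] PC[OF mart_E, of b] PC[OF mart_Tp[OF ep], of a] PC[OF mart_Tp[OF ep], of b] by simp
 finally show ?thesis using CC[of a] CC[of b] by argo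
qed

text \<open>The Carleson bounds require one weight \<open>N\<close> that dominates the martingale of
  the total mass and, up to the factor \<open>n+1\<close>, the squares of the martingales and
  transforms of all blocks together. Therefore \<open>N\<close> is the length of the vector with the
  component \<open>E l f\<close> and with \<open>E l (W k)\<close> and \<open>Tp ep l (W k)\<close>
  for all blocks \<open>k\<close>, the latter scaled by \<open>1 / sqrt n'\<close>. The scaling
  keeps the final weight comparable with \<open>f\<close> in the norm of exponent \<open>3\<close>,
  and the energies of all blocks then sum to a multiple of \<open>n+1\<close>.\<close>

lemma martingale_cubic:
 assumes ep: "predictable ep" and w: "!!i s. 0 <= w i s"
 shows "S (%s. SUM i:{1..2^n}. w i s*(scalar_op.tree_op (Tp ep m) (%_. - 1/2) (%_. 1/2) n w i s)^2)
  <= 45*cubic_const*(real n+1)*S (%s. (SUM i:{1..2^n}. w i s)^3)"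
proof -
 interpret T: scalar_op Om wt "Tp ep m" 1 by (rule scalar_op_Tp[OF ep])
 define K where "K = tree_index n"
 define n' where "n' = real n + 1"
 have n': "0 < n'" unfolding n'_def by simp
 define f where "f s = (SUM i:{1..2^n}. w i s)" for s
 have f0: "0 <= f s" for s unfolding f_def by (intro sum_nonneg w)
 define W where "W = block_coord w"
 define F :: "((nat \<times> nat) \<times> bool) option => nat => 'a => real" where
  "F j = (case j of None => %l. E l f
    | Some (k, b) => if b then (%l s. 1 / sqrt n'*E l (W k) s) else (%l s. 1 / sqrt n'*Tp ep l (W k) s))" for j
 define J where "J = insert None (Some ` (K \<times> (UNIV :: bool set)))"
 have sumJ: "(SUM j:J. g j) = g None + (SUM k:K. g (Some (k, True)) + g (Some (k, False)))" for g :: "_ => real"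
 proof -
  have "(SUM j:J. g j) = g None + (SUM j:K \<times> (UNIV :: bool set). g (Some j))"
   unfolding J_def K_def by (subst sum.insert) (auto simp: sum.reindex)
  also have "(SUM j:K \<times> (UNIV :: bool set). g (Some j)) = (SUM k:K. SUM b:UNIV. g (Some (k, b)))"
   by (rule sum.cartesian_product')
  finally show ?thesis by (simp add: UNIV_bool add.commute)
 qed
 have F: "mart (F j)" for j
  using mart_scale[OF mart_E, of "1 / sqrt n'"] mart_scale[OF mart_Tp[OF ep], of "1 / sqrt n'"] mart_E[of f]
  unfolding F_def by (cases j) auto
 define N where "N l s = L2_set (%j. F j l s) J" for l s
 define Q where "Q l s = (SUM j:J. (F j l s - F j (l-1) s)^2)" for l s
 define q where "q l s = (SUM k:K. esq ep l (W k) s)" for l s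
 have N0: "0 <= N l s" for l s unfolding N_def by (rule L2_set_nonneg)
 have N2: "(N l s)^2 = (E l f s)^2 + q l s/n'" for l s
  unfolding N_def L2_set_power2 sumJ F_def q_def using n'
  by (simp add: power_divide power_mult_distrib sum_divide_distrib add_divide_distrib)
 have qN: "q l s <= n'*(N l s)^2" for l s unfolding N2 using n' by (simp add: distrib_left)
 have q0: "0 <= q l s" for l s unfolding q_def by (intro sum_nonneg) simp
 have EfN: "E l f s <= N l s" for l s
 proof -
  have "(E l f s)^2 <= (N l s)^2" unfolding N2 using q0[of l s] n' by simp
  then show ?thesis using N0 by (rule power2_le_imp_le)
 qed
 have QE: "(SUM k:K. dsq ep l (W k) s) <= n'*Q l s" if l: "l : {1..m}" for l s
 proof -
  have l1: "1 <= l" using l by simp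
  have "Q l s = (D l f s)^2 + (SUM k:K. dsq ep l (W k) s)/n'"
   unfolding Q_def sumJ F_def using n'
   by (simp add: E_step[OF l1] Tp_step[OF l1] flip: right_diff_distrib)
    (simp add: power_divide power_mult_distrib sum_divide_distrib add_divide_distrib)
  then show ?thesis using n' by (simp add: distrib_left)
 qed
 define Z where "Z = (SUM l:{1..m}. S (%s. N (l-1) s*Q l s))"
 have Z: "Z <= 2/3*S (%s. N m s^3)"
  unfolding Z_def Q_def by (rule cube_sum[OF F N_def])
 have S3: "0 <= S (%s. N m s^3)" using N0 by (intro S_nonneg) simp
 \<comment> \<open>The final values contribute \<open>12 + 3/4\<close>, and \<open>Z\<close> has the
   coefficient \<open>12*15 + 3 = 183\<close>. As \<open>Z\<close> is at most \<open>2/3\<close> of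
   the cube, the total is \<open>134.75\<close>.\<close>
 have energy: "(SUM k:K. block_energy N Q ep (W k)) <= 135*n'*S (%s. N m s^3)"
 proof -
  have 1: "(SUM k:K. S (%s. N m s*esq ep m (W k) s)) <= n'*S (%s. N m s^3)"
   unfolding S_sum[symmetric] S_cmult[symmetric] sum_distrib_left[symmetric] q_def[symmetric]
  proof (rule S_mono)
   fix s
   have "N m s*q m s <= N m s*(n'*(N m s)^2)" by (intro mult_left_mono qN N0)
   then show "N m s*q m s <= n'*N m s^3" by (simp add: power2_eq_square power3_eq_cube mult_ac)
  qed
  have 2: "(SUM k:K. SUM l:{1..m}. S (%s. 12*(N (l-1) s*dsq ep l (W k) s)
      + 3*(Q l s*esq ep (l-1) (W k) s/N (l-1) s))) <= 15*n'*Z"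
  proof -
   have "S (%s. SUM k:K. 12*(N (l-1) s*dsq ep l (W k) s)
      + 3*(Q l s*esq ep (l-1) (W k) s/N (l-1) s)) <= S (%s. 15*n'*(N (l-1) s*Q l s))"
    if l: "l : {1..m}" for l
   proof (rule S_mono)
    fix s
    let ?N = "N (l-1) s"
    have Q0: "0 <= Q l s" unfolding Q_def by (intro sum_nonneg) simp
    have "(SUM k:K. 12*(?N*dsq ep l (W k) s)
      + 3*(Q l s*esq ep (l-1) (W k) s/?N))
      = 12*(?N*(SUM k:K. dsq ep l (W k) s)) + 3*(Q l s*q (l-1) s/?N)"
     unfolding q_def by (simp only: sum.distrib sum_distrib_left[symmetric] sum_divide_distrib[symmetric])
    also have "... <= 12*(?N*(n'*Q l s)) + 3*(Q l s*(n'*?N^2)/?N)"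
     by (intro add_mono mult_left_mono divide_right_mono QE[OF l] qN N0 Q0) simp_all
    also have "... = 15*n'*(?N*Q l s)" by (cases "?N = 0") (simp_all add: power2_eq_square)
    finally show "(SUM k:K. 12*(?N*dsq ep l (W k) s)
      + 3*(Q l s*esq ep (l-1) (W k) s/?N)) <= 15*n'*(?N*Q l s)" .
   qed
   then show ?thesis
    unfolding Z_def sum_distrib_left[of "15*n'"] S_sum S_cmult by (subst sum.swap) (rule sum_mono)
  qed
  have 3: "(SUM k:K. SUM l:{1..m}. S (%s. N (l-1) s*(D l (W k) s)^2)) <= n'*Z"
  proof -
   have "S (%s. SUM k:K. N (l-1) s*(D l (W k) s)^2) <= S (%s. n'*(N (l-1) s*Q l s))" if l: "l : {1..m}" for l
   proof (rule S_mono)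
    fix s
    have "(SUM k:K. (D l (W k) s)^2) <= (SUM k:K. dsq ep l (W k) s)" by (intro sum_mono) simp
    then have "(SUM k:K. (D l (W k) s)^2) <= n'*Q l s" using QE[OF l, of s] by linarith
    from mult_left_mono[OF this N0[of "l - 1" s]]
    show "(SUM k:K. N (l-1) s*(D l (W k) s)^2) <= n'*(N (l-1) s*Q l s)" by (simp add: sum_distrib_left mult_ac)
   qed
   then show ?thesis
    unfolding Z_def sum_distrib_left[of n'] S_sum S_cmult by (subst sum.swap) (rule sum_mono)
  qed
  have 4: "(SUM k:K. S (%s. N m s*(Tp ep m (W k) s)^2)) <= (SUM k:K. S (%s. N m s*esq ep m (W k) s))"
   using N0 by (intro sum_mono S_mono mult_left_mono) auto
  have "(SUM k:K. block_energy N Q ep (W k)) <= 12*(n'*S (%s. N m s^3) + 15*n'*Z) + 3*(n'*Z) + 3/4*(n'*S (%s. N m s^3))"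
   unfolding block_energy_def sum.distrib sum_distrib_left[of 12, symmetric] sum_distrib_left[of 3, symmetric] sum_distrib_left[of "3/4", symmetric]
   by (intro add_mono mult_left_mono 1 2 3 order_trans[OF 4 1]) simp_all
  also have "... = n'*(12.75*S (%s. N m s^3) + 183*Z)" by (simp add: algebra_simps)
  also have "... <= n'*(135*S (%s. N m s^3))" using n' Z S3 by (intro mult_left_mono) auto
  finally show ?thesis by simp
 qed
 let ?ka = "%_::nat. - 1/2 :: real" and ?ka' = "%_::nat. 1/2 :: real"
 have node: "abs (T.node ?ka ?ka' w w s b Y Z) <= block_energy N Q ep (block_sum w s b) + block_energy N Q ep (block_sum w s (b + 2^s))"
  if Y: "!!x. abs (Y x) + block_sum w (Suc s) b x <= f x" and Zf: "!!x. abs (Z x) + block_sum w (Suc s) b x <= f x" for s b Y Z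
 proof -
  \<comment> \<open>Since \<open>u\<close> and \<open>h\<close> agree here, \<open>Y\<close> and
    \<open>Z\<close> enter only through \<open>2 T Y + T Z\<close>. The opposite signs of the two
    corners make it the factor of the single commutator \<open>b T a - a T b\<close>; the division
    by \<open>3\<close> restores the bound by \<open>f\<close>.\<close>
  define c where "c x = 1/3*(2*Y x + Z x)" for x
  let ?a = "block_sum w s b" and ?b = "block_sum w s (b + 2^s)"
  have pos: "0 <= block_sum w s b x" for s b x unfolding block_sum_def by (intro sum_nonneg w)
  have Tc: "Tp ep m c x = 1/3*(2*Tp ep m Y x + Tp ep m Z x)" for x
   unfolding c_def[abs_def] by (simp only: T.T_add T.T_scale)
  have cf: "abs (c t) <= f t" for t
  proof -
   have "abs (2*Y t + Z t) <= 3*f t" using Y[of t] Zf[of t] pos[of "Suc s" b t] by linarith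
   then show ?thesis unfolding c_def by (simp add: abs_mult)
  qed
  have nd: "T.node ?ka ?ka' w w s b Y Z = 3*S (%x. Tp ep m c x*(?b x*Tp ep m ?a x - ?a x*Tp ep m ?b x))
    + 3/4*S (%x. ?a x*(Tp ep m ?b x)^2) + 3/4*S (%x. ?b x*(Tp ep m ?a x)^2)"
   unfolding T.node_def T.half_node_def S_add[symmetric] S_cmult[symmetric] Tc
   by (intro S_cong) (simp add: power2_eq_square algebra_simps)
  have ab: "?a x <= N m x" "?b x <= N m x" if "x : Om" for x
  proof -
   have "?a x + ?b x <= f x" using Y[of x] block_sum_Suc[of w s b x] by (simp add: abs_if split: if_splits)
   moreover have "f x <= N m x" using EfN[of m x] E_final[OF that] by simp
   ultimately show "?a x <= N m x" "?b x <= N m x" using pos[of s b x] pos[of s "b + 2^s" x] by linarith+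
  qed
  have "S (%x. ?a x*(Tp ep m ?b x)^2) <= S (%x. N m x*(Tp ep m ?b x)^2)"
   "S (%x. ?b x*(Tp ep m ?a x)^2) <= S (%x. N m x*(Tp ep m ?a x)^2)"
   by (intro S_mono mult_right_mono ab; simp)+
  moreover have "0 <= S (%x. ?a x*(Tp ep m ?b x)^2)" "0 <= S (%x. ?b x*(Tp ep m ?a x)^2)"
   using pos by (intro S_nonneg; simp)+
  moreover have "3*abs (S (%s. Tp ep m c s*(?b s*Tp ep m ?a s - ?a s*Tp ep m ?b s))) + 3/4*S (%s. N m s*(Tp ep m ?a s)^2)
    + 3/4*S (%s. N m s*(Tp ep m ?b s)^2) <= block_energy N Q ep ?a + block_energy N Q ep ?b"
   by (rule commutator_le[OF ep F N_def Q_def cf EfN])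
  ultimately show ?thesis unfolding nd by linarith
 qed
 have e0: "0 <= block_energy N Q ep a" for a
  unfolding block_energy_def Q_def using N0
  by (intro add_nonneg_nonneg mult_nonneg_nonneg sum_nonneg S_nonneg divide_nonneg_nonneg) auto
 have "abs (T.tree_form ?ka ?ka' w w n 0 (%_. 0) (%_. 0) - T.outer_form w w n 0 (%_. 0) (%_. 0))
   <= node_sum (%s b. block_energy N Q ep (block_sum w s b) + block_energy N Q ep (block_sum w s (b + 2^s))) n 0"
  by (rule T.tree_form_bound[where mu = f and mh = f]) (use w node in \<open>auto simp: block_sum_def f_def\<close>)
 also have "... <= (SUM k:K. block_energy N Q ep (W k))"
  unfolding K_def
 proof (rule node_sum_le)
  fix s j :: nat
  have "2*j*2^s = j*2^Suc s" "(2*j+1)*2^s = j*2^Suc s + 2^s" by simp_all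
  then show "block_energy N Q ep (block_sum w s (j*2^Suc s)) + block_energy N Q ep (block_sum w s (j*2^Suc s + 2^s))
    <= block_energy N Q ep (W (s, 2*j)) + block_energy N Q ep (W (s, 2*j+1))"
   unfolding W_def block_coord_def by (simp only: prod.case order_refl)
 qed (rule e0)
 finally have 1: "T.tree_form ?ka ?ka' w w n 0 (%_. 0) (%_. 0) <= 135*n'*S (%s. N m s^3)"
  using energy unfolding T.outer_form_def by (simp add: T.T_zero S_def)
 \<comment> \<open>The block sums are at most \<open>sqrt n'\<close> times \<open>f\<close> in the
   square norm, which the scaling takes back; for their transforms the square function bound at
   exponent \<open>3\<close> is used. The two parts give \<open>4*2\<close> and
   \<open>4*?A\<close>.\<close>
 have 2: "S (%s. N m s^3) <= cubic_const*S (%s. f s^3)"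
 proof -
  let ?A = "transform_const 2 3"
  let ?L = "%s. 1 / sqrt n'*L2_set (%k. Tp ep m (W k) s) K"
  have W2: "L2_set (%k. W k s) K <= sqrt n'*f s" for s
  proof -
   have "(SUM k:K. (W k s)^2) <= n'*(f s)^2"
    using block_coord_squares_le[of w s n] w unfolding W_def K_def n'_def f_def by simp
   then show ?thesis unfolding L2_set_def using f0[of s] n'
    by (metis real_sqrt_le_mono real_sqrt_mult real_sqrt_abs abs_of_nonneg)
  qed
  have N_le: "abs (N m s) <= abs (2*f s) + abs (?L s)" if s: "s : Om" for s
  proof -
   have p: "0 <= ?L s" using n' by (simp add: L2_set_nonneg)
   have Lq: "(?L s)^2 = (SUM k:K. (Tp ep m (W k) s)^2)/n'"
    using n' by (simp add: power_divide L2_set_power2)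
   have "(SUM k:K. (E m (W k) s)^2) <= n'*(f s)^2"
   proof -
    have "(SUM k:K. (E m (W k) s)^2) = (L2_set (%k. W k s) K)^2" unfolding L2_set_power2 using s by (simp add: E_final)
    also have "... <= (sqrt n'*f s)^2" using W2 L2_set_nonneg by (intro power_mono) auto
    finally show ?thesis using n' by (simp add: power_mult_distrib)
   qed
   then have "(SUM k:K. (E m (W k) s)^2)/n' <= (f s)^2" using n' by (simp add: divide_le_eq mult.commute)
   then have "(N m s)^2 <= 2*(f s)^2 + (?L s)^2"
    unfolding N2 Lq q_def sum.distrib add_divide_distrib E_final[OF s, of f] by simp
   also have "... <= (2*f s + ?L s)^2"
    using mult_nonneg_nonneg[OF f0[of s] p] zero_le_power2[of "f s"] by (simp only: power2_sum power_mult_distrib) simp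
   finally have "N m s <= 2*f s + ?L s" by (rule power2_le_imp_le) (use f0[of s] p in simp)
   then show ?thesis using N0[of m s] by linarith
  qed
  let ?M = "nrm 3 (%s. L2_set (%k. W k s) K)" and ?TM = "nrm 3 (%s. L2_set (%k. Tp ep m (W k) s) K)"
  have A0: "0 < ?A" by (rule transform_const_pos) auto
  have "?M <= nrm 3 (%s. sqrt n'*f s)"
  proof (rule nrm_mono)
   show "abs (L2_set (%k. W k s) K) <= abs (sqrt n'*f s)" for s
    using W2[of s] L2_set_nonneg[of "%k. W k s" K] by linarith
  qed simp
  also have "nrm 3 (%s. sqrt n'*f s) = sqrt n'*nrm 3 f" using n' by (subst nrm_cmult) auto
  finally have "?A*?M <= ?A*(sqrt n'*nrm 3 f)" using A0 by (intro mult_left_mono) auto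
  moreover have "?TM <= ?A*?M"
   using martingale_l2_strong[OF ep, of K 3] unfolding T.l2_strong_def K_def by auto
  ultimately have "1 / sqrt n'*?TM <= 1 / sqrt n'*(?A*(sqrt n'*nrm 3 f))"
   using n' by (intro mult_left_mono) auto
  moreover have "nrm 3 ?L = 1 / sqrt n'*?TM" using n' by (subst nrm_cmult) auto
  ultimately have "nrm 3 ?L <= ?A*nrm 3 f" using n' by simp
  moreover have "nrm 3 (N m) <= 4*(nrm 3 (%s. 2*f s) + nrm 3 ?L)"
   by (rule nrm_add_le[OF _ N_le]) auto
  moreover have "nrm 3 (%s. 2*f s) = 2*nrm 3 f" by (subst nrm_cmult) auto
  ultimately have *: "nrm 3 (N m) <= (8 + 4*?A)*nrm 3 f" by (simp add: algebra_simps)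
  have pw: "S (%s. g s^3) = nrm 3 g^3" if "!!s. 0 <= g s" for g
  proof -
   have "S (%s. g s^3) = nrm 3 g powr 3" using that by (subst nrm_powr) (auto simp: powr_3_eq)
   then show ?thesis by (simp add: powr_3_eq nrm_nonneg)
  qed
  show ?thesis
   unfolding pw[of f, OF f0] pw[of "N m", OF N0] power_mult_distrib[symmetric] using * nrm_nonneg by (intro power_mono) auto
 qed
 have "3*S (%s. SUM i:{1..2^n}. w i s*(T.tree_op ?ka ?ka' n w i s)^2) <= 135*n'*S (%s. N m s^3)"
  using 1 unfolding T.cubic_le_tree_form .
 also have "... <= 135*n'*(cubic_const*S (%s. f s^3))"
  using 2 n' by (intro mult_left_mono) auto
 also have "... = 3*(45*cubic_const*n'*S (%s. f s^3))" by simp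
 finally show ?thesis unfolding n'_def f_def by (simp only: mult_le_cancel_left_pos zero_less_numeral)
qed

text \<open>The bound at exponent \<open>3\<close> is used for all predictable coefficients at once,
  because stopping changes them. The matrix enters the extrapolation as the contraction
  \<open>K\<close> from l1 to the maximum norm, and duality uses that it is antisymmetric.\<close>

theorem martingale_tree_strong:
 assumes ep: "predictable ep" and p: "1 < p"
 shows "scalar_op.tree_strong Om wt (Tp ep m) (%_. - 1/2) (%_. 1/2) n p (martingale_tree_const p * sqrt (real n+1))"
proof -
 let ?ka = "%_::nat. - 1/2 :: real" and ?ka' = "%_::nat. 1/2 :: real"
 define B where "B = 40 * sqrt (45*cubic_const) * sqrt (real n+1)"
 have A: "0 < transform_const 2 3" by (rule transform_const_pos) auto
 have B1: "1 <= B"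
 proof -
  have "1 <= 8 + 4*transform_const 2 3" using A by simp
  then have "1 <= cubic_const" by (rule one_le_power)
  then have "1 <= 45*cubic_const" by linarith
  then have "1 <= sqrt (45*cubic_const)" by (intro real_le_rsqrt) (simp only: one_power2)
  moreover have "1 <= sqrt (real n+1)" by simp
  ultimately have "1*1 <= sqrt (45*cubic_const) * sqrt (real n+1)"
   using A by (intro mult_mono) auto
  then show ?thesis unfolding B_def by linarith
 qed
 have strong: "scalar_op.tree_strong Om wt (Tp ep m) ?ka ?ka' n 3 B" if ep: "predictable ep" for ep
 proof -
  interpret T: scalar_op Om wt "Tp ep m" 1 by (rule scalar_op_Tp[OF ep])
  have *: "T.tree_strong ?ka ?ka' n 3 (40*(sqrt (45*cubic_const) * sqrt (real n+1)))"
  proof (rule T.cubic_imp_strong)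
   show "0 < sqrt (45*cubic_const) * sqrt (real n+1)" using A by simp
   show "S (%s. SUM i:{1..2^n}. w i s*(T.tree_op ?ka ?ka' n w i s)^2)
     <= (sqrt (45*cubic_const) * sqrt (real n+1))^2*S (%s. (SUM i:{1..2^n}. w i s)^3)"
    if "!!i s. 0 <= w i s" for w
   proof -
    have "(sqrt (45*cubic_const) * sqrt (real n+1))^2 = 45*cubic_const*(real n+1)"
     using A by (simp add: power_mult_distrib)
    then show ?thesis using martingale_cubic[OF ep that] by simp
   qed
  qed
  show ?thesis unfolding B_def using * by (simp only: mult.assoc)
 qed
 interpret T: scalar_op Om wt "Tp ep m" 1 by (rule scalar_op_Tp[OF ep])
 interpret V: vec_op Om wt "{1..2^n}" "l1_norm (2^n)" "linf_norm (2^n)" "T.tree_op ?ka ?ka' n" "1*(- 1)"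
  by (rule T.vec_op_tree) auto
 have l1_tri: "l1_norm (2^n) (%j. x j + y j) <= l1_norm (2^n) x + l1_norm (2^n) y" for x y :: "nat => real"
  unfolding l1_norm_def sum.distrib[symmetric] by (intro sum_mono norm_triangle_ineq)
 have top: "scalar_op.tree_op (Tp ep m) ?ka ?ka' n u i s = Tp ep m (%s. SUM j:{1..2^n}. tree_matrix ?ka ?ka' n i j*u j s) s"
  if "predictable ep" for ep u i s
  using scalar_op.tree_op_def[OF scalar_op_Tp[OF that]] unfolding tree_apply_def by simp
 have "V.strong_type p (transform_const 3 p*B)"
 proof (rule V.strong_type_all[OF p])
  show "V.strong_type 3 B" using strong[OF ep] unfolding T.tree_strong_def V.strong_type_def .
  let ?q = "upper_exponent 3 p + 1"
  have q: "3 <= ?q" using upper_exponent[OF p, of 3] by simp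
  show "V.restricted_type ?q (extrapolation_const ?q*B)"
   unfolding V.restricted_type_def
  proof (intro allI impI)
   fix u :: "nat => 'a => real" and A assume u: "ALL s:Om. l1_norm (2^n) (%j. u j s) <= indicator A s"
   have "S (%s. linf_norm (2^n) (%i. Tp ep m (%s. SUM j:{1..2^n}. tree_matrix ?ka ?ka' n i j*u j s) s) powr ?q)
     <= (extrapolation_const ?q*B) powr ?q*S (indicator A)"
   proof (rule restricted_extrapolation[where p = 3 and rh = "l1_norm (2^n)"])
    show "linf_norm (2^n) (%i. SUM j:{1..2^n}. tree_matrix ?ka ?ka' n i j*x j) <= l1_norm (2^n) x" for x :: "nat => real"
    proof (rule linf_norm_le)
     fix i
     have "abs (SUM j:{1..2^n}. tree_matrix ?ka ?ka' n i j*x j) <= (SUM j:{1..2^n}. norm (x j))"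
      using tree_matrix_abs_le[of ?ka ?ka' n i]
      by (intro order_trans[OF sum_abs] sum_mono) (auto simp: abs_mult intro!: mult_left_le_one_le)
     then show "norm (SUM j:{1..2^n}. tree_matrix ?ka ?ka' n i j*x j) <= l1_norm (2^n) x" unfolding l1_norm_def by simp
    qed simp
    show "nrm 3 (%s. linf_norm (2^n) (%i. Tp ep m (%s. SUM j:{1..2^n}. tree_matrix ?ka ?ka' n i j*u j s) s))
      <= B*nrm 3 (%s. l1_norm (2^n) (%j. u j s))" if "predictable ep" for ep u
     using strong[OF that] unfolding scalar_op.tree_strong_def[OF scalar_op_Tp[OF that]] top[OF that] by blast
   qed (use u q ep B1 V.rh_nonneg V.rh'_nonneg V.rh_scale V.rh'_scale l1_tri V.rh'_triangle in auto)
   then show "S (%s. linf_norm (2^n) (%j. T.tree_op ?ka ?ka' n u j s) powr ?q) <= (extrapolation_const ?q*B) powr ?q*S (indicator A)"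
    unfolding top[OF ep] .
  qed
 qed (use B1 in auto)
 then have "T.tree_strong ?ka ?ka' n p (transform_const 3 p*B)"
  unfolding T.tree_strong_def V.strong_type_def .
 then show ?thesis
 proof (rule T.tree_strong_mono)
  have "transform_const 3 p*B = transform_const 3 p*(40 * sqrt (45*cubic_const)) * sqrt (real n+1)"
   unfolding B_def by (simp only: mult.assoc)
  also have "... <= martingale_tree_const p * sqrt (real n+1)"
   unfolding martingale_tree_const_def by (intro mult_right_mono) auto
  finally show "transform_const 3 p*B <= martingale_tree_const p * sqrt (real n+1)" .
 qed
qed

end

section \<open>The norms of the spaces\<close>

lemma is_norm_cong: "is_norm d nu ==> (!!i. i : {1..d} ==> x i = y i) ==> nu x = nu y"
 and is_norm_nonneg: "is_norm d nu ==> 0 <= nu x"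
 and is_norm_eq_0: "is_norm d nu ==> nu x = 0 \<longleftrightarrow> (ALL i:{1..d}. x i = 0)"
 and is_norm_scale: "is_norm d nu ==> nu (%i. a*x i) = norm a*nu x"
 and is_norm_triangle: "is_norm d nu ==> nu (%i. x i + y i) <= nu x + nu y"
 unfolding is_norm_def by blast+

lemmas H_norm_cong = is_norm_cong[OF is_norm_H_norm]

lemma H_norm_nonneg: "0 <= H_norm n x"
 unfolding H_norm_L2_set by (rule L2_set_nonneg)

lemma l1_norm_nonneg: "0 <= l1_norm d x"
 unfolding l1_norm_def by (simp add: sum_nonneg)

lemma E_norm_nonneg: "0 <= E_norm n x"
 by (rule is_norm_nonneg[OF is_norm_E_norm])

lemma E_norm_le:
 assumes "!!i. i : {1..2^n} ==> u i + v i = x i"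
 shows "E_norm n x <= l1_norm (2^n) u + H_norm n v"
 unfolding E_norm_def
proof (rule cInf_lower)
 show "bdd_below {l1_norm (2^n) u + H_norm n v | u v. ALL i:{1..2^n}. u i + v i = x i}"
  by (rule bdd_belowI[of _ 0]) (auto intro!: add_nonneg_nonneg l1_norm_nonneg H_norm_nonneg)
qed (use assms in blast)

lemma E_norm_ge:
 fixes x :: "nat => 'k::real_normed_field"
 assumes "!!u v. (!!i. i : {1..2^n} ==> u i + v i = x i) ==> b <= l1_norm (2^n) u + H_norm n v"
 shows "b <= E_norm n x"
 unfolding E_norm_def
proof (rule cInf_greatest)
 have "l1_norm (2^n) x + H_norm n (%_. 0 :: 'k) : {l1_norm (2^n) u + H_norm n v | u v. ALL i:{1..2^n}. u i + v i = x i}"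
  by (intro CollectI, rule exI[of _ x], rule exI[of _ "%_. 0"]) simp
 then show "{l1_norm (2^n) u + H_norm n v | u v. ALL i:{1..2^n}. u i + v i = x i} ~= {}" by blast
qed (use assms in blast)

lemma H_norm_zero [simp]: "H_norm n (%_. 0) = 0" and l1_norm_zero [simp]: "l1_norm d (%_. 0) = 0"
 unfolding H_norm_def l1_norm_def by simp_all

lemma E_norm_le_H: "E_norm n x <= H_norm n x"
 using E_norm_le[of n "%_. 0" x x] by simp

text \<open>The factor \<open>2\<close> avoids the question whether the infimum is attained. It
  gives no room if the norm is zero, but then \<open>x\<close> vanishes on the relevant indices and
  \<open>u = 0\<close> works.\<close>

lemma E_norm_decomposition: "EX u. l1_norm (2^n) u + H_norm n (%i. x i - u i) <= 2*E_norm n x"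
proof (rule ccontr)
 assume neg: "\<nexists>u. l1_norm (2^n) u + H_norm n (%i. x i - u i) <= 2*E_norm n x"
 have "2*E_norm n x <= E_norm n x"
 proof (rule E_norm_ge)
  fix u v :: "nat => 'a" assume uv: "!!i. i : {1..2^n} ==> u i + v i = x i"
  have "H_norm n (%i. x i - u i) = H_norm n v"
   by (rule H_norm_cong) (use uv in \<open>simp add: algebra_simps flip: uv\<close>)
  then show "2*E_norm n x <= l1_norm (2^n) u + H_norm n v" using neg by (metis linear)
 qed
 then have "E_norm n x = 0" using E_norm_nonneg[of n x] by linarith
 then have "ALL i:{1..2^n}. x i = 0" using is_norm_eq_0[OF is_norm_E_norm] by blast
 then have "H_norm n (%i. x i - 0) = 0" using H_norm_cong[of n x "%_. 0"] by simp
 then show False using neg E_norm_nonneg[of n x] by (auto dest: spec[of _ "%_. 0"])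
qed

lemma bij_betw_dyadic_blocks:
 "bij_betw (%(s, j). {j*2^s + 1..(j+1)*2^s}) (tree_index n) (dyadic_blocks n)"
proof (rule bij_betwI')
 fix k k' :: "nat \<times> nat"
 obtain s j where k: "k = (s, j)" by fastforce
 obtain s' j' where k': "k' = (s', j')" by fastforce
 show "((%(s, j). {j*2^s + 1..(j+1)*2^s}) k = (%(s, j). {j*2^s + 1..(j+1)*2^s}) k') = (k = k')"
 proof
  assume eq: "(%(s, j). {j*2^s + 1..(j+1)*2^s}) k = (%(s, j). {j*2^s + 1..(j+1)*2^s}) k'"
  have "(2::nat)^s = 2^s'" using arg_cong[OF eq, of card] unfolding k k' by simp
  then have s: "s = s'" by simp
  have "Min {j*2^s + 1..(j+1)*2^s} = j*2^s + 1" "Min {j'*2^s + 1..(j'+1)*2^s} = j'*2^s + 1"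
   by (rule Min_eqI; simp)+
  then have "j*2^s + 1 = j'*2^s + 1" using eq unfolding k k' s by (simp only: prod.case)
  then show "k = k'" unfolding k k' s by simp
 qed simp
next
 fix k :: "nat \<times> nat" assume "k : tree_index n"
 then obtain s j where k: "k = (s, j)" "s <= n" "j < 2^(n - s)" unfolding tree_index_def by auto
 then show "(%(s, j). {j*2^s + 1..(j+1)*2^s}) k : dyadic_blocks n"
  unfolding dyadic_blocks_def by (intro UN_I[of "n - s"] CollectI exI[of _ "j + 1"]) auto
next
 fix I assume "I : dyadic_blocks n"
 then obtain s j where "s <= n" "1 <= j" "j <= 2^s" "I = {(j-1)*2^(n - s) + 1 .. j*2^(n - s)}"
  unfolding dyadic_blocks_def by auto
 then show "EX k:tree_index n. I = (%(s, j). {j*2^s + 1..(j+1)*2^s}) k"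
  unfolding tree_index_def by (intro bexI[of _ "(n - s, j-1)"]) (cases j; auto)+
qed

lemma H_norm_block_coord:
 fixes w :: "nat => 'a => real"
 shows "H_norm n (%i. w i x) = L2_set (%k. block_coord w k x) (tree_index n)"
proof -
 have "(SUM i:{j*2^s + 1..(j+1)*2^s}. w i x) = block_sum w s (j*2^s) x" for s j
  unfolding block_sum_def
  by (rule sum.reindex_bij_witness[of _ "%i. j*2^s + i" "%i. i - j*2^s"]) auto
 then have "(SUM I:dyadic_blocks n. (norm (SUM i:I. w i x))^2) = (SUM k:tree_index n. (block_coord w k x)^2)"
  unfolding sum.reindex_bij_betw[OF bij_betw_dyadic_blocks, symmetric] block_coord_def
  by (intro sum.cong) auto
 then show ?thesis unfolding H_norm_def L2_set_def by simp
qed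

lemma H_norm_le_l1:
 fixes x :: "nat => real"
 shows "H_norm n x <= sqrt (real n+1)*l1_norm (2^n) x"
proof -
 have "(H_norm n x)^2 <= (sqrt (real n+1)*l1_norm (2^n) x)^2"
  using block_coord_squares_le[of "%i _. x i" "()" n] H_norm_block_coord[of n "%i _. x i" "()"]
  unfolding l1_norm_def by (simp add: L2_set_power2 power_mult_distrib)
 then show ?thesis by (rule power2_le_imp_le) (simp add: l1_norm_nonneg)
qed

lemma H_norm_triangle: "H_norm n (%i. x i + y i) <= H_norm n x + H_norm n y"
 by (rule is_norm_triangle[OF is_norm_H_norm])

lemma H_norm_le_E:
 fixes x :: "nat => real"
 shows "H_norm n x <= sqrt (real n+1)*E_norm n x"
proof -
 have "H_norm n x / sqrt (real n+1) <= E_norm n x"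
 proof (rule E_norm_ge)
  fix u v :: "nat => real" assume uv: "!!i. i : {1..2^n} ==> u i + v i = x i"
  have "H_norm n x = H_norm n (%i. u i + v i)" by (rule H_norm_cong) (simp add: uv)
  also have "... <= H_norm n u + H_norm n v" by (rule H_norm_triangle)
  also have "... <= sqrt (real n+1)*l1_norm (2^n) u + sqrt (real n+1)*H_norm n v"
  proof (rule add_mono[OF H_norm_le_l1])
   have "1 <= sqrt (real n+1)" by simp
   from mult_right_mono[OF this H_norm_nonneg[of n v]]
   show "H_norm n v <= sqrt (real n+1)*H_norm n v" by simp
  qed
  finally show "H_norm n x / sqrt (real n+1) <= l1_norm (2^n) u + H_norm n v"
   by (simp add: divide_le_eq algebra_simps)
 qed
 then show ?thesis by (simp add: divide_le_eq mult.commute)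
qed

section \<open>Rows of the matrices against the norm of \<open>H_n\<close>\<close>

lemma sqrt_mult_add_le:
 fixes a c :: real
 assumes "0 <= k" "0 <= a" "a + c^2 <= b"
 shows "sqrt k * sqrt a + abs c <= sqrt (k+1) * sqrt b"
proof -
 have "(sqrt k * sqrt a + 1*abs c)^2 <= ((sqrt k)^2 + 1^2)*((sqrt a)^2 + abs c^2)"
 proof -
  have "(K^2 + 1^2)*(A^2 + C^2) - (K*A + 1*C)^2 = (K*C - A)^2" for K A C :: real
   by (simp add: power2_eq_square algebra_simps)
  then show ?thesis by (metis diff_ge_0_iff_ge zero_le_power2)
 qed
 also have "... <= (k+1)*b" using assms by (simp add: mult_left_mono)
 finally have "sqrt k * sqrt a + abs c <= sqrt ((k+1)*b)" by (intro real_le_rsqrt) simp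
 then show ?thesis by (simp add: real_sqrt_mult)
qed

lemma node_sum_nonneg: "(!!s b. 0 <= be s b) ==> 0 <= node_sum be s b"
 by (induction s arbitrary: b) auto

text \<open>A row meets one block on each of the \<open>s\<close> levels. The induction descends
  into the half that contains \<open>i\<close>, adds the block sum of the other half and applies the
  Cauchy-Schwarz inequality with one more term.\<close>

lemma tree_apply_abs_le:
 assumes ka: "!!s. abs (ka s) <= 1" "!!s. abs (ka' s) <= 1" and i: "i : {1..2^s}"
 shows "abs (tree_apply ka ka' w s b i x)
  <= sqrt (real s) * sqrt (node_sum (%s b. (block_sum w s b x)^2 + (block_sum w s (b + 2^s) x)^2) s b)"
 using i
proof (induction s arbitrary: b i)
 case 0
 then show ?case by (simp add: tree_apply_def)
next
 case (Suc s)
 let ?be = "%s b. (block_sum w s b x)^2 + (block_sum w s (b + 2^s) x)^2"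
 have nn: "0 <= node_sum ?be s b" for s b by (rule node_sum_nonneg) simp
 have step: "abs (t + k*c) <= sqrt (real (Suc s)) * sqrt (node_sum ?be (Suc s) b)"
  if t: "abs t <= sqrt (real s) * sqrt (node_sum ?be s b')" and k: "abs k <= 1"
   and le: "node_sum ?be s b' + c^2 <= node_sum ?be (Suc s) b" for t k c b'
 proof -
  have "abs (t + k*c) <= abs t + abs c"
   using k abs_triangle_ineq[of t "k*c"] mult_left_le_one_le[of "abs c" "abs k"] by (simp add: abs_mult)
  also have "... <= sqrt (real s) * sqrt (node_sum ?be s b') + abs c" using t by simp
  also have "... <= sqrt (real s+1) * sqrt (node_sum ?be (Suc s) b)" by (rule sqrt_mult_add_le[OF _ nn le]) simp
  finally show ?thesis by (simp add: add.commute)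
 qed
 show ?case
 proof (cases "i <= 2^s")
  case True
  then have i: "i : {1..2^s}" using Suc.prems by auto
  show ?thesis unfolding tree_apply_left[OF i]
   by (rule step[OF Suc.IH[OF i] ka(1)]) (use nn[of s "b + 2^s"] in simp)
 next
  case False
  then have i: "i - 2^s : {1..2^s}" "i = 2^s + (i - 2^s)" using Suc.prems by auto
  show ?thesis
   by (subst i(2), subst tree_apply_right[OF i(1)], rule step[OF Suc.IH[OF i(1)] ka(2)]) (use nn[of s b] in simp)
 qed
qed

lemma tree_apply_le_H:
 fixes w :: "nat => 'a => real"
 assumes ka: "!!s. abs (ka s) <= 1" "!!s. abs (ka' s) <= 1" and i: "i : {1..2^n}"
 shows "abs (tree_apply ka ka' w n 0 i x) <= sqrt (real n+1)*H_norm n (%i. w i x)"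
proof -
 have "node_sum (%s b. (block_sum w s b x)^2 + (block_sum w s (b + 2^s) x)^2) n 0 <= (SUM k:tree_index n. (block_coord w k x)^2)"
 proof (rule node_sum_le)
  fix s j :: nat
  have "2*j*2^s = j*2^Suc s" "(2*j+1)*2^s = j*2^Suc s + 2^s" by simp_all
  then show "(block_sum w s (j*2^Suc s) x)^2 + (block_sum w s (j*2^Suc s + 2^s) x)^2
    <= (block_coord w (s, 2*j) x)^2 + (block_coord w (s, 2*j+1) x)^2"
   unfolding block_coord_def by (simp only: prod.case order_refl)
 qed simp
 then have "sqrt (real n) * sqrt (node_sum (%s b. (block_sum w s b x)^2 + (block_sum w s (b + 2^s) x)^2) n 0)
   <= sqrt (real n+1)*H_norm n (%i. w i x)"
  unfolding H_norm_block_coord L2_set_def by (intro mult_mono real_sqrt_le_mono) (auto intro!: node_sum_nonneg)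
 then show ?thesis using tree_apply_abs_le[where ka = ka and ka' = ka' and w = w and b = 0 and x = x, OF ka i] by linarith
qed

lemma norm_block_le_H:
 assumes "I : dyadic_blocks n" shows "norm (SUM j:I. x j) <= H_norm n x"
 unfolding H_norm_L2_set
 using member_le_L2_set[OF finite_dyadic_blocks assms, of "%I. norm (SUM j:I. x j)"] by simp

lemma whole_block: "{1..2^n} : dyadic_blocks n"
 unfolding dyadic_blocks_def by (intro UN_I[of 0]) (auto intro!: exI[of _ 1])

lemma norm_le_H: "i : {1..2^n} ==> norm (x i) <= H_norm n x"
 using norm_block_le_H[OF singleton_dyadic_blocks] by simp

lemma summation_matrix_tree:
 "i : {1..2^n} ==> j : {1..2^n} ==> summation_matrix i j =
   tree_matrix (%_. - 1/2) (%_. 1/2) n i j + 1/2 + (if i = j then 1/2 else 0)"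
proof (induction n arbitrary: i j)
 case 0
 then show ?case by (simp add: summation_matrix_def)
next
 case (Suc n)
 consider "i <= 2^n" "j <= 2^n" | "2^n < i" "2^n < j" | "i <= 2^n" "2^n < j" | "2^n < i" "j <= 2^n"
  by linarith
 then show ?case
 proof cases
  case 2
  then have "summation_matrix i j = (summation_matrix (i - 2^n) (j - 2^n) :: real)"
   unfolding summation_matrix_def by auto
  moreover have "i = j \<longleftrightarrow> i - 2^n = j - 2^n" using 2 by auto
  moreover have "i - 2^n : {1..2^n}" "j - 2^n : {1..2^n}" using 2 Suc.prems by auto
  ultimately show ?thesis using Suc.IH[of "i - 2^n" "j - 2^n"] 2 by simp
 qed (use Suc in \<open>auto simp: summation_matrix_def\<close>)
qed

lemma D_matrix_tree:
 "i : {1..2^n} ==> j : {1..2^n} ==> D_matrix n i j =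
   tree_matrix (%s. (- 1)^Suc s) (%s. (- 1)^Suc s) n i j + (if i = j then 1 else 0 :: real)"
proof (induction n arbitrary: i j)
 case (Suc n)
 consider "i <= 2^n" "j <= 2^n" | "2^n < i" "2^n < j" | "i <= 2^n" "2^n < j" | "2^n < i" "j <= 2^n"
  by linarith
 then show ?case
 proof cases
  case 2
  have "i = j \<longleftrightarrow> i - 2^n = j - 2^n" using 2 by auto
  moreover have "i - 2^n : {1..2^n}" "j - 2^n : {1..2^n}" using 2 Suc.prems by auto
  ultimately show ?thesis using Suc.IH[of "i - 2^n" "j - 2^n"] 2 by simp
 qed (use Suc in auto)
qed simp

text \<open>The remainders are half of the total sum plus half of one coordinate, respectively one
  coordinate. Both are sums over dyadic blocks and hence below the norm of
  \<open>H_n\<close>.\<close>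

definition near_tree :: "nat => (nat => nat => real) => (nat => real) => (nat => real) => bool" where
 "near_tree n M ka ka' \<longleftrightarrow> (ALL i:{1..2^n}. ALL x.
   abs (mat_vec (2^n) M x i - (SUM j:{1..2^n}. tree_matrix ka ka' n i j*x j)) <= H_norm n x)"

lemma near_tree_summation: "near_tree n summation_matrix (%_. - 1/2) (%_. 1/2)"
 unfolding near_tree_def
proof (intro ballI allI)
 fix i :: nat and x :: "nat => real" assume i: "i : {1..2^n}"
 have "mat_vec (2^n) summation_matrix x i
   = (SUM j:{1..2^n}. tree_matrix (%_. - 1/2) (%_. 1/2) n i j*x j + 1/2*x j + (if i = j then 1/2*x j else 0))"
  unfolding mat_vec_def by (intro sum.cong refl) (simp add: summation_matrix_tree[OF i] distrib_right)
 also have "... = (SUM j:{1..2^n}. tree_matrix (%_. - 1/2) (%_. 1/2) n i j*x j) + (1/2*(SUM j:{1..2^n}. x j) + 1/2*x i)"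
  unfolding sum.distrib sum_distrib_left[symmetric] using i by simp
 finally have e: "mat_vec (2^n) summation_matrix x i - (SUM j:{1..2^n}. tree_matrix (%_. - 1/2) (%_. 1/2) n i j*x j)
   = 1/2*(SUM j:{1..2^n}. x j) + 1/2*x i" by simp
 have "abs (SUM j:{1..2^n}. x j) <= H_norm n x" "abs (x i) <= H_norm n x"
  using norm_block_le_H[OF whole_block, of x n] norm_le_H[OF i, of x] by (simp_all only: real_norm_def)
 then show "abs (mat_vec (2^n) summation_matrix x i - (SUM j:{1..2^n}. tree_matrix (%_. - 1/2) (%_. 1/2) n i j*x j)) <= H_norm n x"
  unfolding e by linarith
qed

lemma near_tree_D: "near_tree n (D_matrix n) (%s. (- 1)^Suc s) (%s. (- 1)^Suc s)"
 unfolding near_tree_def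
proof (intro ballI allI)
 fix i :: nat and x :: "nat => real" assume i: "i : {1..2^n}"
 let ?t = "tree_matrix (%s. (- 1)^Suc s) (%s. (- 1)^Suc s) n i"
 have "mat_vec (2^n) (D_matrix n) x i = (SUM j:{1..2^n}. ?t j*x j + (if i = j then x j else 0))"
  unfolding mat_vec_def by (intro sum.cong refl) (simp add: D_matrix_tree[OF i] distrib_right)
 also have "... = (SUM j:{1..2^n}. ?t j*x j) + x i"
  unfolding sum.distrib using i by simp
 finally show "abs (mat_vec (2^n) (D_matrix n) x i - (SUM j:{1..2^n}. ?t j*x j)) <= H_norm n x"
  using norm_le_H[OF i, of x] by simp
qed

section \<open>Bounds of order \<open>n\<close> and of order \<open>sqrt n\<close>\<close>

context scalar_op
begin

lemma nrm_H_le: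
 assumes l2: "l2_strong (tree_index n) p A"
 shows "nrm p (%s. H_norm n (%i. T (f i) s)) <= A*nrm p (%s. H_norm n (%i. f i s))"
proof -
 have "block_coord (%i s. T (f i) s) k s = T (block_coord f k) s" for k s
  unfolding block_coord_def block_sum_def[abs_def] by (cases k) (simp add: T_sum)
 then show ?thesis
  using l2[unfolded l2_strong_def, rule_format, of "block_coord f"]
  unfolding H_norm_block_coord[of n "%i s. T (f i) s"] H_norm_block_coord[of n f] by simp
qed

lemma nrm_H_le_E:
 assumes l2: "l2_strong (tree_index n) p A" and A: "0 <= A" and p: "1 <= p"
 shows "nrm p (%s. H_norm n (%i. T (f i) s)) <= A*(sqrt (real n+1)*nrm p (%s. E_norm n (%i. f i s)))"
proof -
 have "nrm p (%s. H_norm n (%i. f i s)) <= nrm p (%s. sqrt (real n+1)*E_norm n (%i. f i s))"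
  using p by (intro nrm_mono) (auto simp: H_norm_nonneg abs_mult E_norm_nonneg H_norm_le_E)
 also have "... = sqrt (real n+1)*nrm p (%s. E_norm n (%i. f i s))" using p by (subst nrm_cmult) auto
 finally show ?thesis using nrm_H_le[OF l2, of f] A by (meson mult_left_mono order_trans)
qed

text \<open>The factor \<open>sqrt (n+1)\<close> is lost twice, from \<open>E_n\<close> to
  \<open>H_n\<close> before the transform and from \<open>H_n\<close> to the rows of the matrix
  after it.\<close>

lemma matrix_norm_linear_bound:
 assumes l2: "l2_strong (tree_index n) p A" and A: "0 <= A" and p: "1 <= p"
  and M: "near_tree n M ka ka'" and ka: "!!s. abs (ka s) <= 1" "!!s. abs (ka' s) <= 1"
 shows "nrm p (%s. max (linf_norm (2^n) (mat_vec (2^n) M (%i. T (f i) s))) (E_norm n (%i. T (f i) s)))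
  <= 2*A*(real n+1)*nrm p (%s. E_norm n (%i. f i s))"
proof -
 let ?r = "sqrt (real n+1)"
 have r: "1 <= ?r" by simp
 have "nrm p (%s. max (linf_norm (2^n) (mat_vec (2^n) M (%i. T (f i) s))) (E_norm n (%i. T (f i) s)))
   <= nrm p (%s. 2*?r*H_norm n (%i. T (f i) s))"
 proof (rule nrm_mono)
  fix s
  let ?x = "%i. T (f i) s"
  have H: "0 <= H_norm n ?x" by (rule H_norm_nonneg)
  have rH: "H_norm n ?x <= ?r*H_norm n ?x" using mult_right_mono[OF r H] by simp
  have "linf_norm (2^n) (mat_vec (2^n) M ?x) <= 2*?r*H_norm n ?x"
  proof (rule linf_norm_le)
   fix i :: nat assume i: "i : {1..2^n}"
   have "abs (mat_vec (2^n) M ?x i - (SUM j:{1..2^n}. tree_matrix ka ka' n i j*?x j)) <= H_norm n ?x"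
    using M i unfolding near_tree_def by blast
   moreover have "abs (SUM j:{1..2^n}. tree_matrix ka ka' n i j*?x j) <= ?r*H_norm n ?x"
    using tree_apply_le_H[where ka = ka and ka' = ka' and w = "%i s. T (f i) s" and x = s, OF ka i]
    unfolding tree_apply_def by (simp only: add_0)
   ultimately show "norm (mat_vec (2^n) M ?x i) <= 2*?r*H_norm n ?x" using rH by (simp only: real_norm_def)
  qed simp
  moreover have "E_norm n ?x <= 2*?r*H_norm n ?x" using E_norm_le_H[of n ?x] rH H by linarith
  moreover have "0 <= max (linf_norm (2^n) (mat_vec (2^n) M ?x)) (E_norm n ?x)"
   using E_norm_nonneg[of n ?x] by (simp add: le_max_iff_disj)
  ultimately show "abs (max (linf_norm (2^n) (mat_vec (2^n) M ?x)) (E_norm n ?x)) <= abs (2*?r*H_norm n ?x)" by linarith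
 qed (use p in simp)
 also have "... = 2*?r*nrm p (%s. H_norm n (%i. T (f i) s))" using p by (subst nrm_cmult) auto
 also have "... <= 2*?r*(A*(?r*nrm p (%s. E_norm n (%i. f i s))))"
  by (intro mult_left_mono nrm_H_le_E[OF l2 A p]) simp
 also have "... = 2*A*(?r*?r)*nrm p (%s. E_norm n (%i. f i s))" by (simp only: mult_ac)
 also have "?r*?r = real n + 1" by simp
 finally show ?thesis .
qed

text \<open>At each point the input is split into a part in l1 and a part in \<open>H_n\<close>. The
  first part goes through the tree estimate. The second loses \<open>sqrt (n+1)\<close> only after
  the transform. The remainder of the matrix and the norm of \<open>E_n\<close> need the transform
  only in \<open>H_n\<close> and lose it only before. On a finite set the pointwise choice of the
  splitting raises no question of measurability.\<close>

lemma matrix_norm_sqrt_bound: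
 assumes l2: "l2_strong (tree_index n) p A" and A: "0 <= A" and p: "1 <= p"
  and M: "near_tree n M ka ka'" and ka: "!!s. abs (ka s) <= 1" "!!s. abs (ka' s) <= 1"
  and tree: "tree_strong ka ka' n p (B * sqrt (real n+1))" and B: "0 <= B"
 shows "nrm p (%s. max (linf_norm (2^n) (mat_vec (2^n) M (%i. T (f i) s))) (E_norm n (%i. T (f i) s)))
  <= (8*B + 48*A) * sqrt (real n+1)*nrm p (%s. E_norm n (%i. f i s))"
proof -
 let ?r = "sqrt (real n+1)"
 have r: "1 <= ?r" by simp
 let ?E = "nrm p (%s. E_norm n (%i. f i s))"
 obtain U where U: "!!s. l1_norm (2^n) (U s) + H_norm n (%i. f i s - U s i) <= 2*E_norm n (%i. f i s)"
  using E_norm_decomposition[of n "%i. f i _"] by metis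
 define u where "u i s = U s i" for i s
 define v where "v i s = f i s - u i s" for i s
 have uv: "l1_norm (2^n) (%i. u i s) <= 2*E_norm n (%i. f i s)" "H_norm n (%i. v i s) <= 2*E_norm n (%i. f i s)" for s
  using U[of s] l1_norm_nonneg[of "2^n" "U s"] H_norm_nonneg[of n "%i. f i s - U s i"]
  unfolding u_def v_def by linarith+
 have Tf: "T (f i) s = T (u i) s + T (v i) s" for i s
  unfolding T_add[symmetric] v_def by simp
 let ?F = "%s. max (linf_norm (2^n) (mat_vec (2^n) M (%i. T (f i) s))) (E_norm n (%i. T (f i) s))"
 let ?K = "%s. linf_norm (2^n) (%i. tree_op ka ka' n u i s)"
 let ?V = "%s. ?r*H_norm n (%i. T (v i) s)" and ?W = "%s. H_norm n (%i. T (f i) s)"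
 have "abs (?F s) <= abs (?K s) + abs (?V s + ?W s)" for s
 proof -
  have nn: "0 <= ?K s" "0 <= ?V s" "0 <= ?W s" by (simp_all add: linf_norm_nonneg H_norm_nonneg)
  have "linf_norm (2^n) (mat_vec (2^n) M (%i. T (f i) s)) <= ?K s + (?V s + ?W s)"
  proof (rule linf_norm_le)
   fix i :: nat assume i: "i : {1..2^n}"
   have "abs (mat_vec (2^n) M (%i. T (f i) s) i - (SUM j:{1..2^n}. tree_matrix ka ka' n i j*T (f j) s)) <= ?W s"
    using M i unfolding near_tree_def by blast
   moreover have "(SUM j:{1..2^n}. tree_matrix ka ka' n i j*T (f j) s)
     = tree_op ka ka' n u i s + (SUM j:{1..2^n}. tree_matrix ka ka' n i j*T (v j) s)"
    unfolding tree_op_eq_sum Tf distrib_left sum.distrib ..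
   moreover have "abs (SUM j:{1..2^n}. tree_matrix ka ka' n i j*T (v j) s) <= ?V s"
    using tree_apply_le_H[where ka = ka and ka' = ka' and w = "%i s. T (v i) s" and x = s, OF ka i]
    unfolding tree_apply_def by (simp only: add_0)
   moreover have "abs (tree_op ka ka' n u i s) <= ?K s"
    using linf_norm_ge[OF i, of "%i. tree_op ka ka' n u i s"] by simp
   ultimately show "norm (mat_vec (2^n) M (%i. T (f i) s) i) <= ?K s + (?V s + ?W s)"
    unfolding real_norm_def by linarith
  qed simp
  moreover have "E_norm n (%i. T (f i) s) <= ?K s + (?V s + ?W s)"
   using E_norm_le_H[of n "%i. T (f i) s"] nn by linarith
  moreover have "0 <= ?F s" using E_norm_nonneg[of n "%i. T (f i) s"] by (simp add: le_max_iff_disj)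
  ultimately show ?thesis using nn by linarith
 qed
 then have 1: "nrm p ?F <= 4*(nrm p ?K + nrm p (%s. ?V s + ?W s))" by (rule nrm_add_le[OF p])
 have 2: "nrm p (%s. ?V s + ?W s) <= 4*(nrm p ?V + nrm p ?W)" by (rule nrm_add_le[OF p abs_triangle_ineq])
 have E0: "0 <= ?E" by (rule nrm_nonneg)
 have 3: "nrm p ?K <= B*?r*(2*?E)"
 proof -
  have "nrm p ?K <= B*?r*nrm p (%s. l1_norm (2^n) (%i. u i s))" using tree unfolding tree_strong_def by blast
  also have "nrm p (%s. l1_norm (2^n) (%i. u i s)) <= nrm p (%s. 2*E_norm n (%i. f i s))"
   using p uv by (intro nrm_mono) (auto simp: l1_norm_nonneg E_norm_nonneg abs_mult)
  also have "... = 2*?E" using p by (subst nrm_cmult) auto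
  finally show ?thesis using B by (simp add: mult_left_mono)
 qed
 have 4: "nrm p ?V <= ?r*(A*(2*?E))"
 proof -
  have "nrm p ?V = ?r*nrm p (%s. H_norm n (%i. T (v i) s))" using p by (subst nrm_cmult) auto
  also have "... <= ?r*(A*nrm p (%s. H_norm n (%i. v i s)))" by (intro mult_left_mono nrm_H_le[OF l2]) simp
  also have "nrm p (%s. H_norm n (%i. v i s)) <= nrm p (%s. 2*E_norm n (%i. f i s))"
   using p uv by (intro nrm_mono) (auto simp: H_norm_nonneg E_norm_nonneg abs_mult)
  also have "... = 2*?E" using p by (subst nrm_cmult) auto
  finally show ?thesis using A by (simp add: mult_left_mono)
 qed
 have 5: "nrm p ?W <= A*(?r*?E)" by (rule nrm_H_le_E[OF l2 A p])
 have "nrm p ?F <= 4*(B*?r*(2*?E) + 4*(?r*(A*(2*?E)) + A*(?r*?E)))"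
  using 1 2 3 4 5 by argo
 also have "... = (8*B + 48*A)*?r*?E" by (simp add: algebra_simps)
 finally show ?thesis .
qed

end

section \<open>Discrete estimates for the norms of the spaces\<close>

definition hilbert_bound :: "real => ((nat => 'k::real_normed_field) => real) => real => bool" where
 "hilbert_bound p nu K \<longleftrightarrow> (ALL G f. finite (G :: int set) -->
   (SUM x:G. nu (%i. SUM y:G. (1/of_int (x - y)) *\<^sub>R f i y) powr p) <= K powr p*(SUM x:G. nu (%i. f i x) powr p))"

definition cond_mean :: "'w set => ('w => real) => (nat => 'w => 'w) => nat => ('w => 'k::real_normed_field) => 'w => 'k" where
 "cond_mean Om wt lab k f s = (1/(SUM t:{t : Om. lab k t = lab k s}. wt t)) *\<^sub>R (SUM t:{t : Om. lab k t = lab k s}. wt t *\<^sub>R f t)"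

definition mult_transform ::
  "'w set => ('w => real) => (nat => 'w => 'w) => (nat => 'k::real_normed_field) => nat => ('w => 'k) => 'w => 'k" where
 "mult_transform Om wt lab ep m f s = (SUM k:{1..m}. ep k*(cond_mean Om wt lab k f s - cond_mean Om wt lab (k-1) f s))"

definition umd_bound :: "'w itself => real => ((nat => 'k::real_normed_field) => real) => real => bool" where
 "umd_bound (_ :: 'w itself) p nu K \<longleftrightarrow> (ALL (Om :: 'w set) wt lab m ep f. fin_filtration Om wt lab m --> (ALL k. norm (ep k) <= 1) -->
   (SUM s:Om. wt s*nu (%i. mult_transform Om wt lab ep m (f i) s) powr p) <= K powr p*(SUM s:Om. wt s*nu (%i. f i s) powr p))"

lemma (in weighted_set) sum_le_powr_if_nrm_le:
 assumes "1 <= p" "0 <= K" "!!s. 0 <= f s" "!!s. 0 <= g s" "nrm p f <= K*nrm p g"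
 shows "(SUM s:Om. wt s*f s powr p) <= K powr p*(SUM s:Om. wt s*g s powr p)"
proof -
 have "S (%s. abs (f s) powr p) <= (K*nrm p g) powr p" using assms by (intro nrm_le_imp) auto
 also have "... = K powr p*S (%s. abs (g s) powr p)"
  using assms by (simp add: powr_mult nrm_nonneg nrm_powr)
 finally show ?thesis using assms unfolding S_def by simp
qed

lemma (in weighted_set) nrm_le_if_sum_le_powr:
 assumes "1 <= p" "0 <= K" "!!s. 0 <= f s" "!!s. 0 <= g s"
  "(SUM s:Om. wt s*f s powr p) <= K powr p*(SUM s:Om. wt s*g s powr p)"
 shows "nrm p f <= K*nrm p g"
proof (rule nrm_leI)
 have "S (%s. abs (f s) powr p) <= K powr p*S (%s. abs (g s) powr p)" using assms unfolding S_def by simp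
 also have "... = (K*nrm p g) powr p" using assms by (simp add: powr_mult nrm_nonneg nrm_powr)
 finally show "S (%s. abs (f s) powr p) <= (K*nrm p g) powr p" .
qed (use assms nrm_nonneg in auto)

lemma hilbert_boundI:
 fixes nu :: "(nat => real) => real"
 assumes p: "1 <= p" and K: "0 <= K" and nu: "!!x. 0 <= nu x"
  and le: "!!G f. dht_space G ==>
   weighted_set.nrm G (%_. 1) p (%x. nu (%i. dht G (f i) x)) <= K*weighted_set.nrm G (%_. 1) p (%x. nu (%i. f i x))"
 shows "hilbert_bound p nu K"
 unfolding hilbert_bound_def
proof (intro allI impI)
 fix G :: "int set" and f :: "nat => int => real" assume G: "finite G"
 interpret dht_space G by unfold_locales (rule G)
 show "(SUM x:G. nu (%i. SUM y:G. (1/of_int (x - y)) *\<^sub>R f i y) powr p) <= K powr p*(SUM x:G. nu (%i. f i x) powr p)"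
  using sum_le_powr_if_nrm_le[OF p K nu nu le[OF dht_space_axioms]] unfolding dht_def by simp
qed

lemma umd_boundI:
 fixes nu :: "(nat => real) => real"
 assumes p: "1 <= p" and K: "0 <= K" and nu: "!!x. 0 <= nu x"
  and le: "!!Om wt lab m ep f. fin_filtration (Om :: 'w set) wt (lab :: nat => 'w => 'w) m ==> fin_filtration.predictable Om lab m ep ==>
   weighted_set.nrm Om wt p (%s. nu (%i. fin_filtration.Tp Om wt lab ep m (f i) s)) <= K*weighted_set.nrm Om wt p (%s. nu (%i. f i s))"
 shows "umd_bound TYPE('w) p nu K"
 unfolding umd_bound_def
proof (intro allI impI)
 fix Om :: "'w set" and wt and lab :: "nat => 'w => 'w" and m and ep :: "nat => real" and f :: "nat => 'w => real"
 assume fil: "fin_filtration Om wt lab m" and ep: "ALL k. norm (ep k) <= 1"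
 interpret fin_filtration Om wt lab m by fact
 have "predictable (%k _. ep k)" using ep unfolding predictable_def adapted_def by simp
 moreover have "mult_transform Om wt lab ep m h s = Tp (%k _. ep k) m h s" for h s
  unfolding mult_transform_def Tp_def D_def E_def cond_mean_def atom_def by simp
 ultimately show "(SUM s:Om. wt s*nu (%i. mult_transform Om wt lab ep m (f i) s) powr p) <= K powr p*(SUM s:Om. wt s*nu (%i. f i s) powr p)"
  using sum_le_powr_if_nrm_le[OF p K nu nu le[OF fil]] by simp
qed

lemma E_le_X: "E_norm n x <= X_norm n x" and E_le_Y: "E_norm n x <= Y_norm n x"
 unfolding X_norm_def Y_norm_def by simp_all

abbreviation discrete_bounds ::
  "'w itself => real => ((nat => 'k::real_normed_field) => real) => real => real => bool" where
 "discrete_bounds W p nu a b == hilbert_bound p nu a & umd_bound W p nu b"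

theorem real_bounds:
 assumes p: "1 < p"
 shows "EX C>=0. ALL n. discrete_bounds TYPE('w) p (X_norm n :: (nat => real) => real) (C*(real n+1)) (C * sqrt (real n+1)) &
   discrete_bounds TYPE('w) p (Y_norm n :: (nat => real) => real) (C * sqrt (real n+1)) (C*(real n+1))"
proof -
 obtain A where A: "1 <= A" "!!G (J::(nat \<times> nat) set). dht_space G ==> finite J ==> scalar_op.l2_strong G (%_. 1) (dht G) J p A"
  using dht_l2_strong[OF p, where 'j = "nat \<times> nat"] by auto
 obtain B where B: "1 <= B" "!!G n. dht_space G ==>
   scalar_op.tree_strong G (%_. 1) (dht G) (%s. (- 1)^Suc s) (%s. (- 1)^Suc s) n p (B * sqrt (real n+1))"
  using dht_tree_strong[of "%s. (- 1)^Suc s", OF _ p] by auto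
 let ?A = "transform_const 2 p" and ?B = "martingale_tree_const p"
 have A': "0 < ?A" by (rule transform_const_pos) (use p in auto)
 have B': "0 <= ?B" unfolding martingale_tree_const_def by simp
 have sgn1: "abs ((- 1)^Suc s) <= (1::real)" for s by (simp add: power_abs)
 define C where "C = 8*(B + ?B) + 48*(A + ?A)"
 have C0: "0 <= C" unfolding C_def using A A' B B' by simp
 have lift: "nrmf <= C*ph*NX" if "nrmf <= c*ph*NE" "c <= C" "NE <= NX" "0 <= NE" "0 <= ph" for nrmf c ph NE NX :: real
 proof -
  have "c*ph*NE <= C*ph*NX" using that C0 by (intro mult_mono) auto
  then show ?thesis using that by linarith
 qed
 have cC: "2*A <= C" "2*?A <= C" "8*B + 48*A <= C" "8*?B + 48*?A <= C"
  unfolding C_def using A A' B B' by auto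
 have "hilbert_bound p (X_norm n :: (nat => real) => real) (C*(real n+1))" for n
 proof (rule hilbert_boundI)
  fix G and f :: "nat => int => real" assume G: "dht_space G"
  interpret dht_space G by fact
  show "nrm p (%x. X_norm n (%i. dht G (f i) x)) <= C*(real n+1)*nrm p (%x. X_norm n (%i. f i x))"
   unfolding X_norm_def[of n "%i. dht G (f i) _"]
   by (rule lift[OF matrix_norm_linear_bound[OF A(2)[OF G finite_tree_index] _ _ near_tree_summation] cC(1)])
    (use A p in \<open>auto intro!: nrm_mono nrm_nonneg simp: E_norm_nonneg intro: order_trans[OF E_le_X abs_ge_self]\<close>)
 qed (use p C0 in \<open>auto intro!: is_norm_nonneg[OF is_norm_X_norm]\<close>)
 moreover have "umd_bound TYPE('w) p (X_norm n :: (nat => real) => real) (C * sqrt (real n+1))" for n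
 proof (rule umd_boundI)
  fix Om :: "'w set" and wt and lab :: "nat => 'w => 'w" and m ep and f :: "nat => 'w => real"
  assume "fin_filtration Om wt lab m" and ep: "fin_filtration.predictable Om lab m ep"
  interpret fin_filtration Om wt lab m by fact
  interpret T: scalar_op Om wt "Tp ep m" 1 by (rule scalar_op_Tp[OF ep])
  show "nrm p (%s. X_norm n (%i. Tp ep m (f i) s)) <= C * sqrt (real n+1)*nrm p (%s. X_norm n (%i. f i s))"
   unfolding X_norm_def[of n "%i. Tp ep m (f i) _"]
   by (rule lift[OF T.matrix_norm_sqrt_bound[OF martingale_l2_strong[OF ep finite_tree_index p] _ _ near_tree_summation _ _ martingale_tree_strong[OF ep p] B'] cC(4)])
    (use A' p in \<open>auto intro!: nrm_mono nrm_nonneg simp: E_norm_nonneg intro: order_trans[OF E_le_X abs_ge_self]\<close>)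
 qed (use p C0 in \<open>auto intro!: is_norm_nonneg[OF is_norm_X_norm]\<close>)
 moreover have "hilbert_bound p (Y_norm n :: (nat => real) => real) (C * sqrt (real n+1))" for n
 proof (rule hilbert_boundI)
  fix G and f :: "nat => int => real" assume G: "dht_space G"
  interpret dht_space G by fact
  show "nrm p (%x. Y_norm n (%i. dht G (f i) x)) <= C * sqrt (real n+1)*nrm p (%x. Y_norm n (%i. f i x))"
   unfolding Y_norm_def[of n "%i. dht G (f i) _"]
   by (rule lift[OF matrix_norm_sqrt_bound[OF A(2)[OF G finite_tree_index] _ _ near_tree_D sgn1 sgn1 B(2)[OF G]] cC(3)])
    (use A B p in \<open>auto intro!: nrm_mono nrm_nonneg simp: E_norm_nonneg intro: order_trans[OF E_le_Y abs_ge_self]\<close>)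
 qed (use p C0 in \<open>auto intro!: is_norm_nonneg[OF is_norm_Y_norm]\<close>)
 moreover have "umd_bound TYPE('w) p (Y_norm n :: (nat => real) => real) (C*(real n+1))" for n
 proof (rule umd_boundI)
  fix Om :: "'w set" and wt and lab :: "nat => 'w => 'w" and m ep and f :: "nat => 'w => real"
  assume "fin_filtration Om wt lab m" and ep: "fin_filtration.predictable Om lab m ep"
  interpret fin_filtration Om wt lab m by fact
  interpret T: scalar_op Om wt "Tp ep m" 1 by (rule scalar_op_Tp[OF ep])
  show "nrm p (%s. Y_norm n (%i. Tp ep m (f i) s)) <= C*(real n+1)*nrm p (%s. Y_norm n (%i. f i s))"
   unfolding Y_norm_def[of n "%i. Tp ep m (f i) _"]
   by (rule lift[OF T.matrix_norm_linear_bound[OF martingale_l2_strong[OF ep finite_tree_index p] _ _ near_tree_D sgn1 sgn1] cC(2)])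
    (use A' p in \<open>auto intro!: nrm_mono nrm_nonneg simp: E_norm_nonneg intro: order_trans[OF E_le_Y abs_ge_self]\<close>)
 qed (use p C0 in \<open>auto intro!: is_norm_nonneg[OF is_norm_Y_norm]\<close>)
 ultimately show ?thesis using C0 by blast
qed

section \<open>Complex scalars\<close>

lemma complex_hilbert_bound:
 fixes nu :: "(nat => real) => real" and nu' :: "(nat => complex) => real"
 assumes p: "1 <= p" and K: "0 <= K" and nu: "!!x. 0 <= nu x" and nu': "!!x. 0 <= nu' x"
  and le: "!!x. nu' x <= nu (%i. Re (x i)) + nu (%i. Im (x i))"
  and Re: "!!x. nu (%i. Re (x i)) <= nu' x" and Im: "!!x. nu (%i. Im (x i)) <= nu' x"
  and bound: "hilbert_bound p nu K"
 shows "hilbert_bound p nu' (8*K)"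
 unfolding hilbert_bound_def
proof (intro allI impI)
 fix G :: "int set" and f :: "nat => int => complex" assume G: "finite G"
 interpret weighted_set G "%_. 1" by unfold_locales (use G in auto)
 define H where "H h x = (SUM y:G. (1/of_int (x - y)) *\<^sub>R h y)" for h :: "int => real" and x
 define Hc where "Hc h x = (SUM y:G. (1/of_int (x - y)) *\<^sub>R h y)" for h :: "int => complex" and x
 have ReHc: "Re (Hc h x) = H (%y. Re (h y)) x" "Im (Hc h x) = H (%y. Im (h y)) x" for h x
  unfolding H_def Hc_def by simp_all
 have H: "nrm p (%x. nu (%i. H (h i) x)) <= K*nrm p (%x. nu (%i. h i x))" for h
  unfolding H_def using bound G unfolding hilbert_bound_def
  by (intro nrm_le_if_sum_le_powr[OF p K nu nu]) auto
 have "nrm p (%x. nu' (%i. Hc (f i) x)) <= 4*(nrm p (%x. nu (%i. H (%y. Re (f i y)) x)) + nrm p (%x. nu (%i. H (%y. Im (f i y)) x)))"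
  by (rule nrm_add_le[OF p]) (use le[of "%i. Hc (f i) _"] nu nu' in \<open>simp add: ReHc\<close>)
 also have "... <= 4*(K*nrm p (%x. nu' (%i. f i x)) + K*nrm p (%x. nu' (%i. f i x)))"
 proof (intro mult_left_mono add_mono)
  have "nrm p (%x. nu (%i. Re (f i x))) <= nrm p (%x. nu' (%i. f i x))"
   "nrm p (%x. nu (%i. Im (f i x))) <= nrm p (%x. nu' (%i. f i x))"
   using p Re[of "%i. f i _"] Im[of "%i. f i _"] nu nu' by (auto intro!: nrm_mono)
  then show "nrm p (%x. nu (%i. H (%y. Re (f i y)) x)) <= K*nrm p (%x. nu' (%i. f i x))"
   "nrm p (%x. nu (%i. H (%y. Im (f i y)) x)) <= K*nrm p (%x. nu' (%i. f i x))"
   using H[of "%i y. Re (f i y)"] H[of "%i y. Im (f i y)"] K by (meson mult_left_mono order_trans)+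
 qed simp
 finally have "nrm p (%x. nu' (%i. Hc (f i) x)) <= 8*K*nrm p (%x. nu' (%i. f i x))" by simp
 then show "(SUM x:G. nu' (%i. SUM y:G. (1/of_int (x - y)) *\<^sub>R f i y) powr p)
   <= (8*K) powr p*(SUM x:G. nu' (%i. f i x) powr p)"
  unfolding Hc_def using sum_le_powr_if_nrm_le[OF p _ nu' nu', of "8*K"] K by simp
qed

lemma Re_cond_mean: "Re (cond_mean Om wt lab k f s) = cond_mean Om wt lab k (%s. Re (f s)) s"
 and Im_cond_mean: "Im (cond_mean Om wt lab k f s) = cond_mean Om wt lab k (%s. Im (f s)) s"
 unfolding cond_mean_def by simp_all

lemma Re_mult_transform:
 "Re (mult_transform Om wt lab ep m f s) = mult_transform Om wt lab (%k. Re (ep k)) m (%s. Re (f s)) s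
  + - 1*mult_transform Om wt lab (%k. Im (ep k)) m (%s. Im (f s)) s"
 and Im_mult_transform:
 "Im (mult_transform Om wt lab ep m f s) = mult_transform Om wt lab (%k. Re (ep k)) m (%s. Im (f s)) s
  + mult_transform Om wt lab (%k. Im (ep k)) m (%s. Re (f s)) s"
 unfolding mult_transform_def by (simp_all add: Re_cond_mean Im_cond_mean sum_subtractf sum.distrib)

text \<open>Real and imaginary parts of the multipliers and of the function give four real
  transforms; two rounds of \<open>nrm_add_le\<close> make \<open>4*(8 + 8) = 64\<close>.\<close>

lemma complex_umd_bound:
 fixes nu :: "(nat => real) => real" and nu' :: "(nat => complex) => real"
 assumes p: "1 <= p" and K: "0 <= K" and nu: "is_norm d nu" and nu': "!!x. 0 <= nu' x"
  and le: "!!x. nu' x <= nu (%i. Re (x i)) + nu (%i. Im (x i))"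
  and Re: "!!x. nu (%i. Re (x i)) <= nu' x" and Im: "!!x. nu (%i. Im (x i)) <= nu' x"
  and bound: "umd_bound TYPE('w) p nu K"
 shows "umd_bound TYPE('w) p nu' (64*K)"
 unfolding umd_bound_def
proof (intro allI impI)
 fix Om :: "'w set" and wt and lab :: "nat => 'w => 'w" and m and ep :: "nat => complex" and f :: "nat => 'w => complex"
 assume fil: "fin_filtration Om wt lab m" and ep: "ALL k. norm (ep k) <= 1"
 interpret fin_filtration Om wt lab m by fact
 have nu0: "0 <= nu x" for x by (rule is_norm_nonneg[OF nu])
 let ?T = "%e h s. nu (%i. mult_transform Om wt lab e m (h i) s)"
 let ?a = "%k. Re (ep k)" and ?b = "%k. Im (ep k)" and ?g = "%i s. Re (f i s)" and ?h = "%i s. Im (f i s)"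
 have T: "nrm p (?T e h) <= K*nrm p (%s. nu (%i. h i s))" if "!!k. abs (e k) <= 1" for e h
  using bound fil that unfolding umd_bound_def
  by (intro nrm_le_if_sum_le_powr[OF p K nu0 nu0]) (auto simp: real_norm_def)
 have ab: "abs (?a k) <= 1" "abs (?b k) <= 1" for k
  using ep abs_Re_le_cmod[of "ep k"] abs_Im_le_cmod[of "ep k"] by (meson order_trans)+
 let ?F = "nrm p (%s. nu' (%i. f i s))"
 have gh: "K*nrm p (%s. nu (%i. ?g i s)) <= K*?F" "K*nrm p (%s. nu (%i. ?h i s)) <= K*?F"
  using p K Re[of "%i. f i _"] Im[of "%i. f i _"] nu0 nu' by (auto intro!: mult_left_mono nrm_mono)
 have pt: "nu' (%i. mult_transform Om wt lab ep m (f i) s) <= (?T ?a ?g s + ?T ?b ?h s) + (?T ?a ?h s + ?T ?b ?g s)" for s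
 proof -
  have "nu (%i. - 1*mult_transform Om wt lab ?b m (?h i) s) = ?T ?b ?h s"
   using is_norm_scale[OF nu, of "- 1" "%i. mult_transform Om wt lab ?b m (?h i) s"] by simp
  then have "nu (%i. Re (mult_transform Om wt lab ep m (f i) s)) <= ?T ?a ?g s + ?T ?b ?h s"
   unfolding Re_mult_transform
   using is_norm_triangle[OF nu, of "%i. mult_transform Om wt lab ?a m (?g i) s" "%i. - 1*mult_transform Om wt lab ?b m (?h i) s"]
   by simp
  moreover have "nu (%i. Im (mult_transform Om wt lab ep m (f i) s)) <= ?T ?a ?h s + ?T ?b ?g s"
   unfolding Im_mult_transform by (rule is_norm_triangle[OF nu])
  ultimately show ?thesis using le[of "%i. mult_transform Om wt lab ep m (f i) s"] by linarith
 qed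
 have "nrm p (%s. nu' (%i. mult_transform Om wt lab ep m (f i) s))
   <= 4*(nrm p (%s. ?T ?a ?g s + ?T ?b ?h s) + nrm p (%s. ?T ?a ?h s + ?T ?b ?g s))"
  by (rule nrm_add_le[OF p]) (use pt nu0 nu' in auto)
 also have "... <= 4*(4*(K*?F + K*?F) + 4*(K*?F + K*?F))"
 proof (intro mult_left_mono add_mono)
  have two: "nrm p (%s. ?T e h s + ?T e' h' s) <= 4*(nrm p (?T e h) + nrm p (?T e' h'))" for e e' h h'
   by (rule nrm_add_le[OF p abs_triangle_ineq])
  show "nrm p (%s. ?T ?a ?g s + ?T ?b ?h s) <= 4*(K*?F + K*?F)"
   by (intro order_trans[OF two] mult_left_mono add_mono order_trans[OF T gh(1)] order_trans[OF T gh(2)] ab) simp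
  show "nrm p (%s. ?T ?a ?h s + ?T ?b ?g s) <= 4*(K*?F + K*?F)"
   by (intro order_trans[OF two] mult_left_mono add_mono order_trans[OF T gh(1)] order_trans[OF T gh(2)] ab) simp
 qed simp
 finally have "nrm p (%s. nu' (%i. mult_transform Om wt lab ep m (f i) s)) <= 64*K*?F" by simp
 then show "(SUM s:Om. wt s*nu' (%i. mult_transform Om wt lab ep m (f i) s) powr p)
   <= (64*K) powr p*(SUM s:Om. wt s*nu' (%i. f i s) powr p)"
  using sum_le_powr_if_nrm_le[OF p _ nu' nu', of "64*K"] K by simp
qed

lemma H_norm_mono_linear:
 assumes "!!I. norm (SUM i:I. x i) <= norm (SUM i:I. y i)" shows "H_norm n x <= H_norm n y"
 unfolding H_norm_L2_set by (intro L2_set_mono) (auto intro: assms)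

text \<open>A real-linear contraction of the complex numbers, applied to both parts of a
  decomposition, decomposes the image without increasing the norms.\<close>

lemma E_norm_Re: "E_norm n (%i. Re (x i)) <= E_norm n x" and E_norm_Im: "E_norm n (%i. Im (x i)) <= E_norm n x"
proof -
 have "E_norm n (%i. h (x i)) <= E_norm n x"
  if h: "!!a b. h (a + b) = h a + h b" "h 0 = 0" "!!a. abs (h a) <= norm a" for h :: "complex => real"
 proof (rule E_norm_ge)
  fix u v :: "nat => complex" assume uv: "!!i. i : {1..2^n} ==> u i + v i = x i"
  have "E_norm n (%i. h (x i)) <= l1_norm (2^n) (%i. h (u i)) + H_norm n (%i. h (v i))"
   by (rule E_norm_le) (simp add: h(1)[symmetric] uv)
  also have "... <= l1_norm (2^n) u + H_norm n v"
  proof (rule add_mono)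
   show "l1_norm (2^n) (%i. h (u i)) <= l1_norm (2^n) u" unfolding l1_norm_def using h(3) by (simp add: sum_mono)
   show "H_norm n (%i. h (v i)) <= H_norm n v"
   proof (rule H_norm_mono_linear)
    fix I :: "nat set"
    have "(SUM i:I. h (v i)) = h (SUM i:I. v i)" by (induction I rule: infinite_finite_induct) (auto simp: h)
    then show "norm (SUM i:I. h (v i)) <= norm (SUM i:I. v i)" using h(3) by simp
   qed
  qed
  finally show "E_norm n (%i. h (x i)) <= l1_norm (2^n) u + H_norm n v" .
 qed
 from this[of Re] this[of Im] show "E_norm n (%i. Re (x i)) <= E_norm n x" "E_norm n (%i. Im (x i)) <= E_norm n x"
  by (simp_all add: abs_Re_le_cmod abs_Im_le_cmod)
qed

lemma E_norm_of_real: "E_norm n (%i. complex_of_real (x i)) <= E_norm n x"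
proof (rule E_norm_ge)
 fix u v :: "nat => real" assume uv: "!!i. i : {1..2^n} ==> u i + v i = x i"
 have "E_norm n (%i. complex_of_real (x i)) <= l1_norm (2^n) (%i. complex_of_real (u i)) + H_norm n (%i. complex_of_real (v i))"
  by (rule E_norm_le) (simp flip: uv)
 also have "l1_norm (2^n) (%i. complex_of_real (u i)) = l1_norm (2^n) u" unfolding l1_norm_def by simp
 also have "H_norm n (%i. complex_of_real (v i)) <= H_norm n v"
  by (rule H_norm_mono_linear) (simp flip: of_real_sum)
 finally show "E_norm n (%i. complex_of_real (x i)) <= l1_norm (2^n) u + H_norm n v" by simp
qed

lemma E_norm_Re_Im: "E_norm n x <= E_norm n (%i. Re (x i)) + E_norm n (%i. Im (x i))"
proof -
 have "E_norm n x = E_norm n (%i. complex_of_real (Re (x i)) + \<i>*complex_of_real (Im (x i)))"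
  by (simp flip: complex_eq)
 also have "... <= E_norm n (%i. complex_of_real (Re (x i))) + E_norm n (%i. \<i>*complex_of_real (Im (x i)))"
  by (rule is_norm_triangle[OF is_norm_E_norm])
 also have "E_norm n (%i. \<i>*complex_of_real (Im (x i))) = E_norm n (%i. complex_of_real (Im (x i)))"
  by (subst is_norm_scale[OF is_norm_E_norm]) simp
 finally show ?thesis using E_norm_of_real[of n "%i. Re (x i)"] E_norm_of_real[of n "%i. Im (x i)"] by linarith
qed

lemma matrix_norm_Re_Im:
 fixes M :: "nat => nat => real" and M' :: "nat => nat => complex"  and n :: nat
 assumes M: "!!i j. M' i j = complex_of_real (M i j)"
 defines "nu \<equiv> %x. max (linf_norm (2^n) (mat_vec (2^n) M x)) (E_norm n x)"
  and "nu' \<equiv> %x. max (linf_norm (2^n) (mat_vec (2^n) M' x)) (E_norm n x)"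
 shows "nu (%i. Re (x i)) <= nu' x" "nu (%i. Im (x i)) <= nu' x" "nu' x <= nu (%i. Re (x i)) + nu (%i. Im (x i))"
proof -
 have re: "mat_vec (2^n) M (%i. Re (x i)) i = Re (mat_vec (2^n) M' x i)"
  and im: "mat_vec (2^n) M (%i. Im (x i)) i = Im (mat_vec (2^n) M' x i)" for i
  unfolding mat_vec_def by (simp_all add: M)
 have ge: "norm (mat_vec (2^n) M' x i) <= linf_norm (2^n) (mat_vec (2^n) M' x)" if "i : {1..2^n}" for i
  by (rule linf_norm_ge[OF that])
 have "linf_norm (2^n) (mat_vec (2^n) M (%i. Re (x i))) <= linf_norm (2^n) (mat_vec (2^n) M' x)"
  by (rule linf_norm_le) (auto simp: re intro: order_trans[OF abs_Re_le_cmod ge])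
 then show "nu (%i. Re (x i)) <= nu' x" unfolding nu_def nu'_def using E_norm_Re by (intro max.mono)
 have "linf_norm (2^n) (mat_vec (2^n) M (%i. Im (x i))) <= linf_norm (2^n) (mat_vec (2^n) M' x)"
  by (rule linf_norm_le) (auto simp: im intro: order_trans[OF abs_Im_le_cmod ge])
 then show "nu (%i. Im (x i)) <= nu' x" unfolding nu_def nu'_def using E_norm_Im by (intro max.mono)
 have "linf_norm (2^n) (mat_vec (2^n) M' x)
   <= linf_norm (2^n) (mat_vec (2^n) M (%i. Re (x i))) + linf_norm (2^n) (mat_vec (2^n) M (%i. Im (x i)))"
 proof (rule linf_norm_le)
  fix i :: nat assume i: "i : {1..2^n}"
  show "norm (mat_vec (2^n) M' x i) <= linf_norm (2^n) (mat_vec (2^n) M (%i. Re (x i))) + linf_norm (2^n) (mat_vec (2^n) M (%i. Im (x i)))"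
   using cmod_le[of "mat_vec (2^n) M' x i"] linf_norm_ge[OF i, of "mat_vec (2^n) M (%i. Re (x i))"]
    linf_norm_ge[OF i, of "mat_vec (2^n) M (%i. Im (x i))"] by (simp add: re im)
 qed simp
 then show "nu' x <= nu (%i. Re (x i)) + nu (%i. Im (x i))"
  unfolding nu_def nu'_def using E_norm_Re_Im[of n x] by linarith
qed

lemma D_matrix_of_real: "(D_matrix n i j :: complex) = complex_of_real (D_matrix n i j)"
 by (induction n arbitrary: i j) simp_all

lemma X_norm_Re_Im:
 "X_norm n (%i. Re (x i)) <= X_norm n x" "X_norm n (%i. Im (x i)) <= X_norm n x" "X_norm n x <= X_norm n (%i. Re (x i)) + X_norm n (%i. Im (x i))"
 unfolding X_norm_def by (rule matrix_norm_Re_Im; simp add: summation_matrix_def)+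

lemma Y_norm_Re_Im:
 "Y_norm n (%i. Re (x i)) <= Y_norm n x" "Y_norm n (%i. Im (x i)) <= Y_norm n x" "Y_norm n x <= Y_norm n (%i. Re (x i)) + Y_norm n (%i. Im (x i))"
 unfolding Y_norm_def by (rule matrix_norm_Re_Im[OF D_matrix_of_real])+

lemma hilbert_bound_mono: "hilbert_bound p nu K ==> 0 <= K ==> K <= K' ==> 0 <= p ==> hilbert_bound p nu K'"
 unfolding hilbert_bound_def
 by (meson mult_right_mono order_trans powr_ge_zero powr_mono2 sum_nonneg)

lemma umd_bound_mono:
 fixes nu :: "(nat => 'k::real_normed_field) => real"
 shows "umd_bound TYPE('w) p nu K ==> 0 <= K ==> K <= K' ==> 0 <= p ==> umd_bound TYPE('w) p nu K'"
 unfolding umd_bound_def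
proof (intro allI impI)
 fix Om :: "'w set" and wt and lab :: "nat => 'w => 'w" and m and ep :: "nat => 'k" and f :: "nat => 'w => 'k"
 assume *: "ALL (Om :: 'w set) wt lab m ep f. fin_filtration Om wt lab m --> (ALL k. norm (ep k) <= 1) -->
   (SUM s:Om. wt s*nu (%i. mult_transform Om wt lab ep m (f i) s) powr p) <= K powr p*(SUM s:Om. wt s*nu (%i. f i s) powr p)"
  and K: "0 <= K" "K <= K'" "0 <= p" and fil: "fin_filtration Om wt lab m" and ep: "ALL k. norm (ep k) <= 1"
 interpret fin_filtration Om wt lab m by fact
 have "K powr p*(SUM s:Om. wt s*nu (%i. f i s) powr p) <= K' powr p*(SUM s:Om. wt s*nu (%i. f i s) powr p)"
  using K by (intro mult_right_mono powr_mono2 sum_nonneg mult_nonneg_nonneg) (auto simp: wt_nonneg)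
 then show "(SUM s:Om. wt s*nu (%i. mult_transform Om wt lab ep m (f i) s) powr p) <= K' powr p*(SUM s:Om. wt s*nu (%i. f i s) powr p)"
  using *[rule_format, OF fil, of ep f] ep by (meson order_trans)
qed

theorem complex_bounds:
 assumes p: "1 < p"
 shows "EX C>=0. ALL n. discrete_bounds TYPE('w) p (X_norm n :: (nat => complex) => real) (C*(real n+1)) (C * sqrt (real n+1)) &
   discrete_bounds TYPE('w) p (Y_norm n :: (nat => complex) => real) (C * sqrt (real n+1)) (C*(real n+1))"
proof -
 obtain C where C: "0 <= C"
  "!!n. discrete_bounds TYPE('w) p (X_norm n :: (nat => real) => real) (C*(real n+1)) (C * sqrt (real n+1)) &
   discrete_bounds TYPE('w) p (Y_norm n :: (nat => real) => real) (C * sqrt (real n+1)) (C*(real n+1))"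
  using real_bounds[OF p, where 'w = 'w] by blast
 have p1: "1 <= p" "0 <= p" using p by auto
 note X0 = is_norm_nonneg[OF is_norm_X_norm] and Y0 = is_norm_nonneg[OF is_norm_Y_norm]
 note H = hilbert_bound_mono[OF complex_hilbert_bound[OF p1(1)] _ _ p1(2)] and U = complex_umd_bound[OF p1(1)]
 show ?thesis
 proof (intro exI[of _ "64*C"] conjI allI, unfold mult.assoc)
  fix n
  show "hilbert_bound p (X_norm n :: (nat => complex) => real) (64*(C*(real n+1)))"
   by (rule H[OF _ X0 X0 X_norm_Re_Im(3,1,2) conjunct1[OF conjunct1[OF C(2)]]]) (use C(1) in auto)
  show "umd_bound TYPE('w) p (X_norm n :: (nat => complex) => real) (64*(C * sqrt (real n+1)))"
   by (rule U[OF _ is_norm_X_norm X0 X_norm_Re_Im(3,1,2) conjunct2[OF conjunct1[OF C(2)]]]) (use C(1) in auto)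
  show "hilbert_bound p (Y_norm n :: (nat => complex) => real) (64*(C * sqrt (real n+1)))"
   by (rule H[OF _ Y0 Y0 Y_norm_Re_Im(3,1,2) conjunct1[OF conjunct2[OF C(2)]]]) (use C(1) in auto)
  show "umd_bound TYPE('w) p (Y_norm n :: (nat => complex) => real) (64*(C*(real n+1)))"
   by (rule U[OF _ is_norm_Y_norm Y0 Y_norm_Re_Im(3,1,2) conjunct2[OF conjunct2[OF C(2)]]]) (use C(1) in auto)
 qed (use C(1) in simp)
qed

section \<open>The Hilbert transform as a limit of discrete Hilbert transforms\<close>

lemma is_norm_tendsto:
 fixes nu :: "(nat => 'k::real_normed_field) => real"
 assumes nu: "is_norm d nu" and lim: "!!i. i : {1..d} ==> ((%n. x n i) \<longlongrightarrow> y i) F"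
 shows "((%n. nu (x n)) \<longlongrightarrow> nu y) F"
proof (rule LIM_zero_cancel, rule Lim_null_comparison)
 show "\<forall>\<^sub>F n in F. norm (nu (x n) - nu y) <= (SUM i:{1..d}. norm (x n i - y i)*nu (%j. if j = i then 1 else 0))"
  using is_norm_diff_le[OF nu] by (intro always_eventually) simp
 have "((%n. SUM i:{1..d}. norm (x n i - y i)*nu (%j. if j = i then 1 else 0)) \<longlongrightarrow>
   (SUM i:{1..d}. norm (y i - y i)*nu (%j. if j = i then 1 else 0))) F"
  by (intro tendsto_intros lim)
 then show "((%n. SUM i:{1..d}. norm (x n i - y i)*nu (%j. if j = i then 1 else 0)) \<longlongrightarrow> 0) F"
  by simp
qed

lemma ceiling_tendsto: "(%n. of_int \<lceil>t*real (Suc n)\<rceil>/real (Suc n)) \<longlonglongrightarrow> t"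
proof (rule tendsto_sandwich[of "%_. t" _ _ "%n. t + inverse (real (Suc n))"])
 show "(%n. t + inverse (real (Suc n))) \<longlonglongrightarrow> t"
  using tendsto_add[OF tendsto_const LIMSEQ_inverse_real_of_nat, of t] by simp
 show "\<forall>\<^sub>F n in sequentially. t <= of_int \<lceil>t*real (Suc n)\<rceil>/real (Suc n)"
  by (intro always_eventually allI) (simp add: pos_le_divide_eq)
 show "\<forall>\<^sub>F n in sequentially. of_int \<lceil>t*real (Suc n)\<rceil>/real (Suc n) <= t + inverse (real (Suc n))"
 proof (intro always_eventually allI)
  fix n
  have "of_int \<lceil>t*real (Suc n)\<rceil> <= t*real (Suc n) + 1" by linarith
  then have "of_int \<lceil>t*real (Suc n)\<rceil>/real (Suc n) <= (t*real (Suc n)+1)/real (Suc n)"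
   by (rule divide_right_mono) simp
  also have "... = t + inverse (real (Suc n))" by (simp add: add_divide_distrib inverse_eq_divide)
  finally show "of_int \<lceil>t*real (Suc n)\<rceil>/real (Suc n) <= t + inverse (real (Suc n))" .
 qed
qed simp

text \<open>The sums are integrals of step functions, to which dominated convergence applies.
  Continuity at the origin is not asked for, because the symmetrised quotient to be inserted is only
  bounded there.\<close>

lemma Riemann_sum_tendsto:
 fixes ph :: "real => 'b::{banach, second_countable_topology}"
 assumes [measurable]: "ph : borel_measurable borel" and cont: "!!t. t ~= 0 ==> isCont ph t"
  and bound: "!!t. norm (ph t) <= B" and supp: "!!t. real Q < abs t ==> ph t = 0"
 shows "(%n. SUM j:{- int (Suc n*Q)..int (Suc n*Q)}. (1/real (Suc n)) *\<^sub>R ph (of_int j/real (Suc n)))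
  \<longlonglongrightarrow> integral\<^sup>L lborel ph"
proof -
 define s where "s n t = ph (of_int \<lceil>t*real (Suc n)\<rceil>/real (Suc n))" for n t
 have step: "s n t = (SUM j:{- int (Suc n*Q)..int (Suc n*Q)}.
   indicator {(of_int j-1)/real (Suc n)<..of_int j/real (Suc n)} t *\<^sub>R ph (of_int j/real (Suc n)))" for n t
 proof -
  have ind: "indicator {(of_int j-1)/real (Suc n)<..of_int j/real (Suc n)} t = (if j = \<lceil>t*real (Suc n)\<rceil> then 1 else (0::real))" for j
  proof -
   have "t : {(of_int j-1)/real (Suc n)<..of_int j/real (Suc n)} \<longleftrightarrow> \<lceil>t*real (Suc n)\<rceil> = j"
    unfolding ceiling_eq_iff by (simp add: pos_divide_less_eq pos_le_divide_eq)
   then show ?thesis by (auto simp: indicator_def)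
  qed
  have "(SUM j:{- int (Suc n*Q)..int (Suc n*Q)}. (if j = \<lceil>t*real (Suc n)\<rceil> then 1 else (0::real)) *\<^sub>R ph (of_int j/real (Suc n)))
    = (SUM j:{- int (Suc n*Q)..int (Suc n*Q)}. if j = \<lceil>t*real (Suc n)\<rceil> then s n t else 0)"
   unfolding s_def by (intro sum.cong) auto
  also have "... = s n t"
  proof (cases "\<lceil>t*real (Suc n)\<rceil> : {- int (Suc n*Q)..int (Suc n*Q)}")
   case False
   define c where "c = \<lceil>t*real (Suc n)\<rceil>"
   have "int (Suc n*Q) < abs c" using False unfolding c_def[symmetric] atLeastAtMost_iff by linarith
   then have "real_of_int (int (Suc n*Q)) < real_of_int (abs c)" by (simp only: of_int_less_iff)
   then have "real Q < abs (of_int c/real (Suc n))"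
    by (simp add: pos_less_divide_eq algebra_simps)
   then have "real Q < abs (of_int \<lceil>t*real (Suc n)\<rceil>/real (Suc n))" unfolding c_def .
   then have "s n t = 0" unfolding s_def by (rule supp)
   then show ?thesis by simp
  qed simp
  finally show ?thesis unfolding ind by simp
 qed
 have int_s: "integral\<^sup>L lborel (s n) = (SUM j:{- int (Suc n*Q)..int (Suc n*Q)}. (1/real (Suc n)) *\<^sub>R ph (of_int j/real (Suc n)))" for n
 proof -
  have len: "measure lborel {(of_int j-1)/real (Suc n)<..of_int j/real (Suc n)} = 1/real (Suc n)" for j
  proof -
   have "(of_int j-1)/real (Suc n) <= of_int j/real (Suc n)" by (intro divide_right_mono) auto
   then show ?thesis by (simp add: diff_divide_distrib)
  qed
  have Ioc: "integrable lborel (indicat_real {a<..b})" for a b :: real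
   by (cases "a <= b") auto
  have "integral\<^sup>L lborel (s n) = (SUM j:{- int (Suc n*Q)..int (Suc n*Q)}.
    integral\<^sup>L lborel (%t. indicator {(of_int j-1)/real (Suc n)<..of_int j/real (Suc n)} t *\<^sub>R ph (of_int j/real (Suc n))))"
   unfolding step[abs_def] by (rule Bochner_Integration.integral_sum) (intro integrable_scaleR_left Ioc)
  also have "... = (SUM j:{- int (Suc n*Q)..int (Suc n*Q)}. (1/real (Suc n)) *\<^sub>R ph (of_int j/real (Suc n)))"
  proof (intro sum.cong refl)
   fix j
   have "integral\<^sup>L lborel (indicat_real {(of_int j-1)/real (Suc n)<..of_int j/real (Suc n)}) = 1/real (Suc n)"
    using len[of j] by simp
   then show "(LINT t|lborel. indicat_real {(of_int j-1)/real (Suc n)<..of_int j/real (Suc n)} t *\<^sub>R ph (of_int j/real (Suc n)))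
     = (1/real (Suc n)) *\<^sub>R ph (of_int j/real (Suc n))"
    by (simp only: integral_scaleR_left[OF Ioc])
  qed
  finally show ?thesis .
 qed
 have "(%n. integral\<^sup>L lborel (s n)) \<longlonglongrightarrow> integral\<^sup>L lborel ph"
 proof (rule integral_dominated_convergence[where w = "%t. B*indicator {- (real Q+1)..real Q + 1} t"])
  show "s n : borel_measurable lborel" for n
   unfolding s_def by measurable
  show "integrable lborel (%t. B*indicator {- (real Q+1)..real Q + 1} t)" by simp
  show "AE t in lborel. (%n. s n t) \<longlonglongrightarrow> ph t"
   using AE_lborel_singleton[of 0]
  proof eventually_elim
   case (elim t)
   show ?case unfolding s_def by (rule isCont_tendsto_compose[OF cont[OF elim] ceiling_tendsto])
  qed
  show "AE t in lborel. norm (s n t) <= B*indicator {- (real Q+1)..real Q + 1} t" for n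
  proof (rule AE_I2)
   fix t
   show "norm (s n t) <= B*indicator {- (real Q+1)..real Q + 1} t"
   proof (cases "t : {- (real Q+1)..real Q + 1}")
    case True
    then show ?thesis using bound unfolding s_def by simp
   next
    case False
    let ?c = "of_int \<lceil>t*real (Suc n)\<rceil>/real (Suc n)"
    have "t <= ?c" by (simp add: pos_le_divide_eq)
    moreover have "?c <= t + 1"
    proof -
     have "of_int \<lceil>t*real (Suc n)\<rceil> <= t*real (Suc n) + 1" by linarith
     also have "... <= (t+1)*real (Suc n)" by (simp add: algebra_simps)
     finally show ?thesis by (simp add: pos_divide_le_eq)
    qed
    moreover have "t < - (real Q+1) | real Q + 1 < t" using False by force
    ultimately have "real Q < abs ?c" by linarith
    then have "s n t = 0" unfolding s_def by (rule supp)
    then show ?thesis using False by simp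
   qed
  qed
 qed simp
 then show ?thesis unfolding int_s .
qed

text \<open>The symmetrised quotient \<open>ph\<close> is bounded by the mean value inequality, so
  the principal value is half of an ordinary integral. Its symmetric Riemann sums are discrete
  Hilbert transforms of the samples of \<open>h\<close>: the mesh cancels against the denominator,
  and the term \<open>j = 0\<close> is zero by division by zero, as in the discrete
  transform.\<close>

lemma Hilbert_transform_tendsto:
 fixes h :: "real => 'b::{banach, second_countable_topology}"
 assumes C1: "h C1_differentiable_on UNIV" and supp: "!!y. h y ~= 0 ==> abs y <= R" and Q: "R + abs x <= real Q"
 shows "(%n. SUM j:{- int (Suc n*Q)..int (Suc n*Q)}. (1/of_int j) *\<^sub>R h (x - of_int j/real (Suc n)))
  \<longlonglongrightarrow> pi *\<^sub>R hilbert_transform h x"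
proof -
 obtain h' where h': "!!y. (h has_vector_derivative h' y) (at y)" and h'c: "continuous_on UNIV h'"
  using C1 unfolding C1_differentiable_on_def by auto
 have hc: "isCont h y" for y using h' has_vector_derivative_continuous by blast
 have hcont: "continuous_on UNIV h" using hc by (simp add: continuous_at_imp_continuous_on)
 have [measurable]: "h : borel_measurable borel" by (rule borel_measurable_continuous_onI[OF hcont])
 define ph where "ph t = (1/t) *\<^sub>R (h (x - t) - h (x + t))" for t
 have [measurable]: "ph : borel_measurable borel" unfolding ph_def by measurable
 have ph0: "ph t = 0" if "real Q < abs t" for t
 proof -
  have "R < abs (x - t)" "R < abs (x + t)" using that Q by linarith+
  then have "h (x - t) = 0" "h (x + t) = 0" using supp by force+
  then show ?thesis unfolding ph_def by simp
 qed
 have phcont: "isCont ph t" if "t ~= 0" for t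
 proof -
  have "isCont (%t. h (x - t)) t" "isCont (%t. h (x + t)) t"
   by (rule isCont_o2[OF _ hc], intro continuous_intros)+
  then show ?thesis unfolding ph_def using that by (intro continuous_intros) auto
 qed
 let ?I = "{x - real Q..x + real Q}"
 obtain B where B: "!!y. y : ?I ==> norm (h' y) <= B"
 proof -
  have "compact (h' ` ?I)" by (intro compact_continuous_image continuous_on_subset[OF h'c]) auto
  then have "bounded (h' ` ?I)" by (rule compact_imp_bounded)
  then show ?thesis using that unfolding bounded_iff by blast
 qed
 have "0 <= B" by (rule order_trans[OF norm_ge_zero B[of x]]) simp
 have phB: "norm (ph t) <= 2*B" for t
 proof (cases "abs t <= real Q & t ~= 0")
  case True
  have "norm (h (x - t) - h (x + t)) <= B*norm ((x - t) - (x + t))"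
  proof (rule differentiable_bound[where S = ?I and f' = "%y r. r *\<^sub>R h' y"])
   show "(h has_derivative (%r. r *\<^sub>R h' y)) (at y within ?I)" for y
    using h'[of y] unfolding has_vector_derivative_def by (rule has_derivative_at_withinI)
   show "onorm (%r. r *\<^sub>R h' y) <= B" if "y : ?I" for y
    using mult_left_mono[OF B[OF that], of "abs _"] by (intro onorm_le) (simp add: mult.commute)
  qed (use True in auto)
  also have "norm ((x - t) - (x + t)) = 2*abs t" unfolding real_norm_def by linarith
  finally show ?thesis unfolding ph_def using True by (simp add: divide_le_eq mult_ac)
 next
  case False
  then have "ph t = 0" using ph0[of t] by (auto simp: ph_def)
  then show ?thesis using \<open>0 <= B\<close> by simp
 qed
 have intph: "integrable lborel ph"
 proof (rule Bochner_Integration.integrable_bound)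
  show "integrable lborel (%t. 2*B*indicator {- real Q..real Q} t)" by simp
  show "AE t in lborel. norm (ph t) <= norm (2*B*indicator {- real Q..real Q} t)"
  proof (rule AE_I2)
   show "norm (ph t) <= norm (2*B*indicator {- real Q..real Q} t)" for t
    using phB[of t] ph0[of t] \<open>0 <= B\<close> by (cases "t : {- real Q..real Q}") auto
  qed
 qed simp
 have trunc: "(LINT y:{y. ep < abs (x - y)}|lborel. (1/(x - y)) *\<^sub>R h y) = (1/2) *\<^sub>R (LINT t|lborel. indicator {t. ep < abs t} t *\<^sub>R ph t)"
  if ep: "0 < ep" for ep
 proof -
  define k where "k t = indicator {t. ep < abs t} t *\<^sub>R ((1/t) *\<^sub>R h (x - t))" for t :: real
  have [measurable]: "k : borel_measurable borel" unfolding k_def by measurable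
  have "bounded (h ` {- R..R})"
   by (intro compact_imp_bounded compact_continuous_image continuous_on_subset[OF hcont]) auto
  then obtain M where M: "!!y. y : {- R..R} ==> norm (h y) <= M" unfolding bounded_iff by blast
  have intk: "integrable lborel k"
  proof (rule Bochner_Integration.integrable_bound)
   show "integrable lborel (%t. (M/ep)*indicator {- real Q..real Q} t)" by simp
   show "AE t in lborel. norm (k t) <= norm ((M/ep)*indicator {- real Q..real Q} t)"
   proof (rule AE_I2)
    fix t
    show "norm (k t) <= norm ((M/ep)*indicator {- real Q..real Q} t)"
    proof (cases "ep < abs t & h (x - t) ~= 0")
     case True
     then have R: "abs (x - t) <= R" using supp by blast
     then have "x - t : {- R..R}" "t : {- real Q..real Q}" using Q unfolding atLeastAtMost_iff by linarith+
     then have "norm (h (x - t)) <= M" "t : {- real Q..real Q}" using M by blast+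
     moreover have "norm (h (x - t))/abs t <= norm (h (x - t))/ep" using True ep by (intro divide_left_mono) auto
     moreover have "norm (h (x - t))/ep <= M/ep" using \<open>norm (h (x - t)) <= M\<close> ep by (intro divide_right_mono) auto
     moreover have "norm (k t) = norm (h (x - t))/abs t" unfolding k_def using True by simp
     moreover have "0 <= M" using \<open>norm (h (x - t)) <= M\<close> norm_ge_zero order_trans by blast
     ultimately show ?thesis using ep by simp
    next
     case False
     then show ?thesis unfolding k_def by auto
    qed
   qed
  qed simp
  have "(LINT y:{y. ep < abs (x - y)}|lborel. (1/(x - y)) *\<^sub>R h y) = (LINT y|lborel. k (x - y))"
   unfolding set_lebesgue_integral_def k_def by (intro Bochner_Integration.integral_cong) (auto simp: indicator_def)
  also have "... = (LINT t|lborel. k t)"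
   using lborel_integral_real_affine[of "-1" k x] by simp
  finally have 1: "(LINT y:{y. ep < abs (x - y)}|lborel. (1/(x - y)) *\<^sub>R h y) = (LINT t|lborel. k t)" .
  have 2: "(LINT t|lborel. k t) = (LINT t|lborel. k (- t))"
   using lborel_integral_real_affine[of "-1" k 0] by simp
  have intk': "integrable lborel (%t. k (- t))"
   using lborel_integrable_real_affine[OF intk, of "-1" 0] by simp
  have "(LINT t|lborel. k t) + (LINT t|lborel. k (- t)) = (LINT t|lborel. k t + k (- t))"
   by (rule Bochner_Integration.integral_add[symmetric, OF intk intk'])
  also have "... = (LINT t|lborel. indicator {t. ep < abs t} t *\<^sub>R ph t)"
   unfolding k_def ph_def by (intro Bochner_Integration.integral_cong) (auto simp: indicator_def scaleR_diff_right)
  finally have "2 *\<^sub>R (LINT t|lborel. k t) = (LINT t|lborel. indicator {t. ep < abs t} t *\<^sub>R ph t)"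
   unfolding 2[symmetric] by (simp add: scaleR_2)
  then have "(1/2) *\<^sub>R (2 *\<^sub>R (LINT t|lborel. k t)) = (1/2) *\<^sub>R (LINT t|lborel. indicator {t. ep < abs t} t *\<^sub>R ph t)" by simp
  then show ?thesis unfolding 1 by simp
 qed
 have lim: "((%ep. LINT y:{y. ep < abs (x - y)}|lborel. (1/(x - y)) *\<^sub>R h y) \<longlongrightarrow> (1/2) *\<^sub>R integral\<^sup>L lborel ph) (at_right 0)"
 proof (rule tendsto_at_right_sequentially[where b = 1])
  fix ep :: "nat => real" assume ep: "!!n. 0 < ep n" "ep \<longlonglongrightarrow> 0"
  have "(%n. LINT t|lborel. indicator {t. ep n < abs t} t *\<^sub>R ph t) \<longlonglongrightarrow> integral\<^sup>L lborel ph"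
  proof (rule integral_dominated_convergence[where w = "%t. norm (ph t)"])
   show "integrable lborel (%t. norm (ph t))" using intph by simp
   show "AE t in lborel. (%n. indicator {t. ep n < abs t} t *\<^sub>R ph t) \<longlonglongrightarrow> ph t"
    using AE_lborel_singleton[of 0]
   proof eventually_elim
    case (elim t)
    have "\<forall>\<^sub>F n in sequentially. ep n < abs t" using order_tendstoD(2)[OF ep(2), of "abs t"] elim by simp
    then have "\<forall>\<^sub>F n in sequentially. ph t = indicator {t. ep n < abs t} t *\<^sub>R ph t" by eventually_elim simp
    then show ?case by (rule Lim_transform_eventually[OF tendsto_const])
   qed
   show "AE t in lborel. norm (indicator {t. ep n < abs t} t *\<^sub>R ph t) <= norm (ph t)" for n
    by (intro AE_I2) (auto simp: indicator_def)
  qed measurable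
  then have "(%n. (1/2) *\<^sub>R (LINT t|lborel. indicator {t. ep n < abs t} t *\<^sub>R ph t)) \<longlonglongrightarrow> (1/2) *\<^sub>R integral\<^sup>L lborel ph"
   by (intro tendsto_intros)
  then show "(%n. LINT y:{y. ep n < abs (x - y)}|lborel. (1/(x - y)) *\<^sub>R h y) \<longlonglongrightarrow> (1/2) *\<^sub>R integral\<^sup>L lborel ph"
   by (simp only: trunc[OF ep(1)])
 qed simp
 have "hilbert_transform h x = (1/pi) *\<^sub>R ((1/2) *\<^sub>R integral\<^sup>L lborel ph)"
  unfolding hilbert_transform_def using tendsto_Lim[OF trivial_limit_at_right_real lim] by simp
 then have ht: "pi *\<^sub>R hilbert_transform h x = (1/2) *\<^sub>R integral\<^sup>L lborel ph" by simp
 have "(%n. (1/2) *\<^sub>R (SUM j:{- int (Suc n*Q)..int (Suc n*Q)}. (1/real (Suc n)) *\<^sub>R ph (of_int j/real (Suc n))))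
   \<longlonglongrightarrow> (1/2) *\<^sub>R integral\<^sup>L lborel ph"
  by (intro tendsto_intros Riemann_sum_tendsto[where B = "2*B"] phcont phB ph0) auto
 moreover have "(1/2) *\<^sub>R (SUM j:{- int L..int L}. (1/real (Suc n)) *\<^sub>R ph (of_int j/real (Suc n)))
   = (SUM j:{- int L..int L}. (1/of_int j) *\<^sub>R h (x - of_int j/real (Suc n)))" for n L
 proof -
  define a where "a j = (1/of_int j) *\<^sub>R h (x - of_int j/real (Suc n))" for j
  have "(1/real (Suc n)) *\<^sub>R ph (of_int j/real (Suc n)) = a j + a (- j)" for j
   unfolding ph_def a_def by (simp add: scaleR_diff_right)
  moreover have "(SUM j:{- int L..int L}. a (- j)) = (SUM j:{- int L..int L}. a j)"
   by (rule sum.reindex_bij_witness[of _ uminus uminus]) auto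
  ultimately show ?thesis unfolding a_def[symmetric] by (simp add: sum.distrib scaleR_2[symmetric])
 qed
 ultimately show ?thesis unfolding ht by (simp only:)
qed

section \<open>Transference from the integers to the line\<close>

abbreviation Lp_int :: "'s measure => real => ('x => real) => ('s => 'x) => ennreal" where
 "Lp_int M p nu u == \<integral>\<^sup>+ s. ennreal (nu (u s) powr p) \<partial>M"

lemma Lp_norm_leI:
 assumes p: "0 < p" and C: "0 < C"
  and le: "Lp_int M p nu g <= ennreal (C powr p)*Lp_int M p nu f"
 shows "Lp_norm M p nu g <= ennreal C*Lp_norm M p nu f"
proof (cases "Lp_int M p nu f = \<infinity>")
 case True
 then show ?thesis using C unfolding Lp_norm_def by (simp add: ennreal_mult_top)
next
 case False
 then obtain a where a: "Lp_int M p nu f = ennreal a" "0 <= a"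
  by (metis ennreal_cases infinity_ennreal_def)
 have le': "Lp_int M p nu g <= ennreal (C powr p*a)"
  using le a by (simp add: ennreal_mult)
 then have "Lp_int M p nu g ~= \<infinity>" by (auto simp: top_unique)
 then obtain b where b: "Lp_int M p nu g = ennreal b" "0 <= b"
  by (metis ennreal_cases infinity_ennreal_def)
 have "b <= C powr p*a" using le' a b by (simp add: ennreal_le_iff)
 then have "b powr (1/p) <= (C powr p*a) powr (1/p)" using b p by (intro powr_mono2) auto
 also have "... = C*a powr (1/p)" using C a p by (simp add: powr_mult powr_powr)
 finally show ?thesis using a b C unfolding Lp_norm_def Let_def by (simp flip: ennreal_mult add: ennreal_leI)
qed

text \<open>For fixed \<open>x\<close> the samples of \<open>f\<close> on the grid through
  \<open>x\<close> form a function on \<open>G\<close>, to which the discrete bound applies. Seen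
  from a point \<open>k\<close> of the inner half \<open>B\<close>, the set \<open>G\<close>
  contains every grid point that can carry a nonzero sample, so the truncated transform is the full
  one, shifted by \<open>k\<close> steps. Summing over \<open>k\<close> in \<open>B\<close> and
  using translation invariance gives the bound, with the factor \<open>2\<close> from
  \<open>card G <= 2 * card B\<close>.\<close>

lemma translation_average:
 fixes f :: "real => nat => 'k::{real_normed_field, banach, second_countable_topology}"
 assumes nu: "is_norm d nu" and f: "!!i. i : {1..d} ==> (%x. f x i) : borel_measurable borel"
  and bound: "hilbert_bound p nu K" and supp: "!!x i. f x i ~= 0 ==> abs x <= R" and de: "0 < de" and L: "R + R' <= real L*de"
 shows "(\<integral>\<^sup>+ x. ennreal (nu (%i. SUM j:{- int L..int L}. (1/of_int j) *\<^sub>R f (x - of_int j*de) i) powr p)*indicator {- R'..R'} x \<partial>lborel)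
  <= ennreal (2*K powr p)*Lp_int lborel p nu f"
proof -
 define H where "H x i = (SUM j:{- int L..int L}. (1/of_int j) *\<^sub>R f (x - of_int j*de) i)" for x i
 define G where "G = {- int (2*L)..int (2*L)}"
 define B where "B = {- int L..int L}"
 have finG: "finite G" "finite B" unfolding G_def B_def by auto
 have nu0: "0 <= nu x" for x by (rule is_norm_nonneg[OF nu])
 have num: "(%x. ennreal (nu (g x) powr p)) : borel_measurable borel"
  if "!!i. i : {1..d} ==> (%x. g x i) : borel_measurable borel" for g :: "real => nat => 'k"
  using is_norm_measurable[OF nu, of g borel] that by measurable
 have fm: "(%x. f (x + c) i) : borel_measurable borel" if "i : {1..d}" for c i
  by (rule measurable_compose[OF _ f[OF that]]) measurable
 have trans: "(\<integral>\<^sup>+ x. u (x + c) \<partial>lborel) = (\<integral>\<^sup>+ x. u x \<partial>lborel)" if "u : borel_measurable borel" for u :: "real => ennreal" and c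
  using nn_integral_real_affine[OF that, of 1 c] by (simp add: add.commute)
 define T where "T k x i = (SUM l:G. (1/of_int (k - l)) *\<^sub>R f (x + of_int l*de) i)" for k x i
 have Tm: "(%x. T k x i) : borel_measurable borel" if "i : {1..d}" for k i
  unfolding T_def using fm[OF that] by measurable
 define I where "I = Lp_int lborel p nu f"
 define A where "A = (\<integral>\<^sup>+ x. ennreal (nu (H x) powr p)*indicator {- R'..R'} x \<partial>lborel)"
 have "(SUM k:G. Lp_int lborel p nu (T k)) = (\<integral>\<^sup>+ x. (SUM k:G. ennreal (nu (T k x) powr p)) \<partial>lborel)"
  by (rule nn_integral_sum[symmetric]) (unfold measurable_lborel2, rule num[OF Tm])
 also have "... <= (\<integral>\<^sup>+ x. ennreal (K powr p)*(SUM k:G. ennreal (nu (f (x + of_int k*de)) powr p)) \<partial>lborel)"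
 proof (rule nn_integral_mono)
  fix x
  have "(SUM k:G. nu (T k x) powr p) <= K powr p*(SUM k:G. nu (f (x + of_int k*de)) powr p)"
   using bound[unfolded hilbert_bound_def, rule_format, OF finG(1), of "%i k. f (x + of_int k*de) i"]
   unfolding T_def[abs_def] .
  then have "ennreal (SUM k:G. nu (T k x) powr p) <= ennreal (K powr p*(SUM k:G. nu (f (x + of_int k*de)) powr p))"
   by (rule ennreal_leI)
  then show "(SUM k:G. ennreal (nu (T k x) powr p)) <= ennreal (K powr p)*(SUM k:G. ennreal (nu (f (x + of_int k*de)) powr p))"
   by (simp add: ennreal_mult sum_nonneg)
 qed
 also have "... = ennreal (K powr p)*(SUM k:G. Lp_int lborel p nu (%x. f (x + of_int k*de)))"
  by (subst nn_integral_cmult, unfold measurable_lborel2, intro borel_measurable_sum num fm, assumption,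
    subst nn_integral_sum, unfold measurable_lborel2) (intro num fm, assumption, rule refl)
 also have "... = ennreal (K powr p)*(of_nat (card G)*I)"
  using trans[OF num[OF f]] unfolding I_def by simp
 finally have up: "(SUM k:G. Lp_int lborel p nu (T k)) <= ennreal (K powr p)*(of_nat (card G)*I)" .
 have low: "A <= Lp_int lborel p nu (T k)" if k: "k : B" for k
 proof -
  have "A <= Lp_int lborel p nu (%x. T k (x + - (of_int k*de)))"
   unfolding A_def
  proof (rule nn_integral_mono)
   fix x
   show "ennreal (nu (H x) powr p)*indicator {- R'..R'} x <= ennreal (nu (T k (x + - (of_int k*de))) powr p)"
   proof (cases "x : {- R'..R'}")
    case True
    have far: "f (x - of_int j*de) i = 0" if "int L < abs j" for i j
    proof (rule ccontr)
     assume "f (x - of_int j*de) i ~= 0"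
     then have "abs (x - of_int j*de) <= R" by (rule supp)
     then have "abs (of_int j*de) <= R + R'" using True by auto
     then have "abs (of_int j)*de <= R + R'" using de by (simp add: abs_mult)
     then have "abs (of_int j)*de <= real L*de" using L by linarith
     then have "abs (of_int j) <= real L" by (rule mult_right_le_imp_le) (rule de)
     then show False using that by linarith
    qed
    have "T k (x + - (of_int k*de)) i = H x i" for i
    proof -
     have "T k (x + - (of_int k*de)) i = (SUM l:G. (1/of_int (k - l)) *\<^sub>R f (x - of_int (k - l)*de) i)"
      unfolding T_def by (simp add: algebra_simps)
     also have "... = (SUM j:(%l. k - l) ` G. (1/of_int j) *\<^sub>R f (x - of_int j*de) i)"
      by (subst sum.reindex) (auto simp: inj_on_def)
     also have "... = H x i" unfolding H_def
     proof (rule sum.mono_neutral_right)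
      show "{- int L..int L} \<subseteq> (%l. k - l) ` G"
      proof
       fix j assume "j : {- int L..int L}"
       then have "k - j : G" using k unfolding G_def B_def by auto
       then show "j : (%l. k - l) ` G" by (intro image_eqI[of _ _ "k - j"]) auto
      qed
      show "ALL j:(%l. k - l) ` G - {- int L..int L}. (1/of_int j) *\<^sub>R f (x - of_int j*de) i = 0"
      proof
       fix j assume "j : (%l. k - l) ` G - {- int L..int L}"
       then have "int L < abs j" by auto
       then show "(1/of_int j) *\<^sub>R f (x - of_int j*de) i = 0" using far by simp
      qed
     qed (use finG in simp)
     finally show ?thesis .
    qed
    then have "T k (x + - (of_int k*de)) = H x" by (rule ext)
    then show ?thesis using True by simp
   qed simp
  qed
  also have "... = Lp_int lborel p nu (T k)"
   by (rule trans[OF num[OF Tm]])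
  finally show ?thesis .
 qed
 have "of_nat (card B)*A = (SUM k:B. A)" by simp
 also have "... <= (SUM k:B. Lp_int lborel p nu (T k))" by (rule sum_mono[OF low])
 also have "... <= (SUM k:G. Lp_int lborel p nu (T k))"
  by (rule sum_mono2) (auto simp: G_def B_def)
 also note up
 also have "ennreal (K powr p)*(of_nat (card G)*I) <= ennreal (K powr p)*(of_nat (2*card B)*I)"
  unfolding G_def B_def by (intro mult_left_mono mult_right_mono) (auto simp del: of_nat_mult)
 also have "... = of_nat (card B)*(ennreal (2*K powr p)*I)"
  by (simp add: ennreal_mult mult_ac)
 finally have "of_nat (card B)*A <= of_nat (card B)*(ennreal (2*K powr p)*I)" .
 moreover have "(of_nat (card B) :: ennreal) ~= 0" "(of_nat (card B) :: ennreal) ~= \<infinity>" unfolding B_def by auto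
 ultimately have "A <= ennreal (2*K powr p)*I"
  by (simp add: ennreal_mult_le_mult_iff)
 then show ?thesis unfolding A_def I_def H_def[abs_def] .
qed

lemma nn_integral_le_incseq:
 assumes A: "range A \<subseteq> sets M" "(\<Union>n. A n) = space M" "incseq A" and [measurable]: "u : borel_measurable M"
  and le: "!!n. (\<integral>\<^sup>+ s. u s*indicator (A n) s \<partial>M) <= B"
 shows "(\<integral>\<^sup>+ s. u s \<partial>M) <= B"
proof -
 have [measurable]: "A n : sets M" for n using A(1) by auto
 have "(\<integral>\<^sup>+ s. u s \<partial>M) = (\<integral>\<^sup>+ s. (SUP n. u s*indicator (A n) s) \<partial>M)"
 proof (rule nn_integral_cong)
  fix s assume "s : space M"
  then obtain n where "s : A n" using A(2) by blast
  then have n: "u s = u s*indicator (A n) s" by simp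
  show "u s = (SUP n. u s*indicator (A n) s)"
  proof (rule antisym)
   show "u s <= (SUP n. u s*indicator (A n) s)" by (subst n) (rule SUP_upper, simp)
  qed (intro SUP_least, simp add: indicator_def)
 qed
 also have "... = (SUP n. \<integral>\<^sup>+ s. u s*indicator (A n) s \<partial>M)"
 proof (rule nn_integral_monotone_convergence_SUP)
  have "indicator (A n) s <= (indicator (A n') s :: ennreal)" if "n <= n'" for n n' s
   using incseqD[OF A(3) that] by (auto simp: indicator_def)
  then show "incseq (%n s. u s*indicator (A n) s)"
   unfolding incseq_def le_fun_def by (intro allI impI mult_left_mono) auto
 qed measurable
 also have "... <= B" by (rule SUP_least[OF le])
 finally show ?thesis .
qed

text \<open>Fatou's lemma is applied on bounded intervals, where one window \<open>Q\<close> serves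
  all points. The normalisation by \<open>pi\<close> is only used in the form
  \<open>1 <= pi\<close>, and \<open>2\<close> times \<open>K powr p\<close> is at most
  \<open>(2*K) powr p\<close>. Coordinates outside of \<open>{1..d}\<close> are set to zero so that
  all coordinates have a common bounded support.\<close>

theorem hilbert_const_le:
 fixes nu :: "(nat => 'k::{real_normed_field, banach, second_countable_topology}) => real"
 assumes nu: "is_norm d nu" and p: "1 <= p" and K: "0 < K" and bound: "hilbert_bound p nu K"
 shows "hilbert_const p d nu <= ennreal (2*K)"
 unfolding hilbert_const_def
proof (intro Inf_lower CollectI allI impI)
 fix f0 :: "real => nat => 'k" assume f0: "C1_compact_support d f0"
 define f where "f x i = (if i : {1..d} then f0 x i else 0)" for x i
 have C1: "(%x. f x i) C1_differentiable_on UNIV" if "i : {1..d}" for i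
  using f0 that unfolding C1_compact_support_def f_def by simp
 have "EX R. ALL x. f x i ~= 0 --> abs x <= R" for i
 proof (cases "i : {1..d}")
  case True
  then have "compact (closure {x. f x i ~= 0})" using f0 unfolding C1_compact_support_def f_def by simp
  then have "bounded {x. f x i ~= 0}" using bounded_closure_image bounded_subset closure_subset compact_imp_bounded by metis
  then show ?thesis unfolding bounded_iff by auto
 next
  case False
  then show ?thesis unfolding f_def by (intro exI[of _ 0]) (simp only: if_False, simp)
 qed
 then obtain r where r: "!!x i. f x i ~= 0 ==> abs x <= r i" by metis
 define R where "R = (SUM i:{1..d}. abs (r i))"
 have R: "abs x <= R" if "f x i ~= 0" for x i
 proof -
  have i: "i : {1..d}" using that unfolding f_def by (simp split: if_splits)
  have "abs x <= abs (r i)" using r[OF that] by linarith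
  also have "... <= R" unfolding R_def using i by (intro member_le_sum) auto
  finally show ?thesis .
 qed
 have fm: "(%x. f x i) : borel_measurable borel" for i
 proof (cases "i : {1..d}")
  case True
  have "continuous_on UNIV (%x. f x i)"
   using C1[OF True] C1_differentiable_imp_continuous_on by blast
  then show ?thesis by (rule borel_measurable_continuous_onI)
 next
  case False
  then have "(%x. f x i) = (%_. 0)" unfolding f_def by (simp only: if_False)
  then show ?thesis by simp
 qed
 define H where "H x i = hilbert_transform (%y. f0 y i) x" for x i
 define S where "S Q n x i = (SUM j:{- int (Suc n*Q)..int (Suc n*Q)}. (1/of_int j) *\<^sub>R f (x - of_int j*(1/real (Suc n))) i)" for Q n x i
 have Sm: "(%x. S Q n x i) : borel_measurable borel" for Q n i
 proof -
  have "(%x. f (x - c) i) : borel_measurable borel" for c by (rule measurable_compose[OF _ fm]) measurable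
  then show ?thesis unfolding S_def by measurable
 qed
 have S: "(%n. S Q n x i) \<longlonglongrightarrow> pi *\<^sub>R H x i" if i: "i : {1..d}" and Q: "R + abs x <= real Q" for Q x i
 proof -
  have "(%x. f x i) = (%x. f0 x i)" unfolding f_def using i by (simp only: if_True)
  moreover have "(%n. S Q n x i) \<longlonglongrightarrow> pi *\<^sub>R hilbert_transform (%x. f x i) x"
   unfolding S_def times_divide_eq_right mult_1_right
   by (rule Hilbert_transform_tendsto[OF C1[OF i] _ Q]) (rule R)
  ultimately show ?thesis unfolding H_def by simp
 qed
 define I where "I = Lp_int lborel p nu f0"
 have I: "I = Lp_int lborel p nu f"
  unfolding I_def by (intro nn_integral_cong arg_cong[where f = ennreal] arg_cong2[where f = "(powr)"] is_norm_cong[OF nu]) (auto simp: f_def)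
 let ?A = "%N. {- real N..real N}" and ?i = "%N. indicator {- real N..real N} :: real => ennreal" and ?r = "%N. indicator {- real N..real N} :: real => real"
 have nu0: "0 <= nu x" for x by (rule is_norm_nonneg[OF nu])
 have part: "(\<integral>\<^sup>+ x. ennreal (nu (H x) powr p)*?i N x \<partial>lborel) <= ennreal (2*K powr p)*I" for N
 proof -
  obtain Q where Q: "R + real N <= real Q" using real_arch_simple by blast
  have "(\<integral>\<^sup>+ x. ennreal (nu (H x) powr p)*?i N x \<partial>lborel)
    <= (\<integral>\<^sup>+ x. liminf (%n. ennreal (nu (S Q n x) powr p)*?i N x) \<partial>lborel)"
  proof (rule nn_integral_mono)
   fix x
   show "ennreal (nu (H x) powr p)*?i N x
     <= liminf (%n. ennreal (nu (S Q n x) powr p)*?i N x)"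
   proof (cases "x : ?A N")
    case True
    then have "R + abs x <= real Q" using Q by auto
    then have "(%n. nu (S Q n x)) \<longlonglongrightarrow> nu (%i. pi *\<^sub>R H x i)" by (intro is_norm_tendsto[OF nu] S)
    also have "nu (%i. pi *\<^sub>R H x i) = pi*nu (H x)"
     using is_norm_scale[OF nu, of "of_real pi" "H x"] by (simp add: scaleR_conv_of_real)
    finally have "(%n. nu (S Q n x) powr p) \<longlonglongrightarrow> (pi*nu (H x)) powr p"
     by (rule tendsto_powr'[OF _ tendsto_const]) (use p nu0 in auto)
    then have "(%n. ennreal (nu (S Q n x) powr p)) \<longlonglongrightarrow> ennreal ((pi*nu (H x)) powr p)" by (rule tendsto_ennrealI)
    then have lim: "liminf (%n. ennreal (nu (S Q n x) powr p)) = ennreal ((pi*nu (H x)) powr p)"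
     by (intro lim_imp_Liminf) simp
    have "1*nu (H x) <= pi*nu (H x)" using pi_ge_two nu0 by (intro mult_right_mono) auto
    then have "nu (H x) powr p <= (pi*nu (H x)) powr p" using p nu0 by (intro powr_mono2) auto
    then show ?thesis using True by (simp add: lim ennreal_leI)
   qed simp
  qed
  also have "... <= liminf (%n. \<integral>\<^sup>+ x. ennreal (nu (S Q n x) powr p)*?i N x \<partial>lborel)"
  proof (rule nn_integral_liminf)
   fix n
   have "(%x. nu (S Q n x)) : borel_measurable borel" by (rule is_norm_measurable[OF nu Sm])
   then show "(%x. ennreal (nu (S Q n x) powr p)*?i N x) : borel_measurable lborel" by measurable
  qed
  also have "... <= ennreal (2*K powr p)*I"
  proof (rule Liminf_le)
   show "\<forall>\<^sub>F n in sequentially. (\<integral>\<^sup>+ x. ennreal (nu (S Q n x) powr p)*?i N x \<partial>lborel) <= ennreal (2*K powr p)*I"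
   proof (intro always_eventually allI)
    fix n
    have "R + real N <= real (Suc n*Q)*(1/real (Suc n))"
    proof -
     have "real (Suc n*Q)*(1/real (Suc n)) = real Q" unfolding of_nat_mult by (simp del: of_nat_Suc)
     then show ?thesis using Q by linarith
    qed
    then show "(\<integral>\<^sup>+ x. ennreal (nu (S Q n x) powr p)*?i N x \<partial>lborel) <= ennreal (2*K powr p)*I"
     unfolding I S_def[abs_def] by (intro translation_average[OF nu fm bound R]) auto
   qed
  qed simp
  finally show ?thesis .
 qed
 have Hm: "(%x. H x i) : borel_measurable borel" if i: "i : {1..d}" for i
 proof (rule borel_measurable_LIMSEQ_metric)
  fix N :: nat
  obtain Q where Q: "R + real N <= real Q" using real_arch_simple by blast
  show "(%x. ?r N x *\<^sub>R H x i) : borel_measurable borel"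
  proof (rule borel_measurable_LIMSEQ_metric)
   show "(%x. ?r N x *\<^sub>R ((1/pi) *\<^sub>R S Q n x i)) : borel_measurable borel" for n
    using Sm by measurable
   show "(%n. ?r N x *\<^sub>R ((1/pi) *\<^sub>R S Q n x i)) \<longlonglongrightarrow> ?r N x *\<^sub>R H x i" for x
   proof (cases "x : ?A N")
    case True
    then have "R + abs x <= real Q" using Q by auto
    from tendsto_scaleR[OF tendsto_const S[OF i this], of "1/pi"] show ?thesis using True by simp
   qed simp
  qed
 next
  fix x
  have "\<forall>\<^sub>F N in sequentially. x : ?A N"
  proof -
   obtain M where "abs x <= real M" using real_arch_simple by blast
   then show ?thesis unfolding eventually_sequentially by (intro exI[of _ M]) auto
  qed
  then have "\<forall>\<^sub>F N in sequentially. H x i = ?r N x *\<^sub>R H x i" by eventually_elim simp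
  then show "(%N. ?r N x *\<^sub>R H x i) \<longlonglongrightarrow> H x i"
   by (rule Lim_transform_eventually[OF tendsto_const])
 qed
 have nuH: "(%x. ennreal (nu (H x) powr p)) : borel_measurable borel"
  using is_norm_measurable[OF nu Hm] by measurable
 have "Lp_int lborel p nu H <= ennreal (2*K powr p)*I"
 proof (rule nn_integral_le_incseq[OF _ _ _ _ part])
  show "(\<Union>N. ?A N) = space lborel"
  proof -
   have "EX N. x : ?A N" for x
    using real_arch_simple[of "abs x"] by (auto simp: abs_le_iff minus_le_iff)
   then show ?thesis by auto
  qed
 qed (use nuH in \<open>auto simp: incseq_def\<close>)
 also have "... <= ennreal ((2*K) powr p)*I"
 proof -
  have "2 powr 1 <= (2::real) powr p" using p by (intro powr_mono) auto
  then have "2*K powr p <= (2*K) powr p" using K by (simp add: powr_mult)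
  then show ?thesis by (intro mult_right_mono ennreal_leI) auto
 qed
 finally show "Lp_norm lborel p nu (%x i. hilbert_transform (%y. f0 y i) x) <= ennreal (2*K)*Lp_norm lborel p nu f0"
  unfolding I_def H_def[abs_def] by (intro Lp_norm_leI) (use p K in auto)
qed

section \<open>Discretisation of martingales\<close>

text \<open>A finite model of a measure space: \<open>C s\<close> is the code of the point
  \<open>s\<close>, and \<open>lab k\<close> is the part of a code that is known at time
  \<open>k\<close>. Codes whose cell is a null set are dropped from \<open>codes\<close>, because a
  finite filtration has positive weights.\<close>

locale coding = finite_measure M for M :: "'s measure" +
 fixes C :: "'s => 'w" and lab :: "nat => 'w => 'w" and m :: nat
 assumes finite_codes: "finite (C ` space M)"
  and cell_sets: "C -` {c} \<inter> space M : sets M"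
  and lab_refine: "lab (Suc k) c = lab (Suc k) c' ==> lab k c = lab k c'"
  and lab_final: "inj_on (lab m) (C ` space M)"
begin

definition cell :: "'w => 's set" where
 "cell c = C -` {c} \<inter> space M"

definition weight :: "'w => real" where
 "weight c = measure M (cell c)"

definition codes :: "'w set" where
 "codes = {c : C ` space M. 0 < weight c}"

text \<open>The average over a cell, that is the conditional expectation onto the finest partition
  as a function of codes.\<close>

definition hat :: "('s => 'b::{banach, second_countable_topology}) => 'w => 'b" where
 "hat h t = (1/weight t) *\<^sub>R (LINT s|M. indicator (cell t) s *\<^sub>R h s)"

lemma cell_sets' [measurable]: "cell c : sets M"
 unfolding cell_def by (rule cell_sets)

lemma cell_finite: "emeasure M (cell c) < \<infinity>"
 unfolding infinity_ennreal_def by (rule less_top[THEN iffD1]) (use emeasure_finite[of "cell c"] in \<open>simp only: infinity_ennreal_def not_False_eq_True\<close>)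

lemma finite_codes' [simp]: "finite codes"
 unfolding codes_def using finite_codes by simp

lemma weight_pos: "t : codes ==> 0 < weight t"
 unfolding codes_def by simp

lemma fin_filtration: "fin_filtration codes weight lab m"
proof
 show "finite codes" by simp
 show "inj_on (lab m) codes" by (rule inj_on_subset[OF lab_final]) (auto simp: codes_def)
qed (auto simp: weight_pos less_imp_le intro: lab_refine)

sublocale F: fin_filtration codes weight lab m by (rule fin_filtration)

lemma integral_cells:
 fixes h :: "'s => 'b::{banach, second_countable_topology}"
 assumes h: "integrable M h"
 shows "integrable M (%s. if P (C s) then h s else 0)"
  "(LINT s|M. (if P (C s) then h s else 0)) = (SUM t:{t : codes. P t}. LINT s|M. indicator (cell t) s *\<^sub>R h s)"
proof -
 let ?A = "{t : C ` space M. P t}"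
 have fin: "finite ?A" using finite_codes by simp
 have int: "integrable M (%s. indicator (cell t) s *\<^sub>R h s)" for t
  by (rule integrable_mult_indicator[OF _ h]) simp
 have eq: "(if P (C s) then h s else 0) = (SUM t:?A. indicator (cell t) s *\<^sub>R h s)" if s: "s : space M" for s
 proof -
  have "(SUM t:?A. indicator (cell t) s *\<^sub>R h s) = (SUM t:?A. if t = C s then h s else 0)"
   using s by (intro sum.cong) (auto simp: cell_def)
  also have "... = (if P (C s) then h s else 0)" using s fin by simp
  finally show ?thesis ..
 qed
 show "integrable M (%s. if P (C s) then h s else 0)"
  using Bochner_Integration.integrable_sum[of ?A M "%t s. indicator (cell t) s *\<^sub>R h s", OF int]
  by (subst Bochner_Integration.integrable_cong[OF refl eq]) auto
 have "(LINT s|M. (if P (C s) then h s else 0)) = (LINT s|M. (SUM t:?A. indicator (cell t) s *\<^sub>R h s))"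
  by (rule Bochner_Integration.integral_cong[OF refl eq])
 also have "... = (SUM t:?A. LINT s|M. indicator (cell t) s *\<^sub>R h s)"
  by (rule Bochner_Integration.integral_sum[OF int])
 also have "... = (SUM t:{t : codes. P t}. LINT s|M. indicator (cell t) s *\<^sub>R h s)"
 proof (rule sum.mono_neutral_right[OF fin])
  show "{t : codes. P t} \<subseteq> ?A" unfolding codes_def by auto
  show "ALL t:?A - {t : codes. P t}. (LINT s|M. indicator (cell t) s *\<^sub>R h s) = 0"
  proof
   fix t assume "t : ?A - {t : codes. P t}"
   then have "~ 0 < measure M (cell t)" unfolding codes_def weight_def by auto
   then have "measure M (cell t) = 0" using measure_nonneg[of M "cell t"] by linarith
   then have "cell t : null_sets M" by (intro null_setsI) (auto simp: emeasure_eq_measure)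
   then have "AE s in M. s \<notin> cell t" by (rule AE_not_in)
   then show "(LINT s|M. indicator (cell t) s *\<^sub>R h s) = 0"
    by (intro integral_eq_zero_AE) (auto elim: eventually_mono)
  qed
 qed
 finally show "(LINT s|M. (if P (C s) then h s else 0)) = (SUM t:{t : codes. P t}. LINT s|M. indicator (cell t) s *\<^sub>R h s)" .
qed

lemma integrable_code:
 fixes ph :: "'w => 'b::{banach, second_countable_topology}"
 shows "integrable M (%s. ph (C s))"
proof -
 have int: "integrable M (%s. indicator (cell t) s *\<^sub>R ph t)" for t
  using cell_finite by (intro integrable_scaleR_left integrable_real_indicator) simp_all
 have eq: "ph (C s) = (SUM t:C ` space M. indicator (cell t) s *\<^sub>R ph t)" if s: "s : space M" for s
 proof -
  have "(SUM t:C ` space M. indicator (cell t) s *\<^sub>R ph t) = (SUM t:C ` space M. if t = C s then ph t else 0)"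
   using s by (intro sum.cong) (auto simp: cell_def)
  also have "... = ph (C s)" using s finite_codes by simp
  finally show ?thesis ..
 qed
 show ?thesis
  using Bochner_Integration.integrable_sum[of "C ` space M" M "%t s. indicator (cell t) s *\<^sub>R ph t", OF int]
  by (subst Bochner_Integration.integrable_cong[OF refl eq]) auto
qed

lemma cell_integral_code:
 fixes ph :: "'w => 'b::{banach, second_countable_topology}"
 shows "(LINT s|M. indicator (cell t) s *\<^sub>R ph (C s)) = weight t *\<^sub>R ph t"
proof -
 have "(LINT s|M. indicator (cell t) s *\<^sub>R ph (C s)) = (LINT s|M. indicator (cell t) s *\<^sub>R ph t)"
  by (intro Bochner_Integration.integral_cong) (auto simp: cell_def indicator_def)
 also have "... = weight t *\<^sub>R ph t"
  by (subst integral_scaleR_left[OF integrable_real_indicator[OF cell_sets' cell_finite]])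
   (simp add: weight_def cell_def Int_absorb2)
 finally show ?thesis .
qed

lemma integral_code:
 fixes ph :: "'w => 'b::{banach, second_countable_topology}"
 shows "(LINT s|M. ph (C s)) = (SUM t:codes. weight t *\<^sub>R ph t)"
 using integral_cells(2)[OF integrable_code, of "%_. True" ph] by (simp add: cell_integral_code)

lemma weight_hat: "t : codes ==> weight t *\<^sub>R hat h t = (LINT s|M. indicator (cell t) s *\<^sub>R h s)"
 unfolding hat_def using weight_pos[of t] by simp

lemma hat_code: "t : codes ==> hat (%s. ph (C s)) t = ph t"
 unfolding hat_def cell_integral_code using weight_pos[of t] by simp

lemma hat_diff:
 assumes "integrable M g" "integrable M h"
 shows "hat (%s. g s - h s) t = hat g t - hat h t"
 unfolding hat_def scaleR_diff_right
 using assms by (subst Bochner_Integration.integral_diff) (auto intro!: integrable_mult_indicator simp: scaleR_diff_right)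

lemma cond_mean_cong:
 assumes "!!t. t : codes ==> x t = y t" shows "cond_mean codes weight lab k x t = cond_mean codes weight lab k y t"
 unfolding cond_mean_def using assms by (intro arg_cong2[where f = scaleR] sum.cong) auto

lemma cond_mean_diff: "cond_mean Om wt lab k (%t. x t - y t) c = cond_mean Om wt lab k x c - cond_mean Om wt lab k y c"
 unfolding cond_mean_def by (simp add: scaleR_diff_right sum_subtractf)

lemma cond_mean_hat:
 assumes "integrable M h"
 shows "cond_mean codes weight lab k (hat h) c
  = (1/(SUM t:{t : codes. lab k t = lab k c}. weight t)) *\<^sub>R (LINT s|M. (if lab k (C s) = lab k c then h s else 0))"
 unfolding cond_mean_def integral_cells(2)[OF assms, of "%t. lab k t = lab k c"]
 by (intro arg_cong2[where f = scaleR] refl sum.cong) (auto simp: weight_hat)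

lemma cond_mean_adapted:
 fixes ps :: "'w => 'k::real_normed_field"
 assumes "!!t t'. t : codes ==> t' : codes ==> lab k t = lab k t' ==> ps t = ps t'" "c : codes"
 shows "cond_mean codes weight lab k ps c = ps c"
proof -
 have "(SUM t:{t : codes. lab k t = lab k c}. weight t *\<^sub>R ps t) = (SUM t:{t : codes. lab k t = lab k c}. weight t *\<^sub>R ps c)"
 proof (rule sum.cong[OF refl])
  show "weight t *\<^sub>R ps t = weight t *\<^sub>R ps c" if "t : {t : codes. lab k t = lab k c}" for t
   using assms(1)[of t c] assms(2) that by simp
 qed
 moreover have "... = (SUM t:{t : codes. lab k t = lab k c}. weight t) *\<^sub>R ps c" by (rule scaleR_sum_left[symmetric])
 moreover have "0 < (SUM t:{t : codes. lab k t = lab k c}. weight t)"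
  using F.atom_pos[OF assms(2), of k] unfolding F.atom_def .
 ultimately show ?thesis unfolding cond_mean_def by simp
qed

lemma cond_mean_contraction:
 fixes h :: "'s => 'k::{real_normed_field, banach, second_countable_topology}"
 assumes h: "integrable M h"
 shows "(SUM t:codes. weight t*norm (cond_mean codes weight lab k (hat h) t)) <= (LINT s|M. norm (h s))"
proof -
 have le: "norm (cond_mean codes weight lab k x t) <= F.E k (%t. norm (x t)) t" for x :: "'w => 'k" and t
 proof -
  let ?W = "SUM t:F.atom k t. weight t"
  have W: "0 <= ?W" by (intro sum_nonneg) (auto simp: F.atom_def weight_pos less_imp_le)
  have "norm (cond_mean codes weight lab k x t) = 1/?W*norm (SUM t:F.atom k t. weight t *\<^sub>R x t)"
   unfolding cond_mean_def F.atom_def using W[unfolded F.atom_def] by simp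
  also have "... <= 1/?W*(SUM t:F.atom k t. weight t*norm (x t))"
  proof (rule mult_left_mono)
   have "norm (SUM t:F.atom k t. weight t *\<^sub>R x t) <= (SUM t:F.atom k t. norm (weight t *\<^sub>R x t))" by (rule norm_sum)
   also have "... = (SUM t:F.atom k t. weight t*norm (x t))"
    by (intro sum.cong) (auto simp: F.atom_def weight_pos less_imp_le)
   finally show "norm (SUM t:F.atom k t. weight t *\<^sub>R x t) <= (SUM t:F.atom k t. weight t*norm (x t))" .
  qed (use W in simp)
  finally show ?thesis unfolding F.E_def by simp
 qed
 have "(SUM t:codes. weight t*norm (cond_mean codes weight lab k (hat h) t)) <= F.S (F.E k (%t. norm (hat h t)))"
  unfolding F.S_def by (intro sum_mono mult_left_mono le) (auto simp: weight_pos less_imp_le)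
 also have "... = F.S (%t. norm (hat h t))" by (rule F.S_E)
 also have "... = (SUM t:codes. norm (weight t *\<^sub>R hat h t))"
  unfolding F.S_def by (intro sum.cong) (auto simp: weight_pos less_imp_le)
 also have "... = (SUM t:codes. norm (LINT s|M. indicator (cell t) s *\<^sub>R h s))" by (simp add: weight_hat)
 also have "... <= (SUM t:codes. LINT s|M. norm (indicator (cell t) s *\<^sub>R h s))" by (intro sum_mono integral_norm_bound)
 also have "... = (SUM t:codes. LINT s|M. indicator (cell t) s *\<^sub>R norm (h s))"
  by (intro sum.cong refl Bochner_Integration.integral_cong) auto
 also have "... = (LINT s|M. norm (h s))"
  using integral_cells(2)[of "%s. norm (h s)" "%_. True"] h by simp
 finally show ?thesis .
qed

text \<open>\<open>ps\<close> is its own conditional mean, and the cell averages of \<open>h\<close>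
  and \<open>h'\<close> have equal conditional means by \<open>mart\<close>. So the difference on
  the left is the difference of the conditional means of two approximation errors, and conditional
  means are contractions in L1.\<close>

lemma cond_mean_approx:
 fixes ph ps :: "'w => 'k::{real_normed_field, banach, second_countable_topology}"
 assumes h: "integrable M h" "integrable M h'"
  and ps: "!!t t'. t : codes ==> t' : codes ==> lab k t = lab k t' ==> ps t = ps t'"
  and mart: "!!c. (LINT s|M. (if lab k (C s) = lab k c then h s else 0)) = (LINT s|M. (if lab k (C s) = lab k c then h' s else 0))"
 shows "(LINT s|M. norm (cond_mean codes weight lab k ph (C s) - ps (C s)))
  <= (LINT s|M. norm (ph (C s) - h s)) + (LINT s|M. norm (ps (C s) - h' s))"
proof -
 let ?E = "cond_mean codes weight lab k"
 let ?x = "hat (%s. ph (C s) - h s)" and ?y = "hat (%s. ps (C s) - h' s)"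
 have eq: "?E ph t - ps t = ?E ?x t - ?E ?y t" if t: "t : codes" for t
 proof -
  have "?E ?x t = ?E (%t. ph t - hat h t) t"
   by (rule cond_mean_cong) (simp add: hat_diff[OF integrable_code h(1)] hat_code)
  moreover have "?E ?y t = ?E (%t. ps t - hat h' t) t"
   by (rule cond_mean_cong) (simp add: hat_diff[OF integrable_code h(2)] hat_code)
  moreover have "?E (hat h) t = ?E (hat h') t" by (simp only: cond_mean_hat h mart)
  moreover have "?E ps t = ps t" by (rule cond_mean_adapted[OF ps t])
  ultimately show ?thesis by (simp add: cond_mean_diff)
 qed
 have "(LINT s|M. norm (?E ph (C s) - ps (C s))) = (SUM t:codes. weight t*norm (?E ph t - ps t))"
  using integral_code[of "%c. norm (?E ph c - ps c)"] by simp
 also have "... <= (SUM t:codes. weight t*norm (?E ?x t) + weight t*norm (?E ?y t))"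
 proof (rule sum_mono)
  fix t assume t: "t : codes"
  show "weight t*norm (?E ph t - ps t) <= weight t*norm (?E ?x t) + weight t*norm (?E ?y t)"
   unfolding eq[OF t] distrib_left[symmetric] using weight_pos[OF t] by (intro mult_left_mono norm_triangle_ineq4) auto
 qed
 also have "... <= (LINT s|M. norm (ph (C s) - h s)) + (LINT s|M. norm (ps (C s) - h' s))"
  unfolding sum.distrib using h
  by (intro add_mono cond_mean_contraction Bochner_Integration.integrable_diff integrable_code)
 finally show ?thesis .
qed

lemma umd_bound_code:
 fixes nu :: "(nat => 'k::{real_normed_field, banach, second_countable_topology}) => real"
 assumes bound: "umd_bound TYPE('w) p nu K" and ep: "!!k. norm (ep k) <= 1"
 shows "Lp_int M p nu (%s i. mult_transform codes weight lab ep m (ph i) (C s))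
  <= ennreal (K powr p)*Lp_int M p nu (%s i. ph i (C s))"
proof -
 have nn: "(\<integral>\<^sup>+ s. ennreal (u (C s)) \<partial>M) = ennreal (SUM t:codes. weight t*u t)" if "!!c. 0 <= u c" for u :: "'w => real"
  using nn_integral_eq_integral[OF integrable_code[of u]] that integral_code[of u] by simp
 have "(SUM t:codes. weight t*nu (%i. mult_transform codes weight lab ep m (ph i) t) powr p)
   <= K powr p*(SUM t:codes. weight t*nu (%i. ph i t) powr p)"
  using bound[unfolded umd_bound_def, rule_format, OF fin_filtration ep] .
 then show ?thesis
  using nn[of "%c. nu (%i. mult_transform codes weight lab ep m (ph i) c) powr p"] nn[of "%c. nu (%i. ph i c) powr p"]
  by (simp add: ennreal_leI flip: ennreal_mult')
qed

end

section \<open>Approximation of martingales by finite filtrations\<close>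

lemma is_norm_le_sum:
 fixes nu :: "(nat => 'k::real_normed_field) => real"
 assumes "is_norm d nu"
 shows "nu x <= (SUM i:{1..d}. norm (x i)*nu (%j. if j = i then 1 else 0))"
proof -
 have "nu (%_. 0) = 0" using is_norm_eq_0[OF assms] by simp
 then show ?thesis using is_norm_diff_le[OF assms, of x "%_. 0"] by simp
qed

text \<open>Simple functions that approximate the \<open>g k\<close> do not form a martingale, and
  are used only to build partitions. The code of a point is the table of all their values, and the
  label at time \<open>k\<close> is the table up to row \<open>k\<close>, so the level sets of the
  labels lie in \<open>F k\<close>. The conditional means of the last row with respect to the labels
  are a martingale of the finite model, and they converge to \<open>g k\<close> in L1.\<close>

lemma umd_bound_finite_measure:
 fixes nu :: "(nat => 'k::{real_normed_field, banach, second_countable_topology}) => real" and M :: "'s measure"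
 assumes fin: "finite_measure M" and nu: "is_norm d nu" and dom: "!!x i. i : {1..d} ==> norm (x i) <= nu x"
  and p: "1 <= p" and K: "0 < K" and bound: "umd_bound TYPE(nat => nat => 'k) p nu K"
  and sub: "!!k. k <= m ==> subalgebra M (F k)" and inc: "!!k. k < m ==> sets (F k) \<subseteq> sets (F (Suc k))"
  and meas: "!!k i. k <= m ==> i : {1..d} ==> (%s. g k s i) : borel_measurable (F k)"
  and int: "!!k i. k <= m ==> i : {1..d} ==> integrable M (%s. g k s i)"
  and mart: "!!k i B. k <= m ==> i : {1..d} ==> B : sets (F k) ==>
   (LINT s|M. indicator B s *\<^sub>R g m s i) = (LINT s|M. indicator B s *\<^sub>R g k s i)"
  and ep: "!!k. norm (ep k) <= 1"
 shows "Lp_int M p nu (%s i. SUM k:{1..m}. ep k*(g k s i - g (k-1) s i))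
  <= ennreal (K powr p)*Lp_int M p nu (g m)"
proof (cases "Lp_int M p nu (g m) = \<infinity>")
 case True
 then show ?thesis using K by (simp add: ennreal_mult_top)
next
 case finite: False
 have nu0: "0 <= nu x" for x by (rule is_norm_nonneg[OF nu])
 have space_F: "space (F k) = space M" if "k <= m" for k using sub[OF that] unfolding subalgebra_def by blast
 have sets_mono: "sets (F l) \<subseteq> sets (F k)" if "l <= k" "k <= m" for l k
  using that
 proof (induction k)
  case (Suc k)
  then show ?case using inc[of k] by (cases "l = Suc k") (auto simp: le_Suc_eq)
 qed simp
 have sets_M: "sets (F k) \<subseteq> sets M" if "k <= m" for k using sub[OF that] unfolding subalgebra_def by blast
 have gM: "(%s. g k s i) : borel_measurable M" if "k <= m" "i : {1..d}" for k i
  using int[OF that] by simp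
 define approx where "approx k i h \<longleftrightarrow> (ALL j. simple_function (F k) (h j)) & (ALL s:space M. (%j. h j s) \<longlonglongrightarrow> g k s i) &
   (ALL j. ALL s:space M. norm (h j s) <= 2*norm (g k s i))" for k i and h :: "nat => 's => 'k"
 have "EX h. approx k i h" if "k <= m" "i : {1..d}" for k i
  using borel_measurable_implies_sequence_metric[OF meas[OF that], of 0] space_F[OF that(1)]
  unfolding approx_def by (simp add: dist_norm)
 then obtain f where "!!k i. k <= m ==> i : {1..d} ==> approx k i (f k i)" by metis
 then have f: "!!k i j. k <= m ==> i : {1..d} ==> simple_function (F k) (f k i j)"
  "!!k i s. k <= m ==> i : {1..d} ==> s : space M ==> (%j. f k i j s) \<longlonglongrightarrow> g k s i"
  "!!k i j s. k <= m ==> i : {1..d} ==> s : space M ==> norm (f k i j s) <= 2*norm (g k s i)"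
  unfolding approx_def by blast+
 define C where "C j s = (%k i. if k <= m & i : {1..d} then f k i j s else 0)" for j s
 define lab :: "nat => (nat => nat => 'k) => nat => nat => 'k" where "lab k c = (%l i. if l <= k then c l i else 0)" for k c
 have lab_eq: "lab k c = lab k c' \<longleftrightarrow> (ALL l<=k. ALL i. c l i = c' l i)" for k c c'
  unfolding lab_def fun_eq_iff by auto
 have level_set: "{s : space M. lab k (C j s) = lab k c} : sets (F k)" if k: "k <= m" for k j c
 proof (cases "ALL l<=k. ALL i. i \<notin> {1..d} --> c l i = 0")
  case True
  have "{s : space M. lab k (C j s) = lab k c} = {s : space (F k). ALL l:{..k}. ALL i:{1..d}. f l i j s = c l i}"
   unfolding lab_eq C_def space_F[OF k] using True k by auto
  also have "... : sets (F k)"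
  proof (intro sets.sets_Collect_finite_All)
   fix l i assume "l : {..k}" "i : {1..d}"
   then have l: "l <= k" "l <= m" "i : {1..d}" using k by auto
   have "f l i j -` {c l i} \<inter> space (F l) : sets (F l)" by (rule simple_functionD(2)[OF f(1)[OF l(2,3)]])
   moreover have "f l i j -` {c l i} \<inter> space (F l) = {s : space (F k). f l i j s = c l i}"
    using space_F[OF l(2)] space_F[OF k] by auto
   ultimately show "{s : space (F k). f l i j s = c l i} : sets (F k)" using sets_mono[OF l(1) k] by auto
  qed auto
  finally show ?thesis .
 next
  case False
  then obtain l i where "l <= k" "i \<notin> {1..d}" "c l i ~= 0" by auto
  then have "{s : space M. lab k (C j s) = lab k c} = {}" unfolding lab_eq C_def by auto
  then show ?thesis by (simp only: sets.empty_sets)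
 qed
 have C_0: "C j s l i = 0" if "m < l" for j s l i unfolding C_def using that by simp
 have coding: "coding M (C j) lab m" for j
 proof (rule coding.intro[OF fin], unfold_locales)
  show "finite (C j ` space M)"
  proof (rule finite_subset)
   show "C j ` space M \<subseteq> (%h k i. if k <= m & i : {1..d} then h (k, i) else 0) `
     PiE ({..m} \<times> {1..d}) (%(k, i). f k i j ` space M)"
   proof
    fix c assume "c : C j ` space M"
    then obtain s where s: "s : space M" "c = C j s" by auto
    show "c : (%h k i. if k <= m & i : {1..d} then h (k, i) else 0) ` PiE ({..m} \<times> {1..d}) (%(k, i). f k i j ` space M)"
     by (rule image_eqI[of _ _ "restrict (%(k, i). f k i j s) ({..m} \<times> {1..d})"])
      (use s in \<open>auto simp: C_def fun_eq_iff\<close>)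
   qed
   have "finite (f k i j ` space M)" if "k <= m" "i : {1..d}" for k i
    using simple_functionD(1)[OF f(1)[OF that]] space_F[OF that(1)] by simp
   then show "finite ((%h k i. if k <= m & i : {1..d} then h (k, i) else 0) ` PiE ({..m} \<times> {1..d}) (%(k, i). f k i j ` space M))"
    by (intro finite_imageI finite_PiE) auto
  qed
  show "C j -` {c} \<inter> space M : sets M" for c
  proof (cases "ALL l>m. ALL i. c l i = 0")
   case True
   have "C j s = c \<longleftrightarrow> lab m (C j s) = lab m c" for s
   proof
    assume *: "lab m (C j s) = lab m c"
    show "C j s = c"
    proof (intro ext)
     fix l i
     show "C j s l i = c l i" using * True C_0[of l j s i] unfolding lab_eq by (cases "l <= m") auto
    qed
   qed simp
   then have "C j -` {c} \<inter> space M = {s : space M. lab m (C j s) = lab m c}" by auto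
   then show ?thesis using level_set[of m j c] sets_M[of m] by auto
  next
   case False
   then have "C j s ~= c" for s using C_0[of _ j s] by metis
   then have "C j -` {c} \<inter> space M = {}" by auto
   then show ?thesis by simp
  qed
  show "lab k c = lab k c'" if "lab (Suc k) c = lab (Suc k) c'" for k c c' using that unfolding lab_eq by simp
  have "lab m (C j s) = C j s" for s unfolding lab_def C_def by (auto simp: fun_eq_iff)
  then show "inj_on (lab m) (C j ` space M)" by (auto simp: inj_on_def)
 qed
 define E where "E j k i s = cond_mean (coding.codes M (C j)) (coding.weight M (C j)) lab k (%c. c m i) (C j s)" for j k i s
 have E_int: "integrable M (E j k i)" for j k i unfolding E_def by (rule coding.integrable_code[OF coding])
 have C_int: "integrable M (%s. C j s k i)" for j k i by (rule coding.integrable_code[OF coding, of "%c. c k i"])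
 define a where "a j k i = (LINT s|M. norm (C j s k i - g k s i))" for j k i
 have C_lim: "(%j. C j s k i) \<longlonglongrightarrow> g k s i" if "k <= m" "i : {1..d}" "s : space M" for k i s
  using f(2)[OF that] that unfolding C_def by simp
 have C_bd: "norm (C j s k i) <= 2*norm (g k s i)" if "k <= m" "i : {1..d}" "s : space M" for j k i s
  using f(3)[OF that] that unfolding C_def by simp
 have a: "(%j. a j k i) \<longlonglongrightarrow> 0" if ki: "k <= m" "i : {1..d}" for k i
 proof -
  have "(%j. a j k i) \<longlonglongrightarrow> (LINT s|M. 0)"
   unfolding a_def
  proof (rule integral_dominated_convergence[where w = "%s. 3*norm (g k s i)"])
   show "integrable M (%s. 3*norm (g k s i))" using int[OF ki] by simp
   show "(%s. norm (C j s k i - g k s i)) : borel_measurable M" for j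
    using C_int[of j k i] gM[OF ki] by measurable
   show "AE s in M. (%j. norm (C j s k i - g k s i)) \<longlonglongrightarrow> 0"
   proof (rule AE_I2)
    fix s assume "s : space M"
    from C_lim[OF ki this] show "(%j. norm (C j s k i - g k s i)) \<longlonglongrightarrow> 0"
     by (intro tendsto_norm_zero LIM_zero)
   qed
   show "AE s in M. norm (norm (C j s k i - g k s i)) <= 3*norm (g k s i)" for j
   proof (rule AE_I2)
    fix s assume "s : space M"
    from C_bd[OF ki this, of j] show "norm (norm (C j s k i - g k s i)) <= 3*norm (g k s i)"
     using norm_triangle_ineq4[of "C j s k i" "g k s i"] by simp
   qed
  qed simp
  then show ?thesis by simp
 qed
 \<comment> \<open>The error of the last row occurs once, that of row \<open>k\<close> twice: inside
   the comparison of conditional means, and when the coded row is replaced by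
   \<open>g k\<close>.\<close>
 have E_close: "(LINT s|M. norm (E j k i s - g k s i)) <= a j m i + 2*a j k i" if ki: "k <= m" "i : {1..d}" for j k i
 proof -
  interpret c: coding M "C j" lab m by (rule coding)
  have cell: "(LINT s|M. (if lab k (C j s) = lab k c then g l s i else 0)) = (LINT s|M. indicator {s : space M. lab k (C j s) = lab k c} s *\<^sub>R g l s i)" for c l
   by (intro Bochner_Integration.integral_cong) auto
  have "(LINT s|M. norm (cond_mean c.codes c.weight lab k (%c. c m i) (C j s) - C j s k i)) <= a j m i + a j k i"
   unfolding a_def
  proof (rule c.cond_mean_approx[where ph = "%c. c m i" and ps = "%c. c k i"])
   show "integrable M (%s. g m s i)" "integrable M (%s. g k s i)" using int ki by auto
   show "t k i = t' k i" if "lab k t = lab k t'" for t t' using that unfolding lab_eq by simp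
   show "(LINT s|M. (if lab k (C j s) = lab k c then g m s i else 0)) = (LINT s|M. (if lab k (C j s) = lab k c then g k s i else 0))" for c
    unfolding cell by (rule mart[OF ki level_set[OF ki(1)]])
  qed
  moreover have "(LINT s|M. norm (E j k i s - g k s i)) <= (LINT s|M. norm (E j k i s - C j s k i) + norm (C j s k i - g k s i))"
  proof (rule integral_mono)
   show "norm (E j k i s - g k s i) <= norm (E j k i s - C j s k i) + norm (C j s k i - g k s i)" for s
    using norm_triangle_ineq[of "E j k i s - C j s k i" "C j s k i - g k s i"] by simp
  qed (use E_int C_int int[OF ki] in auto)
  moreover have "(LINT s|M. norm (E j k i s - C j s k i) + norm (C j s k i - g k s i))
    = (LINT s|M. norm (E j k i s - C j s k i)) + a j k i"
   unfolding a_def using E_int C_int int[OF ki] by (intro Bochner_Integration.integral_add) auto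
  ultimately show ?thesis unfolding E_def by linarith
 qed
 \<comment> \<open>One function collects the finitely many errors, so that a single subsequence
   converges almost everywhere for all \<open>k\<close> and \<open>i\<close>. Fatou's lemma then
   handles the transform and dominated convergence the last row.\<close>
 define U where "U j s = (SUM k<=m. SUM i:{1..d}. norm (E j k i s - g k s i))" for j s
 have U_int: "integrable M (U j)" for j
  unfolding U_def using E_int int by (intro Bochner_Integration.integrable_sum integrable_norm Bochner_Integration.integrable_diff) auto
 have "(%j. LINT s|M. norm (U j s)) \<longlonglongrightarrow> 0"
 proof (rule Lim_null_comparison)
  have eq: "(LINT s|M. norm (U j s)) = (SUM k<=m. SUM i:{1..d}. LINT s|M. norm (E j k i s - g k s i))" for j
  proof -
   have "(LINT s|M. norm (U j s)) = (LINT s|M. U j s)"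
    unfolding U_def by (intro Bochner_Integration.integral_cong) (auto simp: sum_nonneg)
   also have "... = (SUM k<=m. SUM i:{1..d}. LINT s|M. norm (E j k i s - g k s i))"
   proof -
    have int1: "integrable M (%s. norm (E j k i s - g k s i))" if "k : {..m}" "i : {1..d}" for k i
     using E_int int that by auto
    have "integrable M (%s. SUM i:{1..d}. norm (E j k i s - g k s i))" if "k : {..m}" for k
     by (intro Bochner_Integration.integrable_sum int1 that)
    then have "(LINT s|M. U j s) = (SUM k<=m. LINT s|M. (SUM i:{1..d}. norm (E j k i s - g k s i)))"
     unfolding U_def by (rule Bochner_Integration.integral_sum)
    also have "... = (SUM k<=m. SUM i:{1..d}. LINT s|M. norm (E j k i s - g k s i))"
     by (intro sum.cong refl Bochner_Integration.integral_sum int1)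
    finally show ?thesis .
   qed
   finally show ?thesis .
  qed
  show "\<forall>\<^sub>F j in sequentially. norm (LINT s|M. norm (U j s)) <= (SUM k<=m. SUM i:{1..d}. a j m i + 2*a j k i)"
   unfolding eq by (intro always_eventually allI) (use E_close in \<open>auto intro!: sum_mono simp: abs_of_nonneg sum_nonneg\<close>)
  have "(%j. SUM k<=m. SUM i:{1..d}. a j m i + 2*a j k i) \<longlonglongrightarrow> (SUM k<=m. SUM i:{1..d}. 0 + 2*0)"
   by (intro tendsto_intros a) auto
  then show "(%j. SUM k<=m. SUM i:{1..d}. a j m i + 2*a j k i) \<longlonglongrightarrow> 0" by simp
 qed
 from tendsto_L1_AE_subseq[OF U_int this] obtain r :: "nat => nat"
  where r: "strict_mono r" "AE s in M. (%n. U (r n) s) \<longlonglongrightarrow> 0" by blast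
 define T where "T j s i = (SUM k:{1..m}. ep k*(E j k i s - E j (k-1) i s))" for j s i
 let ?T = "%s i. SUM k:{1..m}. ep k*(g k s i - g (k-1) s i)"
 have T_meas: "(%s. ennreal (nu (T j s) powr p)) : borel_measurable M" for j
 proof -
  have "(%s. T j s i) : borel_measurable M" for i unfolding T_def using E_int by measurable
  then show ?thesis using is_norm_measurable[OF nu, of "T j" M] by measurable
 qed
 have "Lp_int M p nu ?T <= (\<integral>\<^sup>+ s. liminf (%n. ennreal (nu (T (r n) s) powr p)) \<partial>M)"
 proof (rule nn_integral_mono_AE, use r(2) in eventually_elim)
  case (elim s)
  have "(%n. E (r n) k i s) \<longlonglongrightarrow> g k s i" if "k <= m" "i : {1..d}" for k i
  proof (rule LIM_zero_cancel, rule Lim_null_comparison[OF _ elim], intro always_eventually allI)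
   fix n
   have "norm (E (r n) k i s - g k s i) <= (SUM i:{1..d}. norm (E (r n) k i s - g k s i))"
    using that by (intro member_le_sum[where f = "%i. norm (E (r n) k i s - g k s i)"]) auto
   also have "... <= U (r n) s"
    unfolding U_def using that by (intro member_le_sum[where f = "%k. SUM i:{1..d}. norm (E (r n) k i s - g k s i)"]) (auto intro: sum_nonneg)
   finally show "norm (E (r n) k i s - g k s i) <= U (r n) s" .
  qed
  then have "(%n. T (r n) s i) \<longlonglongrightarrow> ?T s i" if "i : {1..d}" for i
   unfolding T_def using that by (intro tendsto_intros) auto
  then have "(%n. nu (T (r n) s)) \<longlonglongrightarrow> nu (?T s)" by (rule is_norm_tendsto[OF nu])
  then have "(%n. nu (T (r n) s) powr p) \<longlonglongrightarrow> nu (?T s) powr p"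
   by (rule tendsto_powr'[OF _ tendsto_const]) (use p nu0 in auto)
  then have "(%n. ennreal (nu (T (r n) s) powr p)) \<longlonglongrightarrow> ennreal (nu (?T s) powr p)" by (rule tendsto_ennrealI)
  from lim_imp_Liminf[OF _ this] show ?case by simp
 qed
 also have "... <= liminf (%n. Lp_int M p nu (T (r n)))"
  by (rule nn_integral_liminf[OF T_meas])
 also have "... <= liminf (%n. ennreal (K powr p)*Lp_int M p nu (%s. C (r n) s m))"
 proof (rule Liminf_mono, intro always_eventually allI)
  fix n
  interpret c: coding M "C (r n)" lab m by (rule coding)
  show "Lp_int M p nu (T (r n)) <= ennreal (K powr p)*Lp_int M p nu (%s. C (r n) s m)"
   using c.umd_bound_code[where ph = "%i c. c m i" and ep = ep, OF bound ep]
   unfolding T_def[abs_def] E_def mult_transform_def .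
 qed
 also have "... = ennreal (K powr p)*Lp_int M p nu (g m)"
 proof (rule lim_imp_Liminf, simp)
  let ?c = "SUM i:{1..d}. nu (%j. if j = i then 1 else 0)"
  have c0: "0 <= ?c" by (intro sum_nonneg nu0)
  have C_meas: "(%s. ennreal (nu (C j s m) powr p)) : borel_measurable M" for j
   using is_norm_measurable[OF nu, of "%s. C j s m" M] C_int by measurable
  have g_meas: "(%s. nu (g m s)) : borel_measurable M"
   using is_norm_measurable[OF nu, of "%s. g m s" M] gM by simp
  have le: "nu (C j s m) <= 2*?c*nu (g m s)" if s: "s : space M" for j s
  proof -
   have "nu (C j s m) <= (SUM i:{1..d}. norm (C j s m i)*nu (%j. if j = i then 1 else 0))" by (rule is_norm_le_sum[OF nu])
   also have "... <= (SUM i:{1..d}. 2*nu (g m s)*nu (%j. if j = i then 1 else 0))"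
   proof (intro sum_mono mult_right_mono nu0)
    fix i assume i: "i : {1..d}"
    show "norm (C j s m i) <= 2*nu (g m s)" using C_bd[OF le_refl i s, of j] dom[OF i, of "g m s"] by linarith
   qed
   finally show ?thesis by (simp add: sum_distrib_left mult_ac)
  qed
  have "(%j. Lp_int M p nu (%s. C j s m)) \<longlonglongrightarrow> Lp_int M p nu (g m)"
  proof (rule nn_integral_dominated_convergence[where w = "%s. ennreal ((2*?c) powr p)*ennreal (nu (g m s) powr p)"])
   show "AE s in M. ennreal (nu (C j s m) powr p) <= ennreal ((2*?c) powr p)*ennreal (nu (g m s) powr p)" for j
   proof (rule AE_I2)
    fix s assume "s : space M"
    have "nu (C j s m) powr p <= (2*?c*nu (g m s)) powr p"
     using le[OF \<open>s \<in> space M\<close>] p nu0 by (intro powr_mono2) auto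
    also have "... = (2*?c) powr p*nu (g m s) powr p" using c0 nu0 by (simp add: powr_mult)
    finally show "ennreal (nu (C j s m) powr p) <= ennreal ((2*?c) powr p)*ennreal (nu (g m s) powr p)"
     by (simp add: ennreal_leI flip: ennreal_mult)
   qed
   show "(\<integral>\<^sup>+ s. ennreal ((2*?c) powr p)*ennreal (nu (g m s) powr p) \<partial>M) < \<infinity>"
    using finite g_meas by (subst nn_integral_cmult) (auto simp: ennreal_mult_less_top top.not_eq_extremum)
   show "AE s in M. (%j. ennreal (nu (C j s m) powr p)) \<longlonglongrightarrow> ennreal (nu (g m s) powr p)"
   proof (rule AE_I2)
    fix s assume "s : space M"
    then have "(%j. nu (C j s m)) \<longlonglongrightarrow> nu (g m s)" by (intro is_norm_tendsto[OF nu] C_lim) auto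
    then have "(%j. nu (C j s m) powr p) \<longlonglongrightarrow> nu (g m s) powr p"
     by (rule tendsto_powr'[OF _ tendsto_const]) (use p nu0 in auto)
    then show "(%j. ennreal (nu (C j s m) powr p)) \<longlonglongrightarrow> ennreal (nu (g m s) powr p)" by (rule tendsto_ennrealI)
   qed
  qed (use C_meas g_meas in measurable)
  from ennreal_tendsto_cmult[OF _ LIMSEQ_subseq_LIMSEQ[OF this r(1)], of "ennreal (K powr p)"]
  show "(%n. ennreal (K powr p)*Lp_int M p nu (%s. C (r n) s m))
    \<longlonglongrightarrow> ennreal (K powr p)*Lp_int M p nu (g m)"
   by (simp add: o_def)
 qed
 finally show ?thesis .
qed

text \<open>Subtracting \<open>f 0\<close> leaves the increments unchanged and makes their sum equal
  to \<open>g m\<close>. The space is exhausted by sets of finite measure in \<open>F 0\<close>;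
  restriction to such a set preserves the martingale property because it is known at every time.
  There \<open>norm (x i) <= 1 + nu x powr p\<close> turns the finite p-norm into
  integrability.\<close>

theorem umd_const_le:
 fixes nu :: "(nat => 'k::{real_normed_field, banach, second_countable_topology}) => real"
 assumes nu: "is_norm d nu" and dom: "!!x i. i : {1..d} ==> norm (x i) <= nu x"
  and p: "1 <= p" and K: "0 < K" and bound: "umd_bound TYPE(nat => nat => 'k) p nu K"
 shows "umd_const p d nu <= ennreal K"
 unfolding umd_const_def
proof (rule Inf_lower, rule CollectI, unfold umd_estimate_def, intro allI impI, elim conjE)
 fix M :: "real measure" and F m and f :: "nat => real => nat => 'k" and ep :: "nat => 'k"
 assume m: "1 <= m" and mart: "Lp_martingale M F m p d nu f" and ep: "ALL k:{1..m}. norm (ep k) = 1"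
 have sub: "subalgebra M (F k)" and sig: "sigma_finite_measure (restr_to_subalg M (F k))" if "k <= m" for k
  using mart that unfolding Lp_martingale_def sigma_finite_subalgebra_def by auto
 have inc: "subalgebra (F (Suc k)) (F k)" if "k < m" for k using mart that unfolding Lp_martingale_def by auto
 have fF: "(%s. f k s i) : borel_measurable (F k)" and fp: "Lp_norm M p nu (f k) < \<infinity>" if "k <= m" "i : {1..d}" for k i
  using mart that unfolding Lp_martingale_def by auto
 have fM: "(%s. f k s i) : borel_measurable M" if "k <= m" "i : {1..d}" for k i
  by (rule measurable_from_subalg[OF sub[OF that(1)] fF[OF that]])
 have fint: "(LINT s:A|M. f (Suc k) s i) = (LINT s:A|M. f k s i)"
  if "k < m" "A : sets (F k)" "emeasure M A < \<infinity>" "i : {1..d}" for k A i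
  using mart that unfolding Lp_martingale_def by auto
 have nu0: "0 <= nu x" for x by (rule is_norm_nonneg[OF nu])
 have sets_mono: "sets (F l) \<subseteq> sets (F k)" if "l <= k" "k <= m" for l k
  using that
 proof (induction k)
  case (Suc k)
  then show ?case using inc[of k] unfolding subalgebra_def by (cases "l = Suc k") (auto simp: le_Suc_eq)
 qed simp
 define g where "g k s i = (if i : {1..d} then f k s i - f 0 s i else 0)" for k s i
 \<comment> \<open>The multipliers are controlled for \<open>k\<close> in \<open>{1..m}\<close>
   only, while the finite bound asks for all indices.\<close>
 define e where "e k = (if k : {1..m} then ep k else 0)" for k
 let ?T = "%s i. SUM k:{1..m}. e k*(g k s i - g (k-1) s i)"
 have gF: "(%s. g k s i) : borel_measurable (F k)" if "k <= m" for k i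
 proof (cases "i : {1..d}")
  case True
  have "subalgebra (F k) (F 0)"
   using sets_mono[of 0 k] that sub[of 0] sub[of k] unfolding subalgebra_def by auto
  then have "(%s. f 0 s i) : borel_measurable (F k)" by (rule measurable_from_subalg) (rule fF[OF _ True], simp)
  then show ?thesis using fF[OF that True] True unfolding g_def by simp
 next
  case False
  then have "(%s. g k s i) = (%_. 0)" unfolding g_def by (simp only: if_False)
  then show ?thesis by simp
 qed
 have gM: "(%s. g k s i) : borel_measurable M" if "k <= m" for k i
  by (rule measurable_from_subalg[OF sub[OF that] gF[OF that]])
 obtain A :: "nat => real set" where A: "range A \<subseteq> sets (restr_to_subalg M (F 0))"
  "(\<Union>n. A n) = space (restr_to_subalg M (F 0))" "!!n. emeasure (restr_to_subalg M (F 0)) (A n) ~= \<infinity>" "incseq A"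
  using sigma_finite_measure.sigma_finite_incseq[OF sig[of 0]] by blast
 have AF: "A n : sets (F 0)" for n using A(1) sets_restr_to_subalg[OF sub[of 0]] by auto
 have AM: "A n : sets M" for n using AF sub[of 0] unfolding subalgebra_def by auto
 have Afin: "emeasure M (A n) < \<infinity>" for n
  using A(3)[of n] emeasure_restr_to_subalg[OF sub[of 0] AF] by (simp add: less_top)
 have Aspace: "(\<Union>n. A n) = space M" using A(2) space_restr_to_subalg by metis
 have part: "(\<integral>\<^sup>+ s. ennreal (nu (?T s) powr p)*indicator (A n) s \<partial>M)
   <= ennreal (K powr p)*Lp_int M p nu (g m)" for n
 proof -
  define R where "R = restrict_space M (A n)"
  define G where "G k = restrict_space (F k) (A n)" for k
  have Ak: "A n : sets (F k)" if "k <= m" for k using AF sets_mono[of 0 k] that by auto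
  have spF: "space (F k) = space M" if "k <= m" for k using sub[OF that] unfolding subalgebra_def by blast
  have intf: "integrable R (%s. f k s i)" if ki: "k <= m" "i : {1..d}" for k i
  proof (rule integrableI_bounded)
   show "(%s. f k s i) : borel_measurable R"
    unfolding R_def by (rule measurable_restrict_space1[OF fM[OF ki]])
   have fin: "Lp_int M p nu (f k) < \<infinity>"
    using fp[OF ki] unfolding Lp_norm_def Let_def by (auto simp: top.not_eq_extremum split: if_splits)
   have num: "(%s. ennreal (nu (f k s) powr p)) : borel_measurable M"
    using is_norm_measurable[OF nu, of "%s. f k s" M] fM[OF ki(1)] by measurable
   have "(\<integral>\<^sup>+ s. ennreal (norm (f k s i)) \<partial>R) = (\<integral>\<^sup>+ s. ennreal (norm (f k s i))*indicator (A n) s \<partial>M)"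
    unfolding R_def using AM sets.sets_into_space[OF AM] by (subst nn_integral_restrict_space) auto
   also have "... <= (\<integral>\<^sup>+ s. indicator (A n) s + ennreal (nu (f k s) powr p) \<partial>M)"
   proof (rule nn_integral_mono)
    fix s
    have "norm (f k s i) <= 1 + nu (f k s) powr p"
    proof (cases "nu (f k s) <= 1")
     case True
     then show ?thesis using dom[OF ki(2), of "f k s"] by (simp add: add_increasing2)
    next
     case False
     then have "nu (f k s) powr 1 <= nu (f k s) powr p" using p by (intro powr_mono) auto
     then show ?thesis using dom[OF ki(2), of "f k s"] False by simp
    qed
    then have "ennreal (norm (f k s i)) <= ennreal (1 + nu (f k s) powr p)" by (rule ennreal_leI)
    also have "... = 1 + ennreal (nu (f k s) powr p)" by (subst ennreal_plus) auto
    finally show "ennreal (norm (f k s i))*indicator (A n) s <= indicator (A n) s + ennreal (nu (f k s) powr p)"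
     by (auto simp: indicator_def)
   qed
   also have "... = emeasure M (A n) + Lp_int M p nu (f k)"
    using AM by (subst nn_integral_add[OF _ num]) auto
   also have "... < \<infinity>" using Afin[of n] fin by simp
   finally show "(\<integral>\<^sup>+ s. ennreal (norm (f k s i)) \<partial>R) < \<infinity>" .
  qed
  have intg: "integrable R (%s. g k s i)" if ki: "k <= m" "i : {1..d}" for k i
   using intf[OF ki] intf[of 0 i] ki unfolding g_def by simp
  have "(\<integral>\<^sup>+ s. ennreal (nu (?T s) powr p)*indicator (A n) s \<partial>M) = Lp_int R p nu ?T"
   unfolding R_def using AM sets.sets_into_space[OF AM] by (subst nn_integral_restrict_space) auto
  also have "... <= ennreal (K powr p)*Lp_int R p nu (g m)"
  proof (rule umd_bound_finite_measure[where F = G, OF _ nu dom p K bound])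
   show "finite_measure R"
   proof (rule finite_measureI)
    have "emeasure R (space R) = emeasure M (A n)"
     unfolding R_def using AM sets.sets_into_space[OF AM] by (simp add: space_restrict_space emeasure_restrict_space Int_absorb2)
    then show "emeasure R (space R) ~= \<infinity>" using Afin[of n] by (simp add: less_top)
   qed
   show "subalgebra R (G k)" if "k <= m" for k
    using sub[OF that] unfolding subalgebra_def R_def G_def by (auto simp: space_restrict_space sets_restrict_space)
   show "sets (G k) \<subseteq> sets (G (Suc k))" if "k < m" for k
    using sets_mono[of k "Suc k"] that unfolding G_def by (auto simp: sets_restrict_space)
   show "(%s. g k s i) : borel_measurable (G k)" if "k <= m" for k i
    unfolding G_def by (rule measurable_restrict_space1[OF gF[OF that]])
   show "integrable R (%s. g k s i)" if "k <= m" "i : {1..d}" for k i by (rule intg[OF that])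
   show "norm (e k) <= 1" for k using ep unfolding e_def by auto
   fix k i B assume ki: "k <= m" "i : {1..d}" and B: "B : sets (G k)"
   have B': "B : sets (F k)" "B \<subseteq> A n"
    using B Ak[OF ki(1)] unfolding G_def by (auto simp: sets_restrict_space_iff)
   have step: "(LINT s|R. indicator B s *\<^sub>R f l s i) = (LINT s|R. indicator B s *\<^sub>R f k s i)" if "k <= l" "l <= m" for l
    using that
   proof (induction l)
    case (Suc l)
    show ?case
    proof (cases "k = Suc l")
     case False
     then have l: "k <= l" "l < m" using Suc.prems by auto
     have BM: "emeasure M B < \<infinity>" using emeasure_mono[OF B'(2) AM] Afin[of n] by (meson le_less_trans)
     have eq: "(LINT s|R. indicator B s *\<^sub>R f l' s i) = (LINT s:B|M. f l' s i)" for l'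
      unfolding R_def set_lebesgue_integral_def using B'(2) AM sets.sets_into_space[OF AM]
      by (subst integral_restrict_space) (auto simp: indicator_def intro!: Bochner_Integration.integral_cong)
     have "B : sets (F l)" using B'(1) sets_mono[of k l] l by auto
     from fint[OF l(2) this BM ki(2)] show ?thesis using Suc.IH l unfolding eq by simp
    qed simp
   qed simp
   have sp: "(LINT s|R. indicator B s *\<^sub>R g l s i) = (LINT s|R. indicator B s *\<^sub>R f l s i) - (LINT s|R. indicator B s *\<^sub>R f 0 s i)" if "l <= m" for l
   proof -
    have BR: "B : sets R" using B' sub[OF ki(1)] AM unfolding R_def subalgebra_def by (auto simp: sets_restrict_space_iff)
    have "(LINT s|R. indicator B s *\<^sub>R g l s i) = (LINT s|R. indicator B s *\<^sub>R f l s i - indicator B s *\<^sub>R f 0 s i)"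
     using ki(2) unfolding g_def by (intro Bochner_Integration.integral_cong) (auto simp: scaleR_diff_right)
    also have "... = (LINT s|R. indicator B s *\<^sub>R f l s i) - (LINT s|R. indicator B s *\<^sub>R f 0 s i)"
     by (intro Bochner_Integration.integral_diff integrable_mult_indicator BR intf that ki(2)) simp
    finally show ?thesis .
   qed
   show "(LINT s|R. indicator B s *\<^sub>R g m s i) = (LINT s|R. indicator B s *\<^sub>R g k s i)"
    using sp[of m] sp[of k] step[of m] ki by simp
  qed
  also have "... <= ennreal (K powr p)*Lp_int M p nu (g m)"
   unfolding R_def using AM sets.sets_into_space[OF AM]
   by (subst nn_integral_restrict_space) (auto intro!: mult_left_mono nn_integral_mono simp: indicator_def)
  finally show ?thesis .
 qed
 have "Lp_int M p nu ?T <= ennreal (K powr p)*Lp_int M p nu (g m)"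
 proof (rule nn_integral_le_incseq[OF _ Aspace A(4) _ part])
  show "range A \<subseteq> sets M" using AM by auto
  have "(%s. ?T s i) : borel_measurable M" for i
   by (intro borel_measurable_sum borel_measurable_times borel_measurable_const borel_measurable_diff gM) auto
  then show "(%s. ennreal (nu (?T s) powr p)) : borel_measurable M"
   using is_norm_measurable[OF nu, of ?T M] by measurable
 qed
 then have "Lp_norm M p nu ?T <= ennreal K*Lp_norm M p nu (g m)"
  by (intro Lp_norm_leI) (use p K in auto)
 moreover have cong: "Lp_norm M p nu u = Lp_norm M p nu v" if "!!s i. i : {1..d} ==> u s i = v s i" for u v :: "real => nat => 'k"
 proof -
  have "nu (u s) = nu (v s)" for s by (rule is_norm_cong[OF nu]) (rule that)
  then show ?thesis unfolding Lp_norm_def by simp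
 qed
 have "Lp_norm M p nu ?T = Lp_norm M p nu (%s i. SUM k=1..m. ep k*(f k s i - f (k-1) s i))"
  by (rule cong, rule sum.cong) (auto simp: g_def e_def)
 moreover have "Lp_norm M p nu (g m) = Lp_norm M p nu (%s i. SUM k=1..m. f k s i - f (k-1) s i)"
 proof (rule cong)
  fix s i assume i: "i : {1..d}"
  have "(SUM k=1..l. f k s i - f (k-1) s i) = f l s i - f 0 s i" for l by (induction l) auto
  then show "g m s i = (SUM k=1..m. f k s i - f (k-1) s i)" unfolding g_def using i by simp
 qed
 ultimately show "Lp_norm M p nu (%s i. SUM k=1..m. ep k*(f k s i - f (k-1) s i))
   <= ennreal K*Lp_norm M p nu (%s i. SUM k=1..m. f k s i - f (k-1) s i)" by simp
qed

section \<open>Lower bounds\<close>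

text \<open>The dyadic block of length \<open>2^l\<close> next to the one containing \<open>s\<close> in their parent block.\<close>

definition sibling :: "nat => nat => nat => nat set" where
 "sibling n l s = {i : {1..2^n}. (i-1) div 2^Suc l = (s-1) div 2^Suc l & (i-1) div 2^l ~= (s-1) div 2^l}"

lemma div_power_Suc: "i div 2^Suc l = i div 2^l div (2::nat)"
 by (simp add: div_mult2_eq[symmetric] mult.commute)

lemma div_power_mono: "i div 2^l = j div 2^l ==> l <= m ==> i div 2^m = j div (2::nat)^m"
 by (induction m) (auto simp: le_Suc_eq div_power_Suc simp del: power_Suc)

lemma same_block_eq:
 fixes i :: nat
 assumes "i : {1..2^n}" "l <= n"
 shows "{j : {1..2^n}. (j-1) div 2^l = (i-1) div 2^l} = {(i-1) div 2^l*2^l + 1..((i-1) div 2^l+1)*2^l}"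
proof -
 let ?q = "(i-1) div 2^l"
 have "(2::nat)^n = 2^(n - l)*2^l" using assms by (simp flip: power_add)
 moreover have "i - 1 < 2^n" using assms by auto
 ultimately have "?q < 2^(n - l)" by (simp add: less_mult_imp_div_less)
 then have "(?q+1)*2^l <= 2^(n - l)*2^l" by (intro mult_right_mono) auto
 then have le: "(?q+1)*2^l <= 2^n" using \<open>2^n = 2^(n - l) * 2^l\<close> by simp
 have "(j-1) div 2^l = ?q \<longleftrightarrow> ?q*2^l <= j - 1 & j - 1 < (?q+1)*2^l" for j
 proof
  assume "(j-1) div 2^l = ?q"
  then show "?q*2^l <= j - 1 & j - 1 < (?q+1)*2^l"
   using div_times_less_eq_dividend[of "j - 1" "2^l"] dividend_less_div_times[of "2^l" "j - 1"] by simp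
 qed (intro div_nat_eqI, auto simp: mult.commute)
 moreover have "(1 <= j & j <= N) & A <= j - 1 & j - 1 < X \<longleftrightarrow> A + 1 <= j & j <= X" if "X <= N" for j N A X :: nat
  using that by linarith
 ultimately show ?thesis using le by (simp only: set_eq_iff mem_Collect_eq atLeastAtMost_iff simp_thms)
qed

text \<open>The index \<open>q\<close> of the sibling is the block index \<open>a\<close> of
  \<open>s\<close> with its last bit flipped.\<close>

lemma sibling_eq:
 assumes "s : {1..2^n}" "l < n"
 shows "EX i:{1..2^n}. sibling n l s = {(i-1) div 2^l*2^l + 1..((i-1) div 2^l+1)*2^l}"
proof -
 define a where "a = (s-1) div 2^l"
 define q where "q = (if even a then a + 1 else a-1)"
 have sib: "b div 2 = a div 2 & b ~= a \<longleftrightarrow> b = q" for b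
 proof (cases "even a")
  case True
  then obtain k where "a = 2*k" by blast
  then show ?thesis unfolding q_def by auto
 next
  case False
  then obtain k where "a = 2*k + 1" by (rule oddE)
  then show ?thesis unfolding q_def by auto
 qed
 have s: "s - 1 < 2^n" using assms by auto
 have n: "(2::nat)^n = 2^(n - l)*2^l" using assms by (simp flip: power_add)
 have a: "a < 2^(n - l)" using s unfolding a_def n by (simp add: less_mult_imp_div_less)
 have "even (2^(n - l) :: nat)" using assms by simp
 then obtain c where c: "(2::nat)^(n - l) = 2*c" by blast
 have q: "q < 2^(n - l)" using a unfolding q_def c by (cases "even a") (auto elim!: evenE)
 define i where "i = q*2^l + 1"
 have "(q+1)*2^l <= 2^(n - l)*2^l" using q by (intro mult_right_mono) auto
 moreover have "(1::nat) <= 2^l" by simp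
 ultimately have "i <= 2^(n - l)*2^l" unfolding i_def distrib_right mult_1 by linarith
 then have i: "i : {1..2^n}" unfolding n by (simp add: i_def)
 have iq: "(i-1) div 2^l = q" unfolding i_def by simp
 have "sibling n l s = {j : {1..2^n}. (j-1) div 2^l = (i-1) div 2^l}"
  unfolding sibling_def div_power_Suc iq a_def[symmetric] sib ..
 then show ?thesis using same_block_eq[OF i, of l] assms i by auto
qed

lemma block_dyadic:
 fixes i :: nat
 assumes "i : {1..2^n}" "l <= n"
 shows "{(i-1) div 2^l*2^l + 1..((i-1) div 2^l+1)*2^l} : dyadic_blocks n"
proof -
 have "(2::nat)^n = 2^(n - l)*2^l" using assms by (simp flip: power_add)
 moreover have "i - 1 < 2^n" using assms by auto
 ultimately have "(i-1) div 2^l < 2^(n - l)" by (simp add: less_mult_imp_div_less)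
 then show ?thesis
  using assms unfolding dyadic_blocks_def by (intro UN_I[of "n - l"] CollectI exI[of _ "(i-1) div 2^l + 1"]) auto
qed

lemma sibling_dyadic: "s : {1..2^n} ==> l < n ==> sibling n l s : dyadic_blocks n"
 using sibling_eq[of s n l] block_dyadic[of _ n l] by (metis less_imp_le)

lemma card_sibling: "s : {1..2^n} ==> l < n ==> card (sibling n l s) = 2^l"
 using sibling_eq[of s n l] by auto

lemma finite_sibling [simp]: "finite (sibling n l s)"
 unfolding sibling_def by simp

text \<open>The siblings partition the points other than \<open>s\<close>: the point
  \<open>i\<close> lies in the one whose parent is the smallest dyadic block that contains both
  \<open>i\<close> and \<open>s\<close>.\<close>

lemma sum_siblings:
 assumes s: "s : {1..2^n}"
 shows "(SUM i:{1..2^n}. h i) = h s + (SUM l<n. SUM i:sibling n l s. h i)"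
proof -
 have ex: "EX l<n. i : sibling n l s" if i: "i : {1..2^n}" "i ~= s" for i
 proof -
  let ?P = "%m. (i-1) div 2^m = (s-1) div 2^m"
  have Pn: "?P n" using i s by auto
  define m where "m = (LEAST m. ?P m)"
  have Pm: "?P m" unfolding m_def by (rule LeastI[of ?P, OF Pn])
  have "m <= n" unfolding m_def by (rule Least_le[of ?P, OF Pn])
  have "m ~= 0" using Pm i s by (intro notI) auto
  then obtain l where l: "m = Suc l" by (cases m) auto
  have "~ ?P l" using not_less_Least[of l ?P] l unfolding m_def by simp
  then show ?thesis using Pm l \<open>m <= n\<close> i unfolding sibling_def by (intro exI[of _ l]) auto
 qed
 have disj: "sibling n l s \<inter> sibling n l' s = {}" if "l < l'" for l l'
 proof (rule equals0I)
  fix i assume "i : sibling n l s \<inter> sibling n l' s"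
  then have i: "(i-1) div 2^Suc l = (s-1) div 2^Suc l" "(i-1) div 2^l' ~= (s-1) div 2^l'"
   unfolding sibling_def by blast+
  have "Suc l <= l'" using that by simp
  from div_power_mono[OF i(1) this] i(2) show False by contradiction
 qed
 have disj': "sibling n l s \<inter> sibling n l' s = {}" if "l ~= l'" for l l'
  using disj[of l l'] disj[of l' l] that by (cases "l < l'") auto
 have eq: "{1..2^n} = insert s (\<Union>l\<in>{..<n}. sibling n l s)"
 proof
  show "{1..2^n} \<subseteq> insert s (\<Union>l\<in>{..<n}. sibling n l s)"
  proof
   fix i :: nat assume "i : {1..2^n}"
   then show "i : insert s (\<Union>l\<in>{..<n}. sibling n l s)" using ex[of i] by (cases "i = s") auto
  qed
  show "insert s (\<Union>l\<in>{..<n}. sibling n l s) \<subseteq> {1..2^n}" using s unfolding sibling_def by auto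
 qed
 have "s \<notin> (\<Union>l\<in>{..<n}. sibling n l s)" unfolding sibling_def by auto
 then have "(SUM i:{1..2^n}. h i) = h s + (SUM i:(\<Union>l\<in>{..<n}. sibling n l s). h i)"
  unfolding eq by (intro sum.insert) simp_all
 also have "(SUM i:(\<Union>l\<in>{..<n}. sibling n l s). h i) = (SUM l<n. SUM i:sibling n l s. h i)"
  using disj' by (intro sum.UNION_disjoint) auto
 finally show ?thesis .
qed

text \<open>A functional of norm at most one on \<open>E_n\<close>, because it has this norm on l1
  and on \<open>H_n\<close>. For l1 the siblings are disjoint and the coefficients at most one; for
  \<open>H_n\<close> they are distinct dyadic blocks and the coefficients have square sum at most
  one.\<close>

lemma E_norm_sibling:
 fixes z :: "nat => 'k::real_normed_field"
 assumes s: "s : {1..2^n}" and c: "!!l. l < n ==> abs (c l) <= 1" "(SUM l<n. (c l)^2) <= 1"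
 shows "norm (SUM l<n. c l *\<^sub>R (SUM i:sibling n l s. z i)) <= E_norm n z"
proof (rule E_norm_ge)
 fix u v :: "nat => 'k" assume uv: "!!i. i : {1..2^n} ==> u i + v i = z i"
 have "(SUM i:sibling n l s. z i) = (SUM i:sibling n l s. u i) + (SUM i:sibling n l s. v i)" for l
  unfolding sum.distrib[symmetric] by (intro sum.cong) (auto simp: uv sibling_def)
 then have "(SUM l<n. c l *\<^sub>R (SUM i:sibling n l s. z i))
   = (SUM l<n. c l *\<^sub>R (SUM i:sibling n l s. u i)) + (SUM l<n. c l *\<^sub>R (SUM i:sibling n l s. v i))"
  by (simp add: scaleR_add_right sum.distrib)
 then have "norm (SUM l<n. c l *\<^sub>R (SUM i:sibling n l s. z i))
   <= norm (SUM l<n. c l *\<^sub>R (SUM i:sibling n l s. u i)) + norm (SUM l<n. c l *\<^sub>R (SUM i:sibling n l s. v i))"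
  by (simp add: norm_triangle_ineq)
 also have "norm (SUM l<n. c l *\<^sub>R (SUM i:sibling n l s. u i)) <= (SUM l<n. SUM i:sibling n l s. norm (u i))"
 proof (rule order_trans[OF norm_sum sum_mono])
  fix l assume "l : {..<n}"
  then have "norm (c l *\<^sub>R (SUM i:sibling n l s. u i)) <= norm (SUM i:sibling n l s. u i)"
   using c(1)[of l] by (simp add: mult_left_le_one_le)
  also have "... <= (SUM i:sibling n l s. norm (u i))" by (rule norm_sum)
  finally show "norm (c l *\<^sub>R (SUM i:sibling n l s. u i)) <= (SUM i:sibling n l s. norm (u i))" .
 qed
 also have "... <= l1_norm (2^n) u"
  unfolding l1_norm_def sum_siblings[OF s] by simp
 also have "norm (SUM l<n. c l *\<^sub>R (SUM i:sibling n l s. v i)) <= H_norm n v"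
 proof -
  let ?b = "%l. norm (SUM i:sibling n l s. v i)"
  have "norm (SUM l<n. c l *\<^sub>R (SUM i:sibling n l s. v i)) <= (SUM l<n. abs (c l)*abs (?b l))"
   by (rule order_trans[OF norm_sum]) simp
  also have "... <= L2_set c {..<n}*L2_set ?b {..<n}" by (rule L2_set_mult_ineq)
  also have "... <= 1*H_norm n v"
  proof (rule mult_mono)
   show "L2_set c {..<n} <= 1" unfolding L2_set_def using c(2) by simp
   have inj: "inj_on (%l. sibling n l s) {..<n}"
   proof (rule inj_onI)
    fix l l' assume "l : {..<n}" "l' : {..<n}" "sibling n l s = sibling n l' s"
    then have "(2::nat)^l = 2^l'" by (metis card_sibling[OF s] lessThan_iff)
    then show "l = l'" by simp
   qed
   have "(SUM l<n. (?b l)^2) = (SUM I:(%l. sibling n l s) ` {..<n}. (norm (SUM i:I. v i))^2)"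
    by (simp add: sum.reindex[OF inj])
   also have "... <= (SUM I:dyadic_blocks n. (norm (SUM i:I. v i))^2)"
    using sibling_dyadic[OF s] by (intro sum_mono2 finite_dyadic_blocks) auto
   finally show "L2_set ?b {..<n} <= H_norm n v" unfolding L2_set_def H_norm_def by (rule real_sqrt_le_mono)
  qed (auto intro: L2_set_nonneg)
  finally show ?thesis by simp
 qed
 finally show "norm (SUM l<n. c l *\<^sub>R (SUM i:sibling n l s. z i)) <= l1_norm (2^n) u + H_norm n v" by simp
qed

lemma D_matrix_sibling:
 "s : {1..2^n} ==> i : sibling n l s ==> l < n ==> D_matrix n s i = (- 1)^Suc l"
proof (induction n arbitrary: s i)
 case (Suc n)
 have i: "i : {1..2^Suc n}" and e: "(i-1) div 2^Suc l = (s-1) div 2^Suc l" "(i-1) div 2^l ~= (s-1) div 2^l"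
  using Suc.prems unfolding sibling_def by auto
 consider "s <= 2^n" "i <= 2^n" | "2^n < s" "2^n < i" | "(s <= 2^n) ~= (i <= 2^n)" by linarith
 then show ?case
 proof cases
  case 1
  then have si: "s : {1..2^n}" "i : {1..2^n}" using Suc.prems i by auto
  have "l ~= n" using e(2) si by auto
  then show ?thesis using Suc.IH[OF si(1), of i] si e Suc.prems 1 unfolding sibling_def by simp
 next
  case 2
  define s' where "s' = s - 2^n"
  define i' where "i' = i - 2^n"
  have si: "s' : {1..2^n}" "i' : {1..2^n}" using Suc.prems i 2 unfolding s'_def i'_def by auto
  have s: "s - 1 = 2^n + (s'-1)" "i - 1 = 2^n + (i'-1)" using 2 unfolding s'_def i'_def by auto
  have sh: "(2^n + x) div 2^m = 2^(n - m) + x div (2::nat)^m" if "m <= n" for x m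
  proof -
   have "(2::nat)^n = 2^m*2^(n - m)" using that by (simp flip: power_add)
   then show ?thesis by simp
  qed
  have "(i-1) div 2^n = (s-1) div 2^n" unfolding s sh[OF le_refl] using si by auto
  then have "l ~= n" using e(2) by metis
  then have l: "l < n" using Suc.prems by simp
  have "(i'-1) div 2^Suc l = (s'-1) div 2^Suc l" "(i'-1) div 2^l ~= (s'-1) div 2^l"
   using e unfolding s sh[OF Suc_leI[OF l]] sh[OF less_imp_le[OF l]] by (simp_all only: add_left_cancel simp_thms)
  then have "i' : sibling n l s'" using si unfolding sibling_def by blast
  then show ?thesis using Suc.IH[OF si(1) _ l] 2 unfolding s'_def i'_def by simp
 next
  case 3
  have "l = n"
  proof (rule ccontr)
   assume "l ~= n"
   then have "Suc l <= n" using Suc.prems by simp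
   from div_power_mono[OF e(1) this] have "(i-1) div 2^n = (s-1) div 2^n" .
   moreover have "(x-1) div 2^n = 0 \<longleftrightarrow> x <= 2^n" if "x : {1..2^Suc n}" for x :: nat
    using that by (auto simp: div_eq_0_iff)
   ultimately show False using 3 i Suc.prems(1) by metis
  qed
  then show ?thesis using 3 by auto
 qed
qed simp

lemma summation_matrix_norm_le: "norm (summation_matrix i j :: 'k::real_normed_field) <= 1"
 unfolding summation_matrix_def by simp

lemma D_matrix_norm_le: "norm (D_matrix n i j :: 'k::real_normed_field) <= 1"
 by (induction n arbitrary: i j) (simp_all add: norm_mult norm_power)

lemma linf_mat_vec_le_l1:
 assumes "!!i j. norm (M i j) <= 1" "1 <= d" shows "linf_norm d (mat_vec d M z) <= l1_norm d z"
proof (rule linf_norm_le[OF assms(2)])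
 fix i
 have "norm (mat_vec d M z i) <= (SUM j:{1..d}. norm (M i j)*norm (z j))"
  unfolding mat_vec_def by (rule order_trans[OF norm_sum]) (simp add: norm_mult)
 also have "... <= (SUM j:{1..d}. norm (z j))" using assms by (intro sum_mono mult_left_le_one_le) auto
 finally show "norm (mat_vec d M z i) <= l1_norm d z" unfolding l1_norm_def .
qed

lemma E_norm_le_l1: "E_norm n z <= l1_norm (2^n) z"
 using E_norm_le[of n z "%_. 0" z] by simp

lemma X_norm_le_l1: "X_norm n z <= l1_norm (2^n) z"
 unfolding X_norm_def using E_norm_le_l1 linf_mat_vec_le_l1[OF summation_matrix_norm_le, where d = "2^n" and z = z] by simp

lemma Y_norm_le_l1: "Y_norm n z <= l1_norm (2^n) z"
 unfolding Y_norm_def using E_norm_le_l1 linf_mat_vec_le_l1[OF D_matrix_norm_le, where d = "2^n" and z = z] by simp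

text \<open>The value at \<open>s\<close> and \<open>i\<close> of the conditional expectation, on the blocks of length \<open>2^l\<close>,
 of the function with values the unit vectors.\<close>

definition block_mean :: "nat => nat => nat => real" where
 "block_mean l s i = (if (i-1) div 2^l = (s-1) div 2^l then 1/2^l else 0)"

text \<open>The transform with alternating signs of the martingale of block means, which ends at the
  unit vectors. The sign belongs to the height \<open>l\<close>, as in the matrix
  \<open>D_n\<close>.\<close>

definition alternating :: "nat => nat => nat => real" where
 "alternating n s i = (SUM l<n. (- 1)^l*(block_mean l s i - block_mean (Suc l) s i))"

lemma alternating_sum_bounds: "0 <= (SUM j<m. (- 1/2 :: real)^j) & (SUM j<m. (- 1/2 :: real)^j) <= 1"
proof (induction m)
 case (Suc m)
 have "(SUM j<Suc m. (- 1/2 :: real)^j) = 1 - 1/2*(SUM j<m. (- 1/2)^j)"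
  by (subst sum.lessThan_Suc_shift) (simp add: sum_distrib_left sum_negf)
 then show ?case using Suc by simp
qed simp

lemma alternating_self: "0 <= alternating n s s"
proof -
 have "alternating n s s = 1/2*(SUM l<n. (- 1/2)^l)"
  unfolding alternating_def block_mean_def sum_distrib_left power_divide by (intro sum.cong) (simp_all add: right_diff_distrib)
 then show ?thesis using alternating_sum_bounds[of n] by simp
qed

text \<open>On the sibling of height \<open>l\<close> the block means up to height \<open>l\<close>
  vanish. The increment between heights \<open>l\<close> and \<open>l+1\<close> gives the leading
  term, of sign \<open>(- 1)^Suc l\<close>; the coarser increments form an alternating geometric
  series that begins with the same sign, so they cannot weaken it.\<close>

lemma alternating_sibling:
 assumes s: "s : {1..2^n}" and l: "l < n"
 shows "(- 1)^l*(SUM i:sibling n l s. alternating n s i) <= - 1/2"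
proof -
 let ?t = "SUM j<n - Suc l. (- 1/2 :: real)^j"
 have val: "alternating n s i = (- 1)^Suc l/2^Suc l*(1 + 1/2*?t)" if i: "i : sibling n l s" for i
 proof -
  have i': "(i-1) div 2^Suc l = (s-1) div 2^Suc l" "(i-1) div 2^l ~= (s-1) div 2^l"
   using i unfolding sibling_def by blast+
  have same: "(i-1) div 2^r = (s-1) div 2^r \<longleftrightarrow> l < r" for r
  proof (cases "l < r")
   case True
   then show ?thesis using div_power_mono[OF i'(1), of r] by (simp only: Suc_leI simp_thms)
  next
   case False
   then show ?thesis using div_power_mono[of "i - 1" r "s - 1" l] i'(2) by (metis not_le)
  qed
  have bm: "block_mean r s i = (if l < r then 1/2^r else 0)" for r unfolding block_mean_def same ..
  have n: "{..<n} = {..<l} \<union> {l} \<union> {Suc l..<n}" using l by auto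
  have "alternating n s i = (SUM r<l. (- 1)^r*(block_mean r s i - block_mean (Suc r) s i))
    + (- 1)^l*(block_mean l s i - block_mean (Suc l) s i) + (SUM r:{Suc l..<n}. (- 1)^r*(block_mean r s i - block_mean (Suc r) s i))"
   unfolding alternating_def n by (subst sum.union_disjoint; auto)+
  also have "(SUM r<l. (- 1)^r*(block_mean r s i - block_mean (Suc r) s i)) = 0" by (rule sum.neutral) (auto simp: bm)
  also have "(- 1)^l*(block_mean l s i - block_mean (Suc l) s i) = (- 1)^Suc l/2^Suc l" by (simp add: bm)
  also have "(SUM r:{Suc l..<n}. (- 1)^r*(block_mean r s i - block_mean (Suc r) s i))
    = (SUM j<n - Suc l. (- 1)^Suc l/2^Suc l*(1/2*(- 1/2)^j))"
  proof (rule sum.reindex_bij_witness[of _ "%j. j + Suc l" "%r. r - Suc l"])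
   fix r assume "r : {Suc l..<n}"
   then obtain j where j: "r = Suc l + j" by (auto simp: le_iff_add)
   have "(- 1)^Suc l/2^Suc l*(1/2*(- 1/2)^j) = (- 1)^r*(1/2^r - 1/2^Suc r :: real)"
    unfolding power_divide[of "- 1" 2] j power_add power_Suc by (simp add: field_simps)
   then show "(- 1)^Suc l/2^Suc l*(1/2*(- 1/2)^(r - Suc l)) = (- 1)^r*(block_mean r s i - block_mean (Suc r) s i)"
    unfolding bm by (simp only: j) simp
  qed auto
  finally show ?thesis by (simp add: sum_distrib_left distrib_left)
 qed
 have "(SUM i:sibling n l s. alternating n s i) = 2^l*((- 1)^Suc l/2^Suc l*(1 + 1/2*?t))"
  using val card_sibling[OF s l] by simp
 then have "(- 1)^l*(SUM i:sibling n l s. alternating n s i) = - 1/2*(1 + 1/2*?t)"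
  by (simp add: power_mult_distrib[symmetric])
 then show ?thesis using alternating_sum_bounds[of "n - Suc l"] by simp
qed

text \<open>The functional of \<open>E_norm_sibling\<close> with equal coefficients of modulus
  \<open>1 / sqrt n\<close>, whose signs make all \<open>n\<close> sibling sums add up.\<close>

lemma E_norm_alternating:
 assumes s: "s : {1..2^n}"
 shows "sqrt (real n)/2 <= E_norm n (%i. of_real (alternating n s i) :: 'k::real_normed_field)"
proof (cases "n = 0")
 case False
 let ?c = "%l::nat. - ((- 1)^l) / sqrt (real n)"
 have sq: "(?c l)^2 = 1/real n" for l using False by (simp add: power_divide power_even_eq[symmetric])
 have "sqrt (real n)/2 = (SUM l<n. 1 / sqrt (real n)*(1/2))"
  using False real_div_sqrt[of "real n"] by simp
 also have "... <= (SUM l<n. ?c l*(SUM i:sibling n l s. alternating n s i))"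
 proof (rule sum_mono)
  fix l assume "l : {..<n}"
  then have "1/2 <= - ((- 1)^l*(SUM i:sibling n l s. alternating n s i))" using alternating_sibling[OF s, of l] by simp
  then have "1 / sqrt (real n)*(1/2) <= 1 / sqrt (real n)*(- ((- 1)^l*(SUM i:sibling n l s. alternating n s i)))"
   by (rule mult_left_mono) simp
  then show "1 / sqrt (real n)*(1/2) <= ?c l*(SUM i:sibling n l s. alternating n s i)" by simp
 qed
 also have "... <= norm (of_real (SUM l<n. ?c l*(SUM i:sibling n l s. alternating n s i)) :: 'k)" unfolding norm_of_real by (rule abs_ge_self)
 also have "... = norm (SUM l<n. ?c l *\<^sub>R (SUM i:sibling n l s. of_real (alternating n s i)) :: 'k)"
  by (simp add: scaleR_conv_of_real)
 also have "... <= E_norm n (%i. of_real (alternating n s i) :: 'k)"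
 proof (rule E_norm_sibling[OF s])
  show "abs (?c l) <= 1" for l using False by (simp add: abs_divide power_abs)
  show "(SUM l<n. (?c l)^2) <= 1" unfolding sq using False by simp
 qed
 finally show ?thesis .
qed (simp add: E_norm_nonneg)

lemma Y_norm_alternating:
 assumes s: "s : {1..2^n}"
 shows "real n/2 <= Y_norm n (%i. of_real (alternating n s i) :: 'k::real_normed_field)"
proof -
 let ?z = "%i. of_real (alternating n s i) :: 'k"
 have D_real: "(D_matrix n i j :: 'k) = of_real (D_matrix n i j)" for i j
  by (induction n arbitrary: i j) simp_all
 have D_self: "D_matrix n t t = (1::real)" for t by (induction n arbitrary: t) auto
 have "real n/2 = (SUM l<n. 1/2)" by simp
 also have "... <= alternating n s s + (SUM l<n. (- 1)^Suc l*(SUM i:sibling n l s. alternating n s i))"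
 proof -
  have "1/2 <= (- 1)^Suc l*(SUM i:sibling n l s. alternating n s i)" if "l < n" for l
   using alternating_sibling[OF s that] by simp
  then have "(SUM l<n. 1/2) <= (SUM l<n. (- 1)^Suc l*(SUM i:sibling n l s. alternating n s i))" by (intro sum_mono) auto
  then show ?thesis using alternating_self[of n s] by simp
 qed
 also have "... = (SUM i:{1..2^n}. D_matrix n s i*alternating n s i)"
  unfolding sum_siblings[OF s] D_self sum_distrib_left mult_1
  by (intro arg_cong2[where f = "(+)"] sum.cong refl) (simp only: D_matrix_sibling[OF s] lessThan_iff)
 also have "... <= norm (of_real ... :: 'k)" unfolding norm_of_real by (rule abs_ge_self)
 also have "... = norm (mat_vec (2^n) (D_matrix n) ?z s)"
  unfolding mat_vec_def by (subst D_real) simp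
 also have "... <= linf_norm (2^n) (mat_vec (2^n) (D_matrix n) ?z)" by (rule linf_norm_ge[OF s])
 also have "... <= Y_norm n ?z" unfolding Y_norm_def by simp
 finally show ?thesis .
qed

section \<open>Lower bounds for the UMD constants\<close>

lemma Lp_norm_count_space:
 assumes S: "finite S"
 shows "Lp_norm (count_space S) p nu h = ennreal ((SUM s:S. nu (h s) powr p) powr (1/p))"
proof -
 have "(\<integral>\<^sup>+ s. ennreal (nu (h s) powr p) \<partial>count_space S) = ennreal (SUM s:S. nu (h s) powr p)"
  using nn_integral_count_space_finite[OF S, of "%s. ennreal (nu (h s) powr p)"] by simp
 then show ?thesis unfolding Lp_norm_def Let_def by (simp add: sum_nonneg)
qed

text \<open>The martingale runs on \<open>2^n\<close> points with counting measure and has the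
  blocks of length \<open>2^(n - k)\<close> as atoms at time \<open>k\<close>. Its first and last
  value have l1 norm one, so their difference has norm at most \<open>2\<close>, which is the
  denominator. The bound \<open>L\<close> holds at every point, and the total mass cancels.\<close>

theorem umd_const_ge:
 fixes nu :: "(nat => 'k::{real_normed_field, banach, second_countable_topology}) => real"
 assumes nu: "is_norm (2^n) nu" and p: "1 <= p" and n: "1 <= n" and l1: "!!z. nu z <= l1_norm (2^n) z"
  and L: "0 <= L" "!!s. s : {1..2^n} ==> L <= nu (%i. of_real (alternating n s i))"
 shows "ennreal (L/2) <= umd_const p (2^n) nu"
 unfolding umd_const_def
proof (rule Inf_greatest, simp only: mem_Collect_eq)
 fix C assume "umd_estimate TYPE(real) p (2^n) nu C"
 then have est: "umd_estimate TYPE(nat) p (2^n) nu C" by (rule umd_estimate_real_imp[OF nu])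
 let ?N = "{1..2^n :: nat}"
 define M where "M = count_space ?N"
 define F where "F k = vimage_algebra ?N (%s. (s-1) div 2^(n - k)) (count_space UNIV)" for k
 define f where "f k s i = (of_real (block_mean (n - k) s i) :: 'k)" for k s i
 have nu0: "0 <= nu x" for x by (rule is_norm_nonneg[OF nu])
 have finM: "finite_measure M" unfolding M_def by (rule finite_measure_count_space) simp
 have sub: "subalgebra M (F k)" for k unfolding subalgebra_def M_def F_def by (auto simp: sets_vimage_algebra2)
 have mean_sum: "(SUM s:?N. indicator {s : ?N. (s-1) div 2^l : B} s *\<^sub>R (of_real (block_mean l s i) :: 'k))
   = of_real (indicator B ((i-1) div 2^l))" if l: "l <= n" and i: "i : ?N" for l B i
 proof -
  have "(SUM s:?N. indicator {s : ?N. (s-1) div 2^l : B} s *\<^sub>R (of_real (block_mean l s i) :: 'k))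
    = (SUM s:{s : ?N. (s-1) div 2^l = (i-1) div 2^l}. of_real (indicator B ((i-1) div 2^l)/2^l))"
   by (rule sum.mono_neutral_cong_right) (auto simp: block_mean_def indicator_def scaleR_conv_of_real)
  also have "... = of_real (indicator B ((i-1) div 2^l))"
   unfolding same_block_eq[OF i l] by simp
  finally show ?thesis .
 qed
 have F_sets: "A : sets (F k) \<longleftrightarrow> (EX B. A = {s : ?N. (s-1) div 2^(n - k) : B})" for A k
  unfolding F_def by (subst sets_vimage_algebra2) (auto simp: vimage_def Int_def conj_commute)
 have fine: "EX B'. {s : ?N. (s-1) div 2^(n - k) : B} = {s : ?N. (s-1) div 2^(n - Suc k) : B'}"
  if "k < n" for k B
 proof (rule exI[of _ "{b. b div 2 : B}"])
  have "n - k = Suc (n - Suc k)" using that by simp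
  then show "{s : ?N. (s-1) div 2^(n - k) : B} = {s : ?N. (s-1) div 2^(n - Suc k) : {b. b div 2 : B}}"
   by (simp only: div_power_Suc mem_Collect_eq)
 qed
 have integral: "(LINT s:A|M. f k s i) = (SUM s:?N. indicator A s *\<^sub>R f k s i)" for A k i
  unfolding set_lebesgue_integral_def M_def by (rule lebesgue_integral_count_space_finite) simp
 have mart: "Lp_martingale M F n p (2^n) nu f"
  unfolding Lp_martingale_def
 proof (intro conjI allI impI ballI)
  show "sigma_finite_measure M" using finM unfolding finite_measure_def by simp
  fix k
  have "emeasure (restr_to_subalg M (F k)) (space (restr_to_subalg M (F k))) = emeasure M (space M)"
   using emeasure_restr_to_subalg[OF sub, of "space M"] sub[of k] sets.top[of "F k"]
   by (simp add: space_restr_to_subalg subalgebra_def)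
  then have "finite_measure (restr_to_subalg M (F k))"
   using finite_measure.emeasure_finite[OF finM, of "space M"] by (intro finite_measureI) simp
  then show "sigma_finite_subalgebra M (F k)"
   unfolding sigma_finite_subalgebra_def finite_measure_def using sub by simp
 next
  show "subalgebra (F (Suc k)) (F k)" if "k < n" for k
   unfolding subalgebra_def
  proof
   show "space (F k) = space (F (Suc k))" unfolding F_def by simp
   show "sets (F k) \<subseteq> sets (F (Suc k))" using fine[OF that] by (auto simp: F_sets)
  qed
  show "(%s. f k s i) : borel_measurable (F k)" for k i
  proof -
   have "(%s. (s-1) div 2^(n - k)) : F k \<rightarrow>\<^sub>M count_space UNIV" unfolding F_def by (rule measurable_vimage_algebra1) simp
   then show ?thesis
    unfolding f_def block_mean_def
    by (rule measurable_compose[where g = "%b. of_real (if (i-1) div 2^(n - k) = b then 1/2^(n - k) else 0)"]) simp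
  qed
  show "Lp_norm M p nu (f k) < \<infinity>" for k unfolding M_def by (subst Lp_norm_count_space) simp_all
 next
  fix k A i assume k: "k < n" and A: "A : sets (F k)" and i: "i : ?N"
  obtain B where B: "A = {s : ?N. (s-1) div 2^(n - k) : B}" using A unfolding F_sets by blast
  obtain B' where B': "A = {s : ?N. (s-1) div 2^(n - Suc k) : B'}" using fine[OF k, of B] unfolding B by blast
  have "(i-1) div 2^(n - k) : B \<longleftrightarrow> i : A" "(i-1) div 2^(n - Suc k) : B' \<longleftrightarrow> i : A"
   using i by (simp add: B, simp add: B')
  then have "indicator B ((i-1) div 2^(n - k)) = (indicator B' ((i-1) div 2^(n - Suc k)) :: real)"
   unfolding indicator_def by (simp only:)
  moreover have "(LINT s:A|M. f k s i) = of_real (indicator B ((i-1) div 2^(n - k)))"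
   unfolding integral unfolding f_def B by (rule mean_sum) (use i in auto)
  moreover have "(LINT s:A|M. f (Suc k) s i) = of_real (indicator B' ((i-1) div 2^(n - Suc k)))"
   unfolding integral unfolding f_def B' by (rule mean_sum) (use i in auto)
  ultimately show "(LINT s:A|M. f (Suc k) s i) = (LINT s:A|M. f k s i)" by simp
 qed
 let ?e = "%k. (- 1)^(n - k) :: 'k"
 have T: "(SUM k=1..n. ?e k*(f k s i - f (k-1) s i)) = of_real (alternating n s i)" for s i
  unfolding alternating_def f_def of_real_sum
  by (rule sum.reindex_bij_witness[of _ "%l. n - l" "%k. n - k"]) (auto simp: Suc_diff_le)
 have D: "(SUM k=1..n. f k s i - f (k-1) s i) = f n s i - f 0 s i" for s i
 proof -
  have "(SUM k=1..l. f k s i - f (k-1) s i) = f l s i - f 0 s i" for l by (induction l) auto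
  then show ?thesis .
 qed
 have two: "nu (%i. f n s i - f 0 s i) <= 2" if s: "s : ?N" for s
 proof -
  have m1: "l1_norm (2^n) (%i. f k s i) = 1" for k
  proof -
   have "l1_norm (2^n) (%i. f k s i) = (SUM i:{i : ?N. (i-1) div 2^(n - k) = (s-1) div 2^(n - k)}. 1/2^(n - k))"
    unfolding l1_norm_def f_def by (rule sum.mono_neutral_cong_right) (auto simp: block_mean_def norm_divide norm_power)
   then show ?thesis unfolding same_block_eq[OF s diff_le_self] by simp
  qed
  have "nu (%i. f n s i - f 0 s i) <= l1_norm (2^n) (%i. f n s i - f 0 s i)" by (rule l1)
  also have "... <= l1_norm (2^n) (%i. f n s i) + l1_norm (2^n) (%i. f 0 s i)"
   unfolding l1_norm_def sum.distrib[symmetric] by (intro sum_mono norm_triangle_ineq4)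
  finally show ?thesis unfolding m1 by simp
 qed
 have "Lp_norm M p nu (%s i. of_real (alternating n s i)) <= C*Lp_norm M p nu (%s i. f n s i - f 0 s i)"
  using est[unfolded umd_estimate_def, rule_format, of n M F f ?e] mart n unfolding T D by (simp add: norm_power)
 moreover have "ennreal ((2^n*L powr p) powr (1/p)) <= Lp_norm M p nu (%s i. of_real (alternating n s i))"
 proof -
  have "(SUM s:?N. L powr p) <= (SUM s:?N. nu (%i. of_real (alternating n s i)) powr p)"
   using L p by (intro sum_mono powr_mono2) auto
  then show ?thesis
   unfolding M_def using p by (subst Lp_norm_count_space) (auto intro!: ennreal_leI powr_mono2)
 qed
 moreover have "Lp_norm M p nu (%s i. f n s i - f 0 s i) <= ennreal ((2^n*2 powr p) powr (1/p))"
 proof -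
  have "(SUM s:?N. nu (%i. f n s i - f 0 s i) powr p) <= (SUM s:?N. 2 powr p)"
   using two nu0 p by (intro sum_mono powr_mono2) auto
  then show ?thesis
   unfolding M_def using p by (subst Lp_norm_count_space) (auto intro!: ennreal_leI powr_mono2 sum_nonneg)
 qed
 moreover have pw: "(2^n*x powr p) powr (1/p) = (2^n) powr (1/p)*x" if "0 <= x" for x :: real
  using that p by (simp add: powr_mult powr_powr)
 ultimately have le: "ennreal ((2^n) powr (1/p)*L) <= C*ennreal ((2^n) powr (1/p)*2)"
  using L(1) by (simp add: pw) (meson mult_left_mono order_trans zero_le)
 show "ennreal (L/2) <= C"
 proof (cases C)
  case (real c)
  have q: "0 < (2^n :: real) powr (1/p)" by simp
  have "ennreal ((2^n) powr (1/p)*L) <= ennreal (c*((2^n) powr (1/p)*2))"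
   using le real by (simp add: ennreal_mult'')
  then have "(2^n) powr (1/p)*L <= c*((2^n) powr (1/p)*2)"
   using real by (subst (asm) ennreal_le_iff) auto
  then have "(2^n) powr (1/p)*L <= (2^n) powr (1/p)*(2*c)" by (simp add: mult_ac)
  then have "L <= 2*c" using q by (rule mult_left_le_imp_le)
  then show ?thesis using real by (simp add: ennreal_leI)
 qed simp
qed

section \<open>Lower bounds for the Hilbert transform constants\<close>

definition bump :: "real => real" where
 "bump t = 16*(max 0 (t - t^2))^2"

lemma bump_nonneg: "0 <= bump t"
 unfolding bump_def by simp

lemma bump_le_1: "bump t <= 1"
proof -
 have "t - t^2 <= 1/4" using zero_le_power2[of "t - 1/2"] by (simp add: power2_eq_square algebra_simps)
 then have "max 0 (t - t^2) <= 1/4" by (intro max.boundedI) auto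
 then have "(max 0 (t - t^2))^2 <= (1/4)^2" by (rule power_mono) simp
 then show ?thesis unfolding bump_def by (simp add: power2_eq_square)
qed

lemma bump_support: "bump t ~= 0 ==> t : {0<..<1}"
proof -
 assume "bump t ~= 0"
 then have "0 < t - t^2" unfolding bump_def by (cases "0 < t - t^2") auto
 then have "0 < t*(1 - t)" by (simp add: power2_eq_square right_diff_distrib)
 then show ?thesis by (auto simp: zero_less_mult_iff)
qed

lemma bump_ge: "t : {1/4..3/4} ==> 9/16 <= bump t"
proof -
 assume t: "t : {1/4..3/4}"
 then have "0 <= (t - 1/4)*(3/4 - t)" by simp
 also have "... = t - t^2 - 3/16" by (simp add: field_simps power2_eq_square)
 finally have "3/16 <= max 0 (t - t^2)" by simp
 then have "(3/16)^2 <= (max 0 (t - t^2))^2" by (rule power_mono) simp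
 then show ?thesis unfolding bump_def by (simp add: power2_eq_square)
qed

lemma pos_part_square_derivative: "((%u. (max 0 u)^2) has_real_derivative 2*max 0 u) (at u)"
proof -
 consider "u < 0" | "u = 0" | "0 < u" by linarith
 then show ?thesis
 proof cases
  case 1
  have "((%_. 0) has_real_derivative 0) (at u)" by simp
  then have "((%u. (max 0 u)^2) has_real_derivative 0) (at u)"
   by (rule has_field_derivative_transform_within_open[of _ _ _ "{..<0}"]) (use 1 in auto)
  then show ?thesis using 1 by simp
 next
  case 2
  have "((%h::real. (max 0 h)^2/h) \<longlongrightarrow> 0) (at 0)"
  proof (rule Lim_null_comparison)
   show "\<forall>\<^sub>F h::real in at 0. norm ((max 0 h)^2/h) <= abs h"
    by (intro always_eventually allI) (auto simp: max_def power2_eq_square)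
   show "((%h::real. abs h) \<longlongrightarrow> 0) (at 0)" by (rule tendsto_rabs_zero) (rule tendsto_ident_at)
  qed
  then show ?thesis unfolding 2 by (simp add: DERIV_def)
 next
  case 3
  have "((%u. u^2) has_real_derivative 2*u) (at u)" by (auto intro!: derivative_eq_intros)
  then have "((%u. (max 0 u)^2) has_real_derivative 2*u) (at u)"
   by (rule has_field_derivative_transform_within_open[of _ _ _ "{0<..}"]) (use 3 in auto)
  then show ?thesis using 3 by simp
 qed
qed

text \<open>The square of the positive part is continuously differentiable although the positive
  part is not; this is the reason for the square in \<open>bump\<close>.\<close>

lemma bump_C1: "(%x. of_real (bump (N*x - a)) :: 'k::real_normed_field) C1_differentiable_on UNIV"
proof -
 let ?t = "%x. N*x - a"
 let ?D = "%x. 16*(2*max 0 (?t x - (?t x)^2)*(N - 2*?t x*N))"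
 have "((%x. (max 0 (?t x - (?t x)^2))^2) has_real_derivative 2*max 0 (?t x - (?t x)^2)*(N - 2*?t x*N)) (at x)" for x
  by (rule DERIV_chain2[OF pos_part_square_derivative]) (auto intro!: derivative_eq_intros)
 then have "((%x. bump (?t x)) has_real_derivative ?D x) (at x)" for x unfolding bump_def by (rule DERIV_cmult)
 then have "((%x. of_real (bump (?t x)) :: 'k) has_vector_derivative of_real (?D x)) (at x)" for x
  unfolding has_real_derivative_iff_has_vector_derivative by (rule bounded_linear.has_vector_derivative[OF bounded_linear_of_real])
 moreover have "continuous_on UNIV (%x. of_real (?D x) :: 'k)" by (intro continuous_intros)
 ultimately show ?thesis unfolding C1_differentiable_on_def by (intro exI[of _ "%x. of_real (?D x)"]) blast
qed

text \<open>At distance \<open>de\<close> from the support the principal value is an ordinary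
  integral. The middle half of the support has length \<open>1/(2*N)\<close>, the bump is at least
  \<open>9/16\<close> there, and the kernel is at least \<open>N/r\<close> in modulus; this gives
  \<open>9/32/r\<close>, of which the division by \<open>pi < 4\<close> leaves more than
  \<open>1/(16*r)\<close>.\<close>

lemma hilbert_transform_bump:
 fixes N a x de r sg :: real
 assumes N: "0 < N" and sg: "sg : {1, -1}" and de: "0 < de"
  and away: "!!y. a <= N*y ==> N*y <= a + 1 ==> de <= sg*(x - y) & N*(sg*(x - y)) <= r"
 shows "EX w. hilbert_transform (%y. of_real (bump (N*y - a)) :: 'k::{real_normed_field, banach, second_countable_topology}) x = of_real w &
  1/(16*r) <= sg*w"
proof -
 let ?b = "%y. bump (N*y - a)"
 let ?I = "{a/N..(a+1)/N}"
 have mem: "y : ?I \<longleftrightarrow> a <= N*y & N*y <= a + 1" for y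
  using N by (auto simp: field_simps)
 have supp: "y : ?I" if "?b y ~= 0" for y using bump_support[OF that] unfolding mem by auto
 have sg2: "sg * sg = 1" "abs (sg) = 1" using sg by auto
 have away': "de <= sg*(x - y)" "N*(sg*(x - y)) <= r" "de <= abs (x - y)" if "y : ?I" for y
 proof -
  show *: "de <= sg*(x - y)" "N*(sg*(x - y)) <= r" using away[of y] that unfolding mem by auto
  show "de <= abs (x - y)" using * abs_ge_self[of "sg*(x - y)"] sg2 by (simp add: abs_mult)
 qed
 have [measurable]: "?b : borel_measurable borel" unfolding bump_def by measurable
 have int: "integrable lborel (%y. ?b y/(x - y))"
 proof (rule Bochner_Integration.integrable_bound)
  show "integrable lborel (%y. 1/de*indicator ?I y :: real)"
   by (intro integrable_mult_right integrable_real_indicator) (auto simp: emeasure_lborel_Icc_eq)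
  show "AE y in lborel. norm (?b y/(x - y)) <= norm (1/de*indicator ?I y :: real)"
  proof (rule AE_I2)
   fix y
   show "norm (?b y/(x - y)) <= norm (1/de*indicator ?I y :: real)"
   proof (cases "?b y = 0")
    case False
    then show ?thesis
     using supp[OF False] away'(3)[OF supp[OF False]] de bump_le_1[of "N*y - a"] bump_nonneg[of "N*y - a"] by (simp add: frac_le)
   qed simp
  qed
 qed measurable
 define w where "w = 1/pi*(LINT y|lborel. ?b y/(x - y))"
 have "(LINT y:{y. ep < abs (x - y)}|lborel. (1/(x - y)) *\<^sub>R of_real (?b y)) = (of_real (LINT y|lborel. ?b y/(x - y)) :: 'k)"
  if "ep < de" for ep
 proof -
  have "indicator {y. ep < abs (x - y)} y *\<^sub>R (1/(x - y)) *\<^sub>R of_real (?b y) = (of_real (?b y/(x - y)) :: 'k)" for y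
  proof (cases "?b y = 0")
   case False
   then show ?thesis using away'(3)[OF supp[OF False]] that by (simp add: scaleR_conv_of_real mult.commute divide_inverse)
  qed simp
  moreover have "(LINT y|lborel. of_real (?b y/(x - y)) :: 'k) = of_real (LINT y|lborel. ?b y/(x - y))"
   by (rule integral_bounded_linear[OF bounded_linear_of_real int])
  ultimately show ?thesis unfolding set_lebesgue_integral_def by (simp only:)
 qed
 then have "\<forall>\<^sub>F ep in at_right 0. (LINT y:{y. ep < abs (x - y)}|lborel. (1/(x - y)) *\<^sub>R of_real (?b y)) = (of_real (LINT y|lborel. ?b y/(x - y)) :: 'k)"
  using de by (auto simp: eventually_at_right_field)
 then have "hilbert_transform (%y. of_real (?b y) :: 'k) x = of_real w"
  unfolding hilbert_transform_def w_def
  by (subst tendsto_Lim[OF _ tendsto_eventually]) (auto simp: scaleR_conv_of_real)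
 moreover have "1/(16*r) <= sg*w"
 proof -
  let ?J = "{(a + 1/4)/N..(a + 3/4)/N}"
  have J: "y : ?J \<longleftrightarrow> N*y - a : {1/4..3/4}" for y using N by (auto simp: field_simps)
  have r: "0 < r" using away[of "a/N"] N de by (smt (verit) mult_pos_pos nonzero_mult_div_cancel_left times_divide_eq_right)
  have "9/32/r = (LINT y|lborel. 9/16*N/r*indicator ?J y)" using N by (simp add: field_simps)
  also have "... <= (LINT y|lborel. sg*(?b y/(x - y)))"
  proof (rule integral_mono)
   show "integrable lborel (%y. 9/16*N/r*indicator ?J y)"
    by (intro integrable_mult_right integrable_real_indicator) (auto simp: emeasure_lborel_Icc_eq)
   show "integrable lborel (%y. sg*(?b y/(x - y)))" by (intro integrable_mult_right int)
   fix y
   have q: "sg*(?b y/(x - y)) = ?b y/(sg*(x - y))"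
    using sg unfolding divide_inverse inverse_mult_distrib by auto
   show "9/16*N/r*indicator ?J y <= sg*(?b y/(x - y))"
   proof (cases "y : ?J")
    case True
    then have y: "y : ?I" unfolding mem J by auto
    have "9/16*N/r <= ?b y*N/(N*(sg*(x - y)))"
     using away'(1,2)[OF y] de N bump_ge[OF True[unfolded J]] by (intro frac_le mult_right_mono) auto
    also have "... = ?b y/(sg*(x - y))" using N by simp
    finally show ?thesis using True unfolding q by simp
   next
    case False
    show ?thesis
    proof (cases "?b y = 0")
     case b: False
     show ?thesis using False away'(1)[OF supp[OF b]] de bump_nonneg[of "N*y - a"] unfolding q by simp
    qed (use False in simp)
   qed
  qed
  also have "... = sg*w*pi" unfolding w_def integral_mult_right_zero by simp
  finally have "9/32/r <= sg*w*pi" .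
  moreover have "1/(16*r)*pi <= 9/32/r" using r pi_less_4 by (simp add: field_simps)
  ultimately have "1/(16*r)*pi <= sg*w*pi" by linarith
  then show ?thesis using pi_gt_zero by (rule mult_right_le_imp_le)
 qed
 ultimately show ?thesis by blast
qed

lemma bump_l1_norm_le:
 "l1_norm d (%i. of_real (bump (N*x - (real i-1))) :: 'k::real_normed_field) <= (if N*x : {0..real d} then 1 else 0)"
proof -
 let ?b = "%i. bump (N*x - (real i-1))"
 have eq: "l1_norm d (%i. of_real (?b i) :: 'k) = (SUM i:{1..d}. ?b i)"
  unfolding l1_norm_def by (simp add: bump_nonneg)
 show ?thesis
 proof (cases "EX i:{1..d}. ?b i ~= 0")
  case True
  then obtain k where k: "k : {1..d}" "?b k ~= 0" by blast
  have "?b i = 0" if "i ~= k" for i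
  proof (rule ccontr)
   assume "?b i ~= 0"
   from bump_support[OF this] bump_support[OF k(2)] have "abs (real i - real k) < 1" by auto
   then show False using that by linarith
  qed
  then have "(SUM i:{1..d}. ?b i) = ?b k" using k by (intro sum.remove[THEN trans]) (auto intro!: sum.neutral)
  moreover have "N*x : {0..real d}" using bump_support[OF k(2)] k(1) by auto
  ultimately show ?thesis unfolding eq using bump_le_1 by simp
 qed (use eq in simp)
qed

text \<open>The bumps have disjoint supports, so each value of the test function is a multiple of a
  unit vector, and its l1 norm is at most the indicator of the unit interval. In the cell of
  \<open>x\<close> itself nothing is known about the transform, hence \<open>i ~= s\<close>. Only
  the right half of the interval is used, so that at least \<open>2^(n-1)\<close> cells lie to the
  left of \<open>x\<close>.\<close>

theorem hilbert_const_ge: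
 fixes nu :: "(nat => 'k::{real_normed_field, banach, second_countable_topology}) => real"
 assumes nu: "is_norm (2^n) nu" and p: "1 <= p" and n: "1 <= n" and l1: "!!z. nu z <= l1_norm (2^n) z"
  and L: "0 <= L" "!!s w z. s : {2^(n-1) + 1..2^n} ==>
   (!!i. i : {1..2^n} ==> i ~= s ==> z i = of_real (w i)) ==>
   (!!i. i : {1..2^n} ==> i < s ==> 1/(16*(real s - real i+1)) <= w i) ==>
   (!!i. i : {1..2^n} ==> s < i ==> 1/(16*(real i - real s+1)) <= - w i) ==> L <= nu z"
 shows "ennreal (L/2) <= hilbert_const p (2^n) nu"
 unfolding hilbert_const_def
proof (rule Inf_greatest, simp only: mem_Collect_eq)
 let ?N = "2^n :: real"
 let ?f = "%x i. of_real (bump (?N*x - (real i-1))) :: 'k"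
 let ?H = "%x i. hilbert_transform (%y. ?f y i) x"
 fix C assume C: "ALL f. C1_compact_support (2^n) f --> Lp_norm lborel p nu (%x i. hilbert_transform (%y. f y i) x) <= C*Lp_norm lborel p nu f"
 have nu0: "0 <= nu z" for z by (rule is_norm_nonneg[OF nu])
 have "C1_compact_support (2^n) ?f"
  unfolding C1_compact_support_def
 proof (intro ballI conjI bump_C1)
  fix i :: nat
  have "{x. ?f x i ~= 0} \<subseteq> {(real i-1)/?N..real i/?N}" using bump_support by (fastforce simp: field_simps)
  then have "bounded {x. ?f x i ~= 0}" by (rule bounded_subset[OF bounded_closed_interval])
  then show "compact (closure {x. ?f x i ~= 0})" by (simp only: compact_closure)
 qed
 with C have "Lp_norm lborel p nu ?H <= C*Lp_norm lborel p nu ?f" by blast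
 moreover have "Lp_norm lborel p nu ?f <= 1"
 proof -
  have le: "nu (?f x) powr p <= indicator {0..1} x" for x
  proof -
   have "nu (?f x) <= indicator {0..1} x"
    using order_trans[OF l1 bump_l1_norm_le[of "2^n" ?N x]] zero_less_power[of "2::real" n]
    by (auto simp: indicator_def zero_le_mult_iff not_le[symmetric] simp del: zero_less_power split: if_splits)
   then have "nu (?f x) powr p <= indicator {0..1} x powr p" using p nu0 by (intro powr_mono2) auto
   then show ?thesis using p by (auto simp: indicator_def split: if_splits)
  qed
  have "Lp_int lborel p nu ?f <= (\<integral>\<^sup>+ x. indicator {0..1::real} x \<partial>lborel)"
   using le by (intro nn_integral_mono) (metis ennreal_indicator ennreal_leI)
  then have I: "Lp_int lborel p nu ?f <= 1" by simp
  then have "enn2real (Lp_int lborel p nu ?f) powr (1/p) <= 1 powr (1/p)"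
   using p enn2real_mono[OF I] by (intro powr_mono2) auto
  then show ?thesis using I unfolding Lp_norm_def Let_def by (auto simp: top_unique)
 qed
 moreover have "ennreal (L/2) <= Lp_norm lborel p nu ?H"
 proof -
  let ?E = "(%k. real k/?N) ` {0..2^n}"
  \<comment> \<open>Grid points are removed to have a positive distance to the neighbouring cells.
    The measure \<open>1/2\<close> of this set, to the power \<open>1/p\<close>, is at least
    \<open>1/2\<close>, which gives \<open>L/2\<close>.\<close>
  define A where "A = {1/2<..<1} - ?E"
  have A: "A : sets lborel" "emeasure lborel A = ennreal (1/2)"
  proof -
   have "?E : null_sets lborel" by (rule finite_imp_null_set_lborel) simp
   then show "emeasure lborel A = ennreal (1/2)"
    unfolding A_def by (subst emeasure_Diff_null_set) simp_all
   show "A : sets lborel" unfolding A_def by (simp add: finite_imp_closed borel_closed sets.Diff)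
  qed
  have "L <= nu (?H x)" if x: "x : A" for x
  proof -
   define s where "s = nat \<lfloor>?N*x\<rfloor> + 1"
   have N2: "?N = 2*2^(n-1)" using n by (cases n) auto
   have xN: "2^(n-1) < ?N*x" "?N*x < ?N" using x unfolding A_def N2 by auto
   have "0 <= ?N*x" using xN zero_less_power[of "2::real" "n - 1"] by linarith
   then have s1: "real s - 1 <= ?N*x" "?N*x < real s"
    unfolding s_def using of_int_floor_le[of "?N*x"] by (simp_all add: add.commute[of 1])
   have "real (s-1) = real s - 1" unfolding s_def by simp
   then have "real (s-1) < ?N" "2^(n-1) < real s" using s1 xN by linarith+
   then have "real (s-1) < real (2^n)" "real (2^(n-1)) < real s" by (simp_all only: of_nat_power of_nat_numeral)
   then have s: "s : {2^(n-1) + 1..2^n}" unfolding of_nat_less_iff by auto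
   have "?N*x ~= real s - 1"
   proof
    assume "?N*x = real s - 1"
    then have "x = real (s-1)/?N" unfolding s_def by (simp add: field_simps)
    then have "x : ?E" by (rule image_eqI) (use s in auto)
    then show False using x unfolding A_def by blast
   qed
   with s1 have s2: "real s - 1 < ?N*x" by simp
   have "EX w. ?H x i = of_real w & (i < s --> 1/(16*(real s - real i+1)) <= w) & (s < i --> 1/(16*(real i - real s+1)) <= - w)"
    if "i ~= s" for i
   proof (cases "i < s")
    case True
    have "EX w. ?H x i = of_real w & 1/(16*(real s - real i+1)) <= 1*w"
    proof (rule hilbert_transform_bump[where de = "(?N*x - (real s-1))/?N"])
     fix y assume "real i - 1 <= ?N*y" "?N*y <= real i - 1 + 1"
     then have "?N*x - (real s-1) <= ?N*(1*(x - y)) & ?N*(1*(x - y)) <= real s - real i + 1"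
      using s1 True by (simp add: right_diff_distrib)
     then show "(?N*x - (real s-1))/?N <= 1*(x - y) & ?N*(1*(x - y)) <= real s - real i + 1"
      by (simp add: field_simps)
    qed (use s2 in auto)
    then show ?thesis using True by auto
   next
    case False
    have "EX w. ?H x i = of_real w & 1/(16*(real i - real s+1)) <= - 1*w"
    proof (rule hilbert_transform_bump[where de = "(real s - ?N*x)/?N"])
     fix y assume "real i - 1 <= ?N*y" "?N*y <= real i - 1 + 1"
     then have "real s - ?N*x <= ?N*(- 1*(x - y)) & ?N*(- 1*(x - y)) <= real i - real s + 1"
      using s1 that False by (simp add: right_diff_distrib)
     then show "(real s - ?N*x)/?N <= - 1*(x - y) & ?N*(- 1*(x - y)) <= real i - real s + 1"
      by (simp add: field_simps)
    qed (use s1 in auto)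
    then show ?thesis using False that by auto
   qed
   then obtain w where "!!i. i ~= s ==> ?H x i = of_real (w i) & (i < s --> 1/(16*(real s - real i+1)) <= w i) & (s < i --> 1/(16*(real i - real s+1)) <= - w i)"
    by metis
   then show "L <= nu (?H x)" by (intro L(2)[OF s, of _ w]) auto
  qed
  then have ge: "ennreal (L powr p)*indicator A x <= ennreal (nu (?H x) powr p)" for x
   using L(1) p by (cases "x : A") (auto intro!: ennreal_leI powr_mono2)
  have "ennreal (L powr p*(1/2)) = (\<integral>\<^sup>+ x. ennreal (L powr p)*indicator A x \<partial>lborel)"
   unfolding nn_integral_cmult_indicator[OF A(1)] A(2) by (rule ennreal_mult) auto
  also have "... <= Lp_int lborel p nu ?H" by (rule nn_integral_mono) (rule ge)
  finally have I: "ennreal (L powr p*(1/2)) <= Lp_int lborel p nu ?H" .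
  show ?thesis
  proof (cases "Lp_int lborel p nu ?H")
   case (real c)
   have "L/2 <= L*(1/2) powr (1/p)"
    using mult_left_mono[OF powr_mono'[of "1/p" 1 "1/2"] L(1)] p by simp
   also have "... = (L powr p*(1/2)) powr (1/p)" using L(1) p by (simp add: powr_divide powr_powr)
   also have "... <= c powr (1/p)" using I real L(1) p by (intro powr_mono2) auto
   finally show ?thesis using real unfolding Lp_norm_def Let_def by (simp add: ennreal_leI)
  qed (simp add: Lp_norm_def)
 qed
 ultimately show "ennreal (L/2) <= C"
  by (metis (no_types, lifting) mult.right_neutral mult_left_mono order_trans zero_le)
qed

lemma harmonic_ge: "(real m+1)/4 <= (SUM k:{2..2^m + 1}. 1/real k)"
proof (induction m)
 case (Suc m)
 have split: "{2..2^Suc m + 1} = {2..2^m + 1} \<union> {2^m + 2..2^Suc m + 1 :: nat}" using one_le_power[of "2::nat" m] by auto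
 have one: "(1::real) <= 2^m" by simp
 have "1/4 <= real (card {2^m + 2..2^Suc m + 1 :: nat})*(1/(2^Suc m+1))"
  by (simp add: divide_simps) (use one in linarith)
 also have "... <= (SUM k:{2^m + 2..2^Suc m + 1}. 1/real k)"
 proof (rule sum_bounded_below)
  fix k :: nat assume "k : {2^m + 2..2^Suc m + 1}"
  then have "0 < k" "real k <= real (2^Suc m+1)" by (simp_all only: of_nat_le_iff atLeastAtMost_iff) auto
  then show "1/(2^Suc m+1) <= 1/real k" by (intro divide_left_mono) auto
 qed
 finally show ?case using Suc unfolding split by (subst sum.union_disjoint) auto
qed (simp add: numeral_2_eq_2)

text \<open>Row \<open>s-1\<close> of the summation matrix stops just before the unknown coordinate
  \<open>s\<close>. All coordinates in it are positive and bounded below by a harmonic sum of order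
  \<open>n\<close>.\<close>

lemma hilbert_const_X_ge:
 assumes n: "1 <= n" and p: "1 <= p"
 shows "ennreal (real n/128) <= hilbert_const p (2^n) (X_norm n :: (nat => 'k::{real_normed_field, banach, second_countable_topology}) => real)"
proof -
 have "real n/64 <= X_norm n z"
  if s: "s : {2^(n-1) + 1..2^n}" and z: "!!i. i : {1..2^n} ==> i ~= s ==> z i = of_real (w i)"
   and w: "!!i. i : {1..2^n} ==> i < s ==> 1/(16*(real s - real i+1)) <= w i"
  for s w and z :: "nat => 'k"
 proof -
  have "(1::nat) <= 2^(n-1)" by simp
  then have s': "s - 1 : {1..2^n}" "2^(n-1) + 1 <= s" using s by (simp only: atLeastAtMost_iff; linarith)+
  have "real n/4 <= (SUM k:{2..2^(n-1) + 1}. 1/real k)" using harmonic_ge[of "n - 1"] n by (simp add: of_nat_diff)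
  also have "... <= (SUM k:{2..s}. 1/real k)" using s' by (intro sum_mono2) auto
  also have "... = (SUM i:{1..s - 1}. 1/(real s - real i+1))"
   by (rule sum.reindex_bij_witness[of _ "%i. s + 1 - i" "%k. s + 1 - k"]) (auto simp: of_nat_diff)
  also have "... <= (SUM i:{1..s - 1}. 16*w i)"
  proof (rule sum_mono)
   fix i assume "i : {1..s - 1}"
   then have "1/(16*(real s - real i+1)) <= w i" using s by (intro w) auto
   then show "1/(real s - real i+1) <= 16*w i" by (simp only: divide_divide_eq_left[symmetric] mult.commute[of 16] pos_divide_le_eq zero_less_numeral)
  qed
  finally have "real n/64 <= (SUM i:{1..s - 1}. w i)" unfolding sum_distrib_left[symmetric] by simp
  also have "... <= norm (of_real ... :: 'k)" unfolding norm_of_real by (rule abs_ge_self)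
  also have "of_real (SUM i:{1..s - 1}. w i) = mat_vec (2^n) summation_matrix z (s-1)"
   unfolding mat_vec_def of_real_sum
   by (rule sum.mono_neutral_cong_left) (use s z in \<open>auto simp: summation_matrix_def\<close>)
  also have "norm (mat_vec (2^n) summation_matrix z (s-1)) <= linf_norm (2^n) (mat_vec (2^n) summation_matrix z)"
   by (rule linf_norm_ge[OF s'(1)])
  also have "... <= X_norm n z" unfolding X_norm_def by simp
  finally show ?thesis .
 qed
 from hilbert_const_ge[OF is_norm_X_norm p n X_norm_le_l1 _ this] show ?thesis by simp
qed

text \<open>The sibling of height \<open>l\<close> lies on one side of \<open>s\<close> and within
  distance \<open>2^Suc l\<close>. So its \<open>2^l\<close> coordinates have one sign and sum to at
  least \<open>1/32\<close> in modulus. The sign \<open>sg l\<close> is read off the parity of the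
  block index of \<open>s\<close>, since a block of odd index has its sibling on the left.\<close>

lemma hilbert_const_Y_ge:
 assumes n: "1 <= n" and p: "1 <= p"
 shows "ennreal (sqrt (real n)/64) <= hilbert_const p (2^n) (Y_norm n :: (nat => 'k::{real_normed_field, banach, second_countable_topology}) => real)"
proof -
 have "sqrt (real n)/32 <= Y_norm n z"
  if s': "s : {2^(n-1) + 1..2^n}" and z: "!!i. i : {1..2^n} ==> i ~= s ==> z i = of_real (w i)"
   and w: "!!i. i : {1..2^n} ==> i < s ==> 1/(16*(real s - real i+1)) <= w i"
    "!!i. i : {1..2^n} ==> s < i ==> 1/(16*(real i - real s+1)) <= - w i"
  for s w and z :: "nat => 'k"
 proof -
  have s: "s : {1..2^n}" using s' by auto
  define sg where "sg l = (if odd ((s-1) div 2^l) then 1 else -1 :: real)" for l :: nat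
  have sib: "1/32 <= sg l*(SUM i:sibling n l s. w i)" if l: "l < n" for l
  proof -
   have "1/32 = real (card (sibling n l s))*(1/(16*2^Suc l))" unfolding card_sibling[OF s l] by simp
   also have "... <= (SUM i:sibling n l s. sg l*w i)"
   proof (rule sum_bounded_below)
    fix i assume "i : sibling n l s"
    then have i: "i : {1..2^n}" "(i-1) div 2^Suc l = (s-1) div 2^Suc l" "(i-1) div 2^l ~= (s-1) div 2^l"
     unfolding sibling_def by blast+
    define a where "a = (s-1) div 2^l"
    define b where "b = (i-1) div 2^l"
    define q where "q = (s-1) div 2^Suc l*2^Suc l"
    have "b div 2 = a div 2" "b ~= a" using i(2,3) unfolding div_power_Suc a_def b_def by auto
    then have ba: "odd a \<longleftrightarrow> b < a" "b < a | a < b" by presburger+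
    have mono: "x <= y" if "x div 2^l < y div 2^l" for x y :: nat
     using that div_le_mono[of y x "2^l"] by linarith
    have rng: "q <= x - 1 & x - 1 < q + 2^Suc l" if "(x-1) div 2^Suc l = (s-1) div 2^Suc l" for x
     using div_times_less_eq_dividend[of "x - 1" "2^Suc l"] dividend_less_div_times[of "2^Suc l" "x - 1"]
     unfolding q_def that[symmetric] by simp
    have dist: "real i + 1 <= real s + 2^Suc l" "real s + 1 <= real i + 2^Suc l"
    proof -
     have "i + 1 <= s + 2^Suc l" "s + 1 <= i + 2^Suc l" using rng[OF i(2)] rng[OF refl] i(1) s by auto
     then have "real (i+1) <= real (s + 2^Suc l)" "real (s+1) <= real (i + 2^Suc l)" by (simp_all only: of_nat_le_iff)
     then show "real i + 1 <= real s + 2^Suc l" "real s + 1 <= real i + 2^Suc l" by simp_all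
    qed
    have "i ~= s" using i(3) by auto
    show "1/(16*2^Suc l) <= sg l*w i"
    proof (cases "b < a")
     case True
     then have "i < s" using mono[of "i - 1" "s - 1"] i(1) s \<open>i ~= s\<close> unfolding a_def b_def by auto
     then have "1/(16*2^Suc l) <= 1/(16*(real s - real i+1))" using dist by (intro divide_left_mono) auto
     also have "... <= sg l*w i" using w(1)[OF i(1) \<open>i < s\<close>] True ba unfolding sg_def a_def[symmetric] by simp
     finally show ?thesis .
    next
     case False
     then have "s < i" using mono[of "s - 1" "i - 1"] ba i(1) s \<open>i ~= s\<close> unfolding a_def b_def by auto
     then have "1/(16*2^Suc l) <= 1/(16*(real i - real s+1))" using dist by (intro divide_left_mono) auto
     also have "... <= sg l*w i" using w(2)[OF i(1) \<open>s < i\<close>] False ba unfolding sg_def a_def[symmetric] by simp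
     finally show ?thesis .
    qed
   qed
   finally show ?thesis by (simp only: sum_distrib_left)
  qed
  let ?c = "%l. sg l / sqrt (real n)"
  have sq: "(?c l)^2 = 1/real n" for l unfolding sg_def by (simp add: power_divide)
  have "sqrt (real n)/32 = (SUM l<n. 1 / sqrt (real n)*(1/32))"
   using n real_div_sqrt[of "real n"] by simp
  also have "... <= (SUM l<n. 1 / sqrt (real n)*(sg l*(SUM i:sibling n l s. w i)))"
   using sib by (intro sum_mono mult_left_mono) auto
  also have "... = (SUM l<n. ?c l*(SUM i:sibling n l s. w i))" by simp
  also have "... <= norm (of_real ... :: 'k)" unfolding norm_of_real by (rule abs_ge_self)
  also have "of_real (SUM l<n. ?c l*(SUM i:sibling n l s. w i)) = (SUM l<n. ?c l *\<^sub>R (SUM i:sibling n l s. z i))"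
   unfolding of_real_sum of_real_mult scaleR_conv_of_real
   by (intro sum.cong arg_cong2[where f = "(*)"] refl z[symmetric]) (auto simp: sibling_def)
  also have "norm ... <= E_norm n z"
  proof (rule E_norm_sibling[OF s])
   show "abs (?c l) <= 1" for l using n unfolding sg_def by simp
   show "(SUM l<n. (?c l)^2) <= 1" unfolding sq using n by simp
  qed
  also have "... <= Y_norm n z" by (rule E_le_Y)
  finally show ?thesis .
 qed
 from hilbert_const_ge[OF is_norm_Y_norm p n Y_norm_le_l1 _ this] show ?thesis by simp
qed

lemma
 assumes n: "1 <= n" and p: "1 <= p"
 shows umd_const_X_ge: "ennreal (sqrt (real n)/4) <= umd_const p (2^n) (X_norm n :: (nat => 'k::{real_normed_field, banach, second_countable_topology}) => real)"
  and umd_const_Y_ge: "ennreal (real n/4) <= umd_const p (2^n) (Y_norm n :: (nat => 'k) => real)"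
proof -
 from umd_const_ge[OF is_norm_X_norm p n X_norm_le_l1 _ order_trans[OF E_norm_alternating E_le_X]]
 show "ennreal (sqrt (real n)/4) <= umd_const p (2^n) (X_norm n :: (nat => 'k) => real)" by simp
 from umd_const_ge[OF is_norm_Y_norm p n Y_norm_le_l1 _ Y_norm_alternating]
 show "ennreal (real n/4) <= umd_const p (2^n) (Y_norm n :: (nat => 'k) => real)" by simp
qed

section \<open>Assembly of the bounds\<close>

lemma component_le_norm:
 assumes "i : {1..2^n}"
 shows "norm (x i) <= X_norm n x" "norm (x i) <= Y_norm n x"
proof -
 have "norm (x i) <= E_norm n x"
 proof (rule E_norm_ge)
  fix u v assume "!!i. i : {1..2^n} ==> u i + v i = x i"
  then have "norm (x i) <= norm (u i) + norm (v i)" using assms norm_triangle_ineq[of "u i" "v i"] by simp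
  also have "norm (u i) <= l1_norm (2^n) u"
   unfolding l1_norm_def using assms by (intro member_le_sum[of i _ "%i. norm (u i)"]) auto
  also have "norm (v i) <= H_norm n v" by (rule norm_le_H[OF assms])
  finally show "norm (x i) <= l1_norm (2^n) u + H_norm n v" by simp
 qed
 then show "norm (x i) <= X_norm n x" "norm (x i) <= Y_norm n x" using E_le_X E_le_Y order_trans by blast+
qed

text \<open>Replacing \<open>K\<close> by \<open>C+1\<close> makes the constant positive, and
  \<open>a <= 2*b\<close> is the passage from \<open>n+1\<close> to \<open>n\<close>, or between
  their roots. The factor \<open>4\<close> is shared with the corresponding lemma for the UMD
  constant, so that one upper constant serves both.\<close>

lemma hilbert_const_le_scaled:
 fixes nu :: "(nat => 'k::{real_normed_field, banach, second_countable_topology}) => real"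
 assumes "is_norm d nu" "1 <= p" "hilbert_bound p nu (K*a)" "0 <= K" "K <= C" "0 <= a" "a <= 2*b" "0 < b"
 shows "hilbert_const p d nu <= ennreal (4*(C+1)*b)"
proof -
 have "K*a <= (C+1)*(2*b)" using assms by (intro mult_mono) auto
 then have "hilbert_bound p nu ((C+1)*(2*b))" using assms by (intro hilbert_bound_mono[OF assms(3)]) auto
 from hilbert_const_le[OF assms(1,2) _ this] assms show ?thesis by (simp add: mult_ac)
qed

lemma umd_const_le_scaled:
 fixes nu :: "(nat => 'k::{real_normed_field, banach, second_countable_topology}) => real"
 assumes "is_norm d nu" "!!x i. i : {1..d} ==> norm (x i) <= nu x" "1 <= p"
  "umd_bound TYPE(nat => nat => 'k) p nu (K*a)" "0 <= K" "K <= C" "0 <= a" "a <= 2*b" "0 < b"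
 shows "umd_const p d nu <= ennreal (4*(C+1)*b)"
proof -
 have "K*a <= (C+1)*(4*b)" using assms by (intro mult_mono) auto
 then have "umd_bound TYPE(nat => nat => 'k) p nu ((C+1)*(4*b))" using assms by (intro umd_bound_mono[OF assms(4)]) auto
 from umd_const_le[OF assms(1-3) _ this] assms show ?thesis by (simp add: mult_ac)
qed

theorem corollary1p3:
  fixes p :: real
  assumes "1 < p" and "p \<noteq> 2"
  shows "\<exists>c C :: real. 0 < c \<and> c \<le> C \<and> (\<forall>n\<ge>1.
    (let X = (X_norm n :: (nat \<Rightarrow> real) \<Rightarrow> real); Y = (Y_norm n :: (nat \<Rightarrow> real) \<Rightarrow> real); N = 2 ^ n in
       ennreal (c * real n) \<le> hilbert_const p N X \<and> hilbert_const p N X \<le> ennreal (C * real n) \<and>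
       ennreal (c * sqrt (real n)) \<le> umd_const p N X \<and> umd_const p N X \<le> ennreal (C * sqrt (real n)) \<and>
       ennreal (c * real n) \<le> umd_const p N Y \<and> umd_const p N Y \<le> ennreal (C * real n) \<and>
       ennreal (c * sqrt (real n)) \<le> hilbert_const p N Y \<and> hilbert_const p N Y \<le> ennreal (C * sqrt (real n))) \<and>
    (let X = (X_norm n :: (nat \<Rightarrow> complex) \<Rightarrow> real); Y = (Y_norm n :: (nat \<Rightarrow> complex) \<Rightarrow> real); N = 2 ^ n in
       ennreal (c * real n) \<le> hilbert_const p N X \<and> hilbert_const p N X \<le> ennreal (C * real n) \<and>
       ennreal (c * sqrt (real n)) \<le> umd_const p N X \<and> umd_const p N X \<le> ennreal (C * sqrt (real n)) \<and>
       ennreal (c * real n) \<le> umd_const p N Y \<and> umd_const p N Y \<le> ennreal (C * real n) \<and>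
       ennreal (c * sqrt (real n)) \<le> hilbert_const p N Y \<and> hilbert_const p N Y \<le> ennreal (C * sqrt (real n))))"
proof -
 have p: "1 <= p" using assms by simp
 obtain K K' where K: "0 <= K" "0 <= K'" and R:
   "!!n. discrete_bounds TYPE(nat => nat => real) p (X_norm n :: (nat => real) => real) (K*(real n+1)) (K * sqrt (real n+1)) &
    discrete_bounds TYPE(nat => nat => real) p (Y_norm n :: (nat => real) => real) (K * sqrt (real n+1)) (K*(real n+1))"
  and C: "!!n. discrete_bounds TYPE(nat => nat => complex) p (X_norm n :: (nat => complex) => real) (K'*(real n+1)) (K' * sqrt (real n+1)) &
    discrete_bounds TYPE(nat => nat => complex) p (Y_norm n :: (nat => complex) => real) (K' * sqrt (real n+1)) (K'*(real n+1))"
  using real_bounds[OF assms(1), where 'w = "nat => nat => real"] complex_bounds[OF assms(1), where 'w = "nat => nat => complex"] by blast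
 have lin: "0 <= real n + 1" "real n + 1 <= 2*real n" "0 < real n" if "1 <= n" for n using that by auto
 have sq: "0 <= sqrt (real n+1)" "sqrt (real n+1) <= 2 * sqrt (real n)" "0 < sqrt (real n)" if "1 <= n" for n
  using real_sqrt_le_mono[of "real n + 1" "4*real n"] that by (auto simp: real_sqrt_mult)
 have mono: "ennreal (1/128*a) <= C" if "ennreal (a/d) <= C" "1 <= d" "d <= 128" "0 <= a" for a d C
  by (rule order_trans[OF ennreal_leI that(1)]) (use that in \<open>simp add: field_simps mult_left_mono\<close>)
 note H = hilbert_const_le_scaled[OF _ p] and U = umd_const_le_scaled[OF _ _ p]
 note HX = mono[OF hilbert_const_X_ge[OF _ p]] and HY = mono[OF hilbert_const_Y_ge[OF _ p]]
  and UX = mono[OF umd_const_X_ge[OF _ p]] and UY = mono[OF umd_const_Y_ge[OF _ p]]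
 \<comment> \<open>The smallest of the lower constants \<open>1/128\<close>, \<open>1/64\<close>,
   \<open>1/4\<close> is taken for all, and \<open>K + K'\<close> covers both scalar fields.\<close>
 show ?thesis
  unfolding Let_def
  by (intro exI[of _ "1/128"] exI[of _ "4*(K + K' + 1)"] conjI allI impI HX HY UX UY
    H[OF is_norm_X_norm conjunct1[OF conjunct1[OF R]] K(1) _ lin] H[OF is_norm_Y_norm conjunct1[OF conjunct2[OF R]] K(1) _ sq]
    H[OF is_norm_X_norm conjunct1[OF conjunct1[OF C]] K(2) _ lin] H[OF is_norm_Y_norm conjunct1[OF conjunct2[OF C]] K(2) _ sq]
    U[OF is_norm_X_norm component_le_norm(1) conjunct2[OF conjunct1[OF R]] K(1) _ sq]
    U[OF is_norm_Y_norm component_le_norm(2) conjunct2[OF conjunct2[OF R]] K(1) _ lin]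
    U[OF is_norm_X_norm component_le_norm(1) conjunct2[OF conjunct1[OF C]] K(2) _ sq]
    U[OF is_norm_Y_norm component_le_norm(2) conjunct2[OF conjunct2[OF C]] K(2) _ lin])
   (use K in auto)
qed

end
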